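(* Let $N$ be a Poisson random measure on $\mathbb R_+$ with intensity the Lebesgue measure $dx$, let $n\ge2$, and let $f\in\mathbf d_n$ with symmetrization $\tilde f\in\mathbf d_{n,sym}$. If for $dx_2\cdots dx_n$-almost every $(x_2,\dots,x_n)$ the Lebesgue measure of the set $$\Big\{x_1\in\mathbb R_+:\ \frac{\partial^{n-1}\tilde f}{\partial x_2\cdots\partial x_n}(x_1,x_2,\dots,x_n)\ne0\Big\}$$ is infinite, then the random variable $I_n(f)$ has a density on $\mathbb R$ (its law is absolutely continuous with respect to Lebesgue measure).
   Context: $\mathbf d$ is the domain of the Dirichlet form $e[u]=\frac12\int_{\mathbb R_+}u'(t)^2\,dt$ on $L^2(\mathbb R_+,dt)$, i.e. $\mathbf d=H^1(\mathbb R_+)$, with carré du champ $\gamma[u]=u'^2$. $\mathbf d_n$ is the domain of the $n$-fold product form on $L^2(\mathbb R_+^n,dx_1\cdots dx_n)$: the set of $f\in L^2(\mathbb R_+^n)$ which, for each $i$ and almost all values of the other variables, are in $\mathbf d$ as functions of $x_i$, and with $\int\sum_i(\partial f/\partial x_i)^2\,dx_1\cdots dx_n<\infty$; $\mathbf d_{n,sym}$ is the subspace of symmetric functions. The mixed derivative of $\tilde f$ is the one obtained by applying the one-variable derivative (gradient of the form $e$) successively in the variables $x_n,x_{n-1},\dots,x_2$. $\tilde N=N-dx$ is the compensated measure. For $f\in L^2(\mathbb R_+^n)$, $I_n(f)$ is the multiple Poisson integral of order $n$ with respect to $\tilde N$: on symmetric finite sums of weighted indicators of products $A_1\times\cdots\times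 A_n$ of pairwise disjoint sets it is $\int f\,\tilde N(dx_1)\cdots\tilde N(dx_n)$, extended by the isometry $\mathbb E[I_m(f)I_n(g)]=\delta_{mn}n!\langle\tilde f,\tilde g\rangle_{L^2}$, where $\tilde f$ denotes the symmetrization of $f$, and $I_n(f)=I_n(\tilde f)$. *)

theory Defs
  imports "HOL-Probability.Probability" "HOL-Combinatorics.Permutations"
begin

definition square_integrable :: "'b measure \<Rightarrow> ('b \<Rightarrow> real) \<Rightarrow> bool" where
  "square_integrable M u \<longleftrightarrow> u \<in> borel_measurable M \<and> integrable M (\<lambda>x. (u x)\<^sup>2)"

definition halfline :: "real measure" where
  "halfline = restrict_space lborel {0..}"

text \<open>Points of the \<open>n\<close>-fold product are functions on \<open>{1..n}\<close>; index sets other than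
  \<open>{1..n}\<close> serve to freeze some of the variables.\<close>

definition halfline_prod :: "nat set \<Rightarrow> (nat \<Rightarrow> real) measure" where
  "halfline_prod I = (\<Pi>\<^sub>M i\<in>I. halfline)"


text \<open>Elements of \<open>H\<^sup>1\<close> are represented by functions. The derivative is the weak one, tested
  against \<open>C\<^sup>1\<close> functions with compact support in the open half-line, so nothing is imposed at
  the boundary point \<open>0\<close> and both \<open>u\<close> and \<open>u'\<close> may be changed on a null set.\<close>

definition test_function :: "(real \<Rightarrow> real) \<Rightarrow> bool" where
  "test_function \<phi> \<longleftrightarrow>
     \<phi> C1_differentiable_on UNIV \<and> (\<exists>a b. 0 < a \<and> (\<forall>t. t \<notin> {a..b} \<longrightarrow> \<phi> t = 0))"

definition has_gradient :: "(real \<Rightarrow> real) \<Rightarrow> (real \<Rightarrow> real) \<Rightarrow> bool" where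
  "has_gradient u u' \<longleftrightarrow>
     square_integrable halfline u \<and> square_integrable halfline u' \<and>
     (\<forall>\<phi>. test_function \<phi> \<longrightarrow>
        (LINT t|halfline. u t * deriv \<phi> t) = - (LINT t|halfline. u' t * \<phi> t))"

definition H1 :: "(real \<Rightarrow> real) set" where
  "H1 = {u. \<exists>u'. has_gradient u u'}"

text \<open>\<open>g = \<partial>f/\<partial>x\<^sub>i\<close>: for almost all values of the other variables, \<open>f\<close> is in \<open>H1\<close> as a
  function of \<open>x\<^sub>i\<close> and \<open>g\<close> is its gradient there.\<close>

definition has_partial_gradient ::
  "nat \<Rightarrow> nat \<Rightarrow> ((nat \<Rightarrow> real) \<Rightarrow> real) \<Rightarrow> ((nat \<Rightarrow> real) \<Rightarrow> real) \<Rightarrow> bool" where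
  "has_partial_gradient n i f g \<longleftrightarrow>
     g \<in> borel_measurable (halfline_prod {1..n}) \<and>
     (AE y in halfline_prod ({1..n} - {i}).
        has_gradient (\<lambda>t. f (y(i := t))) (\<lambda>t. g (y(i := t))))"

definition H1_prod :: "nat \<Rightarrow> ((nat \<Rightarrow> real) \<Rightarrow> real) set" where
  "H1_prod n = {f. square_integrable (halfline_prod {1..n}) f \<and>
     (\<forall>i\<in>{1..n}. AE y in halfline_prod ({1..n} - {i}). (\<lambda>t. f (y(i := t))) \<in> H1) \<and>
     (\<exists>D. (\<forall>i\<in>{1..n}. has_partial_gradient n i f (D i)) \<and>
          integrable (halfline_prod {1..n}) (\<lambda>x. \<Sum>i=1..n. (D i x)\<^sup>2))}"

definition symmetrization ::
  "nat \<Rightarrow> ((nat \<Rightarrow> real) \<Rightarrow> real) \<Rightarrow> (nat \<Rightarrow> real) \<Rightarrow> real" where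
  "symmetrization n f x = (\<Sum>\<sigma> | \<sigma> permutes {1..n}. f (x \<circ> \<sigma>)) / fact n"

text \<open>\<open>g\<close> is the mixed derivative of \<open>f\<close> in \<open>x\<^sub>n, x\<^sub>n\<^sub>-\<^sub>1, \<dots>, x\<^sub>2\<close>, taken in this order: \<open>h k\<close>
  is the result of differentiating in \<open>x\<^sub>n, \<dots>, x\<^sub>k\<^sub>+\<^sub>1\<close>. It is unique up to null sets.\<close>

definition has_mixed_gradient ::
  "nat \<Rightarrow> ((nat \<Rightarrow> real) \<Rightarrow> real) \<Rightarrow> ((nat \<Rightarrow> real) \<Rightarrow> real) \<Rightarrow> bool" where
  "has_mixed_gradient n f g \<longleftrightarrow>
     (\<exists>h. h n = f \<and> h 1 = g \<and> (\<forall>k\<in>{2..n}. has_partial_gradient n k (h k) (h (k - 1))))"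


text \<open>The Poisson probabilities are written out because \<^const>\<open>poisson_pmf\<close> is only meaningful
  for a positive rate, whereas \<open>\<mu> A = 0\<close> must be allowed. For sigma-finite \<open>\<mu>\<close>, the
  conditions force \<open>N A = \<infinity>\<close> almost surely when \<open>\<mu> A = \<infinity>\<close>.\<close>

definition poisson_random_measure ::
  "'a measure \<Rightarrow> 'b measure \<Rightarrow> ('a \<Rightarrow> 'b measure) \<Rightarrow> bool" where
  "poisson_random_measure P \<mu> N \<longleftrightarrow>
     prob_space P \<and>
     (\<forall>\<omega>\<in>space P. sets (N \<omega>) = sets \<mu>) \<and>
     (\<forall>A\<in>sets \<mu>. (\<lambda>\<omega>. emeasure (N \<omega>) A) \<in> borel_measurable P) \<and>
     (\<forall>A\<in>sets \<mu>. emeasure \<mu> A < \<infinity> \<longrightarrow>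
        (\<forall>k. measure P {\<omega>\<in>space P. emeasure (N \<omega>) A = of_nat k} =
             measure \<mu> A ^ k / fact k * exp (- measure \<mu> A))) \<and>
     (\<forall>(I :: nat set) A. finite I \<longrightarrow> A ` I \<subseteq> sets \<mu> \<longrightarrow> disjoint_family_on A I \<longrightarrow>
        prob_space.indep_vars P (\<lambda>_. borel) (\<lambda>i \<omega>. emeasure (N \<omega>) (A i)) I)"

text \<open>A list of pairs \<open>(c, A)\<close> stands for the sum of the terms \<open>c\<close> times the indicator of
  \<open>A 1 \<times> \<dots> \<times> A n\<close>.\<close>

definition elementary_fun ::
  "nat \<Rightarrow> (real \<times> (nat \<Rightarrow> real set)) list \<Rightarrow> (nat \<Rightarrow> real) \<Rightarrow> real" where
  "elementary_fun n E x = (\<Sum>(c, A)\<leftarrow>E. c * (\<Prod>i=1..n. indicator (A i) (x i)))"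

definition elementary :: "nat \<Rightarrow> (real \<times> (nat \<Rightarrow> real set)) list \<Rightarrow> bool" where
  "elementary n E \<longleftrightarrow>
     (\<forall>(c, A)\<in>set E. disjoint_family_on A {1..n} \<and>
        (\<forall>i\<in>{1..n}. A i \<in> sets halfline \<and> emeasure halfline (A i) < \<infinity>)) \<and>
     (\<forall>\<sigma> x. \<sigma> permutes {1..n} \<longrightarrow> x \<in> space (halfline_prod {1..n}) \<longrightarrow>
        elementary_fun n E (x \<circ> \<sigma>) = elementary_fun n E x)"

definition elementary_integral ::
  "('a \<Rightarrow> real measure) \<Rightarrow> nat \<Rightarrow> (real \<times> (nat \<Rightarrow> real set)) list \<Rightarrow> 'a \<Rightarrow> real" where
  "elementary_integral N n E \<omega> =
     (\<Sum>(c, A)\<leftarrow>E. c * (\<Prod>i=1..n. measure (N \<omega>) (A i) - measure halfline (A i)))"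

text \<open>The isometric extension: \<open>F\<close> is a version of \<open>I\<^sub>n(f)\<close> if it is the \<open>L\<^sup>2(P)\<close>-limit of the
  integrals of symmetric elementary functions converging in \<open>L\<^sup>2\<close> to the symmetrization of
  \<open>f\<close>. By the isometry, such an \<open>F\<close> exists for square-integrable \<open>f\<close> and is unique almost surely.\<close>

definition poisson_integral_version ::
  "'a measure \<Rightarrow> ('a \<Rightarrow> real measure) \<Rightarrow> nat \<Rightarrow> ((nat \<Rightarrow> real) \<Rightarrow> real) \<Rightarrow> ('a \<Rightarrow> real) \<Rightarrow> bool" where
  "poisson_integral_version P N n f F \<longleftrightarrow>
     F \<in> borel_measurable P \<and>
     (\<exists>E. (\<forall>k. elementary n (E k)) \<and>
        (\<lambda>k. \<integral>\<^sup>+x. ennreal ((elementary_fun n (E k) x - symmetrization n f x)\<^sup>2)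
               \<partial>halfline_prod {1..n}) \<longlonglongrightarrow> 0 \<and>
        (\<lambda>k. \<integral>\<^sup>+\<omega>. ennreal ((elementary_integral N n (E k) \<omega> - F \<omega>)\<^sup>2) \<partial>P) \<longlonglongrightarrow> 0)"

definition poisson_integral ::
  "'a measure \<Rightarrow> ('a \<Rightarrow> real measure) \<Rightarrow> nat \<Rightarrow> ((nat \<Rightarrow> real) \<Rightarrow> real) \<Rightarrow> 'a \<Rightarrow> real" where
  "poisson_integral P N n f = (SOME F. poisson_integral_version P N n f F)"

end

theory Submission
  imports Defs
begin

text \<open>Write \<open>F\<close> for the integral and \<open>\<phi>\<close> for the symmetrization. By Mecke's formula, to show that \<open>F\<close>
  almost surely avoids a null set \<open>B\<close> it suffices that \<open>F + V(x)\<close> avoids \<open>B\<close> for almost every added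
  point \<open>x\<close>, where \<open>V(x)\<close> is the integral of order \<open>n - 1\<close> of \<open>n \<phi>(\<cdot>, x)\<close>. Since \<open>\<phi>\<close> is weakly differentiable
  in its last variable, so is \<open>V\<close>, with derivative the integral \<open>V'(x)\<close> of \<open>n \<partial>\<phi>/\<partial>x\<^sub>n(\<cdot>, x)\<close>; and a weakly
  differentiable function of one variable maps into \<open>B\<close> almost only where its derivative vanishes. So
  it remains to see that \<open>V'(x) \<noteq> 0\<close> almost surely.

  This follows from the absence of atoms for integrals of symmetric kernels, by induction on the
  order with Mecke's formula again: an atom of \<open>F\<close> is excluded if, for almost all \<open>x\<close> and \<open>x'\<close>, the lower order integral
  \<open>V(x) - V(x')\<close> has no atom at \<open>0\<close>. The kernels so obtained are iterated differences, which are nonzero where the mixed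
  derivative is. At order one the infinite measure in the hypothesis enters: a first-order integral
  with infinitely many jumps has no atoms.\<close>

section \<open>Square-integrable functions\<close>

text \<open>No measure on configurations is used. Mecke's formula is proved for functions of
  finitely many counts, where it is a shift identity for Poisson weights, and it reaches general
  integrals only as a limit. Adding a point is therefore never an operation on the sample space; it
  is the process \<open>V\<close>, the limit of the increments of elementary integrals. Of the
  isometry only an upper bound is established, with a constant depending on the order; it covers
  nonsymmetric kernels, such as the derivative in the last variable.

  The obstacle is integrability. \<open>H1_prod\<close> makes the first partial derivatives square
  integrable, but the later stages of the mixed derivative are only measurable, and square
  integrable along single lines. They cannot serve as kernels. So one derivative is taken
  stochastically, and the other \<open>n - 2\<close> are traced by finite differences of the kernel,
  which stay in L2 for almost all frozen points. That a vanishing difference forces a vanishing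
  derivative is the same one-variable fact that handles null sets, applied to a single
  value.\<close>

definition sqn :: "'b measure \<Rightarrow> ('b \<Rightarrow> real) \<Rightarrow> ennreal" where
  "sqn M u = (\<integral>\<^sup>+x. ennreal ((u x)\<^sup>2) \<partial>M)"

lemma sqn_cong_AE: "AE x in M. u x = v x \<Longrightarrow> sqn M u = sqn M v"
  unfolding sqn_def by (rule nn_integral_cong_AE) auto

lemma sqn_cong: "(\<And>x. x \<in> space M \<Longrightarrow> u x = v x) \<Longrightarrow> sqn M u = sqn M v"
  unfolding sqn_def by (rule nn_integral_cong) auto

text \<open>This bound stands in for the triangle inequality. It stays within squared norms, so no
  square roots of extended reals occur, and the factor 2 is harmless where only finiteness,
  convergence to 0 and rates up to a constant are concluded.\<close>

lemma sqn_add_le: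
  assumes [measurable]: "u \<in> borel_measurable M" "v \<in> borel_measurable M"
  shows "sqn M (\<lambda>x. u x + v x) \<le> 2 * sqn M u + 2 * sqn M v"
proof -
  have "ennreal ((u x + v x)\<^sup>2) \<le> 2 * ennreal ((u x)\<^sup>2) + 2 * ennreal ((v x)\<^sup>2)" for x
  proof -
    have "0 \<le> (u x - v x)\<^sup>2" by simp
    then have "(u x + v x)\<^sup>2 \<le> 2 * (u x)\<^sup>2 + 2 * (v x)\<^sup>2"
      by (simp add: power2_eq_square algebra_simps)
    then have "ennreal ((u x + v x)\<^sup>2) \<le> ennreal (2 * (u x)\<^sup>2 + 2 * (v x)\<^sup>2)"
      by (rule ennreal_leI)
    then show ?thesis by (simp add: ennreal_plus ennreal_mult)
  qed
  then have "sqn M (\<lambda>x. u x + v x) \<le> (\<integral>\<^sup>+x. 2 * ennreal ((u x)\<^sup>2) + 2 * ennreal ((v x)\<^sup>2) \<partial>M)"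
    unfolding sqn_def by (intro nn_integral_mono) auto
  also have "\<dots> = 2 * sqn M u + 2 * sqn M v"
    unfolding sqn_def by (subst nn_integral_add) (auto simp: nn_integral_cmult)
  finally show ?thesis .
qed

lemma sqn_uminus: "sqn M (\<lambda>x. - u x) = sqn M u"
  by (simp add: sqn_def)

lemma sqn_diff_le:
  assumes "u \<in> borel_measurable M" "v \<in> borel_measurable M"
  shows "sqn M (\<lambda>x. u x - v x) \<le> 2 * sqn M u + 2 * sqn M v"
  using sqn_add_le[of u M "\<lambda>x. - v x"] assms by (simp add: sqn_uminus)

lemma sqn_diff_commute: "sqn M (\<lambda>x. u x - v x) = sqn M (\<lambda>x. v x - u x)"
  by (simp add: sqn_def power2_commute)

lemma sqn_triangle:
  assumes "u \<in> borel_measurable M" "v \<in> borel_measurable M" "w \<in> borel_measurable M"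
  shows "sqn M (\<lambda>x. u x - w x) \<le> 2 * sqn M (\<lambda>x. u x - v x) + 2 * sqn M (\<lambda>x. v x - w x)"
  using sqn_add_le[of "\<lambda>x. u x - v x" M "\<lambda>x. v x - w x"] assms by simp

lemma sqn_cmult:
  assumes [measurable]: "u \<in> borel_measurable M"
  shows "sqn M (\<lambda>x. c * u x) = ennreal (c\<^sup>2) * sqn M u"
  unfolding sqn_def by (simp add: power_mult_distrib ennreal_mult nn_integral_cmult)

lemma sqn_eq_0_AE:
  assumes [measurable]: "u \<in> borel_measurable M" and "sqn M u = 0"
  shows "AE x in M. u x = 0"
  using assms(2) unfolding sqn_def by (subst (asm) nn_integral_0_iff_AE) auto

text \<open>Cauchy-Schwarz for the finite sum. The factor \<open>card I\<close> is sharp for equal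
  summands, which later makes symmetrization a contraction.\<close>

lemma sqn_sum_le:
  assumes "finite I" "\<And>i. i \<in> I \<Longrightarrow> u i \<in> borel_measurable M"
  shows "sqn M (\<lambda>x. \<Sum>i\<in>I. u i x) \<le> of_nat (card I) * (\<Sum>i\<in>I. sqn M (u i))"
proof -
  have "ennreal ((\<Sum>i\<in>I. u i x)\<^sup>2) \<le> of_nat (card I) * (\<Sum>i\<in>I. ennreal ((u i x)\<^sup>2))" for x
  proof -
    have "(\<Sum>i\<in>I. u i x)\<^sup>2 \<le> real (card I) * (\<Sum>i\<in>I. (u i x)\<^sup>2)"
      using sum_squared_le_sum_of_squares[of "\<lambda>i. u i x" I] by (simp add: mult.commute)
    then have "ennreal ((\<Sum>i\<in>I. u i x)\<^sup>2) \<le> ennreal (real (card I) * (\<Sum>i\<in>I. (u i x)\<^sup>2))"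
      by (rule ennreal_leI)
    also have "\<dots> = of_nat (card I) * (\<Sum>i\<in>I. ennreal ((u i x)\<^sup>2))"
      by (subst ennreal_mult) (auto simp: sum_nonneg ennreal_of_nat_eq_real_of_nat)
    finally show ?thesis .
  qed
  then have "sqn M (\<lambda>x. \<Sum>i\<in>I. u i x) \<le> (\<integral>\<^sup>+x. of_nat (card I) * (\<Sum>i\<in>I. ennreal ((u i x)\<^sup>2)) \<partial>M)"
    unfolding sqn_def by (intro nn_integral_mono) auto
  also have "\<dots> = of_nat (card I) * (\<Sum>i\<in>I. sqn M (u i))"
    unfolding sqn_def using assms
    by (subst nn_integral_cmult) (auto intro!: borel_measurable_sum simp: nn_integral_sum simp del: sum_ennreal)
  finally show ?thesis .
qed

lemma tendsto_0_ennreal_affine: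
  fixes f g :: "nat \<Rightarrow> ennreal" and a b :: ennreal
  assumes "f \<longlonglongrightarrow> 0" "g \<longlonglongrightarrow> 0" "a < \<top>" "b < \<top>"
  shows "(\<lambda>k. a * f k + b * g k) \<longlonglongrightarrow> 0"
proof -
  have "(\<lambda>k. a * f k) \<longlonglongrightarrow> a * 0" using assms by (intro ennreal_tendsto_cmult) auto
  moreover have "(\<lambda>k. b * g k) \<longlonglongrightarrow> b * 0" using assms by (intro ennreal_tendsto_cmult) auto
  ultimately have "(\<lambda>k. a * f k + b * g k) \<longlonglongrightarrow> a * 0 + b * 0" by (rule tendsto_add)
  then show ?thesis by simp
qed

lemma tendsto_0_ennreal_le:
  fixes f g :: "nat \<Rightarrow> ennreal"
  assumes "g \<longlonglongrightarrow> 0" "\<And>k. f k \<le> g k"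
  shows "f \<longlonglongrightarrow> 0"
  by (rule tendsto_sandwich[OF _ _ tendsto_const assms(1)]) (auto simp: assms(2))

lemma sqn_tendsto_add:
  assumes m: "\<And>k. X k \<in> borel_measurable M" "\<And>k. Y k \<in> borel_measurable M" "F \<in> borel_measurable M" "G \<in> borel_measurable M"
    and "(\<lambda>k. sqn M (\<lambda>x. X k x - F x)) \<longlonglongrightarrow> 0" "(\<lambda>k. sqn M (\<lambda>x. Y k x - G x)) \<longlonglongrightarrow> 0"
  shows "(\<lambda>k. sqn M (\<lambda>x. (X k x + Y k x) - (F x + G x))) \<longlonglongrightarrow> 0"
proof (rule tendsto_0_ennreal_le)
  show "(\<lambda>k. 2 * sqn M (\<lambda>x. X k x - F x) + 2 * sqn M (\<lambda>x. Y k x - G x)) \<longlonglongrightarrow> 0"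
    by (intro tendsto_0_ennreal_affine assms) auto
  fix k
  have "(\<lambda>x. (X k x + Y k x) - (F x + G x)) = (\<lambda>x. (X k x - F x) + (Y k x - G x))" by auto
  then show "sqn M (\<lambda>x. (X k x + Y k x) - (F x + G x)) \<le> 2 * sqn M (\<lambda>x. X k x - F x) + 2 * sqn M (\<lambda>x. Y k x - G x)"
    using m by (simp add: sqn_add_le)
qed

lemma sqn_limit_unique:
  assumes [measurable]: "\<And>k. X k \<in> borel_measurable M" "F \<in> borel_measurable M" "G \<in> borel_measurable M"
    and "(\<lambda>k. sqn M (\<lambda>x. X k x - F x)) \<longlonglongrightarrow> 0" "(\<lambda>k. sqn M (\<lambda>x. X k x - G x)) \<longlonglongrightarrow> 0"
  shows "AE x in M. F x = G x"
proof -
  have "(\<lambda>k. 2 * sqn M (\<lambda>x. X k x - F x) + 2 * sqn M (\<lambda>x. X k x - G x)) \<longlonglongrightarrow> 0"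
    by (intro tendsto_0_ennreal_affine assms) auto
  moreover have "sqn M (\<lambda>x. F x - G x) \<le> 2 * sqn M (\<lambda>x. X k x - F x) + 2 * sqn M (\<lambda>x. X k x - G x)" for k
    using sqn_triangle[of F M "X k" G] by (simp add: sqn_diff_commute)
  ultimately have "sqn M (\<lambda>x. F x - G x) \<le> 0"
    by (intro LIMSEQ_le_const) auto
  then have "AE x in M. F x - G x = 0" by (intro sqn_eq_0_AE) auto
  then show ?thesis by simp
qed

section \<open>Pointwise limits from geometric rates in the mean\<close>

lemma suminf_geometric_finite:
  fixes C :: real assumes "0 \<le> r" "r < 1" "0 \<le> C"
  shows "(\<Sum>k. ennreal (C * r ^ k)) < \<top>"
proof -
  have "summable (\<lambda>k. C * r ^ k)" using assms by (intro summable_mult summable_geometric) auto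
  then show ?thesis using assms
    by (subst suminf_ennreal2) (auto)
qed

lemma AE_summable_ennreal:
  assumes [measurable]: "\<And>k. f k \<in> borel_measurable M" and nn: "\<And>k x. 0 \<le> f k x"
    and "0 \<le> C" "0 \<le> r" "r < 1" and le: "\<And>k. (\<integral>\<^sup>+x. ennreal (f k x) \<partial>M) \<le> ennreal (C * r ^ k)"
  shows "AE x in M. summable (\<lambda>k. f k x)"
proof -
  have "(\<integral>\<^sup>+x. (\<Sum>k. ennreal (f k x)) \<partial>M) = (\<Sum>k. \<integral>\<^sup>+x. ennreal (f k x) \<partial>M)"
    by (rule nn_integral_suminf) auto
  also have "\<dots> \<le> (\<Sum>k. ennreal (C * r ^ k))" by (intro suminf_le le) auto
  also have "\<dots> < \<top>" using assms by (intro suminf_geometric_finite) auto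
  finally have "AE x in M. (\<Sum>k. ennreal (f k x)) \<noteq> \<infinity>"
    by (intro nn_integral_noteq_infinite) auto
  then show ?thesis
    by eventually_elim (use nn in \<open>auto intro!: summable_suminf_not_top\<close>)
qed

text \<open>The integrals are summable, so the sum of the \<open>f k\<close> is integrable and hence
  finite almost everywhere. Approximations with a geometric rate thus converge pointwise without a
  subsequence depending on a parameter, which matters once a variable is frozen.\<close>

lemma AE_tendsto_0_ennreal:
  fixes f :: "nat \<Rightarrow> 'b \<Rightarrow> ennreal"
  assumes [measurable]: "\<And>k. f k \<in> borel_measurable M"
    and "0 \<le> C" "0 \<le> r" "r < 1" and le: "\<And>k. (\<integral>\<^sup>+x. f k x \<partial>M) \<le> ennreal (C * r ^ k)"
  shows "AE x in M. (\<lambda>k. f k x) \<longlonglongrightarrow> 0"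
proof -
  have "(\<integral>\<^sup>+x. (\<Sum>k. f k x) \<partial>M) = (\<Sum>k. \<integral>\<^sup>+x. f k x \<partial>M)"
    by (rule nn_integral_suminf) auto
  also have "\<dots> \<le> (\<Sum>k. ennreal (C * r ^ k))" by (intro suminf_le le) auto
  also have "\<dots> < \<top>" using assms by (intro suminf_geometric_finite) auto
  finally have "AE x in M. (\<Sum>k. f k x) \<noteq> \<infinity>"
    by (intro nn_integral_noteq_infinite) auto
  then show ?thesis
  proof eventually_elim
    case (elim x)
    then have fin: "f k x < \<top>" for k
      using sum_le_suminf[of "\<lambda>k. f k x" "{k}"] by (auto simp: less_top[symmetric] top_unique)
    have eq: "f k x = ennreal (enn2real (f k x))" for k using fin by simp
    have "summable (\<lambda>k. enn2real (f k x))"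
      by (rule summable_suminf_not_top) (use elim fin in auto)
    then have "(\<lambda>k. enn2real (f k x)) \<longlonglongrightarrow> 0" by (rule summable_LIMSEQ_zero)
    then have "(\<lambda>k. ennreal (enn2real (f k x))) \<longlonglongrightarrow> ennreal 0" by (rule tendsto_ennrealI)
    then show ?case using fin by simp
  qed
qed

text \<open>Completeness of L2 with the rate retained: the norms of the increments decay like
  \<open>(1/2) ^ k\<close>, so the sequence converges almost everywhere, and Fatou's lemma transfers
  the Cauchy bound to the limit. Defining \<open>F\<close> as a pointwise \<open>lim\<close> makes
  it measurable at once.\<close>

lemma sqn_fast_Cauchy_limit:
  assumes m[measurable]: "\<And>k. X k \<in> borel_measurable M" and C: "0 \<le> C"
    and ca: "\<And>j k. k \<le> j \<Longrightarrow> sqn M (\<lambda>x. X j x - X k x) \<le> ennreal (C * (1/4) ^ k)"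
  obtains F where "F \<in> borel_measurable M" "AE x in M. (\<lambda>k. X k x) \<longlonglongrightarrow> F x"
    "\<And>k. sqn M (\<lambda>x. X k x - F x) \<le> ennreal (C * (1/4) ^ k)"
proof
  define F where "F x = lim (\<lambda>k. X k x)" for x
  show Fm[measurable]: "F \<in> borel_measurable M" unfolding F_def by measurable
  \<comment> \<open>The weight \<open>2 ^ k\<close> uses up half of the exponential decay, and what
    remains is still summable; it is what allows passing from squared to plain increments
    below.\<close>
  have "AE x in M. summable (\<lambda>k. 2 ^ k * (X (Suc k) x - X k x)\<^sup>2)"
  proof (rule AE_summable_ennreal[where C = C and r = "1/2"])
    fix k
    have "(\<integral>\<^sup>+x. ennreal (2 ^ k * (X (Suc k) x - X k x)\<^sup>2) \<partial>M) = ennreal (2 ^ k) * sqn M (\<lambda>x. X (Suc k) x - X k x)"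
      unfolding sqn_def by (subst nn_integral_cmult[symmetric]) (auto simp: ennreal_mult)
    also have "\<dots> \<le> ennreal (2 ^ k) * ennreal (C * (1/4) ^ k)"
      by (intro mult_left_mono ca) auto
    also have "\<dots> = ennreal (2 ^ k * (C * (1/4) ^ k))" using C by (simp add: ennreal_mult)
    also have "2 ^ k * (C * (1/4) ^ k) = C * (2 * (1/4)) ^ k" by (simp only: power_mult_distrib) simp
    also have "\<dots> = C * (1/2) ^ k" by simp
    finally show "(\<integral>\<^sup>+x. ennreal (2 ^ k * (X (Suc k) x - X k x)\<^sup>2) \<partial>M) \<le> ennreal (C * (1/2) ^ k)" .
  qed (use C in auto)
  then show conv: "AE x in M. (\<lambda>k. X k x) \<longlonglongrightarrow> F x"
  proof eventually_elim
    case (elim x)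
    have "summable (\<lambda>k. X (Suc k) x - X k x)"
    proof (rule summable_comparison_test')
      show "summable (\<lambda>k. 2 ^ k * (X (Suc k) x - X k x)\<^sup>2 + (1/2::real) ^ k)"
        by (intro summable_add elim summable_geometric) auto
      fix k
      define d where "d = X (Suc k) x - X k x"
      define t :: real where "t = 2 ^ k"
      have t: "t > 0" by (simp add: t_def)
      \<comment> \<open>Arithmetic-geometric mean in the form
        \<open>\<bar>d\<bar> \<le> t * d\<^sup>2 + 1 / t\<close> with \<open>t = 2 ^ k\<close>; both
        terms on the right are summable in \<open>k\<close>.\<close>
      have "0 \<le> (t * \<bar>d\<bar> - 1)\<^sup>2" by simp
      then have "2 * t * \<bar>d\<bar> \<le> t * t * d\<^sup>2 + 1" by (simp add: power2_eq_square algebra_simps)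
      moreover have "t * \<bar>d\<bar> \<le> 2 * t * \<bar>d\<bar>" using t by simp
      ultimately have "t * \<bar>d\<bar> \<le> t * t * d\<^sup>2 + 1" by linarith
      moreover have "t * (t * d\<^sup>2 + 1 / t) = t * t * d\<^sup>2 + 1" using t by (simp add: algebra_simps)
      ultimately have "t * \<bar>d\<bar> \<le> t * (t * d\<^sup>2 + 1 / t)" by simp
      then have "\<bar>d\<bar> \<le> t * d\<^sup>2 + 1 / t" using t mult_le_cancel_left_pos by blast
      then show "norm (X (Suc k) x - X k x) \<le> 2 ^ k * (X (Suc k) x - X k x)\<^sup>2 + (1/2::real) ^ k"
        by (simp add: d_def t_def power_one_over)
    qed
    then have "(\<lambda>n. \<Sum>k<n. X (Suc k) x - X k x) \<longlonglongrightarrow> (\<Sum>k. X (Suc k) x - X k x)"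
      by (rule summable_LIMSEQ)
    then have "(\<lambda>n. (X n x - X 0 x) + X 0 x) \<longlonglongrightarrow> (\<Sum>k. X (Suc k) x - X k x) + X 0 x"
      by (intro tendsto_add tendsto_const) (simp add: sum_lessThan_telescope[of "\<lambda>k. X k x"])
    then have "convergent (\<lambda>n. X n x)" by (auto simp: convergent_def)
    then show ?case by (simp add: F_def convergent_LIMSEQ_iff)
  qed
  show "sqn M (\<lambda>x. X k x - F x) \<le> ennreal (C * (1/4) ^ k)" for k
  proof -
    have "sqn M (\<lambda>x. X k x - F x) = (\<integral>\<^sup>+x. liminf (\<lambda>j. ennreal ((X j x - X k x)\<^sup>2)) \<partial>M)"
      unfolding sqn_def
    proof (rule nn_integral_cong_AE, use conv in eventually_elim)
      case (elim x)
      have "(\<lambda>j. ennreal ((X j x - X k x)\<^sup>2)) \<longlonglongrightarrow> ennreal ((F x - X k x)\<^sup>2)"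
        by (intro tendsto_intros tendsto_ennrealI elim)
      from lim_imp_Liminf[OF trivial_limit_sequentially this] show ?case by (simp add: power2_commute)
    qed
    also have "\<dots> \<le> liminf (\<lambda>j. sqn M (\<lambda>x. X j x - X k x))"
      unfolding sqn_def by (intro nn_integral_liminf) auto
    also have "\<dots> \<le> liminf (\<lambda>j. ennreal (C * (1/4) ^ k))"
      by (intro Liminf_mono eventually_sequentiallyI[of k] ca)
    also have "\<dots> = ennreal (C * (1/4) ^ k)" by (simp add: Liminf_const)
    finally show ?thesis .
  qed
qed

lemma geometric_subseq:
  fixes f :: "nat \<Rightarrow> ennreal" assumes "f \<longlonglongrightarrow> 0"
  obtains r where "strict_mono r" "\<And>k. f (r k) \<le> ennreal ((1/4) ^ k)"
proof -
  have ev: "\<exists>N. \<forall>n\<ge>N. f n < ennreal ((1/4) ^ k)" for k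
    using order_tendstoD(2)[OF assms, of "ennreal ((1/4)^k)"] by (auto simp: eventually_sequentially)
  then obtain N where N: "\<And>k n. N k \<le> n \<Longrightarrow> f n < ennreal ((1/4) ^ k)" by metis
  \<comment> \<open>Partial sums of \<open>Suc (N i)\<close> are strictly increasing and dominate
    \<open>N k\<close> at the same time.\<close>
  define r where "r k = (\<Sum>i\<le>k. Suc (N i))" for k
  have "strict_mono r" by (auto simp: strict_mono_Suc_iff r_def)
  moreover have "N k \<le> r k" for k
  proof -
    have "Suc (N k) \<le> r k" unfolding r_def by (rule member_le_sum) auto
    then show ?thesis by simp
  qed
  ultimately show ?thesis using N that by (meson less_imp_le)
qed

lemma sqn_tendsto_AE_subseq:
  assumes m[measurable]: "\<And>k. X k \<in> borel_measurable M" "F \<in> borel_measurable M"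
    and "\<And>k. sqn M (\<lambda>x. X k x - F x) \<le> ennreal (C * (1/4) ^ k)" "0 \<le> C"
  shows "AE x in M. (\<lambda>k. X k x) \<longlonglongrightarrow> F x"
proof -
  have "AE x in M. (\<lambda>k. ennreal ((X k x - F x)\<^sup>2)) \<longlonglongrightarrow> 0"
    by (rule AE_tendsto_0_ennreal[where C = C and r = "1/4"]) (use assms in \<open>auto simp: sqn_def\<close>)
  then show ?thesis
  proof eventually_elim
    case (elim x)
    then have "(\<lambda>k. (X k x - F x)\<^sup>2) \<longlonglongrightarrow> 0"
      using tendsto_ennreal_iff[of "\<lambda>k. (X k x - F x)\<^sup>2" sequentially 0] by auto
    then have "(\<lambda>k. sqrt ((X k x - F x)\<^sup>2)) \<longlonglongrightarrow> sqrt 0"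
      by (rule tendsto_real_sqrt)
    then have "(\<lambda>k. X k x - F x) \<longlonglongrightarrow> 0"
      by (simp add: tendsto_rabs_zero_iff)
    then show ?case by (simp add: LIM_zero_iff)
  qed
qed

section \<open>Primitives and weak gradients\<close>

text \<open>The half-line is modelled inside \<open>lborel\<close>: at negative arguments nothing
  beyond measurability is asked. The interval includes 0, so that primitives start at the boundary
  point.\<close>

definition locint :: "(real \<Rightarrow> real) \<Rightarrow> bool" where
  "locint v \<longleftrightarrow> v \<in> borel_measurable borel \<and> (\<forall>b. integrable lborel (\<lambda>t. indicator {0..b} t * v t))"

definition prim :: "(real \<Rightarrow> real) \<Rightarrow> real \<Rightarrow> real" where
  "prim v x = (\<integral>t. indicator {0..x} t * v t \<partial>lborel)"

lemma locintD: "locint v \<Longrightarrow> v \<in> borel_measurable borel" "locint v \<Longrightarrow> integrable lborel (\<lambda>t. indicator {0..b} t * v t)"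
  by (auto simp: locint_def)

lemma locint_abs: "locint v \<Longrightarrow> locint (\<lambda>t. \<bar>v t\<bar>)"
proof -
  assume v: "locint v"
  have "integrable lborel (\<lambda>t. \<bar>indicator {0..b} t * v t\<bar>)" for b
    using v by (intro integrable_abs) (auto simp: locint_def)
  then show ?thesis using v by (auto simp: locint_def abs_mult)
qed

lemma locint_add: "locint v \<Longrightarrow> locint w \<Longrightarrow> locint (\<lambda>t. v t + w t)"
  by (auto simp: locint_def distrib_left intro!: Bochner_Integration.integrable_add)

lemma locint_diff: "locint v \<Longrightarrow> locint w \<Longrightarrow> locint (\<lambda>t. v t - w t)"
  by (auto simp: locint_def right_diff_distrib intro!: Bochner_Integration.integrable_diff)

lemma locint_bounded_mult:
  assumes v: "locint v" and g: "g \<in> borel_measurable borel" and S: "S \<subseteq> {0..b}" "S \<in> sets borel"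
    and B: "\<And>t. t \<in> S \<Longrightarrow> \<bar>g t\<bar> \<le> B"
  shows "integrable lborel (\<lambda>t. indicator S t * (g t * v t))"
proof (rule Bochner_Integration.integrable_bound)
  show "integrable lborel (\<lambda>t. B * (indicator {0..b} t * \<bar>v t\<bar>))"
    using locintD(2)[OF locint_abs[OF v]] by (intro integrable_mult_right)
  show "(\<lambda>t. indicator S t * (g t * v t)) \<in> borel_measurable lborel"
    using v g S by (auto dest: locintD)
  show "AE t in lborel. norm (indicator S t * (g t * v t)) \<le> norm (B * (indicator {0..b} t * \<bar>v t\<bar>))"
  proof (intro AE_I2)
    fix t
    show "norm (indicator S t * (g t * v t)) \<le> norm (B * (indicator {0..b} t * \<bar>v t\<bar>))"
      using S(1) B[of t] mult_right_mono[of "\<bar>g t\<bar>" B "\<bar>v t\<bar>"] by (auto simp: indicator_def abs_mult)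
  qed
qed

lemma locint_sub:
  assumes v: "locint v" and S: "S \<subseteq> {0..b}" "S \<in> sets borel"
  shows "integrable lborel (\<lambda>t. indicator S t * v t)"
  using locint_bounded_mult[OF v _ S, of "\<lambda>_. 1" 1] by simp

lemma locint_mult_bounded:
  assumes v: "locint v" and g: "g \<in> borel_measurable borel" and B: "\<And>t. \<bar>g t\<bar> \<le> B"
  shows "locint (\<lambda>t. g t * v t)"
  unfolding locint_def using locint_bounded_mult[OF v g order_refl _ B] g locintD(1)[OF v] by auto

lemma prim_diff:
  assumes v: "locint v" and "0 \<le> x" "x \<le> y"
  shows "prim v y - prim v x = (\<integral>t. indicator {x<..y} t * v t \<partial>lborel)"
proof -
  have "prim v y = (\<integral>t. indicator {0..x} t * v t + indicator {x<..y} t * v t \<partial>lborel)"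
    unfolding prim_def using assms
    by (intro Bochner_Integration.integral_cong) (auto simp: indicator_def)
  also have "\<dots> = prim v x + (\<integral>t. indicator {x<..y} t * v t \<partial>lborel)"
    unfolding prim_def using assms by (intro Bochner_Integration.integral_add locint_sub[where b = y]) auto
  finally show ?thesis by simp
qed

lemma prim_neg: "x < 0 \<Longrightarrow> prim v x = 0"
  by (simp add: prim_def)

text \<open>Dominated convergence: \<open>indicator {0..X n} t\<close> converges for every
  \<open>t \<noteq> x\<close>, and the remaining point is null.\<close>

lemma continuous_prim:
  assumes v: "locint v" shows "continuous_on UNIV (prim v)"
  unfolding continuous_on_eq_continuous_at[OF open_UNIV]
proof
  fix x
  have [measurable]: "v \<in> borel_measurable borel" using v by (rule locintD)
  show "isCont (prim v) x"
    unfolding continuous_at_sequentially comp_def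
  proof (intro allI impI)
    fix X assume X: "X \<longlonglongrightarrow> x"
    then obtain B where B: "\<And>n. \<bar>X n\<bar> \<le> B"
      using Bseq_def[of X] convergent_imp_Bseq[of X] by (auto simp: convergent_def)
    show "(\<lambda>n. prim v (X n)) \<longlonglongrightarrow> prim v x"
      unfolding prim_def
    proof (rule integral_dominated_convergence)
      show "integrable lborel (\<lambda>t. indicator {0..B} t * \<bar>v t\<bar>)"
        by (rule locintD(2)[OF locint_abs[OF v]])
      show "AE t in lborel. (\<lambda>n. indicator {0..X n} t * v t) \<longlonglongrightarrow> indicator {0..x} t * v t"
      proof (rule AE_mp[OF AE_lborel_singleton[of x]], intro AE_I2 impI)
        fix t assume "t \<noteq> x"
        have "\<forall>\<^sub>F n in sequentially. indicator {0..X n} t = (indicator {0..x} t :: real)"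
        proof (cases "t < x")
          case True
          from order_tendstoD(1)[OF X this] show ?thesis by eventually_elim (use True in \<open>auto simp: indicator_def\<close>)
        next
          case False
          then have "x < t" using \<open>t \<noteq> x\<close> by simp
          from order_tendstoD(2)[OF X this] show ?thesis by eventually_elim (use False \<open>t \<noteq> x\<close> in \<open>auto simp: indicator_def\<close>)
        qed
        then have "(\<lambda>n. indicator {0..X n} t) \<longlonglongrightarrow> (indicator {0..x} t :: real)" by (rule tendsto_eventually)
        then show "(\<lambda>n. indicator {0..X n} t * v t) \<longlonglongrightarrow> indicator {0..x} t * v t"
          by (intro tendsto_mult_right)
      qed
      show "AE t in lborel. norm (indicator {0..X n} t * v t) \<le> indicator {0..B} t * \<bar>v t\<bar>" for n
        using B[of n] by (intro AE_I2) (auto simp: indicator_def)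
    qed measurable
  qed
qed

lemma measurable_prim: "locint v \<Longrightarrow> prim v \<in> borel_measurable borel"
  by (intro borel_measurable_continuous_onI continuous_prim)

text \<open>A function whose increments are negligible with respect to those of a fixed function cannot
  move; this replaces differentiation of indefinite integrals.\<close>

lemma eq_if_increments_small:
  fixes H w :: "real \<Rightarrow> real"
  assumes "a \<le> b"
    and small: "\<And>e. 0 < e \<Longrightarrow> \<exists>d>0. \<forall>s t. a \<le> s \<and> s \<le> t \<and> t \<le> b \<and> t - s < d \<longrightarrow> \<bar>H t - H s\<bar> \<le> e * (w t - w s)"
  shows "H b = H a"
proof -
  have bound: "\<bar>H b - H a\<bar> \<le> e * (w b - w a)" if e: "0 < e" for e
  proof -
    from small[OF e] obtain d where d: "d > 0"
      and D: "\<And>s t. a \<le> s \<Longrightarrow> s \<le> t \<Longrightarrow> t \<le> b \<Longrightarrow> t - s < d \<Longrightarrow> \<bar>H t - H s\<bar> \<le> e * (w t - w s)"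
      by blast
    obtain n :: nat where n: "(b - a) / d < real n" using reals_Archimedean2 by blast
    have n0: "n > 0" using n \<open>a \<le> b\<close> d by (intro gr0I) (auto simp: divide_less_0_iff)
    \<comment> \<open>Equidistant points with mesh below \<open>d\<close>. The increments of
      \<open>H\<close> are estimated one by one, and the bounds in terms of \<open>w\<close>
      telescope.\<close>
    define p where "p i = a + real i * ((b - a) / real n)" for i
    have p0: "p 0 = a" and pn: "p n = b" using n0 by (auto simp: p_def)
    have step: "p (Suc i) = p i + (b - a) / real n" for i by (simp add: p_def distrib_right add_divide_distrib)
    have small': "(b - a) / real n < d" using n n0 d by (simp add: field_simps)
    have nn: "(b - a) / real n \<ge> 0" using \<open>a \<le> b\<close> by simp
    have pa: "a \<le> p i" for i
      using mult_nonneg_nonneg[OF of_nat_0_le_iff nn, of i] by (simp add: p_def)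
    have pb: "p (Suc i) \<le> b" if "i < n" for i
    proof -
      have "real (Suc i) * ((b - a) / real n) \<le> real n * ((b - a) / real n)"
        using that nn by (intro mult_right_mono) auto
      then show ?thesis using n0 by (simp add: p_def)
    qed
    have "\<bar>H b - H a\<bar> = \<bar>\<Sum>i<n. H (p (Suc i)) - H (p i)\<bar>"
      by (subst sum_lessThan_telescope) (simp add: p0 pn)
    also have "\<dots> \<le> (\<Sum>i<n. \<bar>H (p (Suc i)) - H (p i)\<bar>)" by (rule sum_abs)
    also have "\<dots> \<le> (\<Sum>i<n. e * (w (p (Suc i)) - w (p i)))"
    proof (intro sum_mono)
      fix i assume "i \<in> {..<n}"
      then show "\<bar>H (p (Suc i)) - H (p i)\<bar> \<le> e * (w (p (Suc i)) - w (p i))"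
        using step[of i] nn small' pa[of i] pb[of i] by (intro D) auto
    qed
    also have "\<dots> = e * (w b - w a)"
      unfolding sum_distrib_left[symmetric] by (subst sum_lessThan_telescope) (simp add: p0 pn)
    finally show ?thesis .
  qed
  have W: "w b - w a \<ge> 0" using bound[of 1] by simp
  have "\<bar>H b - H a\<bar> \<le> 0"
  proof (rule field_le_epsilon)
    fix e :: real assume "e > 0"
    \<comment> \<open>The \<open>+ 1\<close> keeps the quotient positive and defined when
      \<open>w\<close> has no increment.\<close>
    then have "\<bar>H b - H a\<bar> \<le> e / (w b - w a + 1) * (w b - w a)" using W by (intro bound) auto
    also have "\<dots> \<le> e" using W \<open>e > 0\<close> by (simp add: field_simps)
    finally show "\<bar>H b - H a\<bar> \<le> 0 + e" by simp
  qed
  then show ?thesis by simp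
qed

text \<open>Both sides are compared as functions of the upper endpoint. The mean value theorem
  writes an increment of \<open>G\<close> as \<open>g c\<close> times the increment of
  \<open>prim v\<close>, and uniform continuity replaces \<open>g c\<close> by
  \<open>g (prim v r)\<close> with error \<open>e\<close>. So the increments of the difference are
  at most \<open>e\<close> times those of the primitive of \<open>\<bar>v\<bar>\<close>, and
  \<open>eq_if_increments_small\<close> applies; no differentiability of \<open>prim v\<close> is
  involved.\<close>

lemma prim_chain_rule:
  assumes v: "locint v" and G: "\<And>z. (G has_real_derivative g z) (at z)" and g: "continuous_on UNIV g"
    and xy: "0 \<le> x" "x \<le> y"
  shows "G (prim v y) - G (prim v x) = (\<integral>t. indicator {x<..y} t * (g (prim v t) * v t) \<partial>lborel)"
proof -
  define U where "U = prim v"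
  define w where "w = prim (\<lambda>t. \<bar>v t\<bar>)"
  have Uc: "continuous_on S U" for S unfolding U_def using continuous_on_subset[OF continuous_prim[OF v]] by auto
  have [measurable]: "v \<in> borel_measurable borel" using v by (rule locintD)
  have [measurable]: "U \<in> borel_measurable borel" unfolding U_def by (rule measurable_prim[OF v])
  have [measurable]: "g \<in> borel_measurable borel" using g by (rule borel_measurable_continuous_onI)
  have "compact (U ` {0..y})" by (intro compact_continuous_image Uc) auto
  then have "bounded (U ` {0..y})" by (rule compact_imp_bounded)
  then obtain R where R: "\<And>t. t \<in> {0..y} \<Longrightarrow> \<bar>U t\<bar> \<le> R" unfolding bounded_iff by (metis imageI real_norm_def)
  have "compact (g ` {-R..R})" by (intro compact_continuous_image continuous_on_subset[OF g]) auto
  then have "bounded (g ` {-R..R})" by (rule compact_imp_bounded)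
  then obtain B where B: "\<And>z. z \<in> {-R..R} \<Longrightarrow> \<bar>g z\<bar> \<le> B" unfolding bounded_iff by (metis imageI real_norm_def)
  have int: "integrable lborel (\<lambda>t. indicator S t * (g (U t) * v t))" if "S \<subseteq> {0..y}" "S \<in> sets borel" for S
    by (rule locint_bounded_mult[OF v _ that, where B = B]) (use R B that in \<open>auto simp: abs_le_iff minus_le_iff\<close>)
  define J where "J t = (\<integral>r. indicator {x<..t} r * (g (U r) * v r) \<partial>lborel)" for t
  have Jdiff: "J t - J s = (\<integral>r. indicator {s<..t} r * (g (U r) * v r) \<partial>lborel)" if "x \<le> s" "s \<le> t" "t \<le> y" for s t
  proof -
    have "J t = (\<integral>r. indicator {x<..s} r * (g (U r) * v r) + indicator {s<..t} r * (g (U r) * v r) \<partial>lborel)"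
      unfolding J_def using that by (intro Bochner_Integration.integral_cong) (auto simp: indicator_def)
    also have "\<dots> = J s + (\<integral>r. indicator {s<..t} r * (g (U r) * v r) \<partial>lborel)"
      unfolding J_def using that xy by (intro Bochner_Integration.integral_add int) auto
    finally show ?thesis by simp
  qed
  have "G (U y) - J y = G (U x) - J x"
  proof (rule eq_if_increments_small[where w = w, OF xy(2)])
    fix e :: real assume e: "e > 0"
    have "uniformly_continuous_on {-R..R} g"
      by (intro compact_uniformly_continuous continuous_on_subset[OF g]) auto
    then obtain d1 where d1: "d1 > 0" and D1: "\<And>z z'. z \<in> {-R..R} \<Longrightarrow> z' \<in> {-R..R} \<Longrightarrow> dist z' z < d1 \<Longrightarrow> dist (g z') (g z) < e"
      using e unfolding uniformly_continuous_on_def by metis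
    have "uniformly_continuous_on {0..y} U" by (intro compact_uniformly_continuous Uc) auto
    then obtain d where d: "d > 0" and D: "\<And>s t. s \<in> {0..y} \<Longrightarrow> t \<in> {0..y} \<Longrightarrow> dist t s < d \<Longrightarrow> dist (U t) (U s) < d1"
      using d1 unfolding uniformly_continuous_on_def by metis
    show "\<exists>d>0. \<forall>s t. x \<le> s \<and> s \<le> t \<and> t \<le> y \<and> t - s < d \<longrightarrow>
       \<bar>(G (U t) - J t) - (G (U s) - J s)\<bar> \<le> e * (w t - w s)"
    proof (intro exI[of _ d] conjI allI impI d, elim conjE)
      fix s t assume st: "x \<le> s" "s \<le> t" "t \<le> y" "t - s < d"
      \<comment> \<open>The mean value theorem in whichever direction \<open>U\<close> moves; if it
        does not move, the common value serves.\<close>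
      have "\<exists>c. min (U s) (U t) \<le> c \<and> c \<le> max (U s) (U t) \<and> G (U t) - G (U s) = (U t - U s) * g c"
      proof (cases "U s" "U t" rule: linorder_cases)
        case less
        from MVT2[OF this G] obtain z where "U s < z" "z < U t" "G (U t) - G (U s) = (U t - U s) * g z" by blast
        then show ?thesis by (intro exI[of _ z]) auto
      next
        case greater
        from MVT2[OF this G] obtain z where "U t < z" "z < U s" "G (U s) - G (U t) = (U s - U t) * g z" by blast
        then show ?thesis by (intro exI[of _ z]) (auto simp: algebra_simps)
      qed auto
      then obtain c where c: "min (U s) (U t) \<le> c" "c \<le> max (U s) (U t)" and Gc: "G (U t) - G (U s) = (U t - U s) * g c"
        by blast
      have cR: "c \<in> {-R..R}" using c R[of s] R[of t] st xy by (auto simp: min_def max_def split: if_splits)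
      have gc: "\<bar>g c - g (U r)\<bar> \<le> e" if r: "r \<in> {s<..t}" for r
      proof -
        have "dist (U s) (U r) < d1" "dist (U t) (U r) < d1"
          using r st xy D[of r s] D[of r t] by (auto simp: dist_real_def)
        then have "dist c (U r) < d1" using c by (auto simp: dist_real_def min_def max_def split: if_splits)
        moreover have "U r \<in> {-R..R}" using R[of r] r st xy by auto
        ultimately have "dist (g c) (g (U r)) < e" using cR D1 by blast
        then show ?thesis by (simp add: dist_real_def)
      qed
      have "(G (U t) - J t) - (G (U s) - J s) = g c * (U t - U s) - (J t - J s)"
        using Gc by (simp add: algebra_simps)
      also have "\<dots> = (\<integral>r. g c * (indicator {s<..t} r * v r) \<partial>lborel) - (\<integral>r. indicator {s<..t} r * (g (U r) * v r) \<partial>lborel)"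
        unfolding Jdiff[OF st(1-3)] using prim_diff[OF v, of s t] st xy by (simp add: U_def)
      also have "\<dots> = (\<integral>r. g c * (indicator {s<..t} r * v r) - indicator {s<..t} r * (g (U r) * v r) \<partial>lborel)"
        using st xy by (intro Bochner_Integration.integral_diff[symmetric] integrable_mult_right int locint_sub[OF v, where b=y]) auto
      finally have eq: "(G (U t) - J t) - (G (U s) - J s) = (\<integral>r. g c * (indicator {s<..t} r * v r) - indicator {s<..t} r * (g (U r) * v r) \<partial>lborel)" .
      have "\<bar>(G (U t) - J t) - (G (U s) - J s)\<bar> \<le> (\<integral>r. e * (indicator {s<..t} r * \<bar>v r\<bar>) \<partial>lborel)"
        unfolding eq
      proof (rule integral_abs_bound_integral)
        show "integrable lborel (\<lambda>r. g c * (indicator {s<..t} r * v r) - indicator {s<..t} r * (g (U r) * v r))"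
          using st xy by (intro Bochner_Integration.integrable_diff integrable_mult_right int locint_sub[OF v, where b=y]) auto
        show "integrable lborel (\<lambda>r. e * (indicator {s<..t} r * \<bar>v r\<bar>))"
          using st xy by (intro integrable_mult_right locint_sub[OF locint_abs[OF v], where b=y]) auto
        fix r
        show "\<bar>g c * (indicator {s<..t} r * v r) - indicator {s<..t} r * (g (U r) * v r)\<bar> \<le> e * (indicator {s<..t} r * \<bar>v r\<bar>)"
        proof (cases "r \<in> {s<..t}")
          case True
          then have "\<bar>g c * (indicator {s<..t} r * v r) - indicator {s<..t} r * (g (U r) * v r)\<bar> = \<bar>g c - g (U r)\<bar> * \<bar>v r\<bar>"
            by (simp add: abs_mult[symmetric] algebra_simps)
          also have "\<dots> \<le> e * \<bar>v r\<bar>" by (intro mult_right_mono gc True) auto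
          finally show ?thesis using True by simp
        qed simp
      qed
      also have "\<dots> = e * (w t - w s)"
        using prim_diff[OF locint_abs[OF v], of s t] st xy by (simp add: w_def)
      finally show "\<bar>(G (U t) - J t) - (G (U s) - J s)\<bar> \<le> e * (w t - w s)" .
    qed
  qed
  moreover have "J x = 0" by (simp add: J_def)
  ultimately show ?thesis by (simp add: J_def U_def)
qed

text \<open>Truncated multiples of the distance to the complement. \<open>O' = UNIV\<close> is
  excluded because \<open>infdist\<close> to the empty set is 0, so that the functions would vanish
  identically.\<close>

lemma open_continuous_approx:
  fixes O' :: "real set" assumes "open O'" "O' \<noteq> UNIV"
  obtains g :: "nat \<Rightarrow> real \<Rightarrow> real" where
    "\<And>j. continuous_on UNIV (g j)" "\<And>j x. 0 \<le> g j x" "\<And>j x. g j x \<le> indicator O' x"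
    "\<And>x. (\<lambda>j. g j x) \<longlonglongrightarrow> indicator O' x"
proof
  define g where "g j x = min 1 (real j * infdist x (- O'))" for j x
  show "continuous_on UNIV (g j)" for j unfolding g_def by (intro continuous_intros)
  show "0 \<le> g j x" for j x by (simp add: g_def infdist_nonneg)
  show "g j x \<le> indicator O' x" for j x by (auto simp: g_def indicator_def)
  show "(\<lambda>j. g j x) \<longlonglongrightarrow> indicator O' x" for x
  proof (cases "x \<in> O'")
    case True
    have "closed (- O')" using assms by auto
    then have "infdist x (- O') \<noteq> 0" using True assms in_closed_iff_infdist_zero[of "- O'" x] by auto
    then have pos: "infdist x (- O') > 0" using infdist_nonneg[of x "- O'"] by simp
    obtain m :: nat where m: "1 / infdist x (- O') < real m" using reals_Archimedean2 by blast
    have "\<forall>\<^sub>F j in sequentially. g j x = 1"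
      unfolding eventually_sequentially
    proof (intro exI[of _ m] allI impI)
      fix j assume "m \<le> j"
      then have "1 / infdist x (- O') \<le> real j" using m by linarith
      then have "1 \<le> real j * infdist x (- O')" using pos by (simp add: field_simps)
      then show "g j x = 1" by (simp add: g_def)
    qed
    then show ?thesis using True by (auto intro: tendsto_eventually)
  qed (simp add: g_def)
qed

text \<open>\<open>ennreal (f t)\<close> and \<open>ennreal (- f t)\<close> are the positive and
  negative parts of \<open>f\<close>. As densities they define finite measures that agree on all
  rays, hence everywhere, and densities are unique almost everywhere.\<close>

lemma AE_zero_if_ray_integrals_zero:
  fixes f :: "real \<Rightarrow> real"
  assumes f: "integrable lborel f" and z: "\<And>x. (\<integral>t. indicator {x<..} t * f t \<partial>lborel) = 0"
  shows "AE t in lborel. f t = 0"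
proof -
  have [measurable]: "f \<in> borel_measurable borel" using f by auto
  have em: "emeasure (density lborel (\<lambda>t. ennreal (h t))) {x<..} = ennreal (\<integral>t. indicator {x<..} t * max 0 (h t) \<partial>lborel)"
    and ih: "integrable lborel (\<lambda>t. indicator {x<..} t * max 0 (h t))"
    if h: "integrable lborel h" for h :: "real \<Rightarrow> real" and x :: real
  proof -
    have [measurable]: "h \<in> borel_measurable borel" using h by auto
    show ih: "integrable lborel (\<lambda>t. indicator {x<..} t * max 0 (h t))"
    proof (rule Bochner_Integration.integrable_bound[OF h])
      show "(\<lambda>t. indicator {x<..} t * max 0 (h t)) \<in> borel_measurable lborel" by measurable
    qed (auto simp: indicator_def)
    have "emeasure (density lborel (\<lambda>t. ennreal (h t))) {x<..} = (\<integral>\<^sup>+t. ennreal (indicator {x<..} t * max 0 (h t)) \<partial>lborel)"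
      by (subst emeasure_density) (auto intro!: nn_integral_cong simp: indicator_def max_def ennreal_neg)
    also have "\<dots> = ennreal (\<integral>t. indicator {x<..} t * max 0 (h t) \<partial>lborel)"
      by (rule nn_integral_eq_integral[OF ih]) auto
    finally show "emeasure (density lborel (\<lambda>t. ennreal (h t))) {x<..} = ennreal (\<integral>t. indicator {x<..} t * max 0 (h t) \<partial>lborel)" .
  qed
  have nf: "integrable lborel (\<lambda>t. - f t)" using f by simp
  have "density lborel (\<lambda>t. ennreal (f t)) = density lborel (\<lambda>t. ennreal (- f t))"
  proof (rule measure_eqI_lessThan)
    fix x
    show "emeasure (density lborel (\<lambda>t. ennreal (f t))) {x<..} < \<infinity>" using em[OF f] by simp
    have "(\<integral>t. indicator {x<..} t * max 0 (f t) \<partial>lborel) - (\<integral>t. indicator {x<..} t * max 0 (- f t) \<partial>lborel)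
       = (\<integral>t. indicator {x<..} t * max 0 (f t) - indicator {x<..} t * max 0 (- f t) \<partial>lborel)"
      by (intro Bochner_Integration.integral_diff[symmetric] ih f nf)
    also have "\<dots> = (\<integral>t. indicator {x<..} t * f t \<partial>lborel)"
      by (intro Bochner_Integration.integral_cong) (auto simp: indicator_def)
    finally show "emeasure (density lborel (\<lambda>t. ennreal (f t))) {x<..} = emeasure (density lborel (\<lambda>t. ennreal (- f t))) {x<..}"
      unfolding em[OF f] em[OF nf] by (simp add: z)
  qed auto
  then have "AE t in lborel. ennreal (f t) = ennreal (- f t)"
  proof (subst (asm) finite_density_unique)
    have "(\<integral>\<^sup>+t. ennreal (f t) \<partial>lborel) \<le> (\<integral>\<^sup>+t. ennreal (norm (f t)) \<partial>lborel)"
      by (intro nn_integral_mono ennreal_leI) auto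
    also have "\<dots> < \<infinity>" using f by (simp add: integrable_iff_bounded)
    finally show "(\<integral>\<^sup>+t. ennreal (f t) \<partial>lborel) \<noteq> \<infinity>" by simp
  qed auto
  then show ?thesis
    by eventually_elim (metis ennreal_eq_0_iff ennreal_neg linear neg_le_0_iff_le order_antisym)
qed

lemma locint_AE_zero:
  assumes f: "locint f" and z: "\<And>x y. 0 \<le> x \<Longrightarrow> x \<le> y \<Longrightarrow> (\<integral>t. indicator {x<..y} t * f t \<partial>lborel) = 0"
  shows "AE t in lborel. 0 \<le> t \<longrightarrow> f t = 0"
proof -
  have "AE t in lborel. indicator {0<..real n} t * f t = 0" for n
  proof (rule AE_zero_if_ray_integrals_zero)
    show "integrable lborel (\<lambda>t. indicator {0<..real n} t * f t)" by (rule locint_sub[OF f, where b = "real n"]) auto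
    fix x
    have "(\<integral>t. indicator {x<..} t * (indicator {0<..real n} t * f t) \<partial>lborel) = (\<integral>t. indicator {max 0 x<..real n} t * f t \<partial>lborel)"
      by (intro Bochner_Integration.integral_cong) (auto simp: indicator_def)
    then show "(\<integral>t. indicator {x<..} t * (indicator {0<..real n} t * f t) \<partial>lborel) = 0"
      using z[of "max 0 x" "real n"] by (cases "max 0 x \<le> real n") simp_all
  qed
  then have "AE t in lborel. \<forall>n. indicator {0<..real n} t * f t = 0" unfolding AE_all_countable by blast
  then show ?thesis using AE_lborel_singleton[of 0]
  proof eventually_elim
    case (elim t)
    obtain n :: nat where "t \<le> real n" using real_arch_simple by blast
    then show ?case using elim(1)[rule_format, of n] elim(2) by (auto simp: indicator_def split: if_splits)
  qed
qed

text \<open>Cover the translate of \<open>B\<close> by decreasing open sets \<open>A k\<close> of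
  measure at most \<open>1 / Suc k\<close>. If a continuous \<open>g\<close> lies between 0 and
  \<open>indicator (A k)\<close>, its antiderivative oscillates by at most this measure, and the
  chain rule bounds the integral of \<open>g (prim v t) * v t\<close> over every interval by the
  same number. Letting \<open>g\<close> tend to the indicator and then \<open>k\<close> to infinity
  leaves a function all of whose integrals over intervals are 0.\<close>

lemma prim_null_preimage:
  assumes v: "locint v" and B: "B \<in> null_sets lborel"
  shows "AE t in lborel. 0 \<le> t \<longrightarrow> prim v t + c \<in> B \<longrightarrow> v t = 0"
proof -
  define B' where "B' = (\<lambda>z. z - c) ` B"
  have [measurable]: "v \<in> borel_measurable borel" using v by (rule locintD)
  have [measurable]: "prim v \<in> borel_measurable borel" by (rule measurable_prim[OF v])
  have B'eq: "B' = {z. z + c \<in> B}" by (force simp: B'_def image_iff)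
  have Bs[measurable]: "B \<in> sets borel" and B0: "emeasure lborel B = 0" using B by auto
  have B's[measurable]: "B' \<in> sets borel" unfolding B'eq by measurable
  have "emeasure lborel B' = 0"
  proof -
    have "emeasure lborel B' = emeasure (distr lborel borel (\<lambda>z. - c + z)) B'" by (subst lborel_distr_plus) simp
    also have "\<dots> = emeasure lborel B"
      by (subst emeasure_distr) (auto intro!: arg_cong[where f = "emeasure lborel"] simp: B'eq)
    finally show ?thesis using B0 by simp
  qed
  have "\<exists>O'. open O' \<and> B' \<subseteq> O' \<and> emeasure lborel O' < ennreal (1 / real (Suc k))" for k
  proof -
    obtain O' where "open O'" "B' \<subseteq> O'" "emeasure lborel (O' - B') < ennreal (1 / real (Suc k))"
      using outer_regular_lborel[OF B's, of "1 / real (Suc k)"] by auto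
    moreover have "emeasure lborel O' \<le> emeasure lborel (O' - B') + emeasure lborel B'"
      using \<open>B' \<subseteq> O'\<close> \<open>open O'\<close> by (intro order_trans[OF emeasure_mono emeasure_subadditive]) auto
    ultimately show ?thesis using \<open>emeasure lborel B' = 0\<close> by (metis add.right_neutral order_le_less_trans)
  qed
  then obtain O' where O': "\<And>k. open (O' k)" "\<And>k. B' \<subseteq> O' k" "\<And>k. emeasure lborel (O' k) < ennreal (1 / real (Suc k))"
    by metis
  \<comment> \<open>Intersections make the covering decreasing, so that the indicators converge. The
    limit set \<open>A'\<close> may be larger than the null set itself.\<close>
  define A where "A k = (\<Inter>i\<le>k. O' i)" for k
  have Ao: "open (A k)" for k unfolding A_def using O' by (intro open_INT) auto
  have Am[measurable]: "A k \<in> sets borel" for k using Ao by auto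
  have Ale: "emeasure lborel (A k) \<le> ennreal (1 / real (Suc k))" for k
  proof -
    have "emeasure lborel (A k) \<le> emeasure lborel (O' k)"
      using O'(1) by (intro emeasure_mono) (auto simp: A_def)
    then show ?thesis using O'(3)[of k] by simp
  qed
  have Adec: "decseq A" by (auto simp: A_def decseq_def)
  have bound: "\<bar>\<integral>t. indicator {x<..y} t * (indicator (A k) (prim v t) * v t) \<partial>lborel\<bar> \<le> 1 / real (Suc k)"
    if xy: "0 \<le> x" "x \<le> y" for x y k
  proof -
    have "emeasure lborel (A k) < \<top>" using Ale[of k] ennreal_less_top by (rule le_less_trans)
    then have "A k \<noteq> UNIV" by (metis emeasure_lborel_UNIV infinity_ennreal_def order_less_irrefl)
    with Ao obtain g :: "nat \<Rightarrow> real \<Rightarrow> real" where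
      g: "\<And>j. continuous_on UNIV (g j)" "\<And>j x. 0 \<le> g j x" "\<And>j x. g j x \<le> indicator (A k) x"
      "\<And>x. (\<lambda>j. g j x) \<longlonglongrightarrow> indicator (A k) x" by (rule open_continuous_approx) blast
    have gm[measurable]: "g j \<in> borel_measurable borel" for j using g(1) by (rule borel_measurable_continuous_onI)
    have gb: "\<bar>g j t\<bar> \<le> 1" for j t
      using g(2)[of j t] order_trans[OF g(3)[of j t] indicator_le_1] by simp
    have "\<bar>\<integral>t. indicator {x<..y} t * (g j (prim v t) * v t) \<partial>lborel\<bar> \<le> 1 / real (Suc k)" for j
    proof -
      have "isCont (g j) z" for z using g(1)[of j] by (simp add: continuous_on_eq_continuous_at)
      then obtain G where G: "\<And>z. (G has_real_derivative g j z) (at z)"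
        using einterval_antiderivative[of "-\<infinity>" "\<infinity>" "g j"] by (auto simp: has_real_derivative_iff_has_vector_derivative)
      have le: "\<bar>G b - G a\<bar> \<le> 1 / real (Suc k)" if ab: "a \<le> b" for a b
      proof -
        have "ennreal (G b - G a) = (\<integral>\<^sup>+z. ennreal (g j z) * indicator {a..b} z \<partial>lborel)"
          using ab by (intro nn_integral_FTC_Icc[symmetric]) (auto intro: G g has_field_derivative_at_within)
        also have "\<dots> \<le> (\<integral>\<^sup>+z. indicator (A k) z \<partial>lborel)"
        proof (intro nn_integral_mono)
          fix z
          have "ennreal (g j z) \<le> ennreal (indicator (A k) z)" by (intro ennreal_leI g)
          then show "ennreal (g j z) * indicator {a..b} z \<le> indicator (A k) z" by (auto simp: indicator_def ennreal_neg split: if_splits)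
        qed
        also have "\<dots> \<le> ennreal (1 / real (Suc k))" using Ale[of k] by simp
        finally have "G b - G a \<le> 1 / real (Suc k)" by (simp add: ennreal_le_iff)
        moreover have "G a \<le> G b" using ab G g(2) by (intro DERIV_nonneg_imp_nondecreasing[OF ab]) blast
        ultimately show ?thesis by simp
      qed
      have "\<bar>G b - G a\<bar> \<le> 1 / real (Suc k)" for a b
        using le[of a b] le[of b a] by (cases "a \<le> b") (auto simp: abs_minus_commute)
      then show ?thesis using prim_chain_rule[OF v G g(1) xy] by metis
    qed
    moreover have "(\<lambda>j. \<integral>t. indicator {x<..y} t * (g j (prim v t) * v t) \<partial>lborel) \<longlonglongrightarrow>
       (\<integral>t. indicator {x<..y} t * (indicator (A k) (prim v t) * v t) \<partial>lborel)"
    proof (rule integral_dominated_convergence)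
      show "integrable lborel (\<lambda>t. indicator {0..y} t * \<bar>v t\<bar>)" by (rule locintD(2)[OF locint_abs[OF v]])
      show "AE t in lborel. (\<lambda>j. indicator {x<..y} t * (g j (prim v t) * v t)) \<longlonglongrightarrow> indicator {x<..y} t * (indicator (A k) (prim v t) * v t)"
        by (intro AE_I2 tendsto_intros g)
      show "AE t in lborel. norm (indicator {x<..y} t * (g j (prim v t) * v t)) \<le> indicator {0..y} t * \<bar>v t\<bar>" for j
      proof (intro AE_I2)
        fix t
        have "\<bar>g j (prim v t)\<bar> * \<bar>v t\<bar> \<le> 1 * \<bar>v t\<bar>" by (intro mult_right_mono gb) auto
        then show "norm (indicator {x<..y} t * (g j (prim v t) * v t)) \<le> indicator {0..y} t * \<bar>v t\<bar>"
          using xy by (auto simp: indicator_def abs_mult)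
      qed
    qed measurable
    ultimately show ?thesis by (intro LIMSEQ_le_const2[OF tendsto_rabs]) auto
  qed
  define A' where "A' = (\<Inter>k. A k)"
  have [measurable]: "A' \<in> sets borel" unfolding A'_def by measurable
  have "AE t in lborel. 0 \<le> t \<longrightarrow> indicator A' (prim v t) * v t = 0"
  proof (rule locint_AE_zero)
    show "locint (\<lambda>t. indicator A' (prim v t) * v t)"
      by (rule locint_mult_bounded[OF v, where B = 1]) (auto simp: indicator_def)
    fix x y :: real assume xy: "0 \<le> x" "x \<le> y"
    have "(\<lambda>k. \<integral>t. indicator {x<..y} t * (indicator (A k) (prim v t) * v t) \<partial>lborel) \<longlonglongrightarrow>
       (\<integral>t. indicator {x<..y} t * (indicator A' (prim v t) * v t) \<partial>lborel)"
    proof (rule integral_dominated_convergence)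
      show "integrable lborel (\<lambda>t. indicator {0..y} t * \<bar>v t\<bar>)" by (rule locintD(2)[OF locint_abs[OF v]])
      show "AE t in lborel. (\<lambda>k. indicator {x<..y} t * (indicator (A k) (prim v t) * v t)) \<longlonglongrightarrow> indicator {x<..y} t * (indicator A' (prim v t) * v t)"
        unfolding A'_def by (intro AE_I2 tendsto_intros LIMSEQ_indicator_decseq Adec)
      show "AE t in lborel. norm (indicator {x<..y} t * (indicator (A k) (prim v t) * v t)) \<le> indicator {0..y} t * \<bar>v t\<bar>" for k
        using xy by (intro AE_I2) (auto simp: indicator_def abs_mult)
    qed measurable
    moreover have "(\<lambda>k. \<integral>t. indicator {x<..y} t * (indicator (A k) (prim v t) * v t) \<partial>lborel) \<longlonglongrightarrow> 0"
    proof (rule Lim_null_comparison)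
      show "(\<lambda>k. 1 / real (Suc k)) \<longlonglongrightarrow> 0" by (rule LIMSEQ_Suc[OF lim_1_over_n])
    qed (use bound[OF xy] in auto)
    ultimately show "(\<integral>t. indicator {x<..y} t * (indicator A' (prim v t) * v t) \<partial>lborel) = 0"
      by (rule LIMSEQ_unique)
  qed
  moreover have "z \<in> A'" if "z + c \<in> B" for z using O' that by (auto simp: A'_def A_def B'eq)
  ultimately show ?thesis
    by (auto elim!: eventually_mono simp: indicator_def split: if_splits)
qed

text \<open>Mean zero makes the primitive vanish again to the right of the support, so every such
  \<open>\<theta>\<close> is the derivative of a test function. These are the functions that the
  lemma of du Bois-Reymond needs.\<close>

lemma test_function_prim:
  fixes \<theta> :: "real \<Rightarrow> real"
  assumes c: "continuous_on UNIV \<theta>" and ab: "0 < a" "a \<le> b" and z: "\<And>t. t \<notin> {a..b} \<Longrightarrow> \<theta> t = 0"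
    and int0: "(\<integral>t. \<theta> t \<partial>lborel) = 0"
  shows "locint \<theta>" "test_function (prim \<theta>)" "deriv (prim \<theta>) = \<theta>" "\<And>t. t \<notin> {a..b} \<Longrightarrow> prim \<theta> t = 0"
proof -
  have m[measurable]: "\<theta> \<in> borel_measurable borel" using c by (rule borel_measurable_continuous_onI)
  have cont: "isCont \<theta> t" for t using c by (simp add: continuous_on_eq_continuous_at)
  have "integrable lborel (\<lambda>t. \<theta> t * indicator {0..d} t)" for d
    by (rule borel_integrable_atLeastAtMost) (use cont in auto)
  then show li: "locint \<theta>" by (auto simp: locint_def mult.commute)
  obtain F where F: "\<And>z. (F has_real_derivative \<theta> z) (at z)"
    using einterval_antiderivative[of "-\<infinity>" "\<infinity>" \<theta>] cont by (auto simp: has_real_derivative_iff_has_vector_derivative)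
  have FTC: "(\<integral>t. \<theta> t * indicator {x..y} t \<partial>lborel) = F y - F x" if "x \<le> y" for x y
    using that by (intro integral_FTC_Icc_real F cont)
  \<comment> \<open>The hypothesis says nothing at \<open>t = a\<close>; there the value 0 comes
    from continuity.\<close>
  have tha: "\<theta> t = 0" if "t \<le> a" for t
  proof (cases "t = a")
    case True
    have "((\<lambda>t. \<theta> t) \<longlongrightarrow> \<theta> a) (at_left a)" using cont[of a] by (simp add: isCont_def filterlim_at_split)
    moreover have "((\<lambda>t. \<theta> t) \<longlongrightarrow> 0) (at_left a)"
      by (rule tendsto_eventually) (auto simp: eventually_at_left_field intro!: exI[of _ "a - 1"] z)
    ultimately show ?thesis using True by (auto intro: tendsto_unique[OF trivial_limit_at_left_real])
  qed (use that z in auto)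
  have Fa: "F x = F a" if "x \<le> a" for x
  proof -
    have "(\<lambda>t. \<theta> t * indicator {x..a} t) = (\<lambda>_. 0)" using tha by (auto simp: indicator_def fun_eq_iff)
    then show ?thesis using FTC[OF that] by simp
  qed
  have eq: "prim \<theta> x = F x - F a" for x
  proof (cases "x < 0")
    case True then show ?thesis using Fa[of x] ab by (simp add: prim_neg)
  next
    case False
    then show ?thesis using FTC[of 0 x] Fa[of 0] ab by (simp add: prim_def mult.commute)
  qed
  have "(\<lambda>t. \<theta> t * indicator {a..b} t) = \<theta>" using z by (auto simp: indicator_def fun_eq_iff)
  then have Fb: "F b = F a" using FTC[OF ab(2)] int0 by simp
  show z': "prim \<theta> t = 0" if t: "t \<notin> {a..b}" for t
  proof (cases "t < a")
    case True then show ?thesis using Fa[of t] by (simp add: eq)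
  next
    case False
    then have "b < t" using t by auto
    have "(\<integral>s. \<theta> s * indicator {b..t} s \<partial>lborel) = integral\<^sup>L lborel (\<lambda>t::real. 0)"
    proof (rule integral_cong_AE)
      show "AE s in lborel. \<theta> s * indicator {b..t} s = 0"
        using AE_lborel_singleton[of b] by eventually_elim (use z in \<open>auto simp: indicator_def\<close>)
    qed auto
    then show ?thesis using FTC[of b t] \<open>b < t\<close> Fb by (simp add: eq)
  qed
  have D: "(prim \<theta> has_real_derivative \<theta> t) (at t)" for t
    unfolding eq[abs_def] by (auto intro!: derivative_eq_intros F)
  then show "deriv (prim \<theta>) = \<theta>" by (auto intro: DERIV_imp_deriv)
  show "test_function (prim \<theta>)"
    unfolding test_function_def C1_differentiable_on_def
    using D c ab z' by (auto simp: has_real_derivative_iff_has_vector_derivative)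
qed

text \<open>Integration by parts, by polarization of the chain rule for the square.\<close>

lemma prim_product_rule:
  assumes v: "locint v" and w: "locint w" and y: "0 \<le> y"
  shows "prim v y * prim w y = (\<integral>t. indicator {0<..y} t * (prim v t * w t) \<partial>lborel)
    + (\<integral>t. indicator {0<..y} t * (prim w t * v t) \<partial>lborel)"
proof -
  have bd: "integrable lborel (\<lambda>t. indicator {0<..y} t * (prim u t * s t))" if u: "locint u" and s: "locint s" for u s
  proof -
    have "compact (prim u ` {0..y})"
      by (intro compact_continuous_image continuous_on_subset[OF continuous_prim[OF u]]) auto
    then have "bounded (prim u ` {0..y})" by (rule compact_imp_bounded)
    then obtain B where "\<And>t. t \<in> {0..y} \<Longrightarrow> \<bar>prim u t\<bar> \<le> B" unfolding bounded_iff by (metis imageI real_norm_def)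
    then show ?thesis
      by (intro locint_bounded_mult[OF s measurable_prim[OF u], where b = y and B = B]) auto
  qed
  have sq: "(prim u y)\<^sup>2 = 2 * (\<integral>t. indicator {0<..y} t * (prim u t * u t) \<partial>lborel)" if u: "locint u" for u
  proof -
    have "(prim u y)\<^sup>2 - (prim u 0)\<^sup>2 = (\<integral>t. indicator {0<..y} t * ((2 * prim u t) * u t) \<partial>lborel)"
      by (rule prim_chain_rule[OF u _ _ _ y, where G = "\<lambda>z. z\<^sup>2" and g = "\<lambda>z. 2 * z"])
         (auto intro!: derivative_eq_intros continuous_intros)
    also have "\<dots> = 2 * (\<integral>t. indicator {0<..y} t * (prim u t * u t) \<partial>lborel)"
      by (subst integral_mult_right_zero[symmetric]) (simp add: mult_ac)
    moreover have "prim u 0 = 0"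
    proof -
      have "prim u 0 = integral\<^sup>L lborel (\<lambda>t::real. 0)"
        unfolding prim_def
      proof (rule integral_cong_AE)
        show "AE t in lborel. indicator {0..0} t * u t = 0"
          using AE_lborel_singleton[of 0] by eventually_elim auto
      qed (use locintD(1)[OF u] in auto)
      then show ?thesis by simp
    qed
    ultimately show ?thesis by simp
  qed
  have pa: "prim (\<lambda>t. v t + w t) t = prim v t + prim w t" for t
    unfolding prim_def using locintD(2)[OF v] locintD(2)[OF w] by (simp add: distrib_left)
  have "2 * (\<integral>t. indicator {0<..y} t * (prim (\<lambda>t. v t + w t) t * (v t + w t)) \<partial>lborel) =
     2 * ((\<integral>t. indicator {0<..y} t * (prim v t * v t) \<partial>lborel) + (\<integral>t. indicator {0<..y} t * (prim v t * w t) \<partial>lborel)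
       + (\<integral>t. indicator {0<..y} t * (prim w t * v t) \<partial>lborel) + (\<integral>t. indicator {0<..y} t * (prim w t * w t) \<partial>lborel))"
    using bd[OF v v] bd[OF v w] bd[OF w v] bd[OF w w]
    by (subst Bochner_Integration.integral_add[symmetric], simp, simp)+
       (auto intro!: Bochner_Integration.integral_cong simp: pa algebra_simps)
  then have "(prim v y + prim w y)\<^sup>2 = (prim v y)\<^sup>2 + (prim w y)\<^sup>2
       + 2 * ((\<integral>t. indicator {0<..y} t * (prim v t * w t) \<partial>lborel) + (\<integral>t. indicator {0<..y} t * (prim w t * v t) \<partial>lborel))"
    using sq[OF v] sq[OF w] sq[OF locint_add[OF v w]] by (simp add: pa)
  then show ?thesis by (simp add: power2_sum)
qed

section \<open>Weak gradients on the half-line and their primitives\<close>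

lemma halfline_measurable_extend:
  "u \<in> borel_measurable halfline \<Longrightarrow> (\<lambda>t. indicator {0..} t * u t :: real) \<in> borel_measurable borel"
  unfolding halfline_def
  by (subst (asm) borel_measurable_restrict_space_iff) auto

lemma integral_halfline: "(LINT t|halfline. f t) = (\<integral>t. indicator {0..} t * f t \<partial>lborel :: real)"
  unfolding halfline_def by (subst integral_restrict_space) auto

lemma integrable_halfline: "integrable halfline f \<longleftrightarrow> integrable lborel (\<lambda>t. indicator {0..} t * f t :: real)"
  unfolding halfline_def by (subst integrable_restrict_space) auto

lemma AE_halfline: "(AE t in halfline. Q t) \<longleftrightarrow> (AE t in lborel. 0 \<le> t \<longrightarrow> Q t)"
  unfolding halfline_def by (subst AE_restrict_space_iff) auto

lemma locint_square_integrable: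
  assumes "square_integrable halfline u"
  shows "locint (\<lambda>t. indicator {0..} t * u t)"
proof -
  have m[measurable]: "(\<lambda>t. indicator {0..} t * u t) \<in> borel_measurable borel"
    using assms by (auto simp: square_integrable_def intro: halfline_measurable_extend)
  have i: "integrable lborel (\<lambda>t. indicator {0..} t * (u t)\<^sup>2)"
    using assms by (simp add: square_integrable_def integrable_halfline)
  have "integrable lborel (\<lambda>t. indicator {0..b} t * (indicator {0..} t * u t))" for b :: real
  proof (rule Bochner_Integration.integrable_bound)
    show "integrable lborel (\<lambda>t. indicator {0..b} t + indicator {0..} t * (u t)\<^sup>2)"
      by (intro Bochner_Integration.integrable_add i integrable_real_indicator) (auto simp: emeasure_lborel_Icc_eq)
    show "AE t in lborel. norm (indicator {0..b} t * (indicator {0..} t * u t)) \<le> norm (indicator {0..b} t + indicator {0..} t * (u t)\<^sup>2)"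
    proof (intro AE_I2)
      fix t
      \<comment> \<open>On bounded intervals this puts L2 inside L1.\<close>
      have "\<bar>u t\<bar> \<le> 1 + (u t)\<^sup>2"
        using zero_le_power2[of "\<bar>u t\<bar> - 1"] by (simp add: power2_diff)
      then show "norm (indicator {0..b} t * (indicator {0..} t * u t)) \<le> norm (indicator {0..b} t + indicator {0..} t * (u t)\<^sup>2)"
        by (auto simp: indicator_def)
    qed
  qed measurable
  then show ?thesis by (simp add: locint_def)
qed

text \<open>The lemma of du Bois-Reymond.\<close>

lemma locint_eq_const:
  assumes w: "locint w"
    and orth: "\<And>\<theta> a b. continuous_on UNIV \<theta> \<Longrightarrow> 0 < a \<Longrightarrow> a \<le> b \<Longrightarrow> (\<And>t. t \<notin> {a..b} \<Longrightarrow> \<theta> t = 0) \<Longrightarrow>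
       (\<integral>t. \<theta> t \<partial>lborel) = 0 \<Longrightarrow> (\<integral>t. \<theta> t * w t \<partial>lborel) = 0"
  shows "\<exists>c. AE t in lborel. 0 \<le> t \<longrightarrow> w t = c"
proof -
  have [measurable]: "w \<in> borel_measurable borel" using w by (rule locintD)
  have wi: "integrable lborel (\<lambda>t. indicator {p<..<q} t * w t)" if "0 \<le> p" for p q
    using that by (intro locint_sub[OF w, where b = q]) auto
  have approx: "\<exists>g. (\<forall>j. continuous_on UNIV (g j)) \<and> (\<forall>j t. t \<notin> {p..q} \<longrightarrow> g j t = 0) \<and> (\<forall>j. integrable lborel (g j)) \<and>
      (\<lambda>j. \<integral>t. g j t \<partial>lborel) \<longlonglongrightarrow> q - p \<and> (\<forall>j. integrable lborel (\<lambda>t. g j t * w t)) \<and>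
      (\<lambda>j. \<integral>t. g j t * w t \<partial>lborel) \<longlonglongrightarrow> (\<integral>t. indicator {p<..<q} t * w t \<partial>lborel)" if pq: "0 \<le> p" "p < q" for p q
  proof -
    have "{p<..<q} \<noteq> UNIV" by (metis UNIV_I greaterThanLessThan_iff less_irrefl)
    with open_greaterThanLessThan obtain g :: "nat \<Rightarrow> real \<Rightarrow> real" where
      g: "\<And>j. continuous_on UNIV (g j)" "\<And>j x. 0 \<le> g j x" "\<And>j x. g j x \<le> indicator {p<..<q} x"
      "\<And>x. (\<lambda>j. g j x) \<longlonglongrightarrow> indicator {p<..<q} x" by (rule open_continuous_approx) blast
    have gm[measurable]: "g j \<in> borel_measurable borel" for j using g(1) by (rule borel_measurable_continuous_onI)
    have ip: "integrable lborel (indicator {p<..<q} :: real \<Rightarrow> real)" using pq by (intro integrable_real_indicator) auto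
    have gi: "integrable lborel (g j)" for j
      by (rule Bochner_Integration.integrable_bound[OF ip]) (use g in \<open>auto simp: abs_of_nonneg\<close>)
    have gz: "g j t = 0" if "t \<notin> {p..q}" for j t using g(2)[of j t] g(3)[of j t] that by (auto simp: indicator_def split: if_splits)
    have gwle: "\<bar>g j t * w t\<bar> \<le> \<bar>indicator {p<..<q} t * w t\<bar>" for j t
      unfolding abs_mult using g(2)[of j t] g(3)[of j t] by (intro mult_right_mono) auto
    have gwi: "integrable lborel (\<lambda>t. g j t * w t)" for j
      by (rule Bochner_Integration.integrable_bound[OF wi[OF pq(1), of q]]) (use gwle in auto)
    have l1: "(\<lambda>j. \<integral>t. g j t \<partial>lborel) \<longlonglongrightarrow> (\<integral>t. indicator {p<..<q} t \<partial>lborel)"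
      by (rule integral_dominated_convergence[OF _ _ ip]) (use g in \<open>auto simp: abs_of_nonneg\<close>)
    have l2: "(\<lambda>j. \<integral>t. g j t * w t \<partial>lborel) \<longlonglongrightarrow> (\<integral>t. indicator {p<..<q} t * w t \<partial>lborel)"
    proof (rule integral_dominated_convergence)
      show "integrable lborel (\<lambda>t. \<bar>indicator {p<..<q} t * w t\<bar>)" using wi[OF pq(1), of q] by (rule integrable_abs)
      show "AE t in lborel. (\<lambda>j. g j t * w t) \<longlonglongrightarrow> indicator {p<..<q} t * w t" by (intro AE_I2 tendsto_intros g)
    qed (use gwle in auto)
    show ?thesis using g(1) gz gi l1 gwi l2 pq by (intro exI[of _ g]) auto
  qed
  \<comment> \<open>The choice of the interval is arbitrary. A single bump \<open>h j0\<close> of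
    positive mass will serve as the reference for removing means.\<close>
  from approx[of 1 2] obtain h where h: "\<And>j. continuous_on UNIV (h j)" "\<And>j t. t \<notin> {1..2} \<Longrightarrow> h j t = 0"
    "\<And>j. integrable lborel (h j)" "(\<lambda>j. \<integral>t. h j t \<partial>lborel) \<longlonglongrightarrow> 1" "\<And>j. integrable lborel (\<lambda>t. h j t * w t)"
    by (auto simp: )
  have "\<forall>\<^sub>F j in sequentially. (\<integral>t. h j t \<partial>lborel) > 0" using order_tendstoD(1)[OF h(4), of 0] by simp
  then obtain j0 where j0: "(\<integral>t. h j0 t \<partial>lborel) > 0" by (auto dest: eventually_happens)
  define c where "c = (\<integral>t. h j0 t * w t \<partial>lborel) / (\<integral>t. h j0 t \<partial>lborel)"
  have main: "(\<integral>t. \<theta> t * w t \<partial>lborel) = c * (\<integral>t. \<theta> t \<partial>lborel)"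
    if th: "continuous_on UNIV \<theta>" "0 < a" "a \<le> b" "\<And>t. t \<notin> {a..b} \<Longrightarrow> \<theta> t = 0" "integrable lborel \<theta>" "integrable lborel (\<lambda>t. \<theta> t * w t)" for \<theta> a b
  proof -
    \<comment> \<open>With this factor \<open>\<theta> - k * h j0\<close> has mean zero, and its
      support lies in an interval containing both supports, so \<open>orth\<close> applies.\<close>
    define k where "k = (\<integral>t. \<theta> t \<partial>lborel) / (\<integral>t. h j0 t \<partial>lborel)"
    have "(\<integral>t. (\<theta> t - k * h j0 t) * w t \<partial>lborel) = 0"
    proof (rule orth[of _ "min a 1" "max b 2"])
      show "continuous_on UNIV (\<lambda>t. \<theta> t - k * h j0 t)" by (intro continuous_intros th h)
      show "(\<integral>t. \<theta> t - k * h j0 t \<partial>lborel) = 0" using th(5) h(3)[of j0] j0 by (simp add: k_def)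
      show "\<theta> t - k * h j0 t = 0" if "t \<notin> {min a 1..max b 2}" for t
      proof -
        have "t \<notin> {a..b}" "t \<notin> {1..2}" using that by auto
        then show ?thesis using th(4)[of t] h(2)[of t j0] by simp
      qed
    qed (use th(2,3) in auto)
    moreover have "(\<integral>t. (\<theta> t - k * h j0 t) * w t \<partial>lborel) = (\<integral>t. \<theta> t * w t \<partial>lborel) - k * (\<integral>t. h j0 t * w t \<partial>lborel)"
      using th(6) h(5)[of j0] by (simp add: left_diff_distrib mult.assoc)
    ultimately show ?thesis by (simp add: k_def c_def field_simps)
  qed
  have lim: "(\<integral>t. indicator {p<..<q} t * w t \<partial>lborel) = c * (q - p)" if pq: "0 < p" "p < q" for p q
  proof -
    from approx[of p q] pq obtain g where g: "\<And>j. continuous_on UNIV (g j)" "\<And>j t. t \<notin> {p..q} \<Longrightarrow> g j t = 0"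
      "\<And>j. integrable lborel (g j)" "(\<lambda>j. \<integral>t. g j t \<partial>lborel) \<longlonglongrightarrow> q - p" "\<And>j. integrable lborel (\<lambda>t. g j t * w t)"
      "(\<lambda>j. \<integral>t. g j t * w t \<partial>lborel) \<longlonglongrightarrow> (\<integral>t. indicator {p<..<q} t * w t \<partial>lborel)" by auto
    have "(\<integral>t. g j t * w t \<partial>lborel) = c * (\<integral>t. g j t \<partial>lborel)" for j
      using pq by (intro main[OF g(1) pq(1) _ g(2) g(3) g(5)]) auto
    then have "(\<lambda>j. \<integral>t. g j t * w t \<partial>lborel) \<longlonglongrightarrow> c * (q - p)"
      using tendsto_mult_left[OF g(4), of c] by simp
    with g(6) show ?thesis by (rule LIMSEQ_unique)
  qed
  have lc: "locint (\<lambda>_. c)"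
    unfolding locint_def by (auto intro!: integrable_mult_left integrable_real_indicator simp: emeasure_lborel_Icc_eq)
  \<comment> \<open>These intervals stay away from 0, where no test function lives, and exhaust the
    open half-line.\<close>
  have "AE t in lborel. indicator {1 / real (Suc n)<..<real n} t * (w t - c) = 0" for n
  proof (rule AE_zero_if_ray_integrals_zero)
    show "integrable lborel (\<lambda>t. indicator {1 / real (Suc n)<..<real n} t * (w t - c))"
    proof (rule locint_sub[OF locint_diff[OF w lc], where b = "real n"])
      have "{d<..<q} \<subseteq> {0..q}" if "0 < d" for d q :: real using that by auto
      then show "{1 / real (Suc n)<..<real n} \<subseteq> {0..real n}" by simp
    qed auto
    fix x
    define p where "p = max (1 / real (Suc n)) x"
    have p: "p > 0" by (simp add: p_def less_max_iff_disj)
    have "(\<integral>t. indicator {x<..} t * (indicator {1 / real (Suc n)<..<real n} t * (w t - c)) \<partial>lborel) = (\<integral>t. indicator {p<..<real n} t * w t - c * indicator {p<..<real n} t \<partial>lborel)"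
      by (intro Bochner_Integration.integral_cong) (auto simp: indicator_def p_def)
    also have "\<dots> = 0"
    proof (cases "p < real n")
      case True
      then show ?thesis using lim[OF p True] wi[of p "real n"] p
        by (subst Bochner_Integration.integral_diff) (auto intro!: integrable_mult_right integrable_real_indicator)
    qed auto
    finally show "(\<integral>t. indicator {x<..} t * (indicator {1 / real (Suc n)<..<real n} t * (w t - c)) \<partial>lborel) = 0" .
  qed
  then have "AE t in lborel. \<forall>n. indicator {1 / real (Suc n)<..<real n} t * (w t - c) = 0" unfolding AE_all_countable by blast
  then have "AE t in lborel. 0 \<le> t \<longrightarrow> w t = c"
    using AE_lborel_singleton[of 0]
  proof eventually_elim
    case (elim t)
    show ?case
    proof
      assume "0 \<le> t"
      then have "t > 0" using elim by simp
      obtain n :: nat where n: "max t (1 / t) < real n" using reals_Archimedean2 by blast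
      then have "1 / real (Suc n) < t" using \<open>t > 0\<close> by (simp add: field_simps)
      then show "w t = c" using elim(1)[rule_format, of n] n by simp
    qed
  qed
  then show ?thesis by blast
qed

text \<open>Every admissible mean-zero \<open>\<theta>\<close> is the derivative of the test
  function \<open>prim \<theta>\<close>. The definition of the weak gradient moves the derivative
  from \<open>prim \<theta>\<close> to \<open>u\<close>, and the product rule moves it to the
  primitive of \<open>u'\<close>; hence the difference of \<open>u\<close> and this primitive is
  orthogonal to all such \<open>\<theta>\<close> and so constant.\<close>

lemma has_gradient_prim:
  assumes "has_gradient u u'"
  shows "\<exists>c. AE t in halfline. u t = c + prim (\<lambda>t. indicator {0..} t * u' t) t"
proof -
  define U where "U t = indicator {0..} t * u t" for t
  define v where "v t = indicator {0..} t * u' t" for t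
  have U: "locint U" and v: "locint v"
    using assms unfolding U_def v_def has_gradient_def by (auto intro: locint_square_integrable)
  have [measurable]: "U \<in> borel_measurable borel" "v \<in> borel_measurable borel" using U v by (auto dest: locintD)
  have lp: "locint (prim v)"
  proof -
    have "isCont (prim v) t" for t using continuous_prim[OF v] by (simp add: continuous_on_eq_continuous_at)
    then have "integrable lborel (\<lambda>t. prim v t * indicator {0..d} t)" for d
      by (intro borel_integrable_atLeastAtMost) auto
    then show ?thesis using measurable_prim[OF v] by (auto simp: locint_def mult.commute)
  qed
  have "\<exists>c. AE t in lborel. 0 \<le> t \<longrightarrow> U t - prim v t = c"
  proof (rule locint_eq_const[OF locint_diff[OF U lp]])
    fix \<theta> :: "real \<Rightarrow> real" and a b
    assume th: "continuous_on UNIV \<theta>" and ab: "0 < a" "a \<le> b" and z: "\<And>t. t \<notin> {a..b} \<Longrightarrow> \<theta> t = 0"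
      and i0: "(\<integral>t. \<theta> t \<partial>lborel) = 0"
    note T = test_function_prim[OF th ab z i0]
    have [measurable]: "\<theta> \<in> borel_measurable borel" using th by (rule borel_measurable_continuous_onI)
    have "compact (\<theta> ` {a..b})" by (intro compact_continuous_image continuous_on_subset[OF th]) auto
    then have "bounded (\<theta> ` {a..b})" by (rule compact_imp_bounded)
    then obtain B where B: "\<And>t. t \<in> {a..b} \<Longrightarrow> \<bar>\<theta> t\<bar> \<le> B" unfolding bounded_iff by (metis imageI real_norm_def)
    have thi: "integrable lborel (\<lambda>t. \<theta> t * s t)" if s: "locint s" for s
    proof -
      have "integrable lborel (\<lambda>t. indicator {a..b} t * (\<theta> t * s t))"
        by (rule locint_bounded_mult[OF s, where b = b and B = B]) (use B ab in auto)
      also have "(\<lambda>t. indicator {a..b} t * (\<theta> t * s t)) = (\<lambda>t. \<theta> t * s t)" using z by (auto simp: indicator_def fun_eq_iff)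
      finally show ?thesis .
    qed
    have "(LINT t|halfline. u t * \<theta> t) = - (LINT t|halfline. u' t * prim \<theta> t)"
      using assms T(2,3) unfolding has_gradient_def by metis
    then have "(\<integral>t. \<theta> t * U t \<partial>lborel) = - (\<integral>t. prim \<theta> t * v t \<partial>lborel)"
      by (simp add: integral_halfline U_def v_def mult_ac)
    \<comment> \<open>The product rule is evaluated at \<open>b + 1\<close>, beyond the support, so
      that the boundary term is 0.\<close>
    moreover have "(\<integral>t. indicator {0<..b+1} t * (prim v t * \<theta> t) \<partial>lborel) + (\<integral>t. indicator {0<..b+1} t * (prim \<theta> t * v t) \<partial>lborel) = 0"
      using prim_product_rule[OF v T(1), of "b+1"] T(4)[of "b+1"] ab by simp
    moreover have "(\<lambda>t. indicator {0<..b+1} t * (prim v t * \<theta> t)) = (\<lambda>t. \<theta> t * prim v t)"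
    proof
      show "indicator {0<..b+1} t * (prim v t * \<theta> t) = \<theta> t * prim v t" for t
        using z[of t] ab by (cases "t \<in> {a..b}") auto
    qed
    moreover have "(\<lambda>t. indicator {0<..b+1} t * (prim \<theta> t * v t)) = (\<lambda>t. prim \<theta> t * v t)"
    proof
      show "indicator {0<..b+1} t * (prim \<theta> t * v t) = prim \<theta> t * v t" for t
        using T(4)[of t] ab by (cases "t \<in> {a..b}") auto
    qed
    ultimately show "(\<integral>t. \<theta> t * (U t - prim v t) \<partial>lborel) = 0"
      using thi[OF U] thi[OF lp] by (simp add: right_diff_distrib)
  qed
  then obtain c where "AE t in lborel. 0 \<le> t \<longrightarrow> U t - prim v t = c" by blast
  then have "AE t in halfline. u t = c + prim v t"
    unfolding AE_halfline by eventually_elim (auto simp: U_def)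
  then show ?thesis unfolding v_def by blast
qed

text \<open>The integration constant of the representation as a primitive becomes the shift
  \<open>c\<close> in \<open>prim_null_preimage\<close>.\<close>

lemma has_gradient_null_preimage:
  assumes "has_gradient u u'" "B \<in> null_sets lborel"
  shows "AE t in halfline. u t \<in> B \<longrightarrow> u' t = 0"
proof -
  have l: "locint (\<lambda>t. indicator {0..} t * u' t)"
    using assms by (intro locint_square_integrable) (simp add: has_gradient_def)
  obtain c where c: "AE t in halfline. u t = c + prim (\<lambda>t. indicator {0..} t * u' t) t"
    using has_gradient_prim[OF assms(1)] by blast
  show ?thesis using c prim_null_preimage[OF l assms(2), of c] unfolding AE_halfline
    by eventually_elim (auto simp: add.commute)
qed

text \<open>The two primitives representing \<open>u\<close> differ by a constant almost everywhere,
  hence by continuity on the whole half-line. So \<open>v - w\<close> integrates to 0 over every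
  interval.\<close>

lemma has_gradient_unique:
  assumes "has_gradient u v" "has_gradient u w"
  shows "AE t in halfline. v t = w t"
proof -
  define V where "V t = indicator {0..} t * v t" for t
  define W where "W t = indicator {0..} t * w t" for t
  have lV: "locint V" and lW: "locint W"
    using assms unfolding V_def W_def has_gradient_def by (auto intro: locint_square_integrable)
  obtain c where c: "AE t in halfline. u t = c + prim V t" using has_gradient_prim[OF assms(1)] unfolding V_def by blast
  obtain d where d: "AE t in halfline. u t = d + prim W t" using has_gradient_prim[OF assms(2)] unfolding W_def by blast
  have ae: "AE t in lborel. 0 \<le> t \<longrightarrow> prim V t - prim W t = d - c"
    using c d unfolding AE_halfline by eventually_elim auto
  have eq: "prim V t - prim W t = d - c" if "t > 0" for t
  proof -
    \<comment> \<open>A set of full measure is dense: a missed interval \<open>{t<..<t+e}\<close>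
      would have measure 0.\<close>
    have "t \<in> closure ({s. prim V s - prim W s = d - c} \<inter> {0<..})"
    proof (rule ccontr)
      assume "t \<notin> closure ({s. prim V s - prim W s = d - c} \<inter> {0<..})"
      then obtain e where e: "e > 0" "\<And>s. s \<in> ({s. prim V s - prim W s = d - c} \<inter> {0<..}) \<Longrightarrow> dist s t \<ge> e"
        unfolding closure_approachable by (metis not_less)
      from AE_mp[OF ae, of "\<lambda>s. s \<notin> {t<..<t+e}"] have "AE s in lborel. s \<notin> {t<..<t+e}"
        using e that by (force simp: dist_real_def)
      then have "emeasure lborel {t<..<t+e} = 0"
        by (subst AE_iff_measurable[of "{t<..<t+e}" lborel "\<lambda>s. s \<notin> {t<..<t+e}", symmetric]) auto
      then show False using \<open>e > 0\<close> by simp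
    qed
    moreover have "closed {s. prim V s - prim W s = d - c}"
      using continuous_prim[OF lV] continuous_prim[OF lW] by (intro closed_Collect_eq continuous_intros) auto
    ultimately show ?thesis using closure_mono[of "{s. prim V s - prim W s = d - c} \<inter> {0<..}" "{s. prim V s - prim W s = d - c}"]
      closure_closed by blast
  qed
  \<comment> \<open>The boundary point is reached as a limit from the right.\<close>
  have cont: "prim V 0 - prim W 0 = d - c"
  proof -
    have "((\<lambda>t. prim V t - prim W t) \<longlongrightarrow> prim V 0 - prim W 0) (at_right 0)"
      using continuous_prim[OF lV] continuous_prim[OF lW]
      by (intro tendsto_diff) (auto simp: continuous_on_eq_continuous_at isCont_def filterlim_at_split)
    moreover have "((\<lambda>t. prim V t - prim W t) \<longlongrightarrow> d - c) (at_right 0)"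
      by (rule tendsto_eventually) (auto simp: eventually_at_right_field eq intro!: exI[of _ 1])
    ultimately show ?thesis by (rule tendsto_unique[OF trivial_limit_at_right_real])
  qed
  have "AE t in lborel. 0 \<le> t \<longrightarrow> V t - W t = 0"
  proof (rule locint_AE_zero[OF locint_diff[OF lV lW]])
    fix x y :: real assume xy: "0 \<le> x" "x \<le> y"
    have e: "prim V s - prim W s = d - c" if "0 \<le> s" for s using eq[of s] cont that by (cases "s = 0") auto
    have "(\<integral>t. indicator {x<..y} t * (V t - W t) \<partial>lborel) = (prim V y - prim V x) - (prim W y - prim W x)"
      unfolding prim_diff[OF lV xy] prim_diff[OF lW xy] right_diff_distrib
      using xy by (intro Bochner_Integration.integral_diff locint_sub[where b = y] lV lW) auto
    also have "\<dots> = 0" using e[of x] e[of y] xy by simp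
    finally show "(\<integral>t. indicator {x<..y} t * (V t - W t) \<partial>lborel) = 0" .
  qed
  then show ?thesis unfolding AE_halfline by eventually_elim (auto simp: V_def W_def)
qed

lemma has_gradient_lincomb:
  assumes "finite I" "\<And>i. i \<in> I \<Longrightarrow> has_gradient (u i) (v i)"
  shows "has_gradient (\<lambda>t. \<Sum>i\<in>I. c i * u i t) (\<lambda>t. \<Sum>i\<in>I. c i * v i t)"
proof -
  have sq: "square_integrable M (\<lambda>t. \<Sum>i\<in>I. c i * s i t)" if "\<And>i. i \<in> I \<Longrightarrow> square_integrable M (s i)" for s and M :: "real measure"
    using assms(1) that
  proof (induction I rule: finite_induct)
    case empty then show ?case by (simp add: square_integrable_def)
  next
    case (insert i I)
    define A where "A t = c i * s i t" for t
    define B where "B t = (\<Sum>i\<in>I. c i * s i t)" for t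
    have si: "s i \<in> borel_measurable M" "integrable M (\<lambda>t. (s i t)\<^sup>2)" using insert(4)[of i] by (auto simp: square_integrable_def)
    have A: "A \<in> borel_measurable M" "integrable M (\<lambda>t. (A t)\<^sup>2)"
      using si unfolding A_def by (auto simp: power_mult_distrib)
    have B: "B \<in> borel_measurable M" "integrable M (\<lambda>t. (B t)\<^sup>2)"
      using insert unfolding B_def square_integrable_def by auto
    have "integrable M (\<lambda>t. (A t + B t)\<^sup>2)"
    proof (rule Bochner_Integration.integrable_bound)
      show "integrable M (\<lambda>t. 2 * (A t)\<^sup>2 + 2 * (B t)\<^sup>2)" using A B by auto
      show "AE t in M. norm ((A t + B t)\<^sup>2) \<le> norm (2 * (A t)\<^sup>2 + 2 * (B t)\<^sup>2)"
      proof (intro AE_I2)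
        fix t
        have "(A t + B t)\<^sup>2 \<le> 2 * (A t)\<^sup>2 + 2 * (B t)\<^sup>2"
          using zero_le_power2[of "A t - B t"] by (simp add: power2_sum power2_diff)
        then show "norm ((A t + B t)\<^sup>2) \<le> norm (2 * (A t)\<^sup>2 + 2 * (B t)\<^sup>2)" by simp
      qed
    qed (use A B in auto)
    moreover have "(\<lambda>t. A t + B t) \<in> borel_measurable M" using A B by auto
    moreover have "(\<lambda>t. \<Sum>i\<in>insert i I. c i * s i t) = (\<lambda>t. A t + B t)" using insert by (simp add: A_def B_def)
    ultimately show ?case by (simp add: square_integrable_def)
  qed
  \<comment> \<open>Splitting the integrals of sums requires each pairing to be integrable: one
    factor is bounded with compact support, the other locally integrable.\<close>
  have li: "integrable halfline (\<lambda>t. s t * \<phi> t)" if s: "square_integrable halfline s" and c: "continuous_on UNIV \<phi>" and z: "\<And>t. t \<notin> {a..b} \<Longrightarrow> \<phi> t = 0" and a: "0 < a"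
    for s \<phi> a b
  proof -
    have "compact (\<phi> ` {a..b})" by (intro compact_continuous_image continuous_on_subset[OF c]) auto
    then have "bounded (\<phi> ` {a..b})" by (rule compact_imp_bounded)
    then obtain B where B: "\<And>t. t \<in> {a..b} \<Longrightarrow> \<bar>\<phi> t\<bar> \<le> B" unfolding bounded_iff by (metis imageI real_norm_def)
    have "integrable lborel (\<lambda>t. indicator {a..b} t * (\<phi> t * (indicator {0..} t * s t)))"
      by (rule locint_bounded_mult[OF locint_square_integrable[OF s], where b = b and B = B])
         (use B a c in \<open>auto intro: borel_measurable_continuous_onI\<close>)
    also have "(\<lambda>t. indicator {a..b} t * (\<phi> t * (indicator {0..} t * s t))) = (\<lambda>t. indicator {0..} t * (s t * \<phi> t))"
      using z by (force simp: indicator_def)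
    finally show ?thesis by (simp add: integrable_halfline)
  qed
  show ?thesis
    unfolding has_gradient_def
  proof (intro conjI allI impI)
    show "square_integrable halfline (\<lambda>t. \<Sum>i\<in>I. c i * u i t)" "square_integrable halfline (\<lambda>t. \<Sum>i\<in>I. c i * v i t)"
      using assms(2) by (auto intro!: sq simp: has_gradient_def)
    fix \<phi> assume \<phi>: "test_function \<phi>"
    then obtain a b where a: "0 < a" and z: "\<And>t. t \<notin> {a..b} \<Longrightarrow> \<phi> t = 0" and C: "\<phi> C1_differentiable_on UNIV"
      by (auto simp: test_function_def)
    from C obtain D where D: "\<And>x. (\<phi> has_real_derivative D x) (at x)" and Dc: "continuous_on UNIV D"
      by (auto simp: C1_differentiable_on_def has_real_derivative_iff_has_vector_derivative)
    have dD: "deriv \<phi> = D" using D by (auto intro: DERIV_imp_deriv)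
    have \<phi>c: "continuous_on UNIV \<phi>" using D by (meson DERIV_isCont continuous_at_imp_continuous_on)
    \<comment> \<open>The complement of \<open>{a..b}\<close> is open and \<open>\<phi>\<close>
      vanishes on it, so its derivative does too.\<close>
    have Dz: "D t = 0" if "t \<notin> {a..b}" for t
    proof -
      have "((\<lambda>_. 0) has_real_derivative D t) (at t)"
        by (rule DERIV_cong_ev[THEN iffD1, OF refl _ refl D[of t]])
           (use that in \<open>auto intro!: eventually_nhds_in_open[of "- {a..b}", THEN eventually_mono] z\<close>)
      then show ?thesis using DERIV_const DERIV_unique by blast
    qed
    have "(LINT t|halfline. (\<Sum>i\<in>I. c i * u i t) * deriv \<phi> t) = (\<Sum>i\<in>I. c i * (LINT t|halfline. u i t * D t))"
      unfolding dD sum_distrib_right mult.assoc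
      using assms(2) by (subst Bochner_Integration.integral_sum) (auto intro!: integrable_mult_right li[OF _ Dc Dz a] simp: has_gradient_def)
    also have "\<dots> = (\<Sum>i\<in>I. c i * - (LINT t|halfline. v i t * \<phi> t))"
      using assms(2) \<phi> by (intro sum.cong refl arg_cong2[where f = "(*)"]) (auto simp: has_gradient_def dD[symmetric])
    also have "\<dots> = - (LINT t|halfline. (\<Sum>i\<in>I. c i * v i t) * \<phi> t)"
      unfolding sum_distrib_right mult.assoc
      using assms(2) by (subst Bochner_Integration.integral_sum) (auto intro!: integrable_mult_right li[OF _ \<phi>c z a] simp: has_gradient_def sum_negf)
    finally show "(LINT t|halfline. (\<Sum>i\<in>I. c i * u i t) * deriv \<phi> t) = - (LINT t|halfline. (\<Sum>i\<in>I. c i * v i t) * \<phi> t)" .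
  qed
qed

section \<open>Poisson random measures and Mecke's formula\<close>

text \<open>The weights sum to 1, which leaves no room for values outside the naturals. The shift
  identity is \<open>k * (l ^ k / fact k) = l * (l ^ (k - 1) / fact (k - 1))\<close> for
  \<open>k > 0\<close>, summed against \<open>g\<close>; it is Mecke's formula for a single
  set.\<close>

lemma (in prob_space) poisson_variable:
  fixes X :: "'a \<Rightarrow> ennreal"
  assumes X[measurable]: "X \<in> borel_measurable M" and l: "0 \<le> l"
    and po: "\<And>k. prob {\<omega> \<in> space M. X \<omega> = of_nat k} = l ^ k / fact k * exp (- l)"
  shows AE_poisson_nat: "AE \<omega> in M. \<exists>k::nat. X \<omega> = of_nat k"
    and poisson_shift: "g \<in> borel_measurable borel \<Longrightarrow>
      (\<integral>\<^sup>+\<omega>. X \<omega> * g (X \<omega>) \<partial>M) = ennreal l * (\<integral>\<^sup>+\<omega>. g (X \<omega> + 1) \<partial>M)"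
proof -
  define A where "A k = {\<omega> \<in> space M. X \<omega> = of_nat k}" for k :: nat
  have Am[measurable]: "A k \<in> events" for k unfolding A_def by measurable
  have dA: "disjoint_family A" by (auto simp: disjoint_family_on_def A_def)
  have "(\<lambda>k. l ^ k / fact k * exp (- l)) sums (exp l * exp (- l))"
    using sums_mult2[OF exp_converges[of l], of "exp (- l)"] by (simp add: divide_inverse mult.commute)
  moreover have "(\<lambda>k. prob (A k)) sums prob (\<Union>k. A k)"
    using dA by (intro finite_measure_UNION) auto
  ultimately have "prob (\<Union>k. A k) = 1"
    by (simp add: A_def po exp_minus_inverse sums_unique2)
  then have ae: "AE \<omega> in M. \<omega> \<in> (\<Union>k. A k)"
    by (subst (asm) prob_eq_1) auto
  then show "AE \<omega> in M. \<exists>k::nat. X \<omega> = of_nat k"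
    by eventually_elim (auto simp: A_def)
  have eA: "emeasure M (A k) = ennreal (l ^ k / fact k * exp (- l))" for k
    by (simp add: emeasure_eq_measure A_def po)
  have sum: "(\<integral>\<^sup>+\<omega>. h (X \<omega>) \<partial>M) = (\<Sum>k. h (of_nat k) * ennreal (l ^ k / fact k * exp (- l)))"
    if [measurable]: "h \<in> borel_measurable borel" for h :: "ennreal \<Rightarrow> ennreal"
  proof -
    have "(\<integral>\<^sup>+\<omega>. h (X \<omega>) \<partial>M) = (\<integral>\<^sup>+\<omega>. (\<Sum>k. h (of_nat k) * indicator (A k) \<omega>) \<partial>M)"
    proof (rule nn_integral_cong_AE, use ae in eventually_elim)
      case (elim \<omega>)
      then obtain k where k: "\<omega> \<in> A k" by auto
      show ?case using suminf_cmult_indicator[OF dA k, of "\<lambda>k. h (of_nat k)"] k by (simp add: A_def)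
    qed
    also have "\<dots> = (\<Sum>k. h (of_nat k) * emeasure M (A k))"
      by (subst nn_integral_suminf) (auto simp: nn_integral_cmult_indicator)
    finally show ?thesis by (simp add: eA)
  qed
  assume [measurable]: "g \<in> borel_measurable borel"
  have "(\<integral>\<^sup>+\<omega>. X \<omega> * g (X \<omega>) \<partial>M) = (\<Sum>k. of_nat k * g (of_nat k) * ennreal (l ^ k / fact k * exp (- l)))"
    by (subst sum[of "\<lambda>y. y * g y"]) auto
  also have "\<dots> = (\<Sum>k. of_nat (k + 1) * g (of_nat (k + 1)) * ennreal (l ^ (k + 1) / fact (k + 1) * exp (- l)))"
    by (subst suminf_offset[of _ 1]) (auto simp: )
  also have "\<dots> = (\<Sum>k. ennreal l * (g (of_nat k + 1) * ennreal (l ^ k / fact k * exp (- l))))"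
  proof (intro suminf_cong)
    fix k
    have "of_nat (k + 1) * ennreal (l ^ (k + 1) / fact (k + 1) * exp (- l)) = ennreal (real (k + 1) * (l ^ (k + 1) / fact (k + 1) * exp (- l)))"
      using l by (subst ennreal_mult) (auto simp: ennreal_of_nat_eq_real_of_nat simp del: of_nat_add)
    also have "real (k + 1) * (l ^ (k + 1) / fact (k + 1) * exp (- l)) = l * (l ^ k / fact k * exp (- l))"
      unfolding Suc_eq_plus1[symmetric] fact_Suc power_Suc by (simp add: divide_simps del: of_nat_Suc)
    also have "ennreal \<dots> = ennreal l * ennreal (l ^ k / fact k * exp (- l))"
      using l by (intro ennreal_mult) auto
    finally have eq: "of_nat (k + 1) * ennreal (l ^ (k + 1) / fact (k + 1) * exp (- l)) = ennreal l * ennreal (l ^ k / fact k * exp (- l))" .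
    have "of_nat (k + 1) * g (of_nat (k + 1)) * ennreal (l ^ (k + 1) / fact (k + 1) * exp (- l)) =
      g (of_nat k + 1) * (of_nat (k + 1) * ennreal (l ^ (k + 1) / fact (k + 1) * exp (- l)))"
      by (simp only: mult_ac of_nat_add of_nat_1)
    then show "of_nat (k + 1) * g (of_nat (k + 1)) * ennreal (l ^ (k + 1) / fact (k + 1) * exp (- l)) =
      ennreal l * (g (of_nat k + 1) * ennreal (l ^ k / fact k * exp (- l)))"
      unfolding eq by (simp only: mult_ac)
  qed
  also have "\<dots> = ennreal l * (\<integral>\<^sup>+\<omega>. g (X \<omega> + 1) \<partial>M)"
    by (subst sum[of "\<lambda>y. g (y + 1)"]) auto
  finally show "(\<integral>\<^sup>+\<omega>. X \<omega> * g (X \<omega>) \<partial>M) = ennreal l * (\<integral>\<^sup>+\<omega>. g (X \<omega> + 1) \<partial>M)" .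
qed

locale poisson =
  fixes P :: "'a measure" and \<mu> :: "'b measure" and N :: "'a \<Rightarrow> 'b measure"
  assumes prm: "poisson_random_measure P \<mu> N" and sf: "sigma_finite_measure \<mu>"
begin

sublocale P: prob_space P using prm by (simp add: poisson_random_measure_def)
sublocale \<mu>: sigma_finite_measure \<mu> by (rule sf)
sublocale PM: pair_sigma_finite P \<mu> ..

lemma measurable_N[measurable]: "A \<in> sets \<mu> \<Longrightarrow> (\<lambda>\<omega>. emeasure (N \<omega>) A) \<in> borel_measurable P"
  using prm by (simp add: poisson_random_measure_def)

lemma measurable_Nr[measurable]: "A \<in> sets \<mu> \<Longrightarrow> (\<lambda>\<omega>. measure (N \<omega>) A) \<in> borel_measurable P"
  unfolding measure_def by measurable

lemma sets_N: "\<omega> \<in> space P \<Longrightarrow> sets (N \<omega>) = sets \<mu>"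
  using prm by (simp add: poisson_random_measure_def)

lemma N_distribution:
  assumes "A \<in> sets \<mu>" "emeasure \<mu> A < \<infinity>"
  shows "P.prob {\<omega> \<in> space P. emeasure (N \<omega>) A = of_nat k} = measure \<mu> A ^ k / fact k * exp (- measure \<mu> A)"
  using prm assms by (simp add: poisson_random_measure_def)

lemma N_indep:
  assumes "finite I" "\<And>i. i \<in> I \<Longrightarrow> B i \<in> sets \<mu>" "disjoint_family_on B (I :: nat set)"
  shows "P.indep_vars (\<lambda>_. borel) (\<lambda>i \<omega>. emeasure (N \<omega>) (B i)) I"
proof -
  have "B ` I \<subseteq> sets \<mu>" using assms by auto
  then show ?thesis using prm assms(1,3) unfolding poisson_random_measure_def by blast
qed

lemma AE_N_finite:
  assumes "A \<in> sets \<mu>" "emeasure \<mu> A < \<infinity>"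
  shows "AE \<omega> in P. emeasure (N \<omega>) A < \<infinity>"
  using P.AE_poisson_nat[OF measurable_N[OF assms(1)] _ N_distribution[OF assms]]
  by (auto elim!: eventually_mono simp: ennreal_of_nat_eq_real_of_nat)

text \<open>Counts of disjoint sets are independent, so their joint law is a product measure.
  Integrating the coordinate \<open>i0\<close> first, with the others fixed, reduces the claim to
  the shift identity for one Poisson variable.\<close>

lemma mecke_disjoint:
  fixes B :: "nat \<Rightarrow> 'b set" and G :: "(nat \<Rightarrow> ennreal) \<Rightarrow> ennreal"
  assumes I: "finite I" "i0 \<in> I" and B: "\<And>i. i \<in> I \<Longrightarrow> B i \<in> sets \<mu>" "\<And>i. i \<in> I \<Longrightarrow> emeasure \<mu> (B i) < \<infinity>"
    and dB: "disjoint_family_on B I" and G: "G \<in> borel_measurable (PiM I (\<lambda>_. borel))"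
  shows "(\<integral>\<^sup>+\<omega>. emeasure (N \<omega>) (B i0) * G (\<lambda>i\<in>I. emeasure (N \<omega>) (B i)) \<partial>P) =
    emeasure \<mu> (B i0) * (\<integral>\<^sup>+\<omega>. G (\<lambda>i\<in>I. emeasure (N \<omega>) (B i) + (if i = i0 then 1 else 0)) \<partial>P)"
proof -
  \<comment> \<open>Indices outside \<open>I\<close> receive the set \<open>B i0\<close>, so that
    every \<open>D i\<close> is a probability measure and the product is taken over a family defined
    on all naturals.\<close>
  define X where "X i \<omega> = emeasure (N \<omega>) (B (if i \<in> I then i else i0))" for i \<omega>
  define D where "D i = distr P borel (X i)" for i
  define J where "J = I - {i0}"
  have J: "finite J" "i0 \<notin> J" "I = insert i0 J" using I by (auto simp: J_def)
  have Xm[measurable]: "X i \<in> borel_measurable P" for i unfolding X_def using B I by auto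
  have sD: "sets (D i) = sets borel" for i by (simp add: D_def)
  have pD: "prob_space (D i)" for i unfolding D_def by (rule P.prob_space_distr) simp
  interpret D: product_sigma_finite D
    by (intro product_sigma_finite.intro prob_space_imp_sigma_finite pD)
  note [measurable_cong] = sets_PiM_cong[OF refl sD, of I] sets_PiM_cong[OF refl sD, of J] sD
  have "P.indep_vars (\<lambda>_. borel) (\<lambda>i \<omega>. emeasure (N \<omega>) (B i)) I"
    by (rule N_indep[OF I(1) B(1) dB])
  then have "P.indep_vars (\<lambda>_. borel) X I"
    by (subst P.indep_vars_cong[OF refl _ refl, of I X "\<lambda>i \<omega>. emeasure (N \<omega>) (B i)"]) (auto simp: X_def)
  then have eq: "distr P (PiM I (\<lambda>_. borel)) (\<lambda>\<omega>. \<lambda>i\<in>I. X i \<omega>) = PiM I D"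
    unfolding D_def using I by (subst P.indep_vars_iff_distr_eq_PiM[symmetric]) auto
  have int: "(\<integral>\<^sup>+\<omega>. h (\<lambda>i\<in>I. X i \<omega>) \<partial>P) = (\<integral>\<^sup>+v. h v \<partial>PiM I D)" if "h \<in> borel_measurable (PiM I (\<lambda>_. borel))" for h
    unfolding eq[symmetric] using that by (subst nn_integral_distr) auto
  have restr: "(\<lambda>i\<in>I. X i \<omega>) = (\<lambda>i\<in>I. emeasure (N \<omega>) (B i))" for \<omega> by (auto simp: X_def fun_eq_iff)
  have upd: "(\<lambda>y. v(i0 := y)) \<in> borel \<rightarrow>\<^sub>M PiM I (\<lambda>_. borel)" if v: "v \<in> space (PiM J (\<lambda>_. borel :: ennreal measure))" for v
    unfolding J(3) using v by (intro measurable_fun_upd[where J = J]) (auto intro: measurable_const)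
  have G[measurable]: "G \<in> borel_measurable (PiM I (\<lambda>_. borel))" by (rule G)
  have G1[measurable]: "(\<lambda>v. G (v(i0 := v i0 + 1))) \<in> borel_measurable (PiM I (\<lambda>_. borel))"
  proof (rule measurable_compose[OF _ G])
    show "(\<lambda>v. v(i0 := v i0 + 1)) \<in> (PiM I (\<lambda>_. borel :: ennreal measure)) \<rightarrow>\<^sub>M PiM I (\<lambda>_. borel)"
      using I by (intro measurable_fun_upd[where J = I]) (auto simp: insert_absorb)
  qed
  have mD: "(\<lambda>v. v i0 * G v) \<in> borel_measurable (PiM I D)" "(\<lambda>v. G (v(i0 := v i0 + 1))) \<in> borel_measurable (PiM I D)"
    using I by auto
  have "(\<integral>\<^sup>+\<omega>. emeasure (N \<omega>) (B i0) * G (\<lambda>i\<in>I. emeasure (N \<omega>) (B i)) \<partial>P) = (\<integral>\<^sup>+\<omega>. (\<lambda>v. v i0 * G v) (\<lambda>i\<in>I. X i \<omega>) \<partial>P)"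
    using I by (simp add: restr)
  also have "\<dots> = (\<integral>\<^sup>+v. v i0 * G v \<partial>PiM I D)"
    using I by (intro int) auto
  also have "\<dots> = (\<integral>\<^sup>+v. (\<integral>\<^sup>+y. y * G (v(i0 := y)) \<partial>D i0) \<partial>PiM J D)"
    using D.product_nn_integral_insert[OF J(1,2) mD(1)[unfolded J(3)]] by (simp add: J(3))
  also have "\<dots> = (\<integral>\<^sup>+v. emeasure \<mu> (B i0) * (\<integral>\<^sup>+y. G (v(i0 := y + 1)) \<partial>D i0) \<partial>PiM J D)"
  proof (rule nn_integral_cong)
    fix v assume "v \<in> space (PiM J D)"
    then have v: "v \<in> space (PiM J (\<lambda>_. borel :: ennreal measure))" by (simp add: space_PiM D_def)
    have gm[measurable]: "(\<lambda>y. G (v(i0 := y))) \<in> borel_measurable borel" using upd[OF v] by (rule measurable_compose) (rule G)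
    have "(\<integral>\<^sup>+y. y * G (v(i0 := y)) \<partial>D i0) = (\<integral>\<^sup>+\<omega>. X i0 \<omega> * G (v(i0 := X i0 \<omega>)) \<partial>P)"
      unfolding D_def by (subst nn_integral_distr) auto
    also have "\<dots> = ennreal (measure \<mu> (B i0)) * (\<integral>\<^sup>+\<omega>. G (v(i0 := X i0 \<omega> + 1)) \<partial>P)"
      by (rule P.poisson_shift[OF Xm _ _ gm]) (use N_distribution[OF B(1,2)[OF I(2)]] I in \<open>auto simp: X_def\<close>)
    also have "(\<integral>\<^sup>+\<omega>. G (v(i0 := X i0 \<omega> + 1)) \<partial>P) = (\<integral>\<^sup>+y. G (v(i0 := y + 1)) \<partial>D i0)"
      unfolding D_def by (subst nn_integral_distr) auto
    also have "ennreal (measure \<mu> (B i0)) = emeasure \<mu> (B i0)"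
      using B(2)[OF I(2)] by (intro emeasure_eq_ennreal_measure[symmetric]) auto
    finally show "(\<integral>\<^sup>+y. y * G (v(i0 := y)) \<partial>D i0) = emeasure \<mu> (B i0) * (\<integral>\<^sup>+y. G (v(i0 := y + 1)) \<partial>D i0)" .
  qed
  also have "\<dots> = emeasure \<mu> (B i0) * (\<integral>\<^sup>+v. (\<integral>\<^sup>+y. G ((v(i0 := y))(i0 := (v(i0 := y)) i0 + 1)) \<partial>D i0) \<partial>PiM J D)"
  proof (subst nn_integral_cmult)
    have "(\<lambda>(v, y). v(i0 := y + 1)) \<in> (PiM J (\<lambda>_. borel :: ennreal measure) \<Otimes>\<^sub>M borel) \<rightarrow>\<^sub>M PiM I (\<lambda>_. borel)"
      unfolding J(3) split_beta' by (intro measurable_fun_upd[where J = J]) auto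
    from measurable_compose[OF this G]
    have [measurable]: "(\<lambda>(v, y). G (v(i0 := y + 1))) \<in> borel_measurable (PiM J D \<Otimes>\<^sub>M D i0)"
      by (simp add: split_beta' cong: measurable_cong_sets)
    interpret D0: prob_space "D i0" by (rule pD)
    show "(\<lambda>v. \<integral>\<^sup>+y. G (v(i0 := y + 1)) \<partial>D i0) \<in> borel_measurable (PiM J D)" by measurable
  qed simp
  also have "\<dots> = emeasure \<mu> (B i0) * (\<integral>\<^sup>+v. G (v(i0 := v i0 + 1)) \<partial>PiM I D)"
    using D.product_nn_integral_insert[OF J(1,2) mD(2)[unfolded J(3)]] by (simp add: J(3))
  also have "(\<integral>\<^sup>+v. G (v(i0 := v i0 + 1)) \<partial>PiM I D) = (\<integral>\<^sup>+\<omega>. (\<lambda>v. G (v(i0 := v i0 + 1))) (\<lambda>i\<in>I. X i \<omega>) \<partial>P)"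
    by (subst int) auto
  also have "\<dots> = (\<integral>\<^sup>+\<omega>. G (\<lambda>i\<in>I. emeasure (N \<omega>) (B i) + (if i = i0 then 1 else 0)) \<partial>P)"
    using I by (intro nn_integral_cong arg_cong[where f = G]) (auto simp: X_def fun_eq_iff)
  finally show ?thesis .
qed

text \<open>For arbitrary finite families, pass to the atoms of the generated algebra.\<close>

lemma mecke_nn:
  fixes G :: "('b set \<Rightarrow> ennreal) \<Rightarrow> ennreal"
  assumes C: "finite \<C>" "\<And>A. A \<in> \<C> \<Longrightarrow> A \<in> sets \<mu>" "\<And>A. A \<in> \<C> \<Longrightarrow> emeasure \<mu> A < \<infinity>" and K: "K \<in> \<C>"
    and G: "G \<in> borel_measurable (PiM \<C> (\<lambda>_. borel))"
  shows "(\<integral>\<^sup>+\<omega>. emeasure (N \<omega>) K * G (\<lambda>A\<in>\<C>. emeasure (N \<omega>) A) \<partial>P) =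
    (\<integral>\<^sup>+x. indicator K x * (\<integral>\<^sup>+\<omega>. G (\<lambda>A\<in>\<C>. emeasure (N \<omega>) A + indicator A x) \<partial>P) \<partial>\<mu>)"
proof -
  \<comment> \<open>Points are classified by the subfamily of \<open>\<C>\<close> that contains
    them. The empty subfamily is left out, since its atom may have infinite measure; the others are
    numbered because independence is stated for natural indices.\<close>
  define atom where "atom S = {x \<in> space \<mu>. \<forall>A\<in>\<C>. x \<in> A \<longleftrightarrow> A \<in> S}" for S
  have "finite (Pow \<C> - {{}})" using C by simp
  then obtain m :: nat and e where e: "bij_betw e {0..<m} (Pow \<C> - {{}})"
    using ex_bij_betw_nat_finite by blast
  define I where "I = {0..<m}"
  have I: "finite I" by (simp add: I_def)
  have eP: "e i \<in> Pow \<C> - {{}}" if "i \<in> I" for i using bij_betwE[OF e] that unfolding I_def by blast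
  have eI: "e i \<subseteq> \<C>" "e i \<noteq> {}" if "i \<in> I" for i using eP[OF that] by simp_all
  have einj: "i = j" if "e i = e j" "i \<in> I" "j \<in> I" for i j
    using bij_betw_imp_inj_on[OF e] that unfolding I_def inj_on_def by blast
  have esurj: "\<exists>i\<in>I. e i = S" if "S \<subseteq> \<C>" "S \<noteq> {}" for S
  proof -
    have "S \<in> e ` I" using that bij_betw_imp_surj_on[OF e] unfolding I_def by simp
    then show ?thesis by auto
  qed
  define B where "B i = atom (e i)" for i
  have Bs[measurable]: "B i \<in> sets \<mu>" if "i \<in> I" for i
  proof -
    have "B i = (\<Inter>A\<in>\<C>. if A \<in> e i then A else space \<mu> - A)"
    proof (intro equalityI subsetI)
      fix x assume x: "x \<in> (\<Inter>A\<in>\<C>. if A \<in> e i then A else space \<mu> - A)"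
      then have "x \<in> (if K \<in> e i then K else space \<mu> - K)" using K by blast
      then have "x \<in> space \<mu>" using sets.sets_into_space[OF C(2)[OF K]] by (auto split: if_splits)
      moreover have "x \<in> A \<longleftrightarrow> A \<in> e i" if "A \<in> \<C>" for A
        using INT_D[OF x that] by (auto split: if_splits)
      ultimately show "x \<in> B i" by (simp add: B_def atom_def)
    qed (auto simp: B_def atom_def)
    also have "\<dots> \<in> sets \<mu>" using C(1,2) K by (intro sets.finite_INT) auto
    finally show ?thesis .
  qed
  have dB: "disjoint_family_on B I"
    unfolding disjoint_family_on_def
  proof (intro ballI impI)
    fix i j assume ij: "i \<in> I" "j \<in> I" "i \<noteq> j"
    then have "e i \<noteq> e j" using einj by blast
    then show "B i \<inter> B j = {}" using eI[OF ij(1)] eI[OF ij(2)] by (auto simp: B_def atom_def)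
  qed
  have dec: "A = (\<Union>i\<in>{i\<in>I. A \<in> e i}. B i)" if A: "A \<in> \<C>" for A
  proof (intro equalityI subsetI)
    fix x assume x: "x \<in> A"
    have xs: "x \<in> space \<mu>" using C(2)[OF A] x sets.sets_into_space by auto
    define S where "S = {A'\<in>\<C>. x \<in> A'}"
    have "S \<subseteq> \<C>" "S \<noteq> {}" using A x by (auto simp: S_def)
    from esurj[OF this] obtain i where i: "i \<in> I" "e i = S" by auto
    then have "x \<in> B i" "A \<in> e i" using xs A x by (auto simp: B_def atom_def S_def)
    then show "x \<in> (\<Union>i\<in>{i\<in>I. A \<in> e i}. B i)" using i by auto
  next
    fix x assume "x \<in> (\<Union>i\<in>{i\<in>I. A \<in> e i}. B i)"
    then show "x \<in> A" using A by (auto simp: B_def atom_def)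
  qed
  have Bf: "emeasure \<mu> (B i) < \<infinity>" if i: "i \<in> I" for i
  proof -
    from eI[OF i] obtain A where A: "A \<in> e i" "A \<in> \<C>" by auto
    then have "emeasure \<mu> (B i) \<le> emeasure \<mu> A" using C(2) dec[OF A(2)] i by (intro emeasure_mono) auto
    also have "\<dots> < \<infinity>" using C(3) A by auto
    finally show ?thesis .
  qed
  have NA: "emeasure (N \<omega>) A = (\<Sum>i | i \<in> I \<and> A \<in> e i. emeasure (N \<omega>) (B i))" if A: "A \<in> \<C>" and w: "\<omega> \<in> space P" for A \<omega>
  proof -
    have "(\<Sum>i | i \<in> I \<and> A \<in> e i. emeasure (N \<omega>) (B i)) = emeasure (N \<omega>) (\<Union>i\<in>{i\<in>I. A \<in> e i}. B i)"
      using I Bs dB sets_N[OF w] by (intro sum_emeasure) (auto simp: disjoint_family_on_def)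
    then show ?thesis using dec[OF A] by simp
  qed
  have iA: "(indicator A x :: ennreal) = (\<Sum>i | i \<in> I \<and> A \<in> e i. indicator (B i) x)" if A: "A \<in> \<C>" for A x
  proof -
    have "(indicator A x :: ennreal) = indicator (\<Union>i\<in>{i\<in>I. A \<in> e i}. B i) x" using dec[OF A] by simp
    also have "\<dots> = (\<Sum>i | i \<in> I \<and> A \<in> e i. indicator (B i) x)"
      using I dB by (intro indicator_UN_disjoint) (auto simp: disjoint_family_on_def)
    finally show ?thesis .
  qed
  \<comment> \<open>\<open>G\<close> rewritten as a function of the counts of atoms, each member of
    \<open>\<C>\<close> being a disjoint union of atoms.\<close>
  define G' where "G' v = G (\<lambda>A\<in>\<C>. \<Sum>i | i \<in> I \<and> A \<in> e i. v i)" for v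
  have "(\<lambda>v. \<lambda>A\<in>\<C>. \<Sum>i | i \<in> I \<and> A \<in> e i. v i) \<in> PiM I (\<lambda>_. borel) \<rightarrow>\<^sub>M PiM \<C> (\<lambda>_. borel :: ennreal measure)"
    by (intro measurable_restrict borel_measurable_sum) auto
  then have G'[measurable]: "G' \<in> borel_measurable (PiM I (\<lambda>_. borel))"
    unfolding G'_def by (rule measurable_compose) (rule G)
  have GG: "G (\<lambda>A\<in>\<C>. emeasure (N \<omega>) A) = G' (\<lambda>i\<in>I. emeasure (N \<omega>) (B i))" if "\<omega> \<in> space P" for \<omega>
    unfolding G'_def by (intro arg_cong[where f = G]) (auto simp: fun_eq_iff NA[OF _ that] intro!: sum.cong)
  \<comment> \<open>A point in the atom \<open>B i\<close> raises the count of \<open>B i\<close>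
    and of no other atom, and thereby the count of each \<open>A\<close> by
    \<open>indicator A x\<close>.\<close>
  have GG1: "G (\<lambda>A\<in>\<C>. emeasure (N \<omega>) A + indicator A x) = G' (\<lambda>j\<in>I. emeasure (N \<omega>) (B j) + (if j = i then 1 else 0))"
    if "\<omega> \<in> space P" "i \<in> I" "x \<in> B i" for \<omega> i x
  proof -
    have ind: "indicator (B j) x = (if j = i then 1 else 0 :: ennreal)" if "j \<in> I" for j
      using dB \<open>i \<in> I\<close> \<open>x \<in> B i\<close> that by (auto simp: disjoint_family_on_def indicator_def)
    show ?thesis unfolding G'_def
      by (intro arg_cong[where f = G]) (auto simp: fun_eq_iff NA[OF _ that(1)] iA ind sum.distrib[symmetric] intro!: sum.cong)
  qed
  have "(\<integral>\<^sup>+\<omega>. emeasure (N \<omega>) K * G (\<lambda>A\<in>\<C>. emeasure (N \<omega>) A) \<partial>P) =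
      (\<integral>\<^sup>+\<omega>. (\<Sum>i | i \<in> I \<and> K \<in> e i. emeasure (N \<omega>) (B i) * G' (\<lambda>i\<in>I. emeasure (N \<omega>) (B i))) \<partial>P)"
    by (intro nn_integral_cong) (simp add: GG NA[OF K] sum_distrib_right)
  also have "\<dots> = (\<Sum>i | i \<in> I \<and> K \<in> e i. \<integral>\<^sup>+\<omega>. emeasure (N \<omega>) (B i) * G' (\<lambda>i\<in>I. emeasure (N \<omega>) (B i)) \<partial>P)"
    by (subst nn_integral_sum) (auto intro!: borel_measurable_times_ennreal measurable_compose[OF measurable_restrict G'] measurable_N Bs)
  also have "\<dots> = (\<Sum>i | i \<in> I \<and> K \<in> e i. emeasure \<mu> (B i) * (\<integral>\<^sup>+\<omega>. G' (\<lambda>j\<in>I. emeasure (N \<omega>) (B j) + (if j = i then 1 else 0)) \<partial>P))"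
    by (intro sum.cong refl mecke_disjoint) (use I Bs Bf dB G' in auto)
  also have "\<dots> = (\<Sum>i | i \<in> I \<and> K \<in> e i. \<integral>\<^sup>+x. indicator (B i) x * (\<integral>\<^sup>+\<omega>. G' (\<lambda>j\<in>I. emeasure (N \<omega>) (B j) + (if j = i then 1 else 0)) \<partial>P) \<partial>\<mu>)"
    by (intro sum.cong refl) (use Bs in \<open>simp add: nn_integral_multc\<close>)
  also have "\<dots> = (\<integral>\<^sup>+x. (\<Sum>i | i \<in> I \<and> K \<in> e i. indicator (B i) x * (\<integral>\<^sup>+\<omega>. G' (\<lambda>j\<in>I. emeasure (N \<omega>) (B j) + (if j = i then 1 else 0)) \<partial>P)) \<partial>\<mu>)"
    by (subst nn_integral_sum) auto
  also have "\<dots> = (\<integral>\<^sup>+x. indicator K x * (\<integral>\<^sup>+\<omega>. G (\<lambda>A\<in>\<C>. emeasure (N \<omega>) A + indicator A x) \<partial>P) \<partial>\<mu>)"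
  proof (intro nn_integral_cong)
    fix x
    show "(\<Sum>i | i \<in> I \<and> K \<in> e i. indicator (B i) x * (\<integral>\<^sup>+\<omega>. G' (\<lambda>j\<in>I. emeasure (N \<omega>) (B j) + (if j = i then 1 else 0)) \<partial>P)) =
      indicator K x * (\<integral>\<^sup>+\<omega>. G (\<lambda>A\<in>\<C>. emeasure (N \<omega>) A + indicator A x) \<partial>P)"
      unfolding iA[OF K] sum_distrib_right
    proof (intro sum.cong refl)
      fix i assume i: "i \<in> {i. i \<in> I \<and> K \<in> e i}"
      show "indicator (B i) x * (\<integral>\<^sup>+\<omega>. G' (\<lambda>j\<in>I. emeasure (N \<omega>) (B j) + (if j = i then 1 else 0)) \<partial>P) =
        indicator (B i) x * (\<integral>\<^sup>+\<omega>. G (\<lambda>A\<in>\<C>. emeasure (N \<omega>) A + indicator A x) \<partial>P)"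
      proof (cases "x \<in> B i")
        case True
        then show ?thesis using i by (auto intro!: nn_integral_cong GG1[symmetric])
      qed simp
    qed
  qed
  finally show ?thesis .
qed

text \<open>The finitely many counts are almost surely finite, so passing to real-valued counts
  changes the integrands only on null sets of outcomes.\<close>

lemma mecke_nn_real:
  fixes H :: "('b set \<Rightarrow> real) \<Rightarrow> ennreal"
  assumes C: "finite \<C>" "\<And>A. A \<in> \<C> \<Longrightarrow> A \<in> sets \<mu>" "\<And>A. A \<in> \<C> \<Longrightarrow> emeasure \<mu> A < \<infinity>" and K: "K \<in> \<C>"
    and H[measurable]: "H \<in> borel_measurable (PiM \<C> (\<lambda>_. borel))"
  shows "(\<integral>\<^sup>+\<omega>. ennreal (measure (N \<omega>) K) * H (\<lambda>A\<in>\<C>. measure (N \<omega>) A) \<partial>P) =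
    (\<integral>\<^sup>+x. indicator K x * (\<integral>\<^sup>+\<omega>. H (\<lambda>A\<in>\<C>. measure (N \<omega>) A + indicator A x) \<partial>P) \<partial>\<mu>)"
proof -
  define G where "G v = H (\<lambda>A\<in>\<C>. enn2real (v A))" for v
  have "(\<lambda>v. \<lambda>A\<in>\<C>. enn2real (v A)) \<in> PiM \<C> (\<lambda>_. borel) \<rightarrow>\<^sub>M PiM \<C> (\<lambda>_. borel)"
    by (intro measurable_restrict) auto
  then have G: "G \<in> borel_measurable (PiM \<C> (\<lambda>_. borel))" unfolding G_def by (rule measurable_compose) (rule H)
  have fin: "AE \<omega> in P. \<forall>A\<in>\<C>. emeasure (N \<omega>) A < \<infinity>"
    using C by (intro AE_finite_allI AE_N_finite) auto
  have "(\<integral>\<^sup>+\<omega>. ennreal (measure (N \<omega>) K) * H (\<lambda>A\<in>\<C>. measure (N \<omega>) A) \<partial>P) = (\<integral>\<^sup>+\<omega>. emeasure (N \<omega>) K * G (\<lambda>A\<in>\<C>. emeasure (N \<omega>) A) \<partial>P)"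
    by (rule nn_integral_cong_AE, use fin in eventually_elim)
       (use K in \<open>auto simp: G_def measure_def cong: restrict_cong\<close>)
  also have "\<dots> = (\<integral>\<^sup>+x. indicator K x * (\<integral>\<^sup>+\<omega>. G (\<lambda>A\<in>\<C>. emeasure (N \<omega>) A + indicator A x) \<partial>P) \<partial>\<mu>)"
    by (rule mecke_nn[OF C K G])
  also have "\<dots> = (\<integral>\<^sup>+x. indicator K x * (\<integral>\<^sup>+\<omega>. H (\<lambda>A\<in>\<C>. measure (N \<omega>) A + indicator A x) \<partial>P) \<partial>\<mu>)"
  proof (rule nn_integral_cong, rule arg_cong2[where f = "(*)", OF refl], rule nn_integral_cong_AE, use fin in eventually_elim)
    fix x \<omega> assume *: "\<forall>A\<in>\<C>. emeasure (N \<omega>) A < \<infinity>"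
    have "enn2real (emeasure (N \<omega>) A + indicator A x) = measure (N \<omega>) A + indicator A x" if "A \<in> \<C>" for A
      using * that by (auto simp: measure_def enn2real_plus indicator_def)
    then show "G (\<lambda>A\<in>\<C>. emeasure (N \<omega>) A + indicator A x) = H (\<lambda>A\<in>\<C>. measure (N \<omega>) A + indicator A x)"
      unfolding G_def by (auto cong: restrict_cong)
  qed
  finally show ?thesis .
qed

text \<open>Both sides are integrals of \<open>H\<close> against image measures on a
  finite-dimensional space. The nonnegative formula identifies these measures, and then
  integrability and the integrals of signed \<open>H\<close> transfer together.\<close>

lemma mecke_integral:
  fixes H :: "('b set \<Rightarrow> real) \<Rightarrow> real"
  assumes C: "finite \<C>" "\<And>A. A \<in> \<C> \<Longrightarrow> A \<in> sets \<mu>" "\<And>A. A \<in> \<C> \<Longrightarrow> emeasure \<mu> A < \<infinity>" and K: "K \<in> \<C>"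
    and H[measurable]: "H \<in> borel_measurable (PiM \<C> (\<lambda>_. borel))"
  shows "(\<integral>\<omega>. measure (N \<omega>) K * H (\<lambda>A\<in>\<C>. measure (N \<omega>) A) \<partial>P) =
    (\<integral>p. indicator K (snd p) * H (\<lambda>A\<in>\<C>. measure (N (fst p)) A + indicator A (snd p)) \<partial>(P \<Otimes>\<^sub>M \<mu>))"
    and "integrable P (\<lambda>\<omega>. measure (N \<omega>) K * H (\<lambda>A\<in>\<C>. measure (N \<omega>) A)) \<longleftrightarrow>
    integrable (P \<Otimes>\<^sub>M \<mu>) (\<lambda>p. indicator K (snd p) * H (\<lambda>A\<in>\<C>. measure (N (fst p)) A + indicator A (snd p)))"
proof -
  define \<Phi> where "\<Phi> \<omega> = (\<lambda>A\<in>\<C>. measure (N \<omega>) A)" for \<omega>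
  define \<Psi> where "\<Psi> p = (\<lambda>A\<in>\<C>. measure (N (fst p)) A + indicator A (snd p))" for p
  have Km[measurable]: "K \<in> sets \<mu>" using C K by auto
  have \<Phi>[measurable]: "\<Phi> \<in> P \<rightarrow>\<^sub>M PiM \<C> (\<lambda>_. borel)"
    unfolding \<Phi>_def using C by (intro measurable_restrict) auto
  have \<Psi>[measurable]: "\<Psi> \<in> (P \<Otimes>\<^sub>M \<mu>) \<rightarrow>\<^sub>M PiM \<C> (\<lambda>_. borel)"
    unfolding \<Psi>_def
  proof (intro measurable_restrict borel_measurable_add)
    fix A assume "A \<in> \<C>"
    then have [measurable]: "A \<in> sets \<mu>" using C by auto
    show "(\<lambda>p. measure (N (fst p)) A) \<in> borel_measurable (P \<Otimes>\<^sub>M \<mu>)" by measurable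
    show "(\<lambda>p. indicator A (snd p)) \<in> borel_measurable (P \<Otimes>\<^sub>M \<mu>)" by measurable
  qed
  have eq: "distr (density P (\<lambda>\<omega>. ennreal (measure (N \<omega>) K))) (PiM \<C> (\<lambda>_. borel)) \<Phi> =
     distr (density (P \<Otimes>\<^sub>M \<mu>) (\<lambda>p. ennreal (indicator K (snd p)))) (PiM \<C> (\<lambda>_. borel)) \<Psi>"
  proof (rule measure_eqI)
    fix S assume "S \<in> sets (distr (density P (\<lambda>\<omega>. ennreal (measure (N \<omega>) K))) (PiM \<C> (\<lambda>_. borel)) \<Phi>)"
    then have S[measurable]: "S \<in> sets (PiM \<C> (\<lambda>_. borel))" by simp
    have "emeasure (distr (density P (\<lambda>\<omega>. ennreal (measure (N \<omega>) K))) (PiM \<C> (\<lambda>_. borel)) \<Phi>) S =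
      (\<integral>\<^sup>+\<omega>. ennreal (measure (N \<omega>) K) * indicator S (\<Phi> \<omega>) \<partial>P)"
      by (subst emeasure_distr, simp, simp, subst emeasure_density, simp, simp)
         (auto intro!: nn_integral_cong simp: indicator_def)
    also have "\<dots> = (\<integral>\<^sup>+x. indicator K x * (\<integral>\<^sup>+\<omega>. indicator S (\<Psi> (\<omega>, x)) \<partial>P) \<partial>\<mu>)"
      unfolding \<Phi>_def \<Psi>_def fst_conv snd_conv by (rule mecke_nn_real[OF C K]) auto
    also have "\<dots> = (\<integral>\<^sup>+x. (\<integral>\<^sup>+\<omega>. ennreal (indicator K (snd (\<omega>, x))) * indicator S (\<Psi> (\<omega>, x)) \<partial>P) \<partial>\<mu>)"
      by (intro nn_integral_cong) (simp add: nn_integral_cmult ennreal_indicator)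
    also have "\<dots> = (\<integral>\<^sup>+p. ennreal (indicator K (snd p)) * indicator S (\<Psi> p) \<partial>(P \<Otimes>\<^sub>M \<mu>))"
      by (subst PM.nn_integral_snd) auto
    also have "\<dots> = emeasure (distr (density (P \<Otimes>\<^sub>M \<mu>) (\<lambda>p. ennreal (indicator K (snd p)))) (PiM \<C> (\<lambda>_. borel)) \<Psi>) S"
      by (subst emeasure_distr, simp, simp, subst emeasure_density, simp, simp)
         (auto intro!: nn_integral_cong simp: indicator_def)
    finally show "emeasure (distr (density P (\<lambda>\<omega>. ennreal (measure (N \<omega>) K))) (PiM \<C> (\<lambda>_. borel)) \<Phi>) S =
      emeasure (distr (density (P \<Otimes>\<^sub>M \<mu>) (\<lambda>p. ennreal (indicator K (snd p)))) (PiM \<C> (\<lambda>_. borel)) \<Psi>) S" .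
  qed simp
  have "(\<integral>\<omega>. measure (N \<omega>) K * H (\<Phi> \<omega>) \<partial>P) = (\<integral>v. H v \<partial>distr (density P (\<lambda>\<omega>. ennreal (measure (N \<omega>) K))) (PiM \<C> (\<lambda>_. borel)) \<Phi>)"
    by (subst integral_distr, simp, simp, subst integral_real_density) auto
  also have "\<dots> = (\<integral>p. indicator K (snd p) * H (\<Psi> p) \<partial>(P \<Otimes>\<^sub>M \<mu>))"
    unfolding eq by (subst integral_distr, simp, simp, subst integral_real_density) auto
  finally show "(\<integral>\<omega>. measure (N \<omega>) K * H (\<lambda>A\<in>\<C>. measure (N \<omega>) A) \<partial>P) =
    (\<integral>p. indicator K (snd p) * H (\<lambda>A\<in>\<C>. measure (N (fst p)) A + indicator A (snd p)) \<partial>(P \<Otimes>\<^sub>M \<mu>))"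
    by (simp add: \<Phi>_def \<Psi>_def)
  have "integrable P (\<lambda>\<omega>. measure (N \<omega>) K * H (\<Phi> \<omega>)) \<longleftrightarrow> integrable (distr (density P (\<lambda>\<omega>. ennreal (measure (N \<omega>) K))) (PiM \<C> (\<lambda>_. borel)) \<Phi>) H"
    by (subst integrable_distr_eq, simp, simp, subst integrable_real_density) auto
  also have "\<dots> \<longleftrightarrow> integrable (P \<Otimes>\<^sub>M \<mu>) (\<lambda>p. indicator K (snd p) * H (\<Psi> p))"
    unfolding eq by (subst integrable_distr_eq, simp, simp, subst integrable_real_density) auto
  finally show "integrable P (\<lambda>\<omega>. measure (N \<omega>) K * H (\<lambda>A\<in>\<C>. measure (N \<omega>) A)) \<longleftrightarrow>
    integrable (P \<Otimes>\<^sub>M \<mu>) (\<lambda>p. indicator K (snd p) * H (\<lambda>A\<in>\<C>. measure (N (fst p)) A + indicator A (snd p)))"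
    by (simp add: \<Phi>_def \<Psi>_def)
qed

end

section \<open>Products of the half-line\<close>

lemma space_halfline[simp]: "space halfline = {0..}"
  by (simp add: halfline_def space_restrict_space)

lemma sigma_finite_halfline: "sigma_finite_measure halfline"
  unfolding halfline_def by (rule sigma_finite_measure_restrict_space) (auto intro: sigma_finite_lborel)

interpretation halfline: sigma_finite_measure halfline by (rule sigma_finite_halfline)

interpretation halfline_prod: product_sigma_finite "\<lambda>_::nat. halfline"
  by (intro product_sigma_finite.intro sigma_finite_halfline)

lemma sigma_finite_halfline_prod: "finite I \<Longrightarrow> sigma_finite_measure (halfline_prod I)"
  unfolding halfline_prod_def by (rule halfline_prod.sigma_finite)

lemma space_halfline_prod: "space (halfline_prod I) = (\<Pi>\<^sub>E i\<in>I. {0..})"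
  by (simp add: halfline_prod_def space_PiM)

lemma measurable_halfline_id[measurable]: "(\<lambda>x. x) \<in> halfline \<rightarrow>\<^sub>M borel"
  by (simp add: halfline_def measurable_restrict_space1)

lemma measurable_component_halfline[measurable]: "i \<in> I \<Longrightarrow> (\<lambda>x. x i) \<in> halfline_prod I \<rightarrow>\<^sub>M halfline"
  unfolding halfline_prod_def by measurable

lemma measurable_halfline_upd:
  "(\<lambda>p. (fst p)(i := snd p)) \<in> halfline_prod I \<Otimes>\<^sub>M halfline \<rightarrow>\<^sub>M halfline_prod (insert i I)"
  unfolding halfline_prod_def by (intro measurable_fun_upd[where J = I]) auto

lemma measurable_halfline_upd1:
  assumes "y \<in> space (halfline_prod I)"
  shows "(\<lambda>x. y(i := x)) \<in> halfline \<rightarrow>\<^sub>M halfline_prod (insert i I)"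
  using measurable_compose[OF measurable_Pair1'[OF assms, of halfline] measurable_halfline_upd] by simp

lemma measurable_halfline_upd2:
  assumes "x \<ge> 0"
  shows "(\<lambda>y. y(i := x)) \<in> halfline_prod I \<rightarrow>\<^sub>M halfline_prod (insert i I)"
  using measurable_compose[OF measurable_Pair2'[of x halfline "halfline_prod I"] measurable_halfline_upd] assms by simp

lemma nn_integral_halfline_prod_insert:
  assumes "finite I" "i \<notin> I" "f \<in> borel_measurable (halfline_prod (insert i I))"
  shows "(\<integral>\<^sup>+z. f z \<partial>halfline_prod (insert i I)) = (\<integral>\<^sup>+x. (\<integral>\<^sup>+y. f (y(i := x)) \<partial>halfline_prod I) \<partial>halfline)"
  using halfline_prod.product_nn_integral_insert_rev[of I i f] assms unfolding halfline_prod_def by simp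

lemma Suc_insert: "{1..Suc m} = insert (Suc m) {1..m}" by auto

text \<open>Product measures are determined on boxes, where a permutation of the coordinates only
  reorders the factors.\<close>

lemma distr_halfline_prod_permute:
  assumes p: "p permutes I" and I: "finite I"
  shows "distr (halfline_prod I) (halfline_prod I) (\<lambda>z. z \<circ> p) = halfline_prod I"
    and measurable_permute: "(\<lambda>z. z \<circ> p) \<in> halfline_prod I \<rightarrow>\<^sub>M halfline_prod I"
proof -
  have pI: "p i \<in> I \<longleftrightarrow> i \<in> I" for i using p by (rule permutes_in_image)
  show m: "(\<lambda>z. z \<circ> p) \<in> halfline_prod I \<rightarrow>\<^sub>M halfline_prod I"
  proof -
    have "(\<lambda>z. \<lambda>i\<in>I. z (p i)) \<in> halfline_prod I \<rightarrow>\<^sub>M halfline_prod I"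
      unfolding halfline_prod_def by (intro measurable_restrict measurable_component_singleton) (simp add: pI)
    then show ?thesis
    proof (rule measurable_cong[THEN iffD1, rotated])
      fix z assume "z \<in> space (halfline_prod I)"
      then show "(\<lambda>i\<in>I. z (p i)) = z \<circ> p"
        using pI by (auto simp: space_halfline_prod fun_eq_iff PiE_iff extensional_def)
    qed
  qed
  have "distr (halfline_prod I) (halfline_prod I) (\<lambda>z. z \<circ> p) = PiM I (\<lambda>_. halfline)"
  proof (rule halfline_prod.PiM_eqI[OF I])
    fix A :: "nat \<Rightarrow> real set" assume A: "\<And>i. i \<in> I \<Longrightarrow> A i \<in> sets halfline"
    have ip: "inv p permutes I" using p by (rule permutes_inv)
    have ipI: "inv p i \<in> I \<longleftrightarrow> i \<in> I" for i using ip by (rule permutes_in_image)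
    have "(\<lambda>z. z \<circ> p) -` (Pi\<^sub>E I A) \<inter> space (halfline_prod I) = Pi\<^sub>E I (\<lambda>i. A (inv p i))"
    proof (intro equalityI subsetI)
      fix z assume z: "z \<in> (\<lambda>z. z \<circ> p) -` (Pi\<^sub>E I A) \<inter> space (halfline_prod I)"
      have "z i \<in> A (inv p i)" if "i \<in> I" for i
      proof -
        have "(z \<circ> p) (inv p i) \<in> A (inv p i)" using z that ipI by (auto simp: PiE_iff)
        then show ?thesis using permutes_inverses(1)[OF p] by simp
      qed
      then show "z \<in> Pi\<^sub>E I (\<lambda>i. A (inv p i))" using z by (auto simp: space_halfline_prod PiE_iff)
    next
      fix z assume z: "z \<in> Pi\<^sub>E I (\<lambda>i. A (inv p i))"
      have "z (p i) \<in> A i" if "i \<in> I" for i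
        using z that pI[of i] permutes_inverses(2)[OF p, of i] by (auto simp: PiE_iff dest!: bspec[of _ _ "p i"])
      moreover have "z i \<in> {0..}" if "i \<in> I" for i
        using z that A[of "inv p i"] ipI[of i] sets.sets_into_space[of "A (inv p i)" halfline] by (auto simp: PiE_iff)
      ultimately show "z \<in> (\<lambda>z. z \<circ> p) -` (Pi\<^sub>E I A) \<inter> space (halfline_prod I)"
        using z pI by (auto simp: space_halfline_prod PiE_iff extensional_def)
    qed
    then have "emeasure (distr (halfline_prod I) (halfline_prod I) (\<lambda>z. z \<circ> p)) (Pi\<^sub>E I A) = emeasure (halfline_prod I) (Pi\<^sub>E I (\<lambda>i. A (inv p i)))"
      using A I m by (subst emeasure_distr) (auto simp: halfline_prod_def intro!: sets_PiM_I_finite)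
    also have "\<dots> = (\<Prod>i\<in>I. emeasure halfline (A (inv p i)))"
      unfolding halfline_prod_def using A I ipI by (intro halfline_prod.emeasure_PiM) auto
    also have "\<dots> = (\<Prod>i\<in>I. emeasure halfline (A i))"
      using prod.permute[OF ip, of "\<lambda>i. emeasure halfline (A i)"] by (simp add: comp_def)
    finally show "emeasure (distr (halfline_prod I) (halfline_prod I) (\<lambda>z. z \<circ> p)) (Pi\<^sub>E I A) = (\<Prod>i\<in>I. emeasure halfline (A i))" .
  qed (simp add: halfline_prod_def)
  then show "distr (halfline_prod I) (halfline_prod I) (\<lambda>z. z \<circ> p) = halfline_prod I"
    by (simp add: halfline_prod_def)
qed

lemma sqn_permute:
  assumes "p permutes I" "finite I" and [measurable]: "f \<in> borel_measurable (halfline_prod I)"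
  shows "sqn (halfline_prod I) (\<lambda>z. f (z \<circ> p)) = sqn (halfline_prod I) f"
proof -
  have "sqn (halfline_prod I) f = sqn (distr (halfline_prod I) (halfline_prod I) (\<lambda>z. z \<circ> p)) f"
    using distr_halfline_prod_permute[OF assms(1,2)] by simp
  also have "\<dots> = sqn (halfline_prod I) (\<lambda>z. f (z \<circ> p))"
    unfolding sqn_def using measurable_permute[OF assms(1,2)] by (subst nn_integral_distr) auto
  finally show ?thesis by simp
qed

lemma AE_pair_fst:
  assumes "sigma_finite_measure M2" "AE x in M1. Q x"
  shows "AE p in M1 \<Otimes>\<^sub>M M2. Q (fst p)"
proof -
  interpret M2: sigma_finite_measure M2 by fact
  from assms(2) obtain S where S: "S \<in> null_sets M1" "{x \<in> space M1. \<not> Q x} \<subseteq> S"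
    by (auto elim!: AE_E)
  have "S \<times> space M2 \<in> null_sets (M1 \<Otimes>\<^sub>M M2)"
    using S by (auto simp: null_sets_def M2.emeasure_pair_measure_Times)
  then show ?thesis by (rule AE_I') (use S in \<open>auto simp: space_pair_measure\<close>)
qed

section \<open>Elementary functions\<close>

type_synonym rects = "(real \<times> (nat \<Rightarrow> real set)) list"

text \<open>The symmetry demanded by \<open>elementary\<close> is left out on purpose: the
  derivative of a symmetric function in its last variable is not symmetric, and it too must be
  approximated and integrated.\<close>

definition disj_rects :: "nat \<Rightarrow> rects \<Rightarrow> bool" where
  "disj_rects m E \<longleftrightarrow> (\<forall>(c, A)\<in>set E. disjoint_family_on A {1..m} \<and>
        (\<forall>i\<in>{1..m}. A i \<in> sets halfline \<and> emeasure halfline (A i) < \<infinity>))"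

text \<open>The set function \<open>\<nu>\<close> is a parameter, so that the compensated measure
  can be replaced by itself plus a unit mass.\<close>

definition eint :: "nat \<Rightarrow> rects \<Rightarrow> (real set \<Rightarrow> real) \<Rightarrow> real" where
  "eint m E \<nu> = (\<Sum>(c, A)\<leftarrow>E. c * (\<Prod>i=1..m. \<nu> (A i)))"

definition neg_rects :: "rects \<Rightarrow> rects" where
  "neg_rects = map (\<lambda>(c, A). (- c, A))"

text \<open>Freezing the variable \<open>k\<close> at \<open>x\<close> affects only the coefficient:
  the side \<open>A k\<close> remains in the list but is no longer looked at once the rectangle is
  read at order \<open>k - 1\<close>.\<close>

definition sec :: "nat \<Rightarrow> real \<Rightarrow> rects \<Rightarrow> rects" where
  "sec k x = map (\<lambda>(c, A). (c * indicator (A k) x, A))"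

definition permute_rects :: "(nat \<Rightarrow> nat) \<Rightarrow> rects \<Rightarrow> rects" where
  "permute_rects p = map (\<lambda>(c, A). (c, A \<circ> p))"

text \<open>Transpositions with the last place suffice: one added point removes one side, and each
  side in turn is moved to the place that \<open>sec\<close> freezes. For \<open>i = m\<close> the
  transposition is the identity.\<close>

definition swaps :: "nat \<Rightarrow> rects \<Rightarrow> rects" where
  "swaps m E = concat (map (\<lambda>i. permute_rects (Transposition.transpose i m) E) [1..<Suc m])"

lemma disj_rectsD:
  "disj_rects m E \<Longrightarrow> (c, A) \<in> set E \<Longrightarrow> disjoint_family_on A {1..m}"
  "disj_rects m E \<Longrightarrow> (c, A) \<in> set E \<Longrightarrow> i \<in> {1..m} \<Longrightarrow> A i \<in> sets halfline"
  "disj_rects m E \<Longrightarrow> (c, A) \<in> set E \<Longrightarrow> i \<in> {1..m} \<Longrightarrow> emeasure halfline (A i) < \<infinity>"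
  by (auto simp: disj_rects_def)

lemma disj_rectsI:
  assumes "\<And>c A. (c, A) \<in> set E \<Longrightarrow> disjoint_family_on A {1..m}"
    "\<And>c A i. (c, A) \<in> set E \<Longrightarrow> i \<in> {1..m} \<Longrightarrow> A i \<in> sets halfline \<and> emeasure halfline (A i) < \<infinity>"
  shows "disj_rects m E"
  using assms by (auto simp: disj_rects_def)

lemma disj_rects_simps[simp]:
  "disj_rects m []"
  "disj_rects m (z # E) \<longleftrightarrow> disjoint_family_on (snd z) {1..m} \<and>
     (\<forall>i\<in>{1..m}. snd z i \<in> sets halfline \<and> emeasure halfline (snd z i) < \<infinity>) \<and> disj_rects m E"
  "disj_rects m (E @ E') \<longleftrightarrow> disj_rects m E \<and> disj_rects m E'"
  "disj_rects m (neg_rects E) \<longleftrightarrow> disj_rects m E"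
  by (auto simp: disj_rects_def neg_rects_def split_beta)

lemma disj_rects_concat: "(\<And>E. E \<in> set Es \<Longrightarrow> disj_rects m E) \<Longrightarrow> disj_rects m (concat Es)"
  by (induction Es) auto

lemma disj_rects_sec: "disj_rects (Suc m) E \<Longrightarrow> disj_rects m (sec k x E)"
proof (rule disj_rectsI)
  fix c A i assume E: "disj_rects (Suc m) E" and "(c, A) \<in> set (sec k x E)"
  then obtain c' where c': "(c', A) \<in> set E" by (auto simp: sec_def)
  show "disjoint_family_on A {1..m}"
    using disj_rectsD(1)[OF E c'] by (rule disjoint_family_on_mono[rotated]) auto
  show "i \<in> {1..m} \<Longrightarrow> A i \<in> sets halfline \<and> emeasure halfline (A i) < \<infinity>"
    using disj_rectsD(2,3)[OF E c', of i] by auto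
qed

lemma disj_rects_permute:
  assumes "p permutes {1..m}" "disj_rects m E" shows "disj_rects m (permute_rects p E)"
proof -
  have p: "p i \<in> {1..m}" if "i \<in> {1..m}" for i using that permutes_in_image[OF assms(1)] by blast
  have "disjoint_family_on (A \<circ> p) {1..m}" if "disjoint_family_on A {1..m}" for A :: "nat \<Rightarrow> real set"
    unfolding disjoint_family_on_def
  proof (intro ballI impI)
    fix i j assume "i \<in> {1..m}" "j \<in> {1..m}" "i \<noteq> j"
    then have "p i \<in> {1..m}" "p j \<in> {1..m}" "p i \<noteq> p j"
      using p permutes_inj[OF assms(1)] by (auto dest: injD)
    then show "(A \<circ> p) i \<inter> (A \<circ> p) j = {}" using that by (simp add: disjoint_family_on_def)
  qed
  note dj = this
  show ?thesis
  proof (rule disj_rectsI)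
    fix c A i assume "(c, A) \<in> set (permute_rects p E)"
    then obtain A' where A': "(c, A') \<in> set E" "A = A' \<circ> p" by (auto simp: permute_rects_def)
    show "disjoint_family_on A {1..m}" unfolding A'(2) by (rule dj[OF disj_rectsD(1)[OF assms(2) A'(1)]])
    show "i \<in> {1..m} \<Longrightarrow> A i \<in> sets halfline \<and> emeasure halfline (A i) < \<infinity>"
      using disj_rectsD(2,3)[OF assms(2) A'(1) p[of i]] by (simp add: A'(2))
  qed
qed

lemma transpose_permutes: "i \<in> {1..m} \<Longrightarrow> Transposition.transpose i m permutes {1..m::nat}"
  by (rule permutes_swap_id) auto

lemma disj_rects_swaps: "disj_rects m E \<Longrightarrow> disj_rects m (swaps m E)"
  unfolding swaps_def by (intro disj_rects_concat) (auto intro!: disj_rects_permute transpose_permutes)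

lemma eint_simps[simp]:
  "eint m [] \<nu> = 0"
  "eint m ((c, A) # E) \<nu> = c * (\<Prod>i=1..m. \<nu> (A i)) + eint m E \<nu>"
  "eint m (E @ E') \<nu> = eint m E \<nu> + eint m E' \<nu>"
  by (auto simp: eint_def)

lemma eint_neg[simp]: "eint m (neg_rects E) \<nu> = - eint m E \<nu>"
  by (induction E) (auto simp: neg_rects_def)

lemma efun_simps[simp]:
  "elementary_fun m [] z = 0"
  "elementary_fun m ((c, A) # E) z = c * (\<Prod>i=1..m. indicator (A i) (z i)) + elementary_fun m E z"
  "elementary_fun m (E @ E') z = elementary_fun m E z + elementary_fun m E' z"
  by (auto simp: elementary_fun_def)

lemma efun_neg[simp]: "elementary_fun m (neg_rects E) z = - elementary_fun m E z"
  by (induction E) (auto simp: neg_rects_def)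

lemma efun_concat: "elementary_fun m (concat Es) z = (\<Sum>E\<leftarrow>Es. elementary_fun m E z)"
  by (induction Es) auto

lemma eint_concat: "eint m (concat Es) \<nu> = (\<Sum>E\<leftarrow>Es. eint m E \<nu>)"
  by (induction Es) auto

lemma efun_permute:
  assumes "p permutes {1..m}" shows "elementary_fun m (permute_rects p E) (z \<circ> p) = elementary_fun m E z"
proof (induction E)
  case (Cons y E)
  obtain c A where y: "y = (c, A)" by force
  have "(\<Prod>i=1..m. indicator (A (p i)) (z (p i))) = (\<Prod>i=1..m. indicator (A i) (z i) :: real)"
    using prod.permute[OF assms, of "\<lambda>i. indicator (A i) (z i) :: real"] by (simp add: comp_def)
  then show ?case using Cons by (simp add: permute_rects_def y)
qed (simp add: permute_rects_def)

lemma efun_swaps: "elementary_fun m (swaps m E) z = (\<Sum>i=1..m. elementary_fun m E (z \<circ> Transposition.transpose i m))"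
proof -
  have "elementary_fun m (permute_rects (Transposition.transpose i m) E) z = elementary_fun m E (z \<circ> Transposition.transpose i m)" if "i \<in> {1..m}" for i
    using efun_permute[OF transpose_permutes[OF that], of E "z \<circ> Transposition.transpose i m"]
    by (simp add: comp_assoc)
  then show ?thesis
    by (simp add: swaps_def efun_concat comp_def interv_sum_list_conv_sum_set_nat atLeastLessThanSuc_atLeastAtMost
        del: upt_Suc)
qed

lemma efun_sec: "elementary_fun m (sec (Suc m) x E) y = elementary_fun (Suc m) E (y(Suc m := x))"
proof (induction E)
  case (Cons z E)
  obtain c A where z: "z = (c, A)" by force
  have "(\<Prod>i=1..m. indicator (A i) ((y(Suc m := x)) i)) = (\<Prod>i=1..m. indicator (A i) (y i) :: real)"
    by (intro prod.cong) auto
  then show ?case using Cons by (simp add: sec_def z prod.nat_ivl_Suc' mult_ac del: fun_upd_apply) (simp add: mult_ac)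
qed (simp add: sec_def)

lemma measurable_efun[measurable]:
  assumes "disj_rects m E" shows "elementary_fun m E \<in> borel_measurable (halfline_prod {1..m})"
  using assms
proof (induction E)
  case (Cons z E)
  obtain c A where z: "z = (c, A)" by force
  have [measurable]: "A i \<in> sets halfline" if "i \<in> {1..m}" for i
    using Cons(2) that by (auto simp: z disj_rects_def)
  have "(\<lambda>x. indicator (A i) (x i) :: real) \<in> borel_measurable (halfline_prod {1..m})" if i: "i \<in> {1..m}" for i
    using measurable_compose[OF measurable_component_halfline[OF i] borel_measurable_indicator] i by measurable
  moreover have "elementary_fun m ((c, A) # E) = (\<lambda>x. c * (\<Prod>i=1..m. indicator (A i) (x i)) + elementary_fun m E x)"
    by (simp add: fun_eq_iff)
  ultimately show ?case using Cons unfolding z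
    by simp
next
  case Nil
  have "elementary_fun m [] = (\<lambda>_. 0)" by (simp add: fun_eq_iff)
  then show ?case by simp
qed

text \<open>Adding a unit mass at \<open>x\<close> changes the integral by a sum of integrals of lower order, since \<open>x\<close>
  lies in at most one side of each rectangle.\<close>

lemma eint_add_point:
  assumes "disj_rects (Suc m) E"
  shows "eint (Suc m) E (\<lambda>A. \<nu> A + indicator A x) = eint (Suc m) E \<nu> + eint m (sec (Suc m) x (swaps (Suc m) E)) \<nu>"
proof -
  have rect: "(\<Prod>i=1..Suc m. \<nu> (A i) + indicator (A i) x) = (\<Prod>i=1..Suc m. \<nu> (A i)) +
     (\<Sum>i=1..Suc m. indicator (A i) x * (\<Prod>j=1..m. \<nu> (A (Transposition.transpose i (Suc m) j))))"
    if d: "disjoint_family_on A {1..Suc m}" for A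
  proof (cases "\<exists>k\<in>{1..Suc m}. x \<in> A k")
    case False
    then have z: "indicator (A i) x = (0 :: real)" if "i \<in> {1..Suc m}" for i using that by (auto simp: indicator_def)
    have "(\<Prod>i=1..Suc m. \<nu> (A i) + indicator (A i) x) = (\<Prod>i=1..Suc m. \<nu> (A i))"
      by (intro prod.cong refl) (simp only: z add_0_right)
    moreover have "(\<Sum>i=1..Suc m. indicator (A i) x * (\<Prod>j=1..m. \<nu> (A (Transposition.transpose i (Suc m) j)))) = 0"
      by (intro sum.neutral ballI) (simp only: z mult_zero_left)
    ultimately show ?thesis by simp
  next
    case True
    then obtain k where k: "k \<in> {1..Suc m}" "x \<in> A k" by blast
    have ind: "indicator (A i) x = (if i = k then 1 else 0 :: real)" if "i \<in> {1..Suc m}" for i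
      using disjoint_family_onD[OF d that k(1)] k by (auto simp: indicator_def)
    \<comment> \<open>The transposition carries the first \<open>m\<close> places onto all places
      except \<open>k\<close>.\<close>
    have re: "(\<Prod>j=1..m. \<nu> (A (Transposition.transpose k (Suc m) j))) = (\<Prod>j\<in>{1..Suc m} - {k}. \<nu> (A j))"
    proof (rule prod.reindex_bij_betw)
      have "bij_betw (Transposition.transpose k (Suc m)) ({1..Suc m} - {Suc m}) ({1..Suc m} - {Transposition.transpose k (Suc m) (Suc m)})"
        using k transpose_permutes[of k "Suc m"] permutes_imp_bij
        by (intro bij_betw_DiffI) (auto simp: bij_betw_def)
      moreover have "{1..Suc m} - {Suc m} = {1..m}" by auto
      ultimately show "bij_betw (Transposition.transpose k (Suc m)) {1..m} ({1..Suc m} - {k})" by simp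
    qed
    have "(\<Prod>i=1..Suc m. \<nu> (A i) + indicator (A i) x) = (\<nu> (A k) + 1) * (\<Prod>i\<in>{1..Suc m} - {k}. \<nu> (A i))"
      using k by (subst prod.remove[of _ k]) (auto simp: ind intro!: arg_cong2[where f = "(*)"] prod.cong)
    moreover have "(\<Prod>i=1..Suc m. \<nu> (A i)) = \<nu> (A k) * (\<Prod>i\<in>{1..Suc m} - {k}. \<nu> (A i))"
      using k by (subst prod.remove[of _ k]) auto
    moreover have "(\<Sum>i=1..Suc m. indicator (A i) x * (\<Prod>j=1..m. \<nu> (A (Transposition.transpose i (Suc m) j)))) = (\<Prod>i\<in>{1..Suc m} - {k}. \<nu> (A i))"
    proof -
      have "(\<Sum>i=1..Suc m. indicator (A i) x * (\<Prod>j=1..m. \<nu> (A (Transposition.transpose i (Suc m) j)))) =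
        (\<Sum>i=1..Suc m. if i = k then \<Prod>j=1..m. \<nu> (A (Transposition.transpose k (Suc m) j)) else 0)"
        by (intro sum.cong) (auto simp: ind)
      then show ?thesis using k unfolding re by (simp del: sum.cl_ivl_Suc prod.cl_ivl_Suc)
    qed
    ultimately show ?thesis by (simp only: distrib_right mult_1_left)
  qed
  have sw: "eint m (sec (Suc m) x (swaps (Suc m) E)) \<nu> = (\<Sum>i=1..Suc m. eint m (sec (Suc m) x (permute_rects (Transposition.transpose i (Suc m)) E)) \<nu>)"
    by (simp add: swaps_def sec_def map_concat eint_concat comp_def interv_sum_list_conv_sum_set_nat atLeastLessThanSuc_atLeastAtMost
        del: upt_Suc sum.cl_ivl_Suc)
  show ?thesis using assms unfolding sw
  proof (induction E)
    case Nil show ?case by (simp add: sec_def permute_rects_def)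
  next
    case (Cons z E)
    obtain c A where z: "z = (c, A)" by force
    have d: "disjoint_family_on A {1..Suc m}" using Cons(2) by (auto simp: z disj_rects_def)
    have "(\<Sum>i=1..Suc m. eint m (sec (Suc m) x (permute_rects (Transposition.transpose i (Suc m)) (z # E))) \<nu>) =
      (\<Sum>i=1..Suc m. c * (indicator (A i) x * (\<Prod>j=1..m. \<nu> (A (Transposition.transpose i (Suc m) j))))
         + eint m (sec (Suc m) x (permute_rects (Transposition.transpose i (Suc m)) E)) \<nu>)"
      by (intro sum.cong refl) (simp add: z sec_def permute_rects_def)
    also have "\<dots> = c * (\<Sum>i=1..Suc m. indicator (A i) x * (\<Prod>j=1..m. \<nu> (A (Transposition.transpose i (Suc m) j)))) +
       (\<Sum>i=1..Suc m. eint m (sec (Suc m) x (permute_rects (Transposition.transpose i (Suc m)) E)) \<nu>)"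
      by (simp only: sum.distrib sum_distrib_left)
    finally have eq: "(\<Sum>i=1..Suc m. eint m (sec (Suc m) x (permute_rects (Transposition.transpose i (Suc m)) (z # E))) \<nu>) = \<dots>" .
    have "disj_rects (Suc m) E" using Cons(2) by simp
    note IH = Cons.IH[OF this]
    show ?case unfolding eq unfolding z eint_simps rect[OF d] IH by (simp only: algebra_simps)
  qed
qed

lemma abs_eint_le:
  assumes "\<And>c A i. (c, A) \<in> set E \<Longrightarrow> i \<in> {1..m} \<Longrightarrow> \<bar>\<nu> (A i)\<bar> \<le> b"
  shows "\<bar>eint m E \<nu>\<bar> \<le> (\<Sum>(c, A)\<leftarrow>E. \<bar>c\<bar>) * b ^ m"
  using assms
proof (induction E)
  case (Cons z E)
  obtain c A where z: "z = (c, A)" by force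
  have "\<bar>\<Prod>i=1..m. \<nu> (A i)\<bar> \<le> (\<Prod>i=1..m. b)"
    unfolding abs_prod by (intro prod_mono) (use Cons(2)[of c A] in \<open>auto simp: z\<close>)
  then have "\<bar>c * (\<Prod>i=1..m. \<nu> (A i))\<bar> \<le> \<bar>c\<bar> * b ^ m" by (auto simp: abs_mult intro!: mult_left_mono)
  moreover have "\<bar>eint m E \<nu>\<bar> \<le> (\<Sum>(c, A)\<leftarrow>E. \<bar>c\<bar>) * b ^ m" using Cons by auto
  ultimately show ?case unfolding z eint_simps by (simp add: distrib_right)
qed simp

lemma measurable_sum_list_eint:
  assumes "\<And>c A i. (c, A) \<in> set E \<Longrightarrow> i \<in> {1..m} \<Longrightarrow> (\<lambda>x. \<nu> x (A i)) \<in> borel_measurable M"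
  shows "(\<lambda>x. eint m E (\<nu> x)) \<in> borel_measurable M"
  using assms
proof (induction E)
  case (Cons z E)
  obtain c A where z: "z = (c, A)" by force
  show ?case using Cons unfolding z eint_simps
    by (intro borel_measurable_add borel_measurable_times borel_measurable_const borel_measurable_prod) auto
qed simp

lemma measurable_sec_eint:
  assumes "\<And>c A i. (c, A) \<in> set E \<Longrightarrow> i \<in> {1..m} \<Longrightarrow> (\<lambda>x. \<nu> x (A i)) \<in> borel_measurable M"
    "\<And>c A. (c, A) \<in> set E \<Longrightarrow> (\<lambda>x. indicator (A k) (t x) :: real) \<in> borel_measurable M"
  shows "(\<lambda>x. eint m (sec k (t x) E) (\<nu> x)) \<in> borel_measurable M"
  using assms
proof (induction E)
  case Nil then show ?case by (simp add: sec_def)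
next
  case (Cons z E)
  obtain c A where z: "z = (c, A)" by force
  have "(\<lambda>x. eint m (sec k (t x) E) (\<nu> x)) \<in> borel_measurable M"
  proof (rule Cons.IH)
    fix c A i assume c: "(c, A) \<in> set E"
    show "i \<in> {1..m} \<Longrightarrow> (\<lambda>x. \<nu> x (A i)) \<in> borel_measurable M"
      using c by (intro Cons.prems(1)[of c A i]) auto
    show "(\<lambda>x. indicat_real (A k) (t x)) \<in> borel_measurable M"
      using c by (intro Cons.prems(2)[of c A]) auto
  qed
  moreover have "(\<lambda>x. c * indicator (A k) (t x) * (\<Prod>i=1..m. \<nu> x (A i))) \<in> borel_measurable M"
    using Cons(2)[of c A] Cons(3)[of c A] unfolding z
    by (intro borel_measurable_times borel_measurable_const borel_measurable_prod) auto
  ultimately show ?case unfolding z sec_def list.map prod.case eint_simps by (intro borel_measurable_add) (simp_all add: sec_def)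
qed

section \<open>The isometry bound\<close>

lemma eint_cong:
  assumes "\<And>c A i. (c, A) \<in> set E \<Longrightarrow> i \<in> {1..m} \<Longrightarrow> \<nu> (A i) = \<nu>' (A i)"
  shows "eint m E \<nu> = eint m E \<nu>'"
  unfolding eint_def using assms
  by (intro arg_cong[where f = sum_list] map_cong refl) (auto intro!: prod.cong)

lemma integral_sum_list:
  fixes f :: "'b \<Rightarrow> 'c \<Rightarrow> real"
  assumes "\<And>z. z \<in> set zs \<Longrightarrow> integrable M (f z)"
  shows "integrable M (\<lambda>x. \<Sum>z\<leftarrow>zs. f z x) \<and> (\<integral>x. (\<Sum>z\<leftarrow>zs. f z x) \<partial>M) = (\<Sum>z\<leftarrow>zs. \<integral>x. f z x \<partial>M)"
  using assms by (induction zs) auto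

definition sides :: "nat \<Rightarrow> rects \<Rightarrow> real set set" where
  "sides m E = (\<Union>(c, A)\<in>set E. A ` {1..m})"

lemma finite_sides: "finite (sides m E)"
  by (auto simp: sides_def)

lemma sidesI: "(c, A) \<in> set E \<Longrightarrow> i \<in> {1..m} \<Longrightarrow> A i \<in> sides m E"
  unfolding sides_def by (rule UN_I) auto

lemma sides_sets: "disj_rects m E \<Longrightarrow> A \<in> sides m E \<Longrightarrow> A \<in> sets halfline"
  and sides_finite: "disj_rects m E \<Longrightarrow> A \<in> sides m E \<Longrightarrow> emeasure halfline A < \<infinity>"
  by (auto simp: sides_def dest: disj_rectsD)

text \<open>All \<open>m\<close> swapped copies have the norm of \<open>E\<close>, as the product
  measure is invariant under permutations. One factor \<open>m\<close> counts them, the other comes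
  from Cauchy-Schwarz.\<close>

lemma sqn_efun_swaps_le:
  assumes "disj_rects m E"
  shows "sqn (halfline_prod {1..m}) (elementary_fun m (swaps m E)) \<le> ennreal (real m * real m) * sqn (halfline_prod {1..m}) (elementary_fun m E)"
proof -
  note [measurable] = measurable_efun[OF assms]
  have pm: "(\<lambda>z. elementary_fun m E (z \<circ> Transposition.transpose i m)) \<in> borel_measurable (halfline_prod {1..m})" if "i \<in> {1..m}" for i
    by (rule measurable_compose[OF measurable_permute[OF transpose_permutes[OF that]] measurable_efun[OF assms]]) simp
  have "sqn (halfline_prod {1..m}) (elementary_fun m (swaps m E)) = sqn (halfline_prod {1..m}) (\<lambda>z. \<Sum>i\<in>{1..m}. elementary_fun m E (z \<circ> Transposition.transpose i m))"
    by (simp add: efun_swaps[abs_def])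
  also have "\<dots> \<le> of_nat (card {1..m}) * (\<Sum>i\<in>{1..m}. sqn (halfline_prod {1..m}) (\<lambda>z. elementary_fun m E (z \<circ> Transposition.transpose i m)))"
    by (rule sqn_sum_le) (use pm in auto)
  also have "(\<Sum>i\<in>{1..m}. sqn (halfline_prod {1..m}) (\<lambda>z. elementary_fun m E (z \<circ> Transposition.transpose i m))) = (\<Sum>i\<in>{1..m}. sqn (halfline_prod {1..m}) (elementary_fun m E))"
    by (intro sum.cong refl sqn_permute transpose_permutes measurable_efun assms) auto
  finally show ?thesis by (simp add: ennreal_mult ennreal_of_nat_eq_real_of_nat mult.assoc)
qed

locale poisson_halfline =
  fixes P :: "'a measure" and N :: "'a \<Rightarrow> real measure"
  assumes prm_halfline: "poisson_random_measure P halfline N"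

sublocale poisson_halfline \<subseteq> poisson P halfline N
  by (intro poisson.intro prm_halfline sigma_finite_halfline)

context poisson_halfline
begin

definition cN :: "'a \<Rightarrow> real set \<Rightarrow> real" where
  "cN \<omega> A = measure (N \<omega>) A - measure halfline A"

definition EI :: "nat \<Rightarrow> rects \<Rightarrow> 'a \<Rightarrow> real" where
  "EI m E \<omega> = eint m E (cN \<omega>)"

lemma EI_eq: "elementary_integral N m E = EI m E"
  by (simp add: elementary_integral_def EI_def eint_def cN_def fun_eq_iff)

lemma measurable_cN[measurable]: "A \<in> sets halfline \<Longrightarrow> (\<lambda>\<omega>. cN \<omega> A) \<in> borel_measurable P"
  unfolding cN_def by (intro borel_measurable_diff measurable_Nr borel_measurable_const)

lemma measurable_EI: "disj_rects m E \<Longrightarrow> EI m E \<in> borel_measurable P"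
  unfolding EI_def by (rule measurable_sum_list_eint) (auto dest: disj_rectsD)

lemma measurable_EI_sec:
  assumes "disj_rects (Suc m) E"
  shows "(\<lambda>p. EI m (sec (Suc m) (snd p) E) (fst p)) \<in> borel_measurable (P \<Otimes>\<^sub>M halfline)"
  unfolding EI_def
proof (rule measurable_sec_eint)
  fix c A i assume a: "(c, A) \<in> set E" 
  { assume "i \<in> {1..m}"
    then have [measurable]: "A i \<in> sets halfline" using disj_rectsD(2)[OF assms a, of i] by auto
    show "(\<lambda>p. cN (fst p) (A i)) \<in> borel_measurable (P \<Otimes>\<^sub>M halfline)" by measurable }
  have [measurable]: "A (Suc m) \<in> sets halfline" using disj_rectsD(2)[OF assms a, of "Suc m"] by auto
  show "(\<lambda>p. indicat_real (A (Suc m)) (snd p)) \<in> borel_measurable (P \<Otimes>\<^sub>M halfline)" by measurable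
qed

text \<open>With \<open>X\<close> the count of \<open>U\<close>, Mecke's formula turns the
  expectation of \<open>X * (X + 1) ^ p\<close> into the measure of \<open>U\<close> times that of
  \<open>(X + 2) ^ p\<close>, and \<open>X + 2 \<le> 2 * (X + 1)\<close> leads back to the induction
  hypothesis.\<close>

lemma integrable_moments:
  assumes U: "U \<in> sets halfline" "emeasure halfline U < \<infinity>"
  shows "integrable P (\<lambda>\<omega>. (measure (N \<omega>) U + 1) ^ p)"
proof (induction p)
  case (Suc p)
  define X where "X \<omega> = measure (N \<omega>) U" for \<omega>
  note [measurable] = U(1)
  have X[measurable]: "X \<in> borel_measurable P" unfolding X_def by measurable
  have X0: "0 \<le> X \<omega>" for \<omega> by (simp add: X_def)
  have IH: "integrable P (\<lambda>\<omega>. (X \<omega> + 1) ^ p)" using Suc by (simp add: X_def)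
  have "integrable (P \<Otimes>\<^sub>M halfline) (\<lambda>q. indicator U (snd q) * (X (fst q) + 1 + 1) ^ p)"
  proof (rule integrableI_bounded)
    have "(\<integral>\<^sup>+q. ennreal (norm (indicator U (snd q) * (X (fst q) + 1 + 1) ^ p)) \<partial>(P \<Otimes>\<^sub>M halfline))
        \<le> (\<integral>\<^sup>+q. indicator U (snd q) * ennreal (2 ^ p * (X (fst q) + 1) ^ p) \<partial>(P \<Otimes>\<^sub>M halfline))"
    proof (rule nn_integral_mono)
      fix q :: "'a \<times> real"
      define Y where "Y = X (fst q) + 1 + 1"
      define Z where "Z = 2 ^ p * (X (fst q) + 1) ^ p"
      have "Y ^ p \<le> (2 * (X (fst q) + 1)) ^ p"
        unfolding Y_def using X0[of "fst q"] by (intro power_mono) auto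
      then have "Y ^ p \<le> Z" by (simp only: Z_def power_mult_distrib)
      moreover have "0 \<le> Y" using X0[of "fst q"] by (simp add: Y_def)
      ultimately show "ennreal (norm (indicator U (snd q) * (X (fst q) + 1 + 1) ^ p)) \<le> indicator U (snd q) * ennreal (2 ^ p * (X (fst q) + 1) ^ p)"
        unfolding Y_def[symmetric] Z_def[symmetric] by (auto simp: indicator_def intro!: ennreal_leI)
    qed
    also have "\<dots> = (\<integral>\<^sup>+\<omega>. (\<integral>\<^sup>+x. indicator U x * ennreal (2 ^ p * (X \<omega> + 1) ^ p) \<partial>halfline) \<partial>P)"
      by (subst \<mu>.nn_integral_fst[symmetric]) auto
    also have "\<dots> = (\<integral>\<^sup>+\<omega>. emeasure halfline U * ennreal (2 ^ p * (X \<omega> + 1) ^ p) \<partial>P)"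
      by (intro nn_integral_cong) (simp add: nn_integral_multc)
    also have "\<dots> = emeasure halfline U * (\<integral>\<^sup>+\<omega>. ennreal (2 ^ p * (X \<omega> + 1) ^ p) \<partial>P)"
      by (subst nn_integral_cmult) auto
    also have "(\<integral>\<^sup>+\<omega>. ennreal (2 ^ p * (X \<omega> + 1) ^ p) \<partial>P) = ennreal (\<integral>\<omega>. 2 ^ p * (X \<omega> + 1) ^ p \<partial>P)"
      using IH X0 by (intro nn_integral_eq_integral) auto
    finally show "(\<integral>\<^sup>+q. ennreal (norm (indicator U (snd q) * (X (fst q) + 1 + 1) ^ p)) \<partial>(P \<Otimes>\<^sub>M halfline)) < \<infinity>"
      using U(2) by (auto simp: ennreal_mult_less_top intro: le_less_trans)
  qed measurable
  moreover have "(\<lambda>v. (v U + 1) ^ p) \<in> borel_measurable (PiM {U} (\<lambda>_. borel :: real measure))" by measurable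
  moreover have "(\<lambda>q. indicator U (snd q) * (X (fst q) + indicator U (snd q) + 1) ^ p) = (\<lambda>q. indicator U (snd q) * (X (fst q) + 1 + 1) ^ p)"
    by (auto simp: fun_eq_iff indicator_def)
  ultimately have "integrable P (\<lambda>\<omega>. X \<omega> * (X \<omega> + 1) ^ p)"
    using mecke_integral(2)[of "{U}" U "\<lambda>v. (v U + 1) ^ p"] U by (simp add: X_def)
  then have "integrable P (\<lambda>\<omega>. X \<omega> * (X \<omega> + 1) ^ p + (X \<omega> + 1) ^ p)"
    using IH by (rule Bochner_Integration.integrable_add)
  then show ?case by (simp add: X_def algebra_simps)
qed (simp add: P.integrable_const)

lemma integrable_poly_bound:
  assumes U: "U \<in> sets halfline" "emeasure halfline U < \<infinity>" and f: "f \<in> borel_measurable P"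
    and b: "AE \<omega> in P. \<bar>f \<omega>\<bar> \<le> c * (measure (N \<omega>) U + 1) ^ p"
  shows "integrable P f"
proof (rule Bochner_Integration.integrable_bound)
  show "integrable P (\<lambda>\<omega>. c * (measure (N \<omega>) U + 1) ^ p)"
    by (intro integrable_mult_right integrable_moments U)
  show "AE \<omega> in P. norm (f \<omega>) \<le> norm (c * (measure (N \<omega>) U + 1) ^ p)" using b by eventually_elim auto
qed (rule f)

lemma integral_indicator_prod:
  assumes K[measurable]: "K \<in> sets halfline" and fK: "emeasure halfline K < \<infinity>" and f: "integrable P f"
  shows "integrable (P \<Otimes>\<^sub>M halfline) (\<lambda>p. indicator K (snd p) * f (fst p))"
    and "(\<integral>p. indicator K (snd p) * f (fst p) \<partial>(P \<Otimes>\<^sub>M halfline)) = measure halfline K * (\<integral>\<omega>. f \<omega> \<partial>P)"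
proof -
  have [measurable]: "f \<in> borel_measurable P" using f by auto
  show i: "integrable (P \<Otimes>\<^sub>M halfline) (\<lambda>p. indicator K (snd p) * f (fst p))"
  proof (rule integrableI_bounded)
    have "(\<integral>\<^sup>+q. ennreal (norm (indicator K (snd q) * f (fst q))) \<partial>(P \<Otimes>\<^sub>M halfline)) = (\<integral>\<^sup>+\<omega>. (\<integral>\<^sup>+x. indicator K x * ennreal (norm (f \<omega>)) \<partial>halfline) \<partial>P)"
      by (subst \<mu>.nn_integral_fst[symmetric]) (auto intro!: nn_integral_cong simp: indicator_def)
    also have "\<dots> = emeasure halfline K * (\<integral>\<^sup>+\<omega>. ennreal (norm (f \<omega>)) \<partial>P)"
      by (subst nn_integral_cmult[symmetric]) (auto intro!: nn_integral_cong simp: nn_integral_multc)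
    also have "\<dots> < \<infinity>" using f fK by (auto simp: integrable_iff_bounded ennreal_mult_less_top)
    finally show "(\<integral>\<^sup>+q. ennreal (norm (indicator K (snd q) * f (fst q))) \<partial>(P \<Otimes>\<^sub>M halfline)) < \<infinity>" .
  qed measurable
  have "(\<integral>p. indicator K (snd p) * f (fst p) \<partial>(P \<Otimes>\<^sub>M halfline)) = (\<integral>\<omega>. (\<integral>x. indicator K x * f \<omega> \<partial>halfline) \<partial>P)"
    using PM.integral_fst'[OF i] by simp
  also have "\<dots> = measure halfline K * (\<integral>\<omega>. f \<omega> \<partial>P)"
    using fK sets.Int_space_eq2[OF K] by simp
  finally show "(\<integral>p. indicator K (snd p) * f (fst p) \<partial>(P \<Otimes>\<^sub>M halfline)) = measure halfline K * (\<integral>\<omega>. f \<omega> \<partial>P)" .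
qed

text \<open>The count of the union dominates all counts in the family, so products of counts are
  bounded by powers of one Poisson variable. This can fail on the null event where the count of the
  union is infinite, because \<open>measure\<close> then returns 0.\<close>

lemma AE_cN_bound:
  assumes C: "finite \<C>" "\<And>A. A \<in> \<C> \<Longrightarrow> A \<in> sets halfline" "\<And>A. A \<in> \<C> \<Longrightarrow> emeasure halfline A < \<infinity>"
  shows "\<Union>\<C> \<in> sets halfline" "emeasure halfline (\<Union>\<C>) < \<infinity>"
    "AE \<omega> in P. \<forall>A\<in>\<C>. measure (N \<omega>) A \<le> measure (N \<omega>) (\<Union>\<C>) + 1 \<and>
      \<bar>cN \<omega> A\<bar> \<le> (1 + measure halfline (\<Union>\<C>)) * (measure (N \<omega>) (\<Union>\<C>) + 1)"
proof -
  show U: "\<Union>\<C> \<in> sets halfline" using C by (intro sets.finite_Union) auto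
  have "emeasure halfline (\<Union>A\<in>\<C>. A) \<le> (\<Sum>A\<in>\<C>. emeasure halfline A)"
    using C by (intro emeasure_subadditive_finite) auto
  also have "\<dots> < \<infinity>" using C by simp
  finally show fU: "emeasure halfline (\<Union>\<C>) < \<infinity>" by simp
  show "AE \<omega> in P. \<forall>A\<in>\<C>. measure (N \<omega>) A \<le> measure (N \<omega>) (\<Union>\<C>) + 1 \<and>
      \<bar>cN \<omega> A\<bar> \<le> (1 + measure halfline (\<Union>\<C>)) * (measure (N \<omega>) (\<Union>\<C>) + 1)"
    using AE_N_finite[OF U fU] AE_space
  proof eventually_elim
    case (elim \<omega>)
    show ?case
    proof
      fix A assume A: "A \<in> \<C>"
      have "emeasure (N \<omega>) A \<le> emeasure (N \<omega>) (\<Union>\<C>)"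
        using A U sets_N[OF elim(2)] by (intro emeasure_mono) auto
      then have 1: "measure (N \<omega>) A \<le> measure (N \<omega>) (\<Union>\<C>)"
        unfolding measure_def using elim(1) by (intro enn2real_mono) auto
      have "emeasure halfline A \<le> emeasure halfline (\<Union>\<C>)"
        using A U by (intro emeasure_mono) auto
      then have 2: "measure halfline A \<le> measure halfline (\<Union>\<C>)"
        unfolding measure_def using fU by (intro enn2real_mono) auto
      have "\<bar>cN \<omega> A\<bar> \<le> measure (N \<omega>) A + measure halfline A"
        unfolding cN_def using measure_nonneg[of "N \<omega>" A] measure_nonneg[of halfline A] by linarith
      also have "\<dots> \<le> measure (N \<omega>) (\<Union>\<C>) + measure halfline (\<Union>\<C>)" using 1 2 by simp
      also have "\<dots> \<le> (1 + measure halfline (\<Union>\<C>)) * (measure (N \<omega>) (\<Union>\<C>) + 1)"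
        using mult_nonneg_nonneg[OF measure_nonneg[of halfline "\<Union>\<C>"] measure_nonneg[of "N \<omega>" "\<Union>\<C>"]] by (simp add: algebra_simps)
      finally show "measure (N \<omega>) A \<le> measure (N \<omega>) (\<Union>\<C>) + 1 \<and>
        \<bar>cN \<omega> A\<bar> \<le> (1 + measure halfline (\<Union>\<C>)) * (measure (N \<omega>) (\<Union>\<C>) + 1)" using 1 by simp
    qed
  qed
qed

text \<open>The induction hypothesis is used for each frozen \<open>x\<close> and integrated over
  \<open>x\<close>, so the constant does not change.\<close>

lemma sqn_EI_sec_le:
  assumes E: "disj_rects (Suc m) E" and C: "0 \<le> C"
    and IH: "\<And>E. disj_rects m E \<Longrightarrow> sqn P (EI m E) \<le> ennreal C * sqn (halfline_prod {1..m}) (elementary_fun m E)"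
  shows "sqn (P \<Otimes>\<^sub>M halfline) (\<lambda>p. EI m (sec (Suc m) (snd p) E) (fst p)) \<le> ennreal C * sqn (halfline_prod {1..Suc m}) (elementary_fun (Suc m) E)"
proof -
  note [measurable] = measurable_EI_sec[OF E]
  have mf: "(\<lambda>z. ennreal ((elementary_fun (Suc m) E z)\<^sup>2)) \<in> borel_measurable (halfline_prod (insert (Suc m) {1..m}))"
    unfolding Suc_insert[symmetric] using measurable_efun[OF E] by measurable
  have "sqn (P \<Otimes>\<^sub>M halfline) (\<lambda>p. EI m (sec (Suc m) (snd p) E) (fst p)) = (\<integral>\<^sup>+x. sqn P (EI m (sec (Suc m) x E)) \<partial>halfline)"
    unfolding sqn_def by (subst PM.nn_integral_snd[symmetric]) auto
  also have "\<dots> \<le> (\<integral>\<^sup>+x. ennreal C * sqn (halfline_prod {1..m}) (elementary_fun m (sec (Suc m) x E)) \<partial>halfline)"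
    by (intro nn_integral_mono IH disj_rects_sec E)
  also have "\<dots> = ennreal C * (\<integral>\<^sup>+x. sqn (halfline_prod {1..m}) (\<lambda>y. elementary_fun (Suc m) E (y(Suc m := x))) \<partial>halfline)"
  proof (subst nn_integral_cmult)
    interpret Q: sigma_finite_measure "halfline_prod {1..m}" by (rule sigma_finite_halfline_prod) simp
    have "(\<lambda>q. ennreal ((elementary_fun (Suc m) E ((snd q)(Suc m := fst q)))\<^sup>2)) \<in> borel_measurable (halfline \<Otimes>\<^sub>M halfline_prod {1..m})"
      using measurable_compose[OF measurable_compose[OF measurable_pair_swap' measurable_halfline_upd[of "Suc m" "{1..m}"]] mf]
      by (simp add: split_beta)
    then show "(\<lambda>x. sqn (halfline_prod {1..m}) (elementary_fun m (sec (Suc m) x E))) \<in> borel_measurable halfline"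
      unfolding sqn_def efun_sec using Q.borel_measurable_nn_integral_fst by fastforce
  qed (simp add: efun_sec[abs_def])
  also have "\<dots> = ennreal C * sqn (halfline_prod {1..Suc m}) (elementary_fun (Suc m) E)"
    unfolding sqn_def Suc_insert using nn_integral_halfline_prod_insert[OF _ _ mf] by simp
  finally show ?thesis .
qed

text \<open>The isometry bound, by induction on the order: Mecke's formula turns one factor
  \<open>cN \<omega> (A (Suc m))\<close> into a difference operator acting on the remaining integrand.\<close>

lemma sqn_EI_le:
  "\<exists>C\<ge>0. \<forall>E. disj_rects m E \<longrightarrow> sqn P (EI m E) \<le> ennreal C * sqn (halfline_prod {1..m}) (elementary_fun m E)"
proof (induction m)
  case 0
  have "sqn P (EI 0 E) \<le> ennreal 1 * sqn (halfline_prod {1..0}) (elementary_fun 0 E)" for E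
  proof -
    have "EI 0 E = (\<lambda>\<omega>. \<Sum>(c, A)\<leftarrow>E. c)" by (simp add: EI_def eint_def fun_eq_iff)
    moreover have "elementary_fun 0 E = (\<lambda>z. \<Sum>(c, A)\<leftarrow>E. c)" by (simp add: elementary_fun_def fun_eq_iff)
    moreover have "emeasure (halfline_prod {}) (space (halfline_prod {})) = 1"
      unfolding halfline_prod_def by (simp add: PiM_empty)
    ultimately show ?thesis by (simp add: sqn_def P.emeasure_space_1)
  qed
  then show ?case by (intro exI[of _ 1]) auto
next
  case (Suc m)
  then obtain C where C: "0 \<le> C" and IH: "\<And>E. disj_rects m E \<Longrightarrow> sqn P (EI m E) \<le> ennreal C * sqn (halfline_prod {1..m}) (elementary_fun m E)"
    by blast
  \<comment> \<open>The second moment will be the integral of a product \<open>a * b\<close> of two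
    sections; \<open>a\<close> accounts for the summand \<open>C\<close>, and \<open>b\<close>,
    which involves all swaps, for \<open>C\<close> times the square of the order.\<close>
  have "sqn P (EI (Suc m) E) \<le> ennreal (C + C * (real (Suc m) * real (Suc m))) * sqn (halfline_prod {1..Suc m}) (elementary_fun (Suc m) E)"
    if E: "disj_rects (Suc m) E" for E
  proof -
    define D where "D = swaps (Suc m) E"
    have D: "disj_rects (Suc m) D" unfolding D_def using E by (rule disj_rects_swaps)
    define \<C> where "\<C> = sides (Suc m) E"
    have CC: "finite \<C>" "\<And>A. A \<in> \<C> \<Longrightarrow> A \<in> sets halfline" "\<And>A. A \<in> \<C> \<Longrightarrow> emeasure halfline A < \<infinity>"
      unfolding \<C>_def using finite_sides sides_sets[OF E] sides_finite[OF E] by auto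
    define U where "U = \<Union>\<C>"
    note U = AE_cN_bound(1,2)[OF CC, folded U_def]
    define L where "L = 1 + measure halfline U"
    have L: "L \<ge> 1" by (simp add: L_def)
    define X where "X \<omega> = measure (N \<omega>) U + 1" for \<omega>
    have X1: "X \<omega> \<ge> 1" for \<omega> by (simp add: X_def)
    have bd: "AE \<omega> in P. \<forall>A\<in>\<C>. measure (N \<omega>) A \<le> X \<omega> \<and> \<bar>cN \<omega> A\<bar> \<le> L * X \<omega>"
      using AE_cN_bound(3)[OF CC] by (simp add: X_def L_def U_def)
    define G where "G = EI (Suc m) E"
    have Gm[measurable]: "G \<in> borel_measurable P" unfolding G_def by (rule measurable_EI[OF E])
    define S where "S = (\<Sum>(c, A)\<leftarrow>E. \<bar>c\<bar>)"
    have S0: "0 \<le> S" unfolding S_def by (rule sum_list_nonneg) auto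
    have Gb: "AE \<omega> in P. \<bar>G \<omega>\<bar> \<le> S * (L * X \<omega>) ^ Suc m"
      using bd
    proof eventually_elim
      case (elim \<omega>)
      show ?case unfolding G_def EI_def S_def
      proof (rule abs_eint_le)
        show "\<bar>cN \<omega> (A i)\<bar> \<le> L * X \<omega>" if "(c, A) \<in> set E" "i \<in> {1..Suc m}" for c A i
          using elim sidesI[OF that] by (simp add: \<C>_def)
      qed
    qed
    define F where "F A \<omega> = (\<Prod>i=1..m. cN \<omega> (A i))" for A :: "nat \<Rightarrow> real set" and \<omega>
    \<comment> \<open>\<open>b\<close> is the increment of \<open>G\<close> caused by an added
      point; \<open>a\<close> is the bare section of \<open>E\<close>, from which the sum over
      rectangles is reassembled below.\<close>
    define b where "b = (\<lambda>p. EI m (sec (Suc m) (snd p) D) (fst p))"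
    define a where "a = (\<lambda>p. EI m (sec (Suc m) (snd p) E) (fst p))"
    \<comment> \<open>The sides of a rectangle are disjoint, so a point in the last side leaves the
      other factors \<open>F A\<close> unchanged. The compensator cancels the term containing
      \<open>G\<close> itself, and only the increment \<open>b\<close> survives.\<close>
    have key: "integrable P (\<lambda>\<omega>. cN \<omega> (A (Suc m)) * F A \<omega> * G \<omega>)"
      "integrable (P \<Otimes>\<^sub>M halfline) (\<lambda>p. indicator (A (Suc m)) (snd p) * F A (fst p) * b p)"
      "(\<integral>\<omega>. cN \<omega> (A (Suc m)) * F A \<omega> * G \<omega> \<partial>P) = (\<integral>p. indicator (A (Suc m)) (snd p) * F A (fst p) * b p \<partial>(P \<Otimes>\<^sub>M halfline))"
      if cA: "(c, A) \<in> set E" for c A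
    proof -
      define K where "K = A (Suc m)"
      have AC: "A i \<in> \<C>" if "i \<in> {1..Suc m}" for i unfolding \<C>_def using cA that by (rule sidesI)
      have KC: "K \<in> \<C>" unfolding K_def by (rule AC) simp
      note Km[measurable] = CC(2)[OF KC] and Kf = CC(3)[OF KC]
      have Fm[measurable]: "F A \<in> borel_measurable P"
        unfolding F_def using AC CC by (intro borel_measurable_prod measurable_cN) auto
      have Fb: "AE \<omega> in P. \<bar>F A \<omega>\<bar> \<le> (L * X \<omega>) ^ m"
        using bd
      proof eventually_elim
        case (elim \<omega>)
        have "\<bar>F A \<omega>\<bar> \<le> (\<Prod>i=1..m. L * X \<omega>)"
          unfolding F_def abs_prod by (intro prod_mono) (use elim AC in auto)
        then show ?case by simp
      qed
      have FG: "AE \<omega> in P. \<bar>F A \<omega> * G \<omega>\<bar> \<le> (L ^ m * (S * L ^ Suc m)) * X \<omega> ^ (m + Suc m)"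
        using Fb Gb
      proof eventually_elim
        case (elim \<omega>)
        have "\<bar>F A \<omega> * G \<omega>\<bar> \<le> (L * X \<omega>) ^ m * (S * (L * X \<omega>) ^ Suc m)"
          unfolding abs_mult using elim S0 L X1[of \<omega>] by (intro mult_mono) auto
        also have "\<dots> = (L ^ m * (S * L ^ Suc m)) * X \<omega> ^ (m + Suc m)"
          by (simp add: power_mult_distrib power_add mult_ac)
        finally show ?case .
      qed
      have int2: "integrable P (\<lambda>\<omega>. F A \<omega> * G \<omega>)"
        by (rule integrable_poly_bound[OF U _ FG[unfolded X_def]]) measurable
      have int1: "integrable P (\<lambda>\<omega>. measure (N \<omega>) K * (F A \<omega> * G \<omega>))"
      proof (rule integrable_poly_bound[OF U])
        show "AE \<omega> in P. \<bar>measure (N \<omega>) K * (F A \<omega> * G \<omega>)\<bar> \<le> (L ^ m * (S * L ^ Suc m)) * (measure (N \<omega>) U + 1) ^ Suc (m + Suc m)"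
          using FG bd
        proof eventually_elim
          case (elim \<omega>)
          have "\<bar>measure (N \<omega>) K * (F A \<omega> * G \<omega>)\<bar> \<le> X \<omega> * ((L ^ m * (S * L ^ Suc m)) * X \<omega> ^ (m + Suc m))"
            unfolding abs_mult[of "measure (N \<omega>) K"] using elim KC X1[of \<omega>] by (intro mult_mono) auto
          then show ?case by (simp add: X_def mult_ac)
        qed
      qed measurable
      define H where "H v = (\<Prod>i=1..m. v (A i) - measure halfline (A i)) * eint (Suc m) E (\<lambda>B. v B - measure halfline B)" for v
      have Hm: "H \<in> borel_measurable (PiM \<C> (\<lambda>_. borel))"
        unfolding H_def
      proof (intro borel_measurable_times borel_measurable_prod measurable_sum_list_eint borel_measurable_diff borel_measurable_const)
        show "(\<lambda>v. v (A i)) \<in> borel_measurable (PiM \<C> (\<lambda>_. borel :: real measure))" if "i \<in> {1..m}" for i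
          using AC[of i] that by (intro measurable_component_singleton) auto
        show "(\<lambda>v. v (A' i)) \<in> borel_measurable (PiM \<C> (\<lambda>_. borel :: real measure))" if "(c', A') \<in> set E" "i \<in> {1..Suc m}" for c' A' i
          using sidesI[OF that] by (intro measurable_component_singleton) (auto simp: \<C>_def)
      qed
      have Hres: "H (\<lambda>B\<in>\<C>. v B) = H v" for v
      proof -
        have "eint (Suc m) E (\<lambda>B. (\<lambda>B\<in>\<C>. v B) B - measure halfline B) = eint (Suc m) E (\<lambda>B. v B - measure halfline B)"
          by (rule eint_cong) (auto simp: \<C>_def intro: sidesI)
        moreover have "(\<Prod>i=1..m. (\<lambda>B\<in>\<C>. v B) (A i) - measure halfline (A i)) = (\<Prod>i=1..m. v (A i) - measure halfline (A i))"
          using AC by (intro prod.cong) auto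
        ultimately show ?thesis by (simp add: H_def)
      qed
      have HN: "H (\<lambda>B. measure (N \<omega>) B) = F A \<omega> * G \<omega>" for \<omega>
        by (simp add: H_def F_def G_def EI_def cN_def[abs_def])
      have HN1: "H (\<lambda>B. measure (N \<omega>) B + indicator B x) = F A \<omega> * (G \<omega> + b (\<omega>, x))" if x: "x \<in> K" for \<omega> x
      proof -
        have ind0: "indicator (A i) x = (0 :: real)" if "i \<in> {1..m}" for i
        proof -
          have "A i \<inter> A (Suc m) = {}"
            using disj_rectsD(1)[OF E cA] that by (intro disjoint_family_onD[where I = "{1..Suc m}"]) auto
          then show ?thesis using x by (auto simp: K_def disjoint_iff indicator_def)
        qed
        have "(\<lambda>B. measure (N \<omega>) B + indicator B x - measure halfline B) = (\<lambda>B. cN \<omega> B + indicator B x)"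
          by (auto simp: cN_def)
        then have "eint (Suc m) E (\<lambda>B. measure (N \<omega>) B + indicator B x - measure halfline B) = G \<omega> + b (\<omega>, x)"
          by (simp add: eint_add_point[OF E] G_def EI_def b_def D_def)
        moreover have "(\<Prod>i=1..m. measure (N \<omega>) (A i) + indicator (A i) x - measure halfline (A i)) = F A \<omega>"
          unfolding F_def by (intro prod.cong refl) (simp add: ind0 cN_def)
        ultimately show ?thesis by (simp add: H_def)
      qed
      note M = mecke_integral[OF CC KC Hm, unfolded Hres HN]
      have M1: "integrable (P \<Otimes>\<^sub>M halfline) (\<lambda>p. indicator K (snd p) * (F A (fst p) * (G (fst p) + b p)))"
      proof -
        have "(\<lambda>p. indicator K (snd p) * H (\<lambda>B. measure (N (fst p)) B + indicator B (snd p))) = (\<lambda>p. indicator K (snd p) * (F A (fst p) * (G (fst p) + b p)))"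
          by (rule ext) (case_tac "snd p \<in> K"; simp add: Hres HN1)
        then show ?thesis using M(2) int1 by simp
      qed
      have M2: "(\<integral>\<omega>. measure (N \<omega>) K * (F A \<omega> * G \<omega>) \<partial>P) = (\<integral>p. indicator K (snd p) * (F A (fst p) * (G (fst p) + b p)) \<partial>(P \<Otimes>\<^sub>M halfline))"
      proof -
        have "(\<lambda>p. indicator K (snd p) * H (\<lambda>B. measure (N (fst p)) B + indicator B (snd p))) = (\<lambda>p. indicator K (snd p) * (F A (fst p) * (G (fst p) + b p)))"
          by (rule ext) (case_tac "snd p \<in> K"; simp add: Hres HN1)
        then show ?thesis using M(1) by simp
      qed
      note Q = integral_indicator_prod[OF Km Kf int2]
      have e1: "(\<lambda>p. indicator K (snd p) * F A (fst p) * b p) = (\<lambda>p. indicator K (snd p) * (F A (fst p) * (G (fst p) + b p)) - indicator K (snd p) * (F A (fst p) * G (fst p)))"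
        by (auto simp: algebra_simps)
      have e2: "(\<lambda>\<omega>. cN \<omega> K * F A \<omega> * G \<omega>) = (\<lambda>\<omega>. measure (N \<omega>) K * (F A \<omega> * G \<omega>) - measure halfline K * (F A \<omega> * G \<omega>))"
        by (auto simp: cN_def algebra_simps)
      show "integrable P (\<lambda>\<omega>. cN \<omega> (A (Suc m)) * F A \<omega> * G \<omega>)"
        unfolding K_def[symmetric] e2 using int1 int2 by auto
      show "integrable (P \<Otimes>\<^sub>M halfline) (\<lambda>p. indicator (A (Suc m)) (snd p) * F A (fst p) * b p)"
        unfolding K_def[symmetric] e1 by (rule Bochner_Integration.integrable_diff[OF M1 Q(1)])
      show "(\<integral>\<omega>. cN \<omega> (A (Suc m)) * F A \<omega> * G \<omega> \<partial>P) = (\<integral>p. indicator (A (Suc m)) (snd p) * F A (fst p) * b p \<partial>(P \<Otimes>\<^sub>M halfline))"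
        unfolding K_def[symmetric] e1 e2
        using int1 int2 by (subst Bochner_Integration.integral_diff[OF M1 Q(1)]) (simp add: M2 Q(2))
    qed
    \<comment> \<open>Only one of the two factors is expanded into rectangles; the other remains the
      functional on which the difference operator acts.\<close>
    have GG: "(\<lambda>\<omega>. G \<omega> * G \<omega>) = (\<lambda>\<omega>. \<Sum>z\<leftarrow>E. fst z * (cN \<omega> (snd z (Suc m)) * F (snd z) \<omega> * G \<omega>))"
    proof
      fix \<omega>
      have "G \<omega> = (\<Sum>z\<leftarrow>E. fst z * (cN \<omega> (snd z (Suc m)) * F (snd z) \<omega>))"
        unfolding G_def EI_def eint_def F_def
        by (intro arg_cong[where f = sum_list] map_cong refl) (simp add: split_beta prod.nat_ivl_Suc' mult_ac)
      then show "G \<omega> * G \<omega> = (\<Sum>z\<leftarrow>E. fst z * (cN \<omega> (snd z (Suc m)) * F (snd z) \<omega> * G \<omega>))"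
        by (simp add: sum_list_mult_const[symmetric] mult_ac)
    qed
    have ab: "(\<lambda>p. a p * b p) = (\<lambda>p. \<Sum>z\<leftarrow>E. fst z * (indicator (snd z (Suc m)) (snd p) * F (snd z) (fst p) * b p))"
    proof
      fix p
      have "a p = (\<Sum>z\<leftarrow>E. fst z * (indicator (snd z (Suc m)) (snd p) * F (snd z) (fst p)))"
        unfolding a_def EI_def eint_def F_def sec_def map_map
        by (intro arg_cong[where f = sum_list] map_cong refl) (simp add: split_beta mult_ac)
      then have "a p * b p = (\<Sum>z\<leftarrow>E. fst z * (indicator (snd z (Suc m)) (snd p) * F (snd z) (fst p)) * b p)"
        by (simp only: sum_list_mult_const)
      then show "a p * b p = (\<Sum>z\<leftarrow>E. fst z * (indicator (snd z (Suc m)) (snd p) * F (snd z) (fst p) * b p))"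
        by (simp only: mult.assoc)
    qed
    have i1: "integrable P (\<lambda>\<omega>. G \<omega> * G \<omega>)" and v1: "(\<integral>\<omega>. G \<omega> * G \<omega> \<partial>P) = (\<Sum>z\<leftarrow>E. \<integral>\<omega>. fst z * (cN \<omega> (snd z (Suc m)) * F (snd z) \<omega> * G \<omega>) \<partial>P)"
      unfolding GG using integral_sum_list[of E P "\<lambda>z \<omega>. fst z * (cN \<omega> (snd z (Suc m)) * F (snd z) \<omega> * G \<omega>)"] key(1) by auto
    have i2: "integrable (P \<Otimes>\<^sub>M halfline) (\<lambda>p. a p * b p)" and v2: "(\<integral>p. a p * b p \<partial>(P \<Otimes>\<^sub>M halfline)) =
       (\<Sum>z\<leftarrow>E. \<integral>p. fst z * (indicator (snd z (Suc m)) (snd p) * F (snd z) (fst p) * b p) \<partial>(P \<Otimes>\<^sub>M halfline))"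
      unfolding ab using integral_sum_list[of E "P \<Otimes>\<^sub>M halfline" "\<lambda>z p. fst z * (indicator (snd z (Suc m)) (snd p) * F (snd z) (fst p) * b p)"] key(2) by auto
    have v: "(\<integral>\<omega>. G \<omega> * G \<omega> \<partial>P) = (\<integral>p. a p * b p \<partial>(P \<Otimes>\<^sub>M halfline))"
      unfolding v1 v2 using key(3) by (intro arg_cong[where f = sum_list] map_cong refl) auto
    have am[measurable]: "a \<in> borel_measurable (P \<Otimes>\<^sub>M halfline)" unfolding a_def by (rule measurable_EI_sec[OF E])
    have bm[measurable]: "b \<in> borel_measurable (P \<Otimes>\<^sub>M halfline)" unfolding b_def by (rule measurable_EI_sec[OF D])
    have "sqn P G = ennreal (\<integral>\<omega>. G \<omega> * G \<omega> \<partial>P)"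
      unfolding sqn_def power2_eq_square by (rule nn_integral_eq_integral[OF i1]) simp
    also have "\<dots> \<le> ennreal (\<integral>p. \<bar>a p * b p\<bar> \<partial>(P \<Otimes>\<^sub>M halfline))"
      unfolding v by (intro ennreal_leI integral_mono integrable_abs i2) auto
    also have "\<dots> = (\<integral>\<^sup>+p. ennreal \<bar>a p * b p\<bar> \<partial>(P \<Otimes>\<^sub>M halfline))"
      by (intro nn_integral_eq_integral[symmetric] integrable_abs i2) auto
    also have "\<dots> \<le> (\<integral>\<^sup>+p. ennreal ((a p)\<^sup>2) + ennreal ((b p)\<^sup>2) \<partial>(P \<Otimes>\<^sub>M halfline))"
    proof (intro nn_integral_mono)
      fix p
      have "\<bar>a p * b p\<bar> \<le> (a p)\<^sup>2 + (b p)\<^sup>2"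
        using zero_le_power2[of "a p + b p"] zero_le_power2[of "a p - b p"] zero_le_power2[of "a p"] zero_le_power2[of "b p"]
        by (simp add: power2_sum power2_diff abs_le_iff) 
      then have "ennreal \<bar>a p * b p\<bar> \<le> ennreal ((a p)\<^sup>2 + (b p)\<^sup>2)" by (rule ennreal_leI)
      then show "ennreal \<bar>a p * b p\<bar> \<le> ennreal ((a p)\<^sup>2) + ennreal ((b p)\<^sup>2)"
        by (simp add: ennreal_plus)
    qed
    also have "\<dots> = sqn (P \<Otimes>\<^sub>M halfline) a + sqn (P \<Otimes>\<^sub>M halfline) b"
      unfolding sqn_def by (rule nn_integral_add) auto
    also have "\<dots> \<le> ennreal C * sqn (halfline_prod {1..Suc m}) (elementary_fun (Suc m) E) + ennreal C * sqn (halfline_prod {1..Suc m}) (elementary_fun (Suc m) D)"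
      unfolding a_def b_def by (intro add_mono sqn_EI_sec_le E D C IH)
    also have "\<dots> \<le> ennreal C * sqn (halfline_prod {1..Suc m}) (elementary_fun (Suc m) E)
        + ennreal C * (ennreal (real (Suc m) * real (Suc m)) * sqn (halfline_prod {1..Suc m}) (elementary_fun (Suc m) E))"
      unfolding D_def by (intro add_left_mono mult_left_mono sqn_efun_swaps_le E) auto
    also have "\<dots> = ennreal (C + C * (real (Suc m) * real (Suc m))) * sqn (halfline_prod {1..Suc m}) (elementary_fun (Suc m) E)"
      using C by (simp only: ennreal_plus ennreal_mult mult_nonneg_nonneg of_nat_0_le_iff distrib_right mult.assoc)
    finally show ?thesis unfolding G_def .
  qed
  then show ?case using C by (intro exI[of _ "C + C * (real (Suc m) * real (Suc m))"]) auto
qed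

end

section \<open>Approximation by elementary functions\<close>

lemma sqn_dominated:
  assumes [measurable]: "\<And>k. X k \<in> borel_measurable M" "F \<in> borel_measurable M" "w \<in> borel_measurable M"
    and lim: "AE x in M. (\<lambda>k. X k x) \<longlonglongrightarrow> F x" and b: "\<And>k. AE x in M. \<bar>X k x\<bar> \<le> w x" and w: "sqn M w < \<top>"
  shows "(\<lambda>k. sqn M (\<lambda>x. X k x - F x)) \<longlonglongrightarrow> 0"
proof -
  have "AE x in M. \<forall>k. \<bar>X k x\<bar> \<le> w x" unfolding AE_all_countable using b by blast
  then have Fb: "AE x in M. (\<forall>k. \<bar>X k x\<bar> \<le> w x) \<and> \<bar>F x\<bar> \<le> w x"
    using lim by eventually_elim (auto intro: LIMSEQ_le_const2[OF tendsto_rabs])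
  have "(\<lambda>k. \<integral>\<^sup>+x. ennreal ((X k x - F x)\<^sup>2) \<partial>M) \<longlonglongrightarrow> (\<integral>\<^sup>+x. 0 \<partial>M)"
  proof (rule nn_integral_dominated_convergence[where w = "\<lambda>x. 4 * ennreal ((w x)\<^sup>2)"])
    show "(\<integral>\<^sup>+x. 4 * ennreal ((w x)\<^sup>2) \<partial>M) < \<infinity>"
      using w by (subst nn_integral_cmult) (auto simp: sqn_def ennreal_mult_less_top)
    show "AE x in M. ennreal ((X k x - F x)\<^sup>2) \<le> 4 * ennreal ((w x)\<^sup>2)" for k
      using Fb
    proof eventually_elim
      case (elim x)
      then have "\<bar>X k x\<bar> \<le> w x" "\<bar>F x\<bar> \<le> w x" by auto
      then have "\<bar>X k x - F x\<bar> \<le> \<bar>2 * w x\<bar>" by linarith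
      then have "(X k x - F x)\<^sup>2 \<le> (2 * w x)\<^sup>2" unfolding abs_le_square_iff .
      then have "ennreal ((X k x - F x)\<^sup>2) \<le> ennreal (4 * (w x)\<^sup>2)" by (intro ennreal_leI) (simp add: power_mult_distrib)
      then show ?case by (simp add: ennreal_mult)
    qed
    show "AE x in M. (\<lambda>k. ennreal ((X k x - F x)\<^sup>2)) \<longlonglongrightarrow> 0"
      using lim
    proof eventually_elim
      case (elim x)
      have "(\<lambda>k. ennreal ((X k x - F x)\<^sup>2)) \<longlonglongrightarrow> ennreal ((F x - F x)\<^sup>2)"
        by (intro tendsto_intros tendsto_ennrealI elim)
      then show ?case by simp
    qed
  qed auto
  then show ?thesis by (simp add: sqn_def)
qed

lemma sqn_mono: "AE x in M. \<bar>u x\<bar> \<le> \<bar>v x\<bar> \<Longrightarrow> sqn M u \<le> sqn M v"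
  unfolding sqn_def
proof (intro nn_integral_mono_AE, elim eventually_mono)
  fix x assume "\<bar>u x\<bar> \<le> \<bar>v x\<bar>"
  then show "ennreal ((u x)\<^sup>2) \<le> ennreal ((v x)\<^sup>2)"
    by (intro ennreal_leI) (rule abs_le_square_iff[THEN iffD1])
qed

lemma sqn_indicator: "S \<in> sets M \<Longrightarrow> sqn M (indicator S) = emeasure M S"
proof -
  assume S: "S \<in> sets M"
  have "sqn M (indicator S) = (\<integral>\<^sup>+x. indicator S x \<partial>M)"
    unfolding sqn_def by (intro nn_integral_cong) (auto simp: indicator_def)
  then show ?thesis using S by simp
qed

lemma prod_less_top: "finite I \<Longrightarrow> (\<And>i. i \<in> I \<Longrightarrow> f i < (\<top> :: ennreal)) \<Longrightarrow> prod f I < \<top>"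
  by (induction I rule: finite_induct) (auto simp: ennreal_mult_less_top)

definition rect_approx :: "nat \<Rightarrow> ((nat \<Rightarrow> real) \<Rightarrow> real) \<Rightarrow> bool" where
  "rect_approx m \<phi> \<longleftrightarrow> \<phi> \<in> borel_measurable (halfline_prod {1..m}) \<and>
     (\<forall>e>0. \<exists>E. disj_rects m E \<and> sqn (halfline_prod {1..m}) (\<lambda>z. elementary_fun m E z - \<phi> z) \<le> ennreal e)"

lemma rect_approxD:
  assumes "rect_approx m \<phi>" "0 < e"
  obtains E where "disj_rects m E" "sqn (halfline_prod {1..m}) (\<lambda>z. elementary_fun m E z - \<phi> z) \<le> ennreal e"
  using assms by (auto simp: rect_approx_def)

lemma four_quarters: "0 < e \<Longrightarrow> 2 * ennreal (e / 4) + 2 * ennreal (e / 4) = ennreal e"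
  by (simp add: ennreal_plus[symmetric] ennreal_mult''[symmetric] mult_2 del: ennreal_plus)

lemma rect_approx_lim:
  assumes "\<And>k. rect_approx m (\<phi> k)" "\<psi> \<in> borel_measurable (halfline_prod {1..m})"
    and lim: "(\<lambda>k. sqn (halfline_prod {1..m}) (\<lambda>z. \<phi> k z - \<psi> z)) \<longlonglongrightarrow> 0"
  shows "rect_approx m \<psi>"
  unfolding rect_approx_def
proof (intro conjI allI impI)
  fix e :: real assume e: "0 < e"
  have "\<forall>\<^sub>F k in sequentially. sqn (halfline_prod {1..m}) (\<lambda>z. \<phi> k z - \<psi> z) < ennreal (e/4)"
    using order_tendstoD(2)[OF lim, of "ennreal (e/4)"] e by simp
  then obtain k where k: "sqn (halfline_prod {1..m}) (\<lambda>z. \<phi> k z - \<psi> z) < ennreal (e/4)"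
    by (auto dest: eventually_happens)
  obtain E where E: "disj_rects m E" "sqn (halfline_prod {1..m}) (\<lambda>z. elementary_fun m E z - \<phi> k z) \<le> ennreal (e/4)"
    using rect_approxD[OF assms(1)[of k], of "e/4"] e by auto
  have "sqn (halfline_prod {1..m}) (\<lambda>z. elementary_fun m E z - \<psi> z) \<le>
     2 * sqn (halfline_prod {1..m}) (\<lambda>z. elementary_fun m E z - \<phi> k z) + 2 * sqn (halfline_prod {1..m}) (\<lambda>z. \<phi> k z - \<psi> z)"
    using assms E by (intro sqn_triangle measurable_efun) (auto simp: rect_approx_def)
  also have "\<dots> \<le> 2 * ennreal (e/4) + 2 * ennreal (e/4)"
    using E k by (intro add_mono mult_left_mono) auto
  also have "\<dots> = ennreal e" using e by (rule four_quarters)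
  finally show "\<exists>E. disj_rects m E \<and> sqn (halfline_prod {1..m}) (\<lambda>z. elementary_fun m E z - \<psi> z) \<le> ennreal e"
    using E by auto
qed (rule assms)

lemma rect_approx_add:
  assumes "rect_approx m \<phi>" "rect_approx m \<psi>"
  shows "rect_approx m (\<lambda>z. \<phi> z + \<psi> z)"
  unfolding rect_approx_def
proof (intro conjI allI impI)
  show "(\<lambda>z. \<phi> z + \<psi> z) \<in> borel_measurable (halfline_prod {1..m})"
    using assms by (auto simp: rect_approx_def)
  fix e :: real assume e: "0 < e"
  obtain E where E: "disj_rects m E" "sqn (halfline_prod {1..m}) (\<lambda>z. elementary_fun m E z - \<phi> z) \<le> ennreal (e/4)"
    using rect_approxD[OF assms(1), of "e/4"] e by auto
  obtain E' where E': "disj_rects m E'" "sqn (halfline_prod {1..m}) (\<lambda>z. elementary_fun m E' z - \<psi> z) \<le> ennreal (e/4)"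
    using rect_approxD[OF assms(2), of "e/4"] e by auto
  have "sqn (halfline_prod {1..m}) (\<lambda>z. elementary_fun m (E @ E') z - (\<phi> z + \<psi> z)) =
    sqn (halfline_prod {1..m}) (\<lambda>z. (elementary_fun m E z - \<phi> z) + (elementary_fun m E' z - \<psi> z))"
    by (simp add: algebra_simps)
  also have "\<dots> \<le> 2 * sqn (halfline_prod {1..m}) (\<lambda>z. elementary_fun m E z - \<phi> z) + 2 * sqn (halfline_prod {1..m}) (\<lambda>z. elementary_fun m E' z - \<psi> z)"
    using assms measurable_efun[OF E(1)] measurable_efun[OF E'(1)] by (intro sqn_add_le) (auto simp: rect_approx_def)
  also have "\<dots> \<le> 2 * ennreal (e/4) + 2 * ennreal (e/4)"
    using E E' by (intro add_mono mult_left_mono) auto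
  also have "\<dots> = ennreal e" using e by (rule four_quarters)
  finally show "\<exists>E. disj_rects m E \<and> sqn (halfline_prod {1..m}) (\<lambda>z. elementary_fun m E z - (\<phi> z + \<psi> z)) \<le> ennreal e"
    using E E' by (intro exI[of _ "E @ E'"]) auto
qed

lemma rect_approx_0: "rect_approx m (\<lambda>_. 0)"
  unfolding rect_approx_def by (auto intro!: exI[of _ "[]"] simp: sqn_def)

lemma rect_approx_cmult:
  assumes "rect_approx m \<phi>"
  shows "rect_approx m (\<lambda>z. c * \<phi> z)"
  unfolding rect_approx_def
proof (intro conjI allI impI)
  show "(\<lambda>z. c * \<phi> z) \<in> borel_measurable (halfline_prod {1..m})"
    using assms by (auto simp: rect_approx_def)
  fix e :: real assume e: "0 < e"
  have e': "0 < e / (c\<^sup>2 + 1)" using e by (auto intro!: divide_pos_pos add_nonneg_pos)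
  obtain E where E: "disj_rects m E" "sqn (halfline_prod {1..m}) (\<lambda>z. elementary_fun m E z - \<phi> z) \<le> ennreal (e / (c\<^sup>2 + 1))"
    using rect_approxD[OF assms e'] by auto
  define E' where "E' = map (\<lambda>(d, A). (c * d, A)) E"
  have E': "disj_rects m E'" using E(1) by (fastforce simp: E'_def disj_rects_def)
  have eq: "elementary_fun m E' z = c * elementary_fun m E z" for z
    unfolding E'_def by (induction E) (auto simp: algebra_simps)
  have "sqn (halfline_prod {1..m}) (\<lambda>z. elementary_fun m E' z - c * \<phi> z) = sqn (halfline_prod {1..m}) (\<lambda>z. c * (elementary_fun m E z - \<phi> z))"
    by (simp add: eq algebra_simps)
  also have "\<dots> = ennreal (c\<^sup>2) * sqn (halfline_prod {1..m}) (\<lambda>z. elementary_fun m E z - \<phi> z)"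
    using assms measurable_efun[OF E(1)] by (intro sqn_cmult) (auto simp: rect_approx_def)
  also have "\<dots> \<le> ennreal (c\<^sup>2) * ennreal (e / (c\<^sup>2 + 1))" by (intro mult_left_mono E) auto
  also have "\<dots> = ennreal (c\<^sup>2 * (e / (c\<^sup>2 + 1)))" using e' by (intro ennreal_mult[symmetric]) auto
  also have "\<dots> \<le> ennreal e"
  proof (rule ennreal_leI)
    have "c\<^sup>2 * e \<le> e * (c\<^sup>2 + 1)" using e by (simp add: algebra_simps)
    then show "c\<^sup>2 * (e / (c\<^sup>2 + 1)) \<le> e"
      by (simp add: pos_divide_le_eq add_nonneg_pos)
  qed
  finally show "\<exists>E. disj_rects m E \<and> sqn (halfline_prod {1..m}) (\<lambda>z. elementary_fun m E z - c * \<phi> z) \<le> ennreal e"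
    using E' by auto
qed

lemma rect_approx_cong:
  assumes "rect_approx m \<phi>" "\<And>z. z \<in> space (halfline_prod {1..m}) \<Longrightarrow> \<phi> z = \<psi> z"
  shows "rect_approx m \<psi>"
proof -
  have "sqn (halfline_prod {1..m}) (\<lambda>z. elementary_fun m E z - \<phi> z) = sqn (halfline_prod {1..m}) (\<lambda>z. elementary_fun m E z - \<psi> z)" for E
    by (rule sqn_cong) (simp add: assms(2))
  then show ?thesis using assms(1) measurable_cong[of "halfline_prod {1..m}" \<phi> \<psi> borel, OF assms(2)]
    by (auto simp: rect_approx_def)
qed

text \<open>Each coordinate has a law without atoms, so diagonals are null; hence insisting on
  disjoint sides does not shrink the L2 closure of the elementary functions.\<close>

lemma AE_halfline_prod_neq:
  assumes "i \<in> I" "j \<in> I" "i \<noteq> j" and I: "finite I"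
  shows "AE z in halfline_prod I. z i \<noteq> z j"
proof -
  define J where "J = I - {i}"
  have J: "finite J" "i \<notin> J" "insert i J = I" "j \<in> J" using assms by (auto simp: J_def)
  have [measurable]: "(\<lambda>z. z k) \<in> borel_measurable (halfline_prod I)" if "k \<in> I" for k
    using measurable_compose[OF measurable_component_halfline[OF that] measurable_halfline_id] by simp
  have S[measurable]: "{z \<in> space (halfline_prod I). z i = z j} \<in> sets (halfline_prod I)"
    using assms by measurable
  have "emeasure (halfline_prod I) {z \<in> space (halfline_prod I). z i = z j} = (\<integral>\<^sup>+z. indicator {z \<in> space (halfline_prod I). z i = z j} z \<partial>halfline_prod I)"
    by simp
  also have "\<dots> = (\<integral>\<^sup>+y. (\<integral>\<^sup>+x. indicator {z \<in> space (halfline_prod I). z i = z j} (y(i := x)) \<partial>halfline) \<partial>halfline_prod J)"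
    using halfline_prod.product_nn_integral_insert[OF J(1,2), of "indicator {z \<in> space (halfline_prod I). z i = z j}"] S J(3)
    by (simp add: halfline_prod_def)
  also have "\<dots> = (\<integral>\<^sup>+y. 0 \<partial>halfline_prod J)"
  proof (rule nn_integral_cong)
    fix y assume "y \<in> space (halfline_prod J)"
    have "AE x in halfline. x \<noteq> y j" unfolding AE_halfline using AE_lborel_singleton[of "y j"] by eventually_elim auto
    then have "AE x in halfline. indicator {z \<in> space (halfline_prod I). z i = z j} (y(i := x)) = (0 :: ennreal)"
      by eventually_elim (use assms in auto)
    then show "(\<integral>\<^sup>+x. indicator {z \<in> space (halfline_prod I). z i = z j} (y(i := x)) \<partial>halfline) = 0"
      by (subst nn_integral_cong_AE) auto
  qed
  finally have "emeasure (halfline_prod I) {z \<in> space (halfline_prod I). z i = z j} = 0" by simp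
  then show ?thesis by (intro AE_I[OF _ _ S]) auto
qed

text \<open>A product of sides is approximated off the diagonals by cutting the axis into cells of
  length \<open>1 / n\<close> and keeping the products of distinct cells.\<close>

lemma rect_approx_rect:
  assumes A: "\<And>i. i \<in> {1..m} \<Longrightarrow> A i \<in> sets halfline" "\<And>i. i \<in> {1..m} \<Longrightarrow> A i \<subseteq> {0..r}" and r: "0 \<le> r"
  shows "rect_approx m (indicator (Pi\<^sub>E {1..m} A))"
proof -
  \<comment> \<open>\<open>c n t\<close> numbers the cell of length \<open>1 / Suc n\<close> that
    contains \<open>t\<close>; \<open>S n\<close> below consists of the injective choices of cells
    up to the one containing \<open>r\<close>.\<close>
  define c where "c n t = nat \<lfloor>real (Suc n) * t\<rfloor>" for n and t :: real
  define J where "J n k = {t \<in> {0..}. c n t = k}" for n k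
  define S where "S n = {j \<in> Pi\<^sub>E {1..m} (\<lambda>_. {..c n r}). inj_on j {1..m}}" for n
  have fS: "finite (S n)" for n unfolding S_def by (rule finite_subset[of _ "Pi\<^sub>E {1..m} (\<lambda>_. {..c n r})"]) (auto intro: finite_PiE)
  then have "\<exists>js. set js = S n \<and> distinct js" for n by (rule finite_distinct_list)
  then obtain js where js: "\<And>n. set (js n) = S n" "\<And>n. distinct (js n)" by metis
  define E where "E n = map (\<lambda>j. (1 :: real, \<lambda>i. A i \<inter> J n (j i))) (js n)" for n
  have Jm: "J n k \<in> sets halfline" for n k
  proof -
    have "{t \<in> space halfline. c n t = k} \<in> sets halfline" unfolding c_def by measurable
    then show ?thesis by (simp add: J_def)
  qed
  have Af: "emeasure halfline B < \<infinity>" if "B \<in> sets halfline" "B \<subseteq> {0..r}" for B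
  proof -
    have Ir: "{0..r} \<in> sets halfline" using r by (auto simp: halfline_def sets_restrict_space_iff)
    have "emeasure halfline B \<le> emeasure halfline {0..r}" using that Ir by (intro emeasure_mono) auto
    also have "\<dots> = ennreal r" using r unfolding halfline_def by (subst emeasure_restrict_space) auto
    finally show ?thesis using ennreal_less_top by (auto intro: le_less_trans)
  qed
  have E: "disj_rects m (E n)" for n
  proof (rule disj_rectsI)
    fix d B i assume "(d, B) \<in> set (E n)"
    then obtain j where j: "j \<in> S n" "B = (\<lambda>i. A i \<inter> J n (j i))" by (auto simp: E_def js)
    show "disjoint_family_on B {1..m}"
      unfolding disjoint_family_on_def
    proof (intro ballI impI)
      fix i i' assume "i \<in> {1..m}" "i' \<in> {1..m}" "i \<noteq> i'"
      then have "j i \<noteq> j i'" using j(1) unfolding S_def by (auto dest: inj_onD)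
      then show "B i \<inter> B i' = {}" unfolding j(2) J_def by auto
    qed
    show "i \<in> {1..m} \<Longrightarrow> B i \<in> sets halfline \<and> emeasure halfline (B i) < \<infinity>"
    proof -
      assume i: "i \<in> {1..m}"
      have "B i \<in> sets halfline" unfolding j(2) using A(1)[OF i] Jm by (rule sets.Int)
      moreover have "B i \<subseteq> {0..r}" using A(2)[OF i] by (auto simp: j(2))
      ultimately show ?thesis using Af by blast
    qed
  qed
  \<comment> \<open>At most one tuple of cells contains \<open>z\<close>, so the sum collapses to
    the indicator of the box, restricted to points whose coordinates lie in distinct cells.\<close>
  have val: "elementary_fun m (E n) z = indicator (Pi\<^sub>E {1..m} A) z * (if inj_on (\<lambda>i. c n (z i)) {1..m} then 1 else 0)"
    if z: "z \<in> space (halfline_prod {1..m})" for n z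
  proof -
    have zi: "z i \<ge> 0" if "i \<in> {1..m}" for i using z that by (auto simp: space_halfline_prod PiE_iff)
    have "elementary_fun m (E n) z = (\<Sum>j\<leftarrow>js n. \<Prod>i=1..m. indicator (A i \<inter> J n (j i)) (z i))"
      by (simp add: elementary_fun_def E_def comp_def)
    also have "\<dots> = (\<Sum>j\<in>S n. \<Prod>i=1..m. indicator (A i \<inter> J n (j i)) (z i))"
      using js by (simp add: sum_list_distinct_conv_sum_set)
    also have "\<dots> = (\<Sum>j\<in>S n. if j = (\<lambda>i\<in>{1..m}. c n (z i)) then indicator (Pi\<^sub>E {1..m} A) z else 0)"
    proof (rule sum.cong)
      fix j assume j: "j \<in> S n"
      show "(\<Prod>i=1..m. indicator (A i \<inter> J n (j i)) (z i)) = (if j = (\<lambda>i\<in>{1..m}. c n (z i)) then indicator (Pi\<^sub>E {1..m} A) z else (0 :: real))"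
      proof (cases "\<forall>i\<in>{1..m}. z i \<in> A i \<inter> J n (j i)")
        case True
        then have "(\<Prod>i=1..m. indicator (A i \<inter> J n (j i)) (z i)) = (1 :: real)" by (intro prod.neutral) auto
        moreover have "j = (\<lambda>i\<in>{1..m}. c n (z i))"
        proof
          show "j i = (\<lambda>i\<in>{1..m}. c n (z i)) i" for i
            using True j by (cases "i \<in> {1..m}") (auto simp: J_def S_def PiE_iff extensional_def)
        qed
        moreover have "z \<in> Pi\<^sub>E {1..m} A" using True z by (auto simp: space_halfline_prod PiE_iff)
        ultimately show ?thesis by simp
      next
        case False
        then obtain i where i: "i \<in> {1..m}" "z i \<notin> A i \<inter> J n (j i)" by auto
        then have "(\<Prod>i=1..m. indicator (A i \<inter> J n (j i)) (z i)) = (0 :: real)"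
          by (intro prod_zero bexI[of _ i]) (auto simp: indicator_def)
        note p = this
        have "z \<notin> Pi\<^sub>E {1..m} A" if "j = (\<lambda>i\<in>{1..m}. c n (z i))"
          using i zi[OF i(1)] that by (auto simp: J_def)
        then show ?thesis unfolding p by auto
      qed
    qed simp
    also have "\<dots> = (if (\<lambda>i\<in>{1..m}. c n (z i)) \<in> S n then indicator (Pi\<^sub>E {1..m} A) z else 0)"
      using fS by simp
    also have "\<dots> = indicator (Pi\<^sub>E {1..m} A) z * (if inj_on (\<lambda>i. c n (z i)) {1..m} then 1 else 0)"
    proof (cases "z \<in> Pi\<^sub>E {1..m} A")
      case True
      have "c n (z i) \<le> c n r" if "i \<in> {1..m}" for i
      proof -
        have "z i \<le> r" using A(2)[OF that] PiE_mem[OF True that] by auto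
        then show ?thesis unfolding c_def by (intro nat_mono floor_mono mult_left_mono) auto
      qed
      moreover have "inj_on (\<lambda>i\<in>{1..m}. c n (z i)) {1..m} \<longleftrightarrow> inj_on (\<lambda>i. c n (z i)) {1..m}"
        by (rule inj_on_cong) auto
      ultimately show ?thesis using True by (auto simp: S_def)
    qed simp
    finally show ?thesis .
  qed
  have PA: "Pi\<^sub>E {1..m} A \<in> sets (halfline_prod {1..m})"
    unfolding halfline_prod_def using A by (intro sets_PiM_I_finite) auto
  have a1: "rect_approx m (elementary_fun m (E n))" for n
    unfolding rect_approx_def using E measurable_efun[OF E] by (auto intro!: exI[of _ "E n"] simp: sqn_def)
  have a2: "indicator (Pi\<^sub>E {1..m} A) \<in> borel_measurable (halfline_prod {1..m})" using PA by simp
  have a3: "(\<lambda>n. sqn (halfline_prod {1..m}) (\<lambda>z. elementary_fun m (E n) z - indicator (Pi\<^sub>E {1..m} A) z)) \<longlonglongrightarrow> 0"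
  proof (rule sqn_dominated[where w = "indicator (Pi\<^sub>E {1..m} A)"])
    show "elementary_fun m (E n) \<in> borel_measurable (halfline_prod {1..m})" for n by (rule measurable_efun[OF E])
    show "indicator (Pi\<^sub>E {1..m} A) \<in> borel_measurable (halfline_prod {1..m})" using PA by simp
    show "indicator (Pi\<^sub>E {1..m} A) \<in> borel_measurable (halfline_prod {1..m})" using PA by simp
    show "AE z in halfline_prod {1..m}. \<bar>elementary_fun m (E n) z\<bar> \<le> indicator (Pi\<^sub>E {1..m} A) z" for n
      using AE_space by eventually_elim (simp add: val)
    have "emeasure (halfline_prod {1..m}) (Pi\<^sub>E {1..m} A) = (\<Prod>i\<in>{1..m}. emeasure halfline (A i))"
      unfolding halfline_prod_def using A by (intro halfline_prod.emeasure_PiM) auto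
    also have "\<dots> < \<top>" using Af A by (intro prod_less_top) auto
    finally show "sqn (halfline_prod {1..m}) (indicator (Pi\<^sub>E {1..m} A)) < \<top>" using PA by (simp add: sqn_indicator)
    have "AE z in halfline_prod {1..m}. \<forall>i\<in>{1..m}. \<forall>j\<in>{1..m}. i \<noteq> j \<longrightarrow> z i \<noteq> z j"
      by (intro AE_finite_allI) (auto intro: AE_halfline_prod_neq)
    then show "AE z in halfline_prod {1..m}. (\<lambda>n. elementary_fun m (E n) z) \<longlonglongrightarrow> indicator (Pi\<^sub>E {1..m} A) z"
      using AE_space
    proof eventually_elim
      case (elim z)
      have zi: "z i \<ge> 0" if "i \<in> {1..m}" for i using elim(2) that by (auto simp: space_halfline_prod PiE_iff)
      have "\<forall>\<^sub>F n in sequentially. c n (z i) \<noteq> c n (z j)" if ij: "i \<in> {1..m}" "j \<in> {1..m}" "i \<noteq> j" for i j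
      proof -
        have d: "\<bar>z i - z j\<bar> > 0" using elim(1) ij by auto
        obtain n0 :: nat where n0: "1 / \<bar>z i - z j\<bar> < real n0" using reals_Archimedean2 by blast
        show ?thesis unfolding eventually_sequentially
        proof (intro exI[of _ n0] allI impI notI)
          fix n assume "n0 \<le> n" and eq: "c n (z i) = c n (z j)"
          have "\<lfloor>real (Suc n) * z i\<rfloor> = \<lfloor>real (Suc n) * z j\<rfloor>"
            using eq zi[OF ij(1)] zi[OF ij(2)] unfolding c_def by (subst (asm) eq_nat_nat_iff) (auto intro!: mult_nonneg_nonneg)
          then have "\<bar>real (Suc n) * z i - real (Suc n) * z j\<bar> < 1"
            using floor_correct[of "real (Suc n) * z i"] floor_correct[of "real (Suc n) * z j"] by linarith
          then have "real (Suc n) * \<bar>z i - z j\<bar> < 1"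
            by (simp add: right_diff_distrib[symmetric] abs_mult del: of_nat_Suc)
          moreover have "1 < real n0 * \<bar>z i - z j\<bar>" using n0 d by (simp add: field_simps)
          moreover have "real n0 * \<bar>z i - z j\<bar> \<le> real (Suc n) * \<bar>z i - z j\<bar>" using \<open>n0 \<le> n\<close> by (intro mult_right_mono) auto
          ultimately show False by linarith
        qed
      qed
      then have "\<forall>\<^sub>F n in sequentially. \<forall>i\<in>{1..m}. \<forall>j\<in>{1..m}. i \<noteq> j \<longrightarrow> c n (z i) \<noteq> c n (z j)"
        by (intro eventually_ball_finite ballI) (auto simp: eventually_conj_iff)
      then have "\<forall>\<^sub>F n in sequentially. elementary_fun m (E n) z = indicator (Pi\<^sub>E {1..m} A) z"
        by eventually_elim (auto simp: val[OF elim(2)] inj_on_def)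
      then show ?case by (rule tendsto_eventually)
    qed
  qed
  show ?thesis by (rule rect_approx_lim[OF a1 a2 a3])
qed

definition hbox :: "nat \<Rightarrow> real \<Rightarrow> (nat \<Rightarrow> real) set" where
  "hbox m r = Pi\<^sub>E {1..m} (\<lambda>_. {0..r})"

lemma Icc_halfline: "{0..r} \<in> sets halfline" "emeasure halfline {0..r} = ennreal r"
proof -
  show "{0..r} \<in> sets halfline" by (auto simp: halfline_def sets_restrict_space_iff)
  show "emeasure halfline {0..r} = ennreal r"
    unfolding halfline_def by (subst emeasure_restrict_space) (auto simp: emeasure_lborel_Icc_eq ennreal_neg)
qed

lemma hbox_sets[measurable]: "hbox m r \<in> sets (halfline_prod {1..m})"
  unfolding hbox_def halfline_prod_def using Icc_halfline by (intro sets_PiM_I_finite) auto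

lemmas hbox_sets_Suc_0[measurable] = hbox_sets[unfolded One_nat_def]

lemma hbox_finite: "emeasure (halfline_prod {1..m}) (hbox m r) < \<top>"
proof -
  have "emeasure (halfline_prod {1..m}) (hbox m r) = (\<Prod>i\<in>{1..m}. emeasure halfline {0..r})"
    unfolding hbox_def halfline_prod_def using Icc_halfline by (intro halfline_prod.emeasure_PiM) auto
  also have "\<dots> < \<top>" by (intro prod_less_top) (auto simp: Icc_halfline)
  finally show ?thesis .
qed

text \<open>A Dynkin argument starting from cylinder sets. Intersecting with a box keeps the
  measures finite, so that complements and limits of unions stay in L2.\<close>

lemma rect_approx_set:
  assumes S: "S \<in> sets (halfline_prod {1..m})" and r: "0 \<le> r"
  shows "rect_approx m (indicator (S \<inter> hbox m r))"
proof -
  let ?I = "{1..m}"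
  have G: "prod_algebra ?I (\<lambda>_. halfline) = {Pi\<^sub>E ?I X |X. X \<in> (\<Pi> j\<in>?I. sets halfline)}"
    by (rule prod_algebra_eq_finite) simp
  have cyl: "rect_approx m (indicator (Pi\<^sub>E ?I X \<inter> hbox m r))" if X: "X \<in> (\<Pi> j\<in>?I. sets halfline)" for X
  proof -
    have "Pi\<^sub>E ?I X \<inter> hbox m r = Pi\<^sub>E ?I (\<lambda>i. X i \<inter> {0..r})" by (auto simp: hbox_def PiE_iff)
    moreover have "rect_approx m (indicator (Pi\<^sub>E ?I (\<lambda>i. X i \<inter> {0..r})))"
      using X r Icc_halfline by (intro rect_approx_rect[where r = r] sets.Int) auto
    ultimately show ?thesis by simp
  qed
  have "Pi\<^sub>E ?I (\<lambda>_. {0..r}) \<inter> hbox m r = hbox m r" by (simp add: hbox_def)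
  then have bx: "rect_approx m (indicator (hbox m r))"
    using cyl[of "\<lambda>_. {0..r}"] Icc_halfline by simp
  have "S \<in> sigma_sets (\<Pi>\<^sub>E i\<in>?I. space halfline) (prod_algebra ?I (\<lambda>_. halfline))"
    using S unfolding halfline_prod_def sets_PiM .
  from Int_stable_prod_algebra prod_algebra_sets_into_space this show ?thesis
  proof (induction rule: sigma_sets_induct_disjoint)
    case (basic A)
    then obtain X where "X \<in> (\<Pi> j\<in>?I. sets halfline)" "A = Pi\<^sub>E ?I X" unfolding G by blast
    then show ?case using cyl by simp
  next
    case empty show ?case using rect_approx_0[of m] by simp
  next
    case (compl A)
    have "rect_approx m (\<lambda>z. indicator (hbox m r) z + (-1) * indicator (A \<inter> hbox m r) z)"
      by (intro rect_approx_add rect_approx_cmult bx compl)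
    then show ?case
    proof (rule rect_approx_cong)
      fix z assume "z \<in> space (halfline_prod {1..m})"
      then have "z \<in> (\<Pi>\<^sub>E i\<in>?I. space halfline)" by (simp add: space_halfline_prod)
      then show "indicator (hbox m r) z + (-1) * indicator (A \<inter> hbox m r) z = (indicator (((\<Pi>\<^sub>E i\<in>?I. space halfline) - A) \<inter> hbox m r) z :: real)"
        by (auto simp: indicator_def)
    qed
  next
    case (union A)
    have Am[measurable]: "A i \<in> sets (halfline_prod ?I)" for i using union(2) unfolding halfline_prod_def sets_PiM by auto
    have fin: "rect_approx m (\<lambda>z. \<Sum>i<n. indicator (A i \<inter> hbox m r) z)" for n
      by (induction n) (auto intro: rect_approx_0 rect_approx_add union)
    have eq: "(\<Sum>i<n. indicator (A i \<inter> hbox m r) z) = (indicator ((\<Union>i<n. A i) \<inter> hbox m r) z :: real)" for n z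
    proof -
      have "(\<Sum>i<n. indicator (A i \<inter> hbox m r) z) = (indicator (\<Union>i<n. A i \<inter> hbox m r) z :: real)"
        using union(1) by (intro indicator_UN_disjoint[symmetric]) (auto simp: disjoint_family_on_def)
      then show ?thesis by simp
    qed
    show ?case
    proof (rule rect_approx_lim)
      show "rect_approx m (\<lambda>z. \<Sum>i<n. indicator (A i \<inter> hbox m r) z)" for n by (rule fin)
      show "indicator ((\<Union>i. A i) \<inter> hbox m r) \<in> borel_measurable (halfline_prod {1..m})" by measurable
      show "(\<lambda>n. sqn (halfline_prod {1..m}) (\<lambda>z. (\<Sum>i<n. indicator (A i \<inter> hbox m r) z) - indicator ((\<Union>i. A i) \<inter> hbox m r) z)) \<longlonglongrightarrow> 0"
        unfolding eq
      proof (rule sqn_dominated[where w = "indicator (hbox m r)"])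
        show "AE z in halfline_prod {1..m}. (\<lambda>n. indicator ((\<Union>i<n. A i) \<inter> hbox m r) z) \<longlonglongrightarrow> (indicator ((\<Union>i. A i) \<inter> hbox m r) z :: real)"
        proof (intro AE_I2)
          fix z
          have "(\<lambda>n. indicator (\<Union>i<n. A i) z * indicator (hbox m r) z) \<longlonglongrightarrow> (indicator (\<Union>i. A i) z * indicator (hbox m r) z :: real)"
            by (intro tendsto_mult_right LIMSEQ_indicator_UN)
          then show "(\<lambda>n. indicator ((\<Union>i<n. A i) \<inter> hbox m r) z) \<longlonglongrightarrow> (indicator ((\<Union>i. A i) \<inter> hbox m r) z :: real)"
            by (simp add: indicator_inter_arith)
        qed
        show "sqn (halfline_prod {1..m}) (indicator (hbox m r)) < \<top>"
          unfolding sqn_indicator[OF hbox_sets] by (rule hbox_finite)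
        show "AE z in halfline_prod {1..m}. \<bar>indicator ((\<Union>i<n. A i) \<inter> hbox m r) z :: real\<bar> \<le> indicator (hbox m r) z" for n
          by (intro AE_I2) (auto simp: indicator_def)
        show "indicator ((\<Union>i<n. A i) \<inter> hbox m r) \<in> borel_measurable (halfline_prod {1..m})" for n by measurable
        show "indicator ((\<Union>i. A i) \<inter> hbox m r) \<in> borel_measurable (halfline_prod {1..m})" by measurable
        show "indicator (hbox m r) \<in> borel_measurable (halfline_prod {1..m})" by measurable
      qed
    qed
  qed
qed

lemma rect_approx_nonneg:
  assumes u: "u \<in> borel_measurable (halfline_prod {1..m})" "\<And>z. 0 \<le> u z" "sqn (halfline_prod {1..m}) u < \<top>" and r: "0 \<le> r"
  shows "rect_approx m (\<lambda>z. u z * indicator (hbox m r) z)"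
proof -
  let ?M = "halfline_prod {1..m}"
  \<comment> \<open>Finiteness is carried as a premise through the induction, because every summand
    and every approximant has to inherit it from the function above it.\<close>
  have "sqn ?M u < \<top> \<longrightarrow> rect_approx m (\<lambda>z. u z * indicator (hbox m r) z)"
    using u(1,2)
  proof (induction rule: borel_measurable_induct_real)
    case (set A)
    have "indicator (A \<inter> hbox m r) = (\<lambda>z. indicator A z * indicator (hbox m r) z :: real)"
      by (simp add: fun_eq_iff indicator_inter_arith)
    then show ?case using rect_approx_set[OF set r] by simp
  next
    case (mult u c)
    show ?case
    proof
      assume fin: "sqn ?M (\<lambda>x. c * u x) < \<top>"
      show "rect_approx m (\<lambda>z. c * u z * indicator (hbox m r) z)"
      proof (cases "c = 0")
        case True then show ?thesis using rect_approx_0 by simp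
      next
        case False
        have "sqn ?M u = ennreal ((1/c)\<^sup>2) * sqn ?M (\<lambda>x. c * u x)"
          using mult(2) False by (subst sqn_cmult[symmetric]) auto
        also have "\<dots> < \<top>" using fin by (simp add: ennreal_mult_less_top)
        finally have "rect_approx m (\<lambda>z. u z * indicator (hbox m r) z)" using mult by simp
        from rect_approx_cmult[OF this, of c] show ?thesis by (simp add: mult.assoc)
      qed
    qed
  next
    case (add u v)
    show ?case
    proof
      assume fin: "sqn ?M (\<lambda>x. v x + u x) < \<top>"
      have "sqn ?M u \<le> sqn ?M (\<lambda>x. v x + u x)" "sqn ?M v \<le> sqn ?M (\<lambda>x. v x + u x)"
        using add(2,4) by (auto intro!: sqn_mono AE_I2)
      then have "sqn ?M u < \<top>" "sqn ?M v < \<top>" using fin by (auto intro: le_less_trans)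
      then have "rect_approx m (\<lambda>z. v z * indicator (hbox m r) z + u z * indicator (hbox m r) z)"
        using add by (intro rect_approx_add) auto
      then show "rect_approx m (\<lambda>z. (v z + u z) * indicator (hbox m r) z)" by (simp add: distrib_right)
    qed
  next
    case (seq U)
    show ?case
    proof
      assume fin: "sqn ?M u < \<top>"
      have le: "U i z \<le> u z" if "z \<in> space ?M" for i z
        using seq(3) seq(4)[OF that] by (intro incseq_le) (auto simp: incseq_def le_fun_def)
      have "sqn ?M (U i) < \<top>" for i
      proof -
        have "sqn ?M (U i) \<le> sqn ?M u" using le seq(2) u(2) by (intro sqn_mono AE_I2) auto
        then show ?thesis using fin by (rule le_less_trans)
      qed
      then have ra: "rect_approx m (\<lambda>z. U i z * indicator (hbox m r) z)" for i using seq(5) by simp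
      show "rect_approx m (\<lambda>z. u z * indicator (hbox m r) z)"
      proof (rule rect_approx_lim[OF ra])
        show "(\<lambda>z. u z * indicator (hbox m r) z) \<in> borel_measurable ?M" using u(1) by measurable
        show "(\<lambda>k. sqn ?M (\<lambda>z. U k z * indicator (hbox m r) z - u z * indicator (hbox m r) z)) \<longlonglongrightarrow> 0"
        proof (rule sqn_dominated[where w = u])
          show "AE x in ?M. (\<lambda>k. U k x * indicator (hbox m r) x) \<longlonglongrightarrow> u x * indicator (hbox m r) x"
            by (intro AE_I2 tendsto_mult_right seq(4))
          show "AE x in ?M. \<bar>U k x * indicator (hbox m r) x\<bar> \<le> u x" for k
            using le seq(2) u(2) by (intro AE_I2) (auto simp: indicator_def)
        qed (use seq(1) u(1) fin in auto)
      qed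
    qed
  qed
  then show ?thesis using u(3) by simp
qed

theorem L2_rect_approx:
  assumes f: "f \<in> borel_measurable (halfline_prod {1..m})" "sqn (halfline_prod {1..m}) f < \<top>"
  shows "rect_approx m f"
proof -
  let ?M = "halfline_prod {1..m}"
  have part: "rect_approx m (\<lambda>z. max 0 (g z) * indicator (hbox m r) z)" if "g \<in> borel_measurable ?M" "sqn ?M g < \<top>" "0 \<le> r" for g r
  proof -
    have "sqn ?M (\<lambda>z. max 0 (g z)) \<le> sqn ?M g" by (intro sqn_mono AE_I2) auto
    then show ?thesis using that by (intro rect_approx_nonneg) (auto intro: le_less_trans)
  qed
  have "rect_approx m (\<lambda>z. max 0 (f z) * indicator (hbox m (real n)) z + (-1) * (max 0 (- f z) * indicator (hbox m (real n)) z))" for n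
    using f by (intro rect_approx_add rect_approx_cmult part) (auto simp: sqn_uminus)
  then have ra: "rect_approx m (\<lambda>z. f z * indicator (hbox m (real n)) z)" for n
    by (rule rect_approx_cong) (auto simp: max_def indicator_def)
  show ?thesis
  proof (rule rect_approx_lim[OF ra f(1)])
    show "(\<lambda>k. sqn ?M (\<lambda>z. f z * indicator (hbox m (real k)) z - f z)) \<longlonglongrightarrow> 0"
    proof (rule sqn_dominated[where w = "\<lambda>z. \<bar>f z\<bar>"])
      show "AE z in ?M. (\<lambda>k. f z * indicator (hbox m (real k)) z) \<longlonglongrightarrow> f z"
        using AE_space
      proof eventually_elim
        case (elim z)
        define R where "R = (\<Sum>i\<in>{1..m}. z i)"
        have zi: "0 \<le> z i" if "i \<in> {1..m}" for i using elim that by (auto simp: space_halfline_prod PiE_iff)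
        have "z i \<le> R" if "i \<in> {1..m}" for i unfolding R_def using that zi by (intro member_le_sum) auto
        then have "z \<in> hbox m (real k)" if "R \<le> real k" for k
          using that elim by (force simp: hbox_def space_halfline_prod PiE_iff)
        moreover obtain k0 :: nat where "R \<le> real k0" using real_arch_simple by blast
        ultimately have "\<forall>\<^sub>F k in sequentially. f z * indicator (hbox m (real k)) z = f z"
          by (intro eventually_sequentiallyI[of k0]) (auto simp: indicator_def)
        then show ?case by (rule tendsto_eventually)
      qed
      show "sqn ?M (\<lambda>z. \<bar>f z\<bar>) < \<top>" using f by (simp add: sqn_def)
      show "AE z in ?M. \<bar>f z * indicator (hbox m (real k)) z\<bar> \<le> \<bar>f z\<bar>" for k
        by (intro AE_I2) (auto simp: indicator_def)
      note [measurable] = f(1)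
      show "(\<lambda>z. f z * indicator (hbox m (real k)) z) \<in> borel_measurable ?M" for k by measurable
      show "f \<in> borel_measurable ?M" "(\<lambda>z. \<bar>f z\<bar>) \<in> borel_measurable ?M" by measurable
    qed
  qed
qed

section \<open>Versions of the integrals and their sections\<close>

declare One_nat_def[simp del]

lemma sqn_halfline_prod_Suc:
  assumes f: "f \<in> borel_measurable (halfline_prod {1..Suc m})"
  shows "(\<lambda>x. sqn (halfline_prod {1..m}) (\<lambda>y. f (y(Suc m := x)))) \<in> borel_measurable halfline"
    and "(\<integral>\<^sup>+x. sqn (halfline_prod {1..m}) (\<lambda>y. f (y(Suc m := x))) \<partial>halfline) = sqn (halfline_prod {1..Suc m}) f"
proof -
  interpret Q: sigma_finite_measure "halfline_prod {1..m}" by (rule sigma_finite_halfline_prod) simp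
  have mf: "(\<lambda>z. ennreal ((f z)\<^sup>2)) \<in> borel_measurable (halfline_prod (insert (Suc m) {1..m}))"
    unfolding Suc_insert[symmetric] using f by measurable
  have "(\<lambda>q. ennreal ((f ((snd q)(Suc m := fst q)))\<^sup>2)) \<in> borel_measurable (halfline \<Otimes>\<^sub>M halfline_prod {1..m})"
    using measurable_compose[OF measurable_compose[OF measurable_pair_swap' measurable_halfline_upd[of "Suc m" "{1..m}"]] mf]
    by (simp add: split_beta)
  then show "(\<lambda>x. sqn (halfline_prod {1..m}) (\<lambda>y. f (y(Suc m := x)))) \<in> borel_measurable halfline"
    unfolding sqn_def using Q.borel_measurable_nn_integral_fst by fastforce
  show "(\<integral>\<^sup>+x. sqn (halfline_prod {1..m}) (\<lambda>y. f (y(Suc m := x))) \<partial>halfline) = sqn (halfline_prod {1..Suc m}) f"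
    unfolding sqn_def Suc_insert using nn_integral_halfline_prod_insert[OF _ _ mf] by simp
qed

lemma measurable_section:
  assumes "f \<in> borel_measurable (halfline_prod {1..Suc m})" "0 \<le> x"
  shows "(\<lambda>y. f (y(Suc m := x))) \<in> borel_measurable (halfline_prod {1..m})"
  using measurable_compose[OF measurable_halfline_upd2[OF assms(2), of "Suc m" "{1..m}"], of f borel] assms(1)
  by (simp add: Suc_insert)

lemma eint_sec_neg: "eint m (sec k x (neg_rects E)) \<nu> = - eint m (sec k x E) \<nu>"
  by (induction E) (auto simp: neg_rects_def sec_def)

lemma eint_sec_append: "eint m (sec k x (E @ E')) \<nu> = eint m (sec k x E) \<nu> + eint m (sec k x E') \<nu>"
  by (simp add: sec_def)

lemma quarter_sum_le:
  assumes "0 \<le> B" "k \<le> j" "a \<le> ennreal (B * (1/4) ^ j)" "b \<le> ennreal (B * (1/4) ^ k)"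
  shows "2 * a + 2 * b \<le> ennreal (4 * B * (1/4) ^ k)"
proof -
  have "(1/4::real) ^ j \<le> (1/4) ^ k" using assms by (intro power_decreasing) auto
  then have "a \<le> ennreal (B * (1/4) ^ k)"
    using assms by (intro order_trans[OF assms(3)] ennreal_leI mult_left_mono) auto
  then have "2 * a + 2 * b \<le> 2 * ennreal (B * (1/4) ^ k) + 2 * ennreal (B * (1/4) ^ k)"
    using assms(4) by (intro add_mono mult_left_mono) auto
  also have "2 * ennreal (B * (1/4) ^ k) = ennreal (2 * (B * (1/4) ^ k))"
    using assms(1) by (subst ennreal_mult) auto
  also have "ennreal (2 * (B * (1/4) ^ k)) + ennreal (2 * (B * (1/4) ^ k)) = ennreal (2 * (B * (1/4) ^ k) + 2 * (B * (1/4) ^ k))"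
    using assms(1) by (intro ennreal_plus[symmetric]) auto
  also have "2 * (B * (1/4) ^ k) + 2 * (B * (1/4) ^ k) = 4 * B * (1/4) ^ k" by simp
  finally show ?thesis .
qed

text \<open>Fubini for null sets, with the product built up one coordinate at a time; freezing the
  new coordinate is what adding a point does to a kernel.\<close>

lemma AE_halfline_prod_insert:
  assumes I: "finite I" "i \<notin> I" and Q: "AE z in halfline_prod (insert i I). Q z"
  shows "AE x in halfline. AE y in halfline_prod I. Q (y(i := x))"
proof -
  from Q obtain S where S: "{z \<in> space (halfline_prod (insert i I)). \<not> Q z} \<subseteq> S" "emeasure (halfline_prod (insert i I)) S = 0" "S \<in> sets (halfline_prod (insert i I))"
    by (rule AE_E)
  have Sm: "(\<lambda>z. indicator S z :: ennreal) \<in> borel_measurable (halfline_prod (insert i I))" using S(3) by simp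
  interpret Q: sigma_finite_measure "halfline_prod I" by (rule sigma_finite_halfline_prod) (rule I)
  have jm: "(\<lambda>q. indicator S ((snd q)(i := fst q)) :: ennreal) \<in> borel_measurable (halfline \<Otimes>\<^sub>M halfline_prod I)"
    using measurable_compose[OF measurable_compose[OF measurable_pair_swap' measurable_halfline_upd[of i I]] Sm]
    by (simp add: split_beta)
  then have m: "(\<lambda>x. \<integral>\<^sup>+y. indicator S (y(i := x)) \<partial>halfline_prod I) \<in> borel_measurable halfline"
    using Q.borel_measurable_nn_integral_fst by fastforce
  have "(\<integral>\<^sup>+x. (\<integral>\<^sup>+y. indicator S (y(i := x)) \<partial>halfline_prod I) \<partial>halfline) = 0"
    using nn_integral_halfline_prod_insert[OF I Sm] S by simp
  then have "AE x in halfline. (\<integral>\<^sup>+y. indicator S (y(i := x)) \<partial>halfline_prod I) = 0"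
    using m by (subst (asm) nn_integral_0_iff_AE) auto
  then show ?thesis using AE_space
  proof eventually_elim
    case (elim x)
    then have x: "0 \<le> x" by simp
    have "(\<lambda>y. indicator S (y(i := x)) :: ennreal) \<in> borel_measurable (halfline_prod I)"
      by (rule measurable_compose[OF measurable_halfline_upd2[OF x] Sm])
    then have "AE y in halfline_prod I. indicator S (y(i := x)) = (0 :: ennreal)"
      using elim(1) by (subst (asm) nn_integral_0_iff_AE) auto
    then show ?case using AE_space
    proof eventually_elim
      case (elim y)
      have "y(i := x) \<in> space (halfline_prod (insert i I))"
        using elim(2) x I by (auto simp: space_halfline_prod PiE_iff extensional_def)
      then show ?case using elim(1) S(1) by (auto simp: indicator_def split: if_splits)
    qed
  qed
qed

context poisson_halfline
begin

lemma EI_append: "EI m (E @ E') \<omega> = EI m E \<omega> + EI m E' \<omega>"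
  and EI_neg: "EI m (neg_rects E) \<omega> = - EI m E \<omega>"
  by (simp_all add: EI_def)

text \<open>In contrast to \<open>poisson_integral_version\<close>, neither kernel nor approximants
  are symmetrized, and measurability of the kernel is part of the notion. In this form it is stable
  under differences and under freezing a variable.\<close>

definition version :: "nat \<Rightarrow> ((nat \<Rightarrow> real) \<Rightarrow> real) \<Rightarrow> ('a \<Rightarrow> real) \<Rightarrow> bool" where
  "version m \<psi> F \<longleftrightarrow> F \<in> borel_measurable P \<and> \<psi> \<in> borel_measurable (halfline_prod {1..m}) \<and>
     (\<exists>E. (\<forall>k. disj_rects m (E k)) \<and>
        (\<lambda>k. sqn (halfline_prod {1..m}) (\<lambda>z. elementary_fun m (E k) z - \<psi> z)) \<longlonglongrightarrow> 0 \<and>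
        (\<lambda>k. sqn P (\<lambda>\<omega>. EI m (E k) \<omega> - F \<omega>)) \<longlonglongrightarrow> 0)"

lemma versionD: "version m \<psi> F \<Longrightarrow> F \<in> borel_measurable P"
  "version m \<psi> F \<Longrightarrow> \<psi> \<in> borel_measurable (halfline_prod {1..m})"
  by (auto simp: version_def)

lemma version_fast:
  assumes "version m \<psi> F"
  obtains E where "\<And>k. disj_rects m (E k)"
    "\<And>k. sqn (halfline_prod {1..m}) (\<lambda>z. elementary_fun m (E k) z - \<psi> z) \<le> ennreal ((1/4) ^ k)"
    "\<And>k. sqn P (\<lambda>\<omega>. EI m (E k) \<omega> - F \<omega>) \<le> ennreal ((1/4) ^ k)"
proof -
  obtain E where E: "\<And>k. disj_rects m (E k)"
    "(\<lambda>k. sqn (halfline_prod {1..m}) (\<lambda>z. elementary_fun m (E k) z - \<psi> z)) \<longlonglongrightarrow> 0"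
    "(\<lambda>k. sqn P (\<lambda>\<omega>. EI m (E k) \<omega> - F \<omega>)) \<longlonglongrightarrow> 0"
    using assms by (auto simp: version_def)
  have "(\<lambda>k. sqn (halfline_prod {1..m}) (\<lambda>z. elementary_fun m (E k) z - \<psi> z) + sqn P (\<lambda>\<omega>. EI m (E k) \<omega> - F \<omega>)) \<longlonglongrightarrow> 0"
    using tendsto_add[OF E(2,3)] by simp
  then obtain r where r: "\<And>k. sqn (halfline_prod {1..m}) (\<lambda>z. elementary_fun m (E (r k)) z - \<psi> z) + sqn P (\<lambda>\<omega>. EI m (E (r k)) \<omega> - F \<omega>) \<le> ennreal ((1/4) ^ k)"
    by (rule geometric_subseq) blast
  show ?thesis
  proof (rule that[of "\<lambda>k. E (r k)"])
    show "sqn (halfline_prod {1..m}) (\<lambda>z. elementary_fun m (E (r k)) z - \<psi> z) \<le> ennreal ((1/4) ^ k)" for k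
      using r[of k] by (rule order_trans[rotated]) simp
    show "sqn P (\<lambda>\<omega>. EI m (E (r k)) \<omega> - F \<omega>) \<le> ennreal ((1/4) ^ k)" for k
      using r[of k] by (rule order_trans[rotated]) simp
  qed (rule E)
qed

text \<open>A null kernel makes the approximants small in L2, and the isometry bound carries this
  over to their integrals. With \<open>version_diff\<close> it yields uniqueness of
  versions.\<close>

lemma version_null:
  assumes v: "version m \<psi> F" and z: "AE z in halfline_prod {1..m}. \<psi> z = 0"
  shows "AE \<omega> in P. F \<omega> = 0"
proof -
  obtain E where E: "\<And>k. disj_rects m (E k)"
    "(\<lambda>k. sqn (halfline_prod {1..m}) (\<lambda>z. elementary_fun m (E k) z - \<psi> z)) \<longlonglongrightarrow> 0"
    "(\<lambda>k. sqn P (\<lambda>\<omega>. EI m (E k) \<omega> - F \<omega>)) \<longlonglongrightarrow> 0"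
    using v by (auto simp: version_def)
  obtain C where C: "0 \<le> C" "\<And>E. disj_rects m E \<Longrightarrow> sqn P (EI m E) \<le> ennreal C * sqn (halfline_prod {1..m}) (elementary_fun m E)"
    using sqn_EI_le by blast
  have eq: "sqn (halfline_prod {1..m}) (elementary_fun m (E k)) = sqn (halfline_prod {1..m}) (\<lambda>z. elementary_fun m (E k) z - \<psi> z)" for k
    by (rule sqn_cong_AE, use z in eventually_elim) simp
  have "(\<lambda>k. sqn P (\<lambda>\<omega>. EI m (E k) \<omega> - 0)) \<longlonglongrightarrow> 0"
  proof (rule tendsto_0_ennreal_le)
    show "(\<lambda>k. ennreal C * sqn (halfline_prod {1..m}) (\<lambda>z. elementary_fun m (E k) z - \<psi> z)) \<longlonglongrightarrow> 0"
      using ennreal_tendsto_cmult[OF _ E(2), of "ennreal C"] by simp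
    show "sqn P (\<lambda>\<omega>. EI m (E k) \<omega> - 0) \<le> ennreal C * sqn (halfline_prod {1..m}) (\<lambda>z. elementary_fun m (E k) z - \<psi> z)" for k
      using C(2)[OF E(1)] by (simp add: eq)
  qed
  from sqn_limit_unique[OF measurable_EI[OF E(1)] versionD(1)[OF v] _ E(3) this] show ?thesis by simp
qed

lemma version_diff:
  assumes v: "version m \<psi> F" "version m \<psi>' F'"
  shows "version m (\<lambda>z. \<psi> z - \<psi>' z) (\<lambda>\<omega>. F \<omega> - F' \<omega>)"
proof -
  obtain E where E: "\<And>k. disj_rects m (E k)"
    "(\<lambda>k. sqn (halfline_prod {1..m}) (\<lambda>z. elementary_fun m (E k) z - \<psi> z)) \<longlonglongrightarrow> 0"
    "(\<lambda>k. sqn P (\<lambda>\<omega>. EI m (E k) \<omega> - F \<omega>)) \<longlonglongrightarrow> 0"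
    using v by (auto simp: version_def)
  obtain E' where E': "\<And>k. disj_rects m (E' k)"
    "(\<lambda>k. sqn (halfline_prod {1..m}) (\<lambda>z. elementary_fun m (E' k) z - \<psi>' z)) \<longlonglongrightarrow> 0"
    "(\<lambda>k. sqn P (\<lambda>\<omega>. EI m (E' k) \<omega> - F' \<omega>)) \<longlonglongrightarrow> 0"
    using v by (auto simp: version_def)
  note [measurable] = versionD[OF v(1)] versionD[OF v(2)] measurable_efun[OF E(1)] measurable_efun[OF E'(1)] measurable_EI[OF E(1)] measurable_EI[OF E'(1)]
  have n1: "(\<lambda>k. sqn (halfline_prod {1..m}) (\<lambda>z. - elementary_fun m (E' k) z - (- \<psi>' z))) \<longlonglongrightarrow> 0"
    using E'(2) by (subst sqn_diff_commute) (simp add: algebra_simps)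
  have n2: "(\<lambda>k. sqn P (\<lambda>\<omega>. - EI m (E' k) \<omega> - (- F' \<omega>))) \<longlonglongrightarrow> 0"
    using E'(3) by (subst sqn_diff_commute) (simp add: algebra_simps)
  have "(\<lambda>k. sqn (halfline_prod {1..m}) (\<lambda>z. (elementary_fun m (E k) z + - elementary_fun m (E' k) z) - (\<psi> z + - \<psi>' z))) \<longlonglongrightarrow> 0"
    by (rule sqn_tendsto_add[OF _ _ _ _ E(2) n1]) auto
  moreover have "(\<lambda>k. sqn P (\<lambda>z. (EI m (E k) z + - EI m (E' k) z) - (F z + - F' z))) \<longlonglongrightarrow> 0"
    by (rule sqn_tendsto_add[OF _ _ _ _ E(3) n2]) auto
  ultimately show ?thesis unfolding version_def using E(1) E'(1)
    by (intro conjI exI[of _ "\<lambda>k. E k @ neg_rects (E' k)"]) (auto simp: EI_append EI_neg)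
qed

lemma version_unique:
  assumes "version m \<psi> F" "version m \<psi>' F'" "AE z in halfline_prod {1..m}. \<psi> z = \<psi>' z"
  shows "AE \<omega> in P. F \<omega> = F' \<omega>"
  using version_null[OF version_diff[OF assms(1,2)]] assms(3) by (auto elim!: eventually_mono)

lemma version_cong:
  assumes v: "version m \<psi> F" and eq: "\<And>z. z \<in> space (halfline_prod {1..m}) \<Longrightarrow> \<psi> z = \<psi>' z"
  shows "version m \<psi>' F"
proof -
  have "sqn (halfline_prod {1..m}) (\<lambda>z. elementary_fun m E z - \<psi> z) = sqn (halfline_prod {1..m}) (\<lambda>z. elementary_fun m E z - \<psi>' z)" for E
    by (rule sqn_cong) (simp add: eq)
  then show ?thesis using v measurable_cong[of "halfline_prod {1..m}" \<psi> \<psi>' borel, OF eq] by (simp add: version_def)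
qed

lemma EI_fast_limit:
  assumes E: "\<And>k. disj_rects m (E k)" and \<psi>[measurable]: "\<psi> \<in> borel_measurable (halfline_prod {1..m})" and B: "0 \<le> B"
    and b: "\<And>k. sqn (halfline_prod {1..m}) (\<lambda>z. elementary_fun m (E k) z - \<psi> z) \<le> ennreal (B * (1/4) ^ k)"
  shows "\<exists>F\<in>borel_measurable P. (\<lambda>k. sqn P (\<lambda>\<omega>. EI m (E k) \<omega> - F \<omega>)) \<longlonglongrightarrow> 0"
proof -
  obtain C where C: "0 \<le> C" "\<And>E. disj_rects m E \<Longrightarrow> sqn P (EI m E) \<le> ennreal C * sqn (halfline_prod {1..m}) (elementary_fun m E)"
    using sqn_EI_le by blast
  note [measurable] = measurable_efun[OF E] measurable_EI[OF E]
  have ca: "sqn P (\<lambda>\<omega>. EI m (E j) \<omega> - EI m (E k) \<omega>) \<le> ennreal ((C * (4 * B)) * (1/4) ^ k)" if "k \<le> j" for j k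
  proof -
    have "sqn P (\<lambda>\<omega>. EI m (E j) \<omega> - EI m (E k) \<omega>) = sqn P (EI m (E j @ neg_rects (E k)))"
      by (intro sqn_cong) (simp add: EI_append EI_neg)
    also have "\<dots> \<le> ennreal C * sqn (halfline_prod {1..m}) (elementary_fun m (E j @ neg_rects (E k)))"
      by (rule C) (simp add: E)
    also have "sqn (halfline_prod {1..m}) (elementary_fun m (E j @ neg_rects (E k))) = sqn (halfline_prod {1..m}) (\<lambda>z. elementary_fun m (E j) z - elementary_fun m (E k) z)"
      by (intro sqn_cong) simp
    also have "\<dots> \<le> 2 * sqn (halfline_prod {1..m}) (\<lambda>z. elementary_fun m (E j) z - \<psi> z) + 2 * sqn (halfline_prod {1..m}) (\<lambda>z. \<psi> z - elementary_fun m (E k) z)"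
      by (rule sqn_triangle) auto
    also have "\<dots> \<le> ennreal (4 * B * (1/4) ^ k)"
      using b[of k] by (intro quarter_sum_le[OF B that b]) (simp add: sqn_diff_commute)
    finally show ?thesis using C(1) B by (simp add: ennreal_mult[symmetric] mult_left_mono mult.assoc)
  qed
  have CB: "0 \<le> C * (4 * B)" using C(1) B by simp
  obtain F where F: "F \<in> borel_measurable P" "\<And>k. sqn P (\<lambda>\<omega>. EI m (E k) \<omega> - F \<omega>) \<le> ennreal ((C * (4 * B)) * (1/4) ^ k)"
    by (rule sqn_fast_Cauchy_limit[OF measurable_EI[OF E] CB ca]) blast+
  have "(\<lambda>k. ennreal ((C * (4 * B)) * (1/4) ^ k)) \<longlonglongrightarrow> ennreal ((C * (4 * B)) * 0)"
    by (intro tendsto_ennrealI tendsto_mult tendsto_const LIMSEQ_power_zero) simp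
  then have g0: "(\<lambda>k. ennreal ((C * (4 * B)) * (1/4) ^ k)) \<longlonglongrightarrow> 0" by simp
  have "(\<lambda>k. sqn P (\<lambda>\<omega>. EI m (E k) \<omega> - F \<omega>)) \<longlonglongrightarrow> 0"
    by (rule tendsto_0_ennreal_le[OF g0 F(2)])
  with F(1) show ?thesis by blast
qed

text \<open>Freezing the last variable turns an integral of order \<open>Suc m\<close> into a process of integrals of
  order \<open>m\<close>, jointly measurable in the frozen variable.\<close>

lemma section_process:
  assumes G: "\<And>k. disj_rects (Suc m) (G k)" and \<psi>[measurable]: "\<psi> \<in> borel_measurable (halfline_prod {1..Suc m})" and B: "0 \<le> B"
    and b: "\<And>k. sqn (halfline_prod {1..Suc m}) (\<lambda>z. elementary_fun (Suc m) (G k) z - \<psi> z) \<le> ennreal (B * (1/4) ^ k)"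
  obtains V D where "V \<in> borel_measurable (P \<Otimes>\<^sub>M halfline)"
    "AE p in P \<Otimes>\<^sub>M halfline. (\<lambda>k. EI m (sec (Suc m) (snd p) (G k)) (fst p)) \<longlonglongrightarrow> V p"
    "AE x in halfline. version m (\<lambda>y. \<psi> (y(Suc m := x))) (\<lambda>\<omega>. V (\<omega>, x))"
    "0 \<le> D" "\<And>k. sqn (P \<Otimes>\<^sub>M halfline) (\<lambda>p. EI m (sec (Suc m) (snd p) (G k)) (fst p) - V p) \<le> ennreal (D * (1/4) ^ k)"
proof -
  define a where "a k = (\<lambda>p. EI m (sec (Suc m) (snd p) (G k)) (fst p))" for k
  have am[measurable]: "a k \<in> borel_measurable (P \<Otimes>\<^sub>M halfline)" for k unfolding a_def by (rule measurable_EI_sec[OF G])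
  note [measurable] = measurable_efun[OF G]
  obtain C where C: "0 \<le> C" "\<And>E. disj_rects m E \<Longrightarrow> sqn P (EI m E) \<le> ennreal C * sqn (halfline_prod {1..m}) (elementary_fun m E)"
    using sqn_EI_le by blast
  have ca: "sqn (P \<Otimes>\<^sub>M halfline) (\<lambda>p. a j p - a k p) \<le> ennreal ((C * (4 * B)) * (1/4) ^ k)" if "k \<le> j" for j k
  proof -
    have "sqn (P \<Otimes>\<^sub>M halfline) (\<lambda>p. a j p - a k p) = sqn (P \<Otimes>\<^sub>M halfline) (\<lambda>p. EI m (sec (Suc m) (snd p) (G j @ neg_rects (G k))) (fst p))"
      by (intro sqn_cong) (simp add: a_def EI_def eint_sec_append eint_sec_neg)
    also have "\<dots> \<le> ennreal C * sqn (halfline_prod {1..Suc m}) (elementary_fun (Suc m) (G j @ neg_rects (G k)))"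
      by (rule sqn_EI_sec_le[OF _ C]) (simp add: G)
    also have "sqn (halfline_prod {1..Suc m}) (elementary_fun (Suc m) (G j @ neg_rects (G k))) = sqn (halfline_prod {1..Suc m}) (\<lambda>z. elementary_fun (Suc m) (G j) z - elementary_fun (Suc m) (G k) z)"
      by (intro sqn_cong) simp
    also have "\<dots> \<le> 2 * sqn (halfline_prod {1..Suc m}) (\<lambda>z. elementary_fun (Suc m) (G j) z - \<psi> z) + 2 * sqn (halfline_prod {1..Suc m}) (\<lambda>z. \<psi> z - elementary_fun (Suc m) (G k) z)"
      by (rule sqn_triangle) auto
    also have "\<dots> \<le> ennreal (4 * B * (1/4) ^ k)"
      using b[of k] by (intro quarter_sum_le[OF B that b]) (simp add: sqn_diff_commute)
    finally show ?thesis using C(1) B by (simp add: ennreal_mult[symmetric] mult_left_mono mult.assoc)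
  qed
  define D where "D = C * (4 * B)"
  have D: "0 \<le> D" using C B by (simp add: D_def)
  obtain V where V[measurable]: "V \<in> borel_measurable (P \<Otimes>\<^sub>M halfline)" and lim: "AE p in P \<Otimes>\<^sub>M halfline. (\<lambda>k. a k p) \<longlonglongrightarrow> V p"
    and Vb: "\<And>k. sqn (P \<Otimes>\<^sub>M halfline) (\<lambda>p. a k p - V p) \<le> ennreal (D * (1/4) ^ k)"
    by (rule sqn_fast_Cauchy_limit[OF am D ca[folded D_def]]) blast+
  have f1: "AE x in halfline. (\<lambda>k. sqn (halfline_prod {1..m}) (\<lambda>y. elementary_fun (Suc m) (G k) (y(Suc m := x)) - \<psi> (y(Suc m := x)))) \<longlonglongrightarrow> 0"
  proof (rule AE_tendsto_0_ennreal[OF _ B])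
    show "(\<lambda>x. sqn (halfline_prod {1..m}) (\<lambda>y. elementary_fun (Suc m) (G k) (y(Suc m := x)) - \<psi> (y(Suc m := x)))) \<in> borel_measurable halfline" for k
      by (rule sqn_halfline_prod_Suc(1)[of "\<lambda>z. elementary_fun (Suc m) (G k) z - \<psi> z"]) measurable
    show "(\<integral>\<^sup>+x. sqn (halfline_prod {1..m}) (\<lambda>y. elementary_fun (Suc m) (G k) (y(Suc m := x)) - \<psi> (y(Suc m := x))) \<partial>halfline) \<le> ennreal (B * (1/4) ^ k)" for k
      by (subst sqn_halfline_prod_Suc(2)[of "\<lambda>z. elementary_fun (Suc m) (G k) z - \<psi> z"]) (measurable, rule b)
  qed auto
  have f2: "AE x in halfline. (\<lambda>k. sqn P (\<lambda>\<omega>. a k (\<omega>, x) - V (\<omega>, x))) \<longlonglongrightarrow> 0"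
  proof (rule AE_tendsto_0_ennreal[OF _ D])
    show "(\<lambda>x. sqn P (\<lambda>\<omega>. a k (\<omega>, x) - V (\<omega>, x))) \<in> borel_measurable halfline" for k
      unfolding sqn_def by measurable
    show "(\<integral>\<^sup>+x. sqn P (\<lambda>\<omega>. a k (\<omega>, x) - V (\<omega>, x)) \<partial>halfline) \<le> ennreal (D * (1/4) ^ k)" for k
      using Vb[of k] unfolding sqn_def by (subst PM.nn_integral_snd) auto
  qed auto
  have "AE x in halfline. version m (\<lambda>y. \<psi> (y(Suc m := x))) (\<lambda>\<omega>. V (\<omega>, x))"
    using f1 f2 AE_space
  proof eventually_elim
    case (elim x)
    show ?case unfolding version_def
    proof (intro conjI exI[of _ "\<lambda>k. sec (Suc m) x (G k)"] allI)
      show "(\<lambda>\<omega>. V (\<omega>, x)) \<in> borel_measurable P" using elim(3) by measurable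
      show "(\<lambda>y. \<psi> (y(Suc m := x))) \<in> borel_measurable (halfline_prod {1..m})" using elim(3) by (intro measurable_section \<psi>) simp
      show "disj_rects m (sec (Suc m) x (G k))" for k by (rule disj_rects_sec[OF G])
      show "(\<lambda>k. sqn (halfline_prod {1..m}) (\<lambda>z. elementary_fun m (sec (Suc m) x (G k)) z - \<psi> (z(Suc m := x)))) \<longlonglongrightarrow> 0"
        using elim(1) by (simp add: efun_sec)
      show "(\<lambda>k. sqn P (\<lambda>\<omega>. EI m (sec (Suc m) x (G k)) \<omega> - V (\<omega>, x))) \<longlonglongrightarrow> 0"
        using elim(2) by (simp add: a_def)
    qed
  qed
  then show ?thesis using V lim D Vb unfolding a_def by (intro that) auto
qed

lemma L2_fast_rects:
  assumes "f \<in> borel_measurable (halfline_prod {1..m})" "sqn (halfline_prod {1..m}) f < \<top>"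
  obtains E where "\<And>k. disj_rects m (E k)" "\<And>k. sqn (halfline_prod {1..m}) (\<lambda>z. elementary_fun m (E k) z - f z) \<le> ennreal (1 * (1/4) ^ k)"
proof -
  have "\<exists>E. disj_rects m E \<and> sqn (halfline_prod {1..m}) (\<lambda>z. elementary_fun m E z - f z) \<le> ennreal (1 * (1/4) ^ k)" for k
    using rect_approxD[OF L2_rect_approx[OF assms], of "1 * (1/4) ^ k"] by auto
  then show ?thesis using that by metis
qed

text \<open>Mecke's formula in the limit: adding an independent point to the configuration turns \<open>F\<close> into
  \<open>F + V\<close>, where \<open>V\<close> is the integral of the sections.\<close>

lemma mecke_version:
  assumes v: "version (Suc m) \<psi> F"
  obtains V where "V \<in> borel_measurable (P \<Otimes>\<^sub>M halfline)"
    "AE x in halfline. version m (\<lambda>y. \<Sum>i=1..Suc m. \<psi> (y(Suc m := x) \<circ> Transposition.transpose i (Suc m))) (\<lambda>\<omega>. V (\<omega>, x))"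
    "\<And>K B. K \<in> sets halfline \<Longrightarrow> emeasure halfline K < \<infinity> \<Longrightarrow> B \<in> sets borel \<Longrightarrow>
      (\<integral>\<^sup>+\<omega>. ennreal (measure (N \<omega>) K) * indicator B (F \<omega>) \<partial>P) =
      (\<integral>\<^sup>+p. indicator K (snd p) * indicator B (F (fst p) + V p) \<partial>(P \<Otimes>\<^sub>M halfline))"
proof -
  note Fm[measurable] = versionD(1)[OF v] and \<psi>[measurable] = versionD(2)[OF v]
  obtain E where E: "\<And>k. disj_rects (Suc m) (E k)"
    "\<And>k. sqn (halfline_prod {1..Suc m}) (\<lambda>z. elementary_fun (Suc m) (E k) z - \<psi> z) \<le> ennreal ((1/4) ^ k)"
    "\<And>k. sqn P (\<lambda>\<omega>. EI (Suc m) (E k) \<omega> - F \<omega>) \<le> ennreal ((1/4) ^ k)"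
    using version_fast[OF v] by blast
  note [measurable] = measurable_efun[OF E(1)] measurable_EI[OF E(1)]
  define \<psi>' where "\<psi>' z = (\<Sum>i=1..Suc m. \<psi> (z \<circ> Transposition.transpose i (Suc m)))" for z
  have pm: "(\<lambda>z. f (z \<circ> Transposition.transpose i (Suc m))) \<in> borel_measurable (halfline_prod {1..Suc m})"
    if "i \<in> {1..Suc m}" "f \<in> borel_measurable (halfline_prod {1..Suc m})" for i and f :: "_ \<Rightarrow> real"
    by (rule measurable_compose[OF measurable_permute[OF transpose_permutes[OF that(1)]] that(2)]) simp
  have \<psi>'m[measurable]: "\<psi>' \<in> borel_measurable (halfline_prod {1..Suc m})"
    unfolding \<psi>'_def by (intro borel_measurable_sum pm \<psi>)
  define D where "D k = swaps (Suc m) (E k)" for k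
  have D: "disj_rects (Suc m) (D k)" for k unfolding D_def by (rule disj_rects_swaps[OF E(1)])
  define B where "B = real (Suc m) * real (Suc m)"
  have B: "0 \<le> B" by (simp add: B_def)
  \<comment> \<open>Transpositions preserve the norm, so the swapped approximants converge to the
    swapped kernel at the old rate, up to the factor \<open>B\<close>.\<close>
  have Db: "sqn (halfline_prod {1..Suc m}) (\<lambda>z. elementary_fun (Suc m) (D k) z - \<psi>' z) \<le> ennreal (B * (1/4) ^ k)" for k
  proof -
    define f where "f z = elementary_fun (Suc m) (E k) z - \<psi> z" for z
    have f[measurable]: "f \<in> borel_measurable (halfline_prod {1..Suc m})" unfolding f_def by measurable
    have "sqn (halfline_prod {1..Suc m}) (\<lambda>z. elementary_fun (Suc m) (D k) z - \<psi>' z) =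
       sqn (halfline_prod {1..Suc m}) (\<lambda>z. \<Sum>i\<in>{1..Suc m}. f (z \<circ> Transposition.transpose i (Suc m)))"
      by (simp only: D_def efun_swaps \<psi>'_def f_def sum_subtractf)
    also have "\<dots> \<le> of_nat (card {1..Suc m}) * (\<Sum>i\<in>{1..Suc m}. sqn (halfline_prod {1..Suc m}) (\<lambda>z. f (z \<circ> Transposition.transpose i (Suc m))))"
      by (intro sqn_sum_le pm f) auto
    also have "(\<Sum>i\<in>{1..Suc m}. sqn (halfline_prod {1..Suc m}) (\<lambda>z. f (z \<circ> Transposition.transpose i (Suc m)))) = (\<Sum>i\<in>{1..Suc m}. sqn (halfline_prod {1..Suc m}) f)"
      by (intro sum.cong refl sqn_permute transpose_permutes f) auto
    also have "of_nat (card {1..Suc m}) * \<dots> = ennreal B * sqn (halfline_prod {1..Suc m}) f"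
      by (simp add: B_def ennreal_mult ennreal_of_nat_eq_real_of_nat mult.assoc del: of_nat_Suc)
    also have "\<dots> \<le> ennreal B * ennreal ((1/4) ^ k)" using E(2)[of k] by (intro mult_left_mono) (auto simp: f_def[abs_def])
    also have "\<dots> = ennreal (B * (1/4) ^ k)" using B by (simp add: ennreal_mult)
    finally show ?thesis .
  qed
  obtain V where V[measurable]: "V \<in> borel_measurable (P \<Otimes>\<^sub>M halfline)"
    and Vlim: "AE p in P \<Otimes>\<^sub>M halfline. (\<lambda>k. EI m (sec (Suc m) (snd p) (D k)) (fst p)) \<longlonglongrightarrow> V p"
    and Vv: "AE x in halfline. version m (\<lambda>y. \<psi>' (y(Suc m := x))) (\<lambda>\<omega>. V (\<omega>, x))"
    using section_process[OF D \<psi>'m B Db] by blast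
  have Flim: "AE \<omega> in P. (\<lambda>k. EI (Suc m) (E k) \<omega>) \<longlonglongrightarrow> F \<omega>"
    by (rule sqn_tendsto_AE_subseq[where C = 1]) (use E(3) in auto)
  define a where "a k = (\<lambda>p. EI m (sec (Suc m) (snd p) (D k)) (fst p))" for k
  have am[measurable]: "a k \<in> borel_measurable (P \<Otimes>\<^sub>M halfline)" for k unfolding a_def by (rule measurable_EI_sec[OF D])
  \<comment> \<open>For an elementary integral, adding a point is an algebraic operation on finitely
    many counts, which \<open>eint_add_point\<close> evaluates.\<close>
  have elem: "(\<integral>\<^sup>+\<omega>. ennreal (measure (N \<omega>) K) * h (EI (Suc m) (E k) \<omega>) \<partial>P) =
      (\<integral>\<^sup>+p. indicator K (snd p) * h (EI (Suc m) (E k) (fst p) + a k p) \<partial>(P \<Otimes>\<^sub>M halfline))"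
    if K: "K \<in> sets halfline" "emeasure halfline K < \<infinity>" and h[measurable]: "h \<in> borel_measurable borel" for K k and h :: "real \<Rightarrow> ennreal"
  proof -
    define \<C> where "\<C> = insert K (sides (Suc m) (E k))"
    have CC: "finite \<C>" "\<And>A. A \<in> \<C> \<Longrightarrow> A \<in> sets halfline" "\<And>A. A \<in> \<C> \<Longrightarrow> emeasure halfline A < \<infinity>"
      unfolding \<C>_def using finite_sides sides_sets[OF E(1)] sides_finite[OF E(1)] K by auto
    have KC: "K \<in> \<C>" by (simp add: \<C>_def)
    define H where "H v = h (eint (Suc m) (E k) (\<lambda>B. v B - measure halfline B))" for v
    have "(\<lambda>v. eint (Suc m) (E k) (\<lambda>B. v B - measure halfline B)) \<in> borel_measurable (PiM \<C> (\<lambda>_. borel :: real measure))"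
    proof (intro measurable_sum_list_eint borel_measurable_diff borel_measurable_const)
      show "(\<lambda>v. v (A' i)) \<in> borel_measurable (PiM \<C> (\<lambda>_. borel :: real measure))" if "(c', A') \<in> set (E k)" "i \<in> {1..Suc m}" for c' A' i
        using sidesI[OF that] by (intro measurable_component_singleton) (auto simp: \<C>_def)
    qed
    from measurable_compose[OF this h] have Hm: "H \<in> borel_measurable (PiM \<C> (\<lambda>_. borel))" unfolding H_def .
    have Hres: "H (\<lambda>B\<in>\<C>. v B) = H v" for v
      unfolding H_def by (intro arg_cong[where f = h] eint_cong) (auto simp: \<C>_def dest: sidesI)
    have HN: "H (\<lambda>B. measure (N \<omega>) B) = h (EI (Suc m) (E k) \<omega>)" for \<omega>
      by (simp add: H_def EI_def cN_def[abs_def])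
    have HN1: "H (\<lambda>B. measure (N \<omega>) B + indicator B x) = h (EI (Suc m) (E k) \<omega> + a k (\<omega>, x))" for \<omega> x
    proof -
      have "(\<lambda>B. measure (N \<omega>) B + indicator B x - measure halfline B) = (\<lambda>B. cN \<omega> B + indicator B x)"
        by (auto simp: cN_def)
      then show ?thesis by (simp add: H_def eint_add_point[OF E(1)] EI_def a_def D_def)
    qed
    have "(\<integral>\<^sup>+\<omega>. ennreal (measure (N \<omega>) K) * h (EI (Suc m) (E k) \<omega>) \<partial>P) = (\<integral>\<^sup>+x. indicator K x * (\<integral>\<^sup>+\<omega>. h (EI (Suc m) (E k) \<omega> + a k (\<omega>, x)) \<partial>P) \<partial>halfline)"
      using mecke_nn_real[OF CC KC Hm] unfolding Hres HN HN1 .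
    also have "\<dots> = (\<integral>\<^sup>+x. (\<integral>\<^sup>+\<omega>. indicator K (snd (\<omega>, x)) * h (EI (Suc m) (E k) (fst (\<omega>, x)) + a k (\<omega>, x)) \<partial>P) \<partial>halfline)"
    proof (rule nn_integral_cong)
      fix x assume [measurable]: "x \<in> space halfline"
      have "(\<lambda>\<omega>. h (EI (Suc m) (E k) \<omega> + a k (\<omega>, x))) \<in> borel_measurable P" by measurable
      then show "indicator K x * (\<integral>\<^sup>+\<omega>. h (EI (Suc m) (E k) \<omega> + a k (\<omega>, x)) \<partial>P) =
        (\<integral>\<^sup>+\<omega>. indicator K (snd (\<omega>, x)) * h (EI (Suc m) (E k) (fst (\<omega>, x)) + a k (\<omega>, x)) \<partial>P)"
        by (simp add: nn_integral_cmult)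
    qed
    also have "\<dots> = (\<integral>\<^sup>+p. indicator K (snd p) * h (EI (Suc m) (E k) (fst p) + a k p) \<partial>(P \<Otimes>\<^sub>M halfline))"
      using K(1) by (subst PM.nn_integral_snd) auto
    finally show ?thesis .
  qed
  have NK: "(\<integral>\<^sup>+\<omega>. ennreal (measure (N \<omega>) K) \<partial>P) = emeasure halfline K"
    and indK: "(\<integral>\<^sup>+p. indicator K (snd p) \<partial>(P \<Otimes>\<^sub>M halfline)) = emeasure halfline K"
    if K: "K \<in> sets halfline" "emeasure halfline K < \<infinity>" for K
  proof -
    show i: "(\<integral>\<^sup>+p. indicator K (snd p) \<partial>(P \<Otimes>\<^sub>M halfline)) = emeasure halfline K"
      using K(1) by (subst PM.nn_integral_snd[symmetric]) (auto simp: P.emeasure_space_1)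
    show "(\<integral>\<^sup>+\<omega>. ennreal (measure (N \<omega>) K) \<partial>P) = emeasure halfline K"
      using elem[OF K, of "\<lambda>_. 1" 0] i by simp
  qed
  \<comment> \<open>Continuous functions bounded by 1 pass to the almost sure limits under an
    integrable weight. Borel sets are reached afterwards, through the equality of two
    measures.\<close>
  have cont: "(\<integral>\<^sup>+\<omega>. ennreal (measure (N \<omega>) K) * ennreal (g (F \<omega>)) \<partial>P) =
      (\<integral>\<^sup>+p. indicator K (snd p) * ennreal (g (F (fst p) + V p)) \<partial>(P \<Otimes>\<^sub>M halfline))"
    if K: "K \<in> sets halfline" "emeasure halfline K < \<infinity>" and g: "continuous_on UNIV g" "\<And>x. g x \<le> 1" for K and g :: "real \<Rightarrow> real"
  proof -
    have gm[measurable]: "g \<in> borel_measurable borel" using g(1) by (rule borel_measurable_continuous_onI)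
    have gc: "isCont g x" for x using g(1) by (simp add: continuous_on_eq_continuous_at)
    have g1: "ennreal (g x) \<le> 1" for x using g(2)[of x] by (metis ennreal_1 ennreal_leI)
    note [measurable] = K(1)
    have "(\<lambda>k. \<integral>\<^sup>+\<omega>. ennreal (measure (N \<omega>) K) * ennreal (g (EI (Suc m) (E k) \<omega>)) \<partial>P) \<longlonglongrightarrow> (\<integral>\<^sup>+\<omega>. ennreal (measure (N \<omega>) K) * ennreal (g (F \<omega>)) \<partial>P)"
    proof (rule nn_integral_dominated_convergence[where w = "\<lambda>\<omega>. ennreal (measure (N \<omega>) K)"])
      show "(\<integral>\<^sup>+\<omega>. ennreal (measure (N \<omega>) K) \<partial>P) < \<infinity>" using NK[OF K] K by simp
      show "AE \<omega> in P. ennreal (measure (N \<omega>) K) * ennreal (g (EI (Suc m) (E k) \<omega>)) \<le> ennreal (measure (N \<omega>) K)" for k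
        using mult_left_mono[OF g1] by (intro AE_I2) (metis mult.right_neutral zero_le)
      show "AE \<omega> in P. (\<lambda>k. ennreal (measure (N \<omega>) K) * ennreal (g (EI (Suc m) (E k) \<omega>))) \<longlonglongrightarrow> ennreal (measure (N \<omega>) K) * ennreal (g (F \<omega>))"
        using Flim by eventually_elim (intro ennreal_tendsto_cmult tendsto_ennrealI isCont_tendsto_compose[OF gc]; simp)
    qed measurable
    moreover have "(\<lambda>k. \<integral>\<^sup>+p. indicator K (snd p) * ennreal (g (EI (Suc m) (E k) (fst p) + a k p)) \<partial>(P \<Otimes>\<^sub>M halfline)) \<longlonglongrightarrow> (\<integral>\<^sup>+p. indicator K (snd p) * ennreal (g (F (fst p) + V p)) \<partial>(P \<Otimes>\<^sub>M halfline))"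
    proof (rule nn_integral_dominated_convergence[where w = "\<lambda>p. indicator K (snd p)"])
      show "(\<integral>\<^sup>+p. indicator K (snd p) \<partial>(P \<Otimes>\<^sub>M halfline)) < \<infinity>" using indK[OF K] K by simp
      show "AE p in P \<Otimes>\<^sub>M halfline. indicator K (snd p) * ennreal (g (EI (Suc m) (E k) (fst p) + a k p)) \<le> indicator K (snd p)" for k
        using mult_left_mono[OF g1] by (intro AE_I2) (metis mult.right_neutral zero_le)
      show "AE p in P \<Otimes>\<^sub>M halfline. (\<lambda>k. indicator K (snd p) * ennreal (g (EI (Suc m) (E k) (fst p) + a k p))) \<longlonglongrightarrow> indicator K (snd p) * ennreal (g (F (fst p) + V p))"
        using Vlim AE_pair_fst[OF sigma_finite_halfline Flim]
      proof eventually_elim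
        case (elim p)
        have "(\<lambda>k. EI (Suc m) (E k) (fst p) + a k p) \<longlonglongrightarrow> F (fst p) + V p"
          using elim by (intro tendsto_add) (simp_all add: a_def)
        then have "(\<lambda>k. ennreal (g (EI (Suc m) (E k) (fst p) + a k p))) \<longlonglongrightarrow> ennreal (g (F (fst p) + V p))"
          by (intro tendsto_ennrealI isCont_tendsto_compose[OF gc])
        then show ?case by (intro ennreal_tendsto_cmult) (auto simp: indicator_def)
      qed
    qed measurable
    moreover have "(\<integral>\<^sup>+\<omega>. ennreal (measure (N \<omega>) K) * ennreal (g (EI (Suc m) (E k) \<omega>)) \<partial>P) =
       (\<integral>\<^sup>+p. indicator K (snd p) * ennreal (g (EI (Suc m) (E k) (fst p) + a k p)) \<partial>(P \<Otimes>\<^sub>M halfline))" for k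
      by (rule elem[OF K, of "\<lambda>z. ennreal (g z)"]) measurable
    ultimately show ?thesis by (simp add: LIMSEQ_unique)
  qed
  show ?thesis
  proof (rule that[OF V Vv[unfolded \<psi>'_def]])
    fix K B assume K: "K \<in> sets halfline" "emeasure halfline K < \<infinity>" and B: "B \<in> sets (borel :: real measure)"
    note [measurable] = K(1)
    \<comment> \<open>The two sides of the claim are finite measures evaluated at \<open>B\<close>.
      They agree on rays, whose indicators are pointwise limits of continuous functions.\<close>
    define M1 where "M1 = distr (density P (\<lambda>\<omega>. ennreal (measure (N \<omega>) K))) borel F"
    define M2 where "M2 = distr (density (P \<Otimes>\<^sub>M halfline) (\<lambda>p. indicator K (snd p))) borel (\<lambda>p. F (fst p) + V p)"
    have i1: "(\<integral>\<^sup>+x. h x \<partial>M1) = (\<integral>\<^sup>+\<omega>. ennreal (measure (N \<omega>) K) * h (F \<omega>) \<partial>P)" if [measurable]: "h \<in> borel_measurable borel" for h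
      unfolding M1_def by (subst nn_integral_distr, simp, simp, subst nn_integral_density) auto
    have i2: "(\<integral>\<^sup>+x. h x \<partial>M2) = (\<integral>\<^sup>+p. indicator K (snd p) * h (F (fst p) + V p) \<partial>(P \<Otimes>\<^sub>M halfline))" if [measurable]: "h \<in> borel_measurable borel" for h
      unfolding M2_def by (subst nn_integral_distr, simp, simp, subst nn_integral_density) auto
    have s: "sets M1 = sets borel" "sets M2 = sets borel" by (simp_all add: M1_def M2_def)
    note [measurable_cong] = s
    have f1: "(\<integral>\<^sup>+x. 1 \<partial>M1) < \<infinity>" using i1[of "\<lambda>_. 1"] NK[OF K] K by simp
    have f2: "(\<integral>\<^sup>+x. 1 \<partial>M2) < \<infinity>" using i2[of "\<lambda>_. 1"] indK[OF K] K by simp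
    have "M1 = M2"
    proof (rule measure_eqI_lessThan[OF s])
      fix c :: real
      have "emeasure M1 {c<..} \<le> emeasure M1 (space M1)" by (rule emeasure_space)
      then show "emeasure M1 {c<..} < \<infinity>" using f1 by simp
      have "{c<..} \<noteq> UNIV" by (metis UNIV_I greaterThan_iff less_irrefl)
      with open_greaterThan obtain g :: "nat \<Rightarrow> real \<Rightarrow> real" where
        g: "\<And>j. continuous_on UNIV (g j)" "\<And>j x. 0 \<le> g j x" "\<And>j x. g j x \<le> indicator {c<..} x"
          "\<And>x. (\<lambda>j. g j x) \<longlonglongrightarrow> indicator {c<..} x" by (rule open_continuous_approx) blast
      have gm[measurable]: "g j \<in> borel_measurable borel" for j using g(1) by (rule borel_measurable_continuous_onI)
      have g1: "g j x \<le> 1" for j x using order_trans[OF g(3)[of j x] indicator_le_1] .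
      have g1': "ennreal (g j x) \<le> 1" for j x using g1[of j x] by (metis ennreal_1 ennreal_leI)
      have lim: "(\<lambda>j. \<integral>\<^sup>+x. ennreal (g j x) \<partial>M) \<longlonglongrightarrow> emeasure M {c<..}" if M: "sets M = sets borel" "(\<integral>\<^sup>+x. 1 \<partial>M) < \<infinity>" for M
      proof -
        note [measurable_cong] = M(1)
        have "(\<lambda>j. \<integral>\<^sup>+x. ennreal (g j x) \<partial>M) \<longlonglongrightarrow> (\<integral>\<^sup>+x. ennreal (indicator {c<..} x) \<partial>M)"
        proof (rule nn_integral_dominated_convergence[OF _ _ _ _ M(2)])
          have bM: "borel_measurable M = (borel_measurable borel :: (real \<Rightarrow> ennreal) set)"
            by (rule measurable_cong_sets[OF M(1) refl])
          show "(\<lambda>x. ennreal (g j x)) \<in> borel_measurable M" for j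
            unfolding bM by (rule measurable_compose[OF gm measurable_ennreal])
          show "(\<lambda>x. ennreal (indicator {c<..} x)) \<in> borel_measurable M" unfolding bM by simp
          show "AE x in M. ennreal (g j x) \<le> 1" for j by (intro AE_I2 g1')
          show "AE x in M. (\<lambda>j. ennreal (g j x)) \<longlonglongrightarrow> ennreal (indicator {c<..} x)"
            by (intro AE_I2 tendsto_ennrealI g(4))
        qed measurable
        also have "(\<integral>\<^sup>+x. ennreal (indicator {c<..} x) \<partial>M) = emeasure M {c<..}"
          by (simp add: ennreal_indicator M(1))
        finally show ?thesis .
      qed
      have "(\<integral>\<^sup>+x. ennreal (g j x) \<partial>M1) = (\<integral>\<^sup>+x. ennreal (g j x) \<partial>M2)" for j
        using cont[OF K g(1)[of j] g1] by (simp add: i1 i2)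
      then show "emeasure M1 {c<..} = emeasure M2 {c<..}"
        using lim[OF s(1) f1] lim[OF s(2) f2] by (simp add: LIMSEQ_unique)
    qed
    then have eq: "(\<integral>\<^sup>+x. indicator B x \<partial>M1) = (\<integral>\<^sup>+x. indicator B x \<partial>M2)" by (rule arg_cong)
    show "(\<integral>\<^sup>+\<omega>. ennreal (measure (N \<omega>) K) * indicator B (F \<omega>) \<partial>P) =
      (\<integral>\<^sup>+p. indicator K (snd p) * indicator B (F (fst p) + V p) \<partial>(P \<Otimes>\<^sub>M halfline))"
      using eq unfolding i1[OF borel_measurable_indicator[OF B]] i2[OF borel_measurable_indicator[OF B]] .
  qed
qed

text \<open>Mecke's formula sees an outcome only through the weight \<open>N K\<close>, so some
  \<open>K\<close> must be charged. The interval \<open>{0..j}\<close> is empty with probability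
  \<open>exp (- j)\<close>, and this tends to 0 because the intensity has infinite total
  mass.\<close>

lemma AE_N_positive: "AE \<omega> in P. \<exists>j::nat. measure (N \<omega>) {0..real j} \<noteq> 0"
proof -
  define A where "A j = {0..real j}" for j :: nat
  have Am[measurable]: "A j \<in> sets halfline" and Af: "emeasure halfline (A j) < \<infinity>" and Al: "measure halfline (A j) = real j" for j
    using Icc_halfline[of "real j"] by (auto simp: A_def measure_def)
  have fin: "AE \<omega> in P. \<forall>j. emeasure (N \<omega>) (A j) < \<infinity>"
    unfolding AE_all_countable using AE_N_finite[OF Am Af] by blast
  define S where "S = {\<omega> \<in> space P. \<forall>j. emeasure (N \<omega>) (A j) = 0}"
  have S[measurable]: "S \<in> sets P" unfolding S_def by measurable
  have "P.prob S \<le> exp (- real j)" for j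
  proof -
    have "P.prob S \<le> P.prob {\<omega> \<in> space P. emeasure (N \<omega>) (A j) = of_nat 0}"
      by (intro P.finite_measure_mono) (auto simp: S_def)
    also have "\<dots> = exp (- real j)" using N_distribution[OF Am Af, of j 0] by (simp add: Al)
    finally show ?thesis .
  qed
  moreover have "(\<lambda>j. exp (- real j)) \<longlonglongrightarrow> 0"
    by (rule filterlim_compose[OF exp_at_bot]) (simp add: filterlim_uminus_at_bot filterlim_real_sequentially)
  ultimately have "P.prob S \<le> 0" by (intro LIMSEQ_le_const) auto
  then have "P.prob S = 0" using measure_nonneg[of P S] by linarith
  then have "AE \<omega> in P. \<omega> \<notin> S" by (intro AE_not_in) (auto simp: P.emeasure_eq_measure null_sets_def)
  then show ?thesis using fin AE_space
  proof eventually_elim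
    case (elim \<omega>)
    then obtain j where "emeasure (N \<omega>) (A j) \<noteq> 0" by (auto simp: S_def)
    then have "measure (N \<omega>) (A j) \<noteq> 0" using elim(2)[rule_format, of j] by (auto simp: measure_def enn2real_eq_0_iff)
    then show ?case by (auto simp: A_def)
  qed
qed

text \<open>Taking \<open>K = {0..j}\<close>, the event that \<open>F\<close> lies in
  \<open>B\<close> gets weight 0 for every \<open>j\<close>; some of these weights is positive at
  almost every outcome.\<close>

lemma mecke_null:
  assumes F[measurable]: "F \<in> borel_measurable P" and V: "V \<in> borel_measurable (P \<Otimes>\<^sub>M halfline)" and B[measurable]: "B \<in> sets borel"
    and mecke: "\<And>K B. K \<in> sets halfline \<Longrightarrow> emeasure halfline K < \<infinity> \<Longrightarrow> B \<in> sets borel \<Longrightarrow>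
      (\<integral>\<^sup>+\<omega>. ennreal (measure (N \<omega>) K) * indicator B (F \<omega>) \<partial>P) =
      (\<integral>\<^sup>+p. indicator K (snd p) * indicator B (F (fst p) + V p) \<partial>(P \<Otimes>\<^sub>M halfline))"
    and ae: "AE p in P \<Otimes>\<^sub>M halfline. F (fst p) + V p \<notin> B"
  shows "AE \<omega> in P. F \<omega> \<notin> B"
proof -
  have "AE \<omega> in P. ennreal (measure (N \<omega>) {0..real j}) * indicator B (F \<omega>) = 0" for j
  proof -
    note [measurable] = Icc_halfline(1)[of "real j"]
    have "(\<integral>\<^sup>+\<omega>. ennreal (measure (N \<omega>) {0..real j}) * indicator B (F \<omega>) \<partial>P) =
      (\<integral>\<^sup>+p. indicator {0..real j} (snd p) * indicator B (F (fst p) + V p) \<partial>(P \<Otimes>\<^sub>M halfline))"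
      by (rule mecke) (auto simp: Icc_halfline)
    also have "\<dots> = (\<integral>\<^sup>+p. 0 \<partial>(P \<Otimes>\<^sub>M halfline))"
      by (rule nn_integral_cong_AE, use ae in eventually_elim) simp
    finally have "(\<integral>\<^sup>+\<omega>. ennreal (measure (N \<omega>) {0..real j}) * indicator B (F \<omega>) \<partial>P) = 0" by simp
    then show ?thesis by (subst (asm) nn_integral_0_iff_AE) auto
  qed
  then have "AE \<omega> in P. \<forall>j. ennreal (measure (N \<omega>) {0..real j}) * indicator B (F \<omega>) = 0"
    unfolding AE_all_countable by blast
  then show ?thesis using AE_N_positive
  proof eventually_elim
    case (elim \<omega>)
    then obtain j :: nat where j: "measure (N \<omega>) {0..real j} \<noteq> 0" by blast
    then have "0 < measure (N \<omega>) {0..real j}" using measure_nonneg[of "N \<omega>" "{0..real j}"] by linarith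
    then show ?case using elim(1)[rule_format, of j] by (auto simp: indicator_def split: if_splits)
  qed
qed

end

section \<open>Absence of atoms\<close>

text \<open>Exchanging two almost-everywhere quantifiers requires the set of good sections to be
  measurable; it is the zero set of an integral over the complement of \<open>W\<close>.\<close>

lemma sets_AE_section:
  assumes "sigma_finite_measure M2" and W[measurable]: "W \<in> sets (M1 \<Otimes>\<^sub>M M2)"
  shows "{x \<in> space M1. AE y in M2. (x, y) \<in> W} \<in> sets M1"
proof -
  interpret M2: sigma_finite_measure M2 by fact
  define f :: "_ \<Rightarrow> ennreal" where "f = indicator (space (M1 \<Otimes>\<^sub>M M2) - W)"
  have f[measurable]: "f \<in> borel_measurable (M1 \<Otimes>\<^sub>M M2)" unfolding f_def by measurable
  have "(AE y in M2. (x, y) \<in> W) \<longleftrightarrow> (\<integral>\<^sup>+y. f (x, y) \<partial>M2) = 0" if x: "x \<in> space M1" for x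
  proof -
    have "(\<lambda>y. f (x, y)) \<in> borel_measurable M2" using x by measurable
    then have "(\<integral>\<^sup>+y. f (x, y) \<partial>M2) = 0 \<longleftrightarrow> (AE y in M2. f (x, y) = 0)" by (rule nn_integral_0_iff_AE)
    also have "\<dots> \<longleftrightarrow> (AE y in M2. (x, y) \<in> W)"
      by (rule AE_cong) (use x in \<open>auto simp: f_def space_pair_measure indicator_def split: if_splits\<close>)
    finally show ?thesis by simp
  qed
  then have "{x \<in> space M1. AE y in M2. (x, y) \<in> W} = {x \<in> space M1. (\<integral>\<^sup>+y. f (x, y) \<partial>M2) = 0}" by auto
  also have "\<dots> \<in> sets M1" by measurable
  finally show ?thesis .
qed

lemma AE_halfline_prod_restrict:
  assumes A: "A \<subseteq> I" "finite I" and Q: "AE y in halfline_prod A. Q y"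
  shows "AE z in halfline_prod I. Q (restrict z A)"
proof -
  obtain S where S: "{y \<in> space (halfline_prod A). \<not> Q y} \<subseteq> S" "emeasure (halfline_prod A) S = 0" "S \<in> sets (halfline_prod A)"
    using Q by (rule AE_E)
  have fin: "finite A" "finite (I - A)" using A by (auto intro: finite_subset)
  have I: "A \<union> (I - A) = I" using A by auto
  have dm: "distr (halfline_prod A \<Otimes>\<^sub>M halfline_prod (I - A)) (halfline_prod I) (merge A (I - A)) = halfline_prod I"
    using halfline_prod.distr_merge[of A "I - A"] fin I by (simp add: halfline_prod_def)
  have mm: "merge A (I - A) \<in> halfline_prod A \<Otimes>\<^sub>M halfline_prod (I - A) \<rightarrow>\<^sub>M halfline_prod I"
    using measurable_merge[of A "I - A" "\<lambda>_. halfline"] I by (simp add: halfline_prod_def)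
  have rm: "(\<lambda>z. restrict z A) \<in> halfline_prod I \<rightarrow>\<^sub>M halfline_prod A"
    unfolding halfline_prod_def using A(1) by (rule measurable_restrict_subset)
  have "AE y in halfline_prod A. y \<notin> S" using S(2,3) by (intro AE_not_in) auto
  then have "AE p in halfline_prod A \<Otimes>\<^sub>M halfline_prod (I - A). fst p \<notin> S"
    by (rule AE_pair_fst[OF sigma_finite_halfline_prod[OF fin(2)]])
  then have "AE p in halfline_prod A \<Otimes>\<^sub>M halfline_prod (I - A). restrict (merge A (I - A) p) A \<notin> S"
    using AE_space
  proof eventually_elim
    case (elim p)
    have "restrict (merge A (I - A) p) A = fst p"
      using elim(2) by (auto simp: space_pair_measure space_halfline_prod merge_def fun_eq_iff PiE_iff extensional_def split: prod.splits)
    then show ?case using elim(1) by simp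
  qed
  moreover have "{z \<in> space (halfline_prod I). restrict z A \<notin> S} \<in> sets (halfline_prod I)"
    using measurable_sets[OF rm S(3)] by (auto simp: vimage_def Int_def Collect_neg_eq set_diff_eq conj_commute intro!: sets.sets_Collect_neg)
  ultimately have "AE z in distr (halfline_prod A \<Otimes>\<^sub>M halfline_prod (I - A)) (halfline_prod I) (merge A (I - A)). restrict z A \<notin> S"
    by (subst AE_distr_iff[OF mm]) auto
  then have "AE z in halfline_prod I. restrict z A \<notin> S" unfolding dm .
  then show ?thesis using AE_space
  proof eventually_elim
    case (elim z)
    have "restrict z A \<in> space (halfline_prod A)" using elim(2) A(1) by (auto simp: space_halfline_prod PiE_iff)
    then show ?case using elim(1) S(1) by auto
  qed
qed

section \<open>Iterated differences of kernels\<close>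

definition mix :: "nat set \<Rightarrow> (nat \<Rightarrow> real) \<Rightarrow> (nat \<Rightarrow> real) \<Rightarrow> nat \<Rightarrow> real" where
  "mix S z z' i = (if i \<in> S then z' i else z i)"

lemma measurable_mix: "(\<lambda>p. mix S (fst p) (snd p)) \<in> halfline_prod I \<Otimes>\<^sub>M halfline_prod I \<rightarrow>\<^sub>M halfline_prod I"
proof -
  have "(\<lambda>p. \<lambda>i\<in>I. if i \<in> S then snd p i else fst p i) \<in> halfline_prod I \<Otimes>\<^sub>M halfline_prod I \<rightarrow>\<^sub>M PiM I (\<lambda>_. halfline)"
  proof (rule measurable_restrict)
    fix i assume i: "i \<in> I"
    show "(\<lambda>p. if i \<in> S then snd p i else fst p i) \<in> halfline_prod I \<Otimes>\<^sub>M halfline_prod I \<rightarrow>\<^sub>M halfline"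
      using measurable_compose[OF measurable_fst measurable_component_halfline[OF i]]
        measurable_compose[OF measurable_snd measurable_component_halfline[OF i]] by (cases "i \<in> S") auto
  qed
  then have "(\<lambda>p. \<lambda>i\<in>I. if i \<in> S then snd p i else fst p i) \<in> halfline_prod I \<Otimes>\<^sub>M halfline_prod I \<rightarrow>\<^sub>M halfline_prod I"
    by (simp add: halfline_prod_def)
  then show ?thesis
    by (rule measurable_cong[THEN iffD1, rotated])
       (auto simp: space_pair_measure space_halfline_prod mix_def fun_eq_iff PiE_iff extensional_def)
qed

lemma mix_space: "z \<in> space (halfline_prod I) \<Longrightarrow> z' \<in> space (halfline_prod I) \<Longrightarrow> mix S z z' \<in> space (halfline_prod I)"
  by (auto simp: space_halfline_prod mix_def PiE_iff extensional_def)

text \<open>The mixed point uses the coordinates of \<open>z\<close> off \<open>S\<close> and those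
  of \<open>z'\<close> in \<open>S\<close>, each index once. Apart from coordinates that do not
  enter, the pair is thus a single point of the product over \<open>I\<close>, and null sets pull
  back to null sets.\<close>

lemma AE_mix:
  assumes S: "S \<subseteq> I" "finite I" and Q: "AE z in halfline_prod I. Q z"
  shows "AE p in halfline_prod I \<Otimes>\<^sub>M halfline_prod I. Q (mix S (fst p) (snd p))"
proof -
  let ?M = "halfline_prod I" and ?A = "I - S"
  have fin: "finite S" "finite ?A" using S by (auto intro: finite_subset)
  interpret MM: pair_sigma_finite ?M ?M
    by (intro pair_sigma_finite.intro sigma_finite_halfline_prod S(2))
  interpret AS: pair_sigma_finite "halfline_prod ?A" "halfline_prod S"
    by (intro pair_sigma_finite.intro sigma_finite_halfline_prod fin)
  obtain N where N: "{z \<in> space ?M. \<not> Q z} \<subseteq> N" "emeasure ?M N = 0" "N \<in> sets ?M"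
    using Q by (rule AE_E)
  have I: "?A \<union> S = I" using S by auto
  have dm: "distr (halfline_prod ?A \<Otimes>\<^sub>M halfline_prod S) ?M (merge ?A S) = ?M"
  proof -
    have "?A \<inter> S = {}" by auto
    from halfline_prod.distr_merge[OF this fin(2,1)] show ?thesis unfolding halfline_prod_def I .
  qed
  have mm: "merge ?A S \<in> halfline_prod ?A \<Otimes>\<^sub>M halfline_prod S \<rightarrow>\<^sub>M ?M"
    using measurable_merge[of ?A S "\<lambda>_. halfline"] I by (simp add: halfline_prod_def)
  have "AE z in distr (halfline_prod ?A \<Otimes>\<^sub>M halfline_prod S) ?M (merge ?A S). z \<notin> N"
    unfolding dm using N(2,3) by (intro AE_not_in) auto
  from AE_distrD[OF mm this] have "AE u in halfline_prod ?A. AE v in halfline_prod S. merge ?A S (u, v) \<notin> N"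
    by (rule AS.AE_pair)
  then have "AE z in ?M. AE v in halfline_prod S. merge ?A S (restrict z ?A, v) \<notin> N"
    by (rule AE_halfline_prod_restrict[rotated 2]) (use S in auto)
  then have "AE z in ?M. AE z' in ?M. merge ?A S (restrict z ?A, restrict z' S) \<notin> N"
    by eventually_elim (rule AE_halfline_prod_restrict[OF S])
  then have ae: "AE z in ?M. AE z' in ?M. mix S z z' \<notin> N"
    using AE_space
  proof eventually_elim
    case (elim z)
    note z = elim(2)
    show ?case using elim(1) AE_space
    proof eventually_elim
      case (elim z')
      have "mix S z z' = merge ?A S (restrict z ?A, restrict z' S)"
        using S z elim(2) by (auto simp: mix_def merge_def fun_eq_iff space_halfline_prod PiE_iff extensional_def)
      then show ?case using elim(1) by simp
    qed
  qed
  have "AE p in ?M \<Otimes>\<^sub>M ?M. mix S (fst p) (snd p) \<notin> N"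
  proof (rule MM.AE_pair_measure)
    have "(\<lambda>p. mix S (fst p) (snd p)) -` (space ?M - N) \<inter> space (?M \<Otimes>\<^sub>M ?M) \<in> sets (?M \<Otimes>\<^sub>M ?M)"
      by (rule measurable_sets[OF measurable_mix]) (use N(3) in auto)
    moreover have "(\<lambda>p. mix S (fst p) (snd p)) -` (space ?M - N) \<inter> space (?M \<Otimes>\<^sub>M ?M) = {p \<in> space (?M \<Otimes>\<^sub>M ?M). mix S (fst p) (snd p) \<notin> N}"
      by (auto simp: space_pair_measure intro: mix_space)
    ultimately show "{p \<in> space (?M \<Otimes>\<^sub>M ?M). mix S (fst p) (snd p) \<notin> N} \<in> sets (?M \<Otimes>\<^sub>M ?M)" by simp
  qed (use ae in simp)
  then show ?thesis using AE_space
  proof eventually_elim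
    case (elim p)
    then show ?case using N(1) mix_space[of "fst p" I "snd p" S] by (auto simp: space_pair_measure)
  qed
qed

text \<open>\<open>diffs m \<phi> z z'\<close> is the iterated difference of \<open>\<phi>\<close> in the variables \<open>2, \<dots>, m\<close>, between the
  coordinates of \<open>z\<close> and those of \<open>z'\<close>. In the induction on the order it replaces the
  mixed derivative, whose intermediate stages need not be square integrable.\<close>

definition diffs :: "nat \<Rightarrow> ((nat \<Rightarrow> real) \<Rightarrow> real) \<Rightarrow> (nat \<Rightarrow> real) \<Rightarrow> (nat \<Rightarrow> real) \<Rightarrow> real" where
  "diffs m \<phi> z z' = (\<Sum>S\<in>Pow {2..m}. (-1) ^ card S * \<phi> (mix S z z'))"

text \<open>Each subset of \<open>{2..m}\<close> is paired with the subset that also contains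
  \<open>Suc m\<close>; the latter has the opposite sign.\<close>

lemma diffs_split:
  assumes "1 \<le> m"
  shows "diffs (Suc m) \<phi> z z' = (\<Sum>S\<in>Pow {2..m}. (-1) ^ card S * (\<phi> (mix S z z') - \<phi> ((mix S z z')(Suc m := z' (Suc m)))))"
proof -
  have I: "{2..Suc m} = insert (Suc m) {2..m}" using assms by auto
  have inj: "inj_on (insert (Suc m)) (Pow {2..m})"
  proof (rule inj_onI)
    fix S T assume ST: "S \<in> Pow {2..m}" "T \<in> Pow {2..m}" "insert (Suc m) S = insert (Suc m) T"
    have "Suc m \<notin> S" "Suc m \<notin> T" using ST by auto
    then show "S = T" using ST(3) by (metis Diff_insert_absorb)
  qed
  have m1: "mix (insert (Suc m) S) z z' = (mix S z z')(Suc m := z' (Suc m))" for S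
    by (auto simp: mix_def fun_eq_iff)
  have "diffs (Suc m) \<phi> z z' = (\<Sum>S\<in>Pow {2..m}. (-1) ^ card S * \<phi> (mix S z z')) + (\<Sum>S\<in>insert (Suc m) ` Pow {2..m}. (-1) ^ card S * \<phi> (mix S z z'))"
    unfolding diffs_def I Pow_insert by (rule sum.union_disjoint) auto
  also have "(\<Sum>S\<in>insert (Suc m) ` Pow {2..m}. (-1) ^ card S * \<phi> (mix S z z')) = (\<Sum>S\<in>Pow {2..m}. (-1) ^ card (insert (Suc m) S) * \<phi> (mix (insert (Suc m) S) z z'))"
    by (subst sum.reindex[OF inj]) simp
  also have "\<dots> = (\<Sum>S\<in>Pow {2..m}. - ((-1) ^ card S * \<phi> ((mix S z z')(Suc m := z' (Suc m)))))"
  proof (intro sum.cong refl)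
    fix S assume S: "S \<in> Pow {2..m}"
    then have "card (insert (Suc m) S) = Suc (card S)"
      by (subst card_insert_disjoint) (auto intro: finite_subset)
    then show "(-1) ^ card (insert (Suc m) S) * \<phi> (mix (insert (Suc m) S) z z') = - ((-1) ^ card S * \<phi> ((mix S z z')(Suc m := z' (Suc m))))"
      by (simp add: m1)
  qed
  finally show ?thesis by (simp add: sum.distrib[symmetric] right_diff_distrib)
qed

text \<open>Subtracting the sections of the kernel at two added points amounts to peeling the last
  variable off the iterated difference. This is the algebra behind the induction on the
  order.\<close>

lemma diffs_Suc:
  assumes "1 \<le> m"
  shows "diffs (Suc m) \<phi> (z(Suc m := x)) (z'(Suc m := x')) = diffs m (\<lambda>y. \<phi> (y(Suc m := x)) - \<phi> (y(Suc m := x'))) z z'"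
proof -
  have "mix S (z(Suc m := x)) (z'(Suc m := x')) = (mix S z z')(Suc m := x)" if "S \<in> Pow {2..m}" for S
    using that by (auto simp: mix_def fun_eq_iff)
  then show ?thesis unfolding diffs_split[OF assms] by (simp add: diffs_def)
qed

lemma diffs_cmult: "diffs m (\<lambda>y. c * \<phi> y) z z' = c * diffs m \<phi> z z'"
  unfolding diffs_def sum_distrib_left by (intro sum.cong refl) (simp add: mult_ac)

lemma diffs_1: "diffs 1 \<phi> z z' = \<phi> z"
proof -
  have "mix {} z z' = z" by (auto simp: mix_def)
  then show ?thesis by (simp add: diffs_def)
qed

lemma measurable_diffs:
  assumes "\<phi> \<in> borel_measurable (halfline_prod I)"
  shows "(\<lambda>p. diffs m \<phi> (fst p) (snd p)) \<in> borel_measurable (halfline_prod I \<Otimes>\<^sub>M halfline_prod I)"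
  unfolding diffs_def
  by (intro borel_measurable_sum borel_measurable_times borel_measurable_const measurable_compose[OF measurable_mix assms])

text \<open>The invariant of the induction on the order. \<open>g\<close>, in the end the mixed
  derivative, only marks points at which the iterated difference cannot vanish; it is frozen along
  with the kernel and never differenced. At order one \<open>diffs\<close> is the kernel itself,
  which is then nonzero on a set of infinite measure.\<close>

definition nondegenerate :: "nat \<Rightarrow> ((nat \<Rightarrow> real) \<Rightarrow> real) \<Rightarrow> ((nat \<Rightarrow> real) \<Rightarrow> real) \<Rightarrow> bool" where
  "nondegenerate m \<phi> g \<longleftrightarrow> g \<in> borel_measurable (halfline_prod {1..m}) \<and>
     (AE p in halfline_prod {1..m} \<Otimes>\<^sub>M halfline_prod {1..m}. g (fst p) \<noteq> 0 \<longrightarrow> diffs m \<phi> (fst p) (snd p) \<noteq> 0) \<and>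
     (AE y in halfline_prod {2..m}. emeasure halfline {t \<in> {0..}. g (y(1 := t)) \<noteq> 0} = \<infinity>)"

text \<open>Fubini for each of the two points, followed by an exchange of the quantifiers over
  \<open>y\<close> and \<open>x'\<close>, so that both frozen coordinates come first.\<close>

lemma AE_sections_pair:
  assumes W: "W \<in> sets (halfline_prod {1..Suc m} \<Otimes>\<^sub>M halfline_prod {1..Suc m})"
    and ae: "AE p in halfline_prod {1..Suc m} \<Otimes>\<^sub>M halfline_prod {1..Suc m}. p \<in> W"
  shows "AE x in halfline. AE x' in halfline. AE p in halfline_prod {1..m} \<Otimes>\<^sub>M halfline_prod {1..m}.
    ((fst p)(Suc m := x), (snd p)(Suc m := x')) \<in> W"
proof -
  let ?M = "halfline_prod {1..m}" and ?M' = "halfline_prod {1..Suc m}"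
  interpret M: sigma_finite_measure ?M by (rule sigma_finite_halfline_prod) simp
  interpret MM: pair_sigma_finite ?M ?M ..
  interpret Mh: pair_sigma_finite ?M halfline ..
  interpret MM': pair_sigma_finite ?M' ?M'
    by (intro pair_sigma_finite.intro sigma_finite_halfline_prod) auto
  have "AE z in ?M'. AE z' in ?M'. (z, z') \<in> W" using ae by (rule MM'.AE_pair)
  then have "AE x in halfline. AE y in ?M. AE z' in ?M'. (y(Suc m := x), z') \<in> W"
    unfolding Suc_insert by (rule AE_halfline_prod_insert[rotated 2]) auto
  then show ?thesis using AE_space
  proof eventually_elim
    case (elim x)
    then have x: "0 \<le> x" by simp
    have ux: "(\<lambda>y. y(Suc m := x)) \<in> ?M \<rightarrow>\<^sub>M ?M'"
      using measurable_halfline_upd2[OF x, of "Suc m" "{1..m}"] by (simp add: Suc_insert)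
    have uu: "(\<lambda>q. (fst q)(Suc m := snd q)) \<in> ?M \<Otimes>\<^sub>M halfline \<rightarrow>\<^sub>M ?M'"
      using measurable_halfline_upd[of "Suc m" "{1..m}"] by (simp add: Suc_insert)
    have 1: "AE y in ?M. AE x' in halfline. AE y' in ?M. (y(Suc m := x), y'(Suc m := x')) \<in> W"
      using elim(1)
    proof eventually_elim
      case (elim y)
      show ?case using elim(1) unfolding Suc_insert by (rule AE_halfline_prod_insert[rotated 2]) auto
    qed
    define W1 where "W1 = {q \<in> space ((?M \<Otimes>\<^sub>M halfline) \<Otimes>\<^sub>M ?M). ((fst (fst q))(Suc m := x), (snd q)(Suc m := snd (fst q))) \<in> W}"
    have "(\<lambda>q. ((fst (fst q))(Suc m := x), (snd q)(Suc m := snd (fst q)))) \<in> (?M \<Otimes>\<^sub>M halfline) \<Otimes>\<^sub>M ?M \<rightarrow>\<^sub>M ?M' \<Otimes>\<^sub>M ?M'"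
    proof (rule measurable_Pair)
      show "(\<lambda>q. (fst (fst q))(Suc m := x)) \<in> (?M \<Otimes>\<^sub>M halfline) \<Otimes>\<^sub>M ?M \<rightarrow>\<^sub>M ?M'"
        by (rule measurable_compose[OF _ ux]) measurable
      have "(\<lambda>q. (snd q, snd (fst q))) \<in> (?M \<Otimes>\<^sub>M halfline) \<Otimes>\<^sub>M ?M \<rightarrow>\<^sub>M ?M \<Otimes>\<^sub>M halfline" by measurable
      from measurable_compose[OF this uu]
      show "(\<lambda>q. (snd q)(Suc m := snd (fst q))) \<in> (?M \<Otimes>\<^sub>M halfline) \<Otimes>\<^sub>M ?M \<rightarrow>\<^sub>M ?M'" by simp
    qed
    from measurable_sets[OF this W] have W1: "W1 \<in> sets ((?M \<Otimes>\<^sub>M halfline) \<Otimes>\<^sub>M ?M)"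
      by (simp add: W1_def vimage_def Int_def conj_commute)
    have R: "{q \<in> space (?M \<Otimes>\<^sub>M halfline). AE y' in ?M. ((fst q)(Suc m := x), y'(Suc m := snd q)) \<in> W} \<in> sets (?M \<Otimes>\<^sub>M halfline)"
    proof -
      have eq: "(AE y' in ?M. ((fst q)(Suc m := x), y'(Suc m := snd q)) \<in> W) \<longleftrightarrow> (AE y' in ?M. (q, y') \<in> W1)" if "q \<in> space (?M \<Otimes>\<^sub>M halfline)" for q
        by (rule AE_cong) (use that in \<open>auto simp: W1_def space_pair_measure\<close>)
      have "{q \<in> space (?M \<Otimes>\<^sub>M halfline). AE y' in ?M. ((fst q)(Suc m := x), y'(Suc m := snd q)) \<in> W} = {q \<in> space (?M \<Otimes>\<^sub>M halfline). AE y' in ?M. (q, y') \<in> W1}"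
        by (intro Collect_cong conj_cong refl, rule eq)
      then show ?thesis using sets_AE_section[OF M.sigma_finite_measure_axioms W1] by simp
    qed
    have "AE x' in halfline. AE y in ?M. AE y' in ?M. (y(Suc m := x), y'(Suc m := x')) \<in> W"
      using Mh.AE_commute[where P = "\<lambda>y x'. AE y' in ?M. (y(Suc m := x), y'(Suc m := x')) \<in> W", OF R] 1 by (rule iffD1)
    then show ?case using AE_space
    proof eventually_elim
      case (elim x')
      then have x': "0 \<le> x'" by simp
      have ux': "(\<lambda>y. y(Suc m := x')) \<in> ?M \<rightarrow>\<^sub>M ?M'"
        using measurable_halfline_upd2[OF x', of "Suc m" "{1..m}"] by (simp add: Suc_insert)
      have "(\<lambda>p. ((fst p)(Suc m := x), (snd p)(Suc m := x'))) \<in> ?M \<Otimes>\<^sub>M ?M \<rightarrow>\<^sub>M ?M' \<Otimes>\<^sub>M ?M'"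
        by (intro measurable_Pair measurable_compose[OF measurable_fst ux] measurable_compose[OF measurable_snd ux'])
      from measurable_sets[OF this W]
      have "{p \<in> space (?M \<Otimes>\<^sub>M ?M). ((fst p)(Suc m := x), (snd p)(Suc m := x')) \<in> W} \<in> sets (?M \<Otimes>\<^sub>M ?M)"
        by (simp add: vimage_def Int_def conj_commute)
      then show ?case by (rule MM.AE_pair_measure) (use elim(1) in simp)
    qed
  qed
qed

lemma nondegenerate_Suc:
  assumes nd: "nondegenerate (Suc m) \<phi> g" and \<phi>[measurable]: "\<phi> \<in> borel_measurable (halfline_prod {1..Suc m})" and m: "1 \<le> m" and c: "c \<noteq> 0"
  shows "AE x in halfline. AE x' in halfline.
    nondegenerate m (\<lambda>y. c * (\<phi> (y(Suc m := x)) - \<phi> (y(Suc m := x')))) (\<lambda>y. g (y(Suc m := x)))"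
proof -
  let ?M = "halfline_prod {1..m}" and ?M' = "halfline_prod {1..Suc m}"
  have g[measurable]: "g \<in> borel_measurable ?M'" using nd by (simp add: nondegenerate_def)
  note [measurable] = measurable_diffs[OF \<phi>]
  define W where "W = {p \<in> space (?M' \<Otimes>\<^sub>M ?M'). g (fst p) \<noteq> 0 \<longrightarrow> diffs (Suc m) \<phi> (fst p) (snd p) \<noteq> 0}"
  have W: "W \<in> sets (?M' \<Otimes>\<^sub>M ?M')" unfolding W_def by measurable
  have "AE p in ?M' \<Otimes>\<^sub>M ?M'. p \<in> W"
    using nd AE_space unfolding nondegenerate_def W_def by auto
  from AE_sections_pair[OF W this]
  have 1: "AE x in halfline. AE x' in halfline. AE p in ?M \<Otimes>\<^sub>M ?M. ((fst p)(Suc m := x), (snd p)(Suc m := x')) \<in> W" .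
  have I: "{2..Suc m} = insert (Suc m) {2..m}" using m by auto
  have "AE y in halfline_prod {2..Suc m}. emeasure halfline {t \<in> {0..}. g (y(1 := t)) \<noteq> 0} = \<infinity>"
    using nd by (simp add: nondegenerate_def)
  then have 2: "AE x in halfline. AE y in halfline_prod {2..m}. emeasure halfline {t \<in> {0..}. g ((y(Suc m := x))(1 := t)) \<noteq> 0} = \<infinity>"
    unfolding I by (rule AE_halfline_prod_insert[rotated 2]) auto
  show ?thesis using 1 2 AE_space
  proof eventually_elim
    case (elim x)
    note x = elim
    show ?case using x(1) AE_space
    proof eventually_elim
      case (elim x')
      show ?case unfolding nondegenerate_def
      proof (intro conjI)
        show "(\<lambda>y. g (y(Suc m := x))) \<in> borel_measurable ?M" using x(3) by (intro measurable_section g) simp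
        show "AE p in ?M \<Otimes>\<^sub>M ?M. g ((fst p)(Suc m := x)) \<noteq> 0 \<longrightarrow> diffs m (\<lambda>y. c * (\<phi> (y(Suc m := x)) - \<phi> (y(Suc m := x')))) (fst p) (snd p) \<noteq> 0"
          using elim(1) by eventually_elim (simp add: W_def diffs_Suc[OF m] diffs_cmult c)
        have "(y(Suc m := x))(1 := t) = (y(1 := t))(Suc m := x)" for y :: "nat \<Rightarrow> real" and t
          using m by (intro fun_upd_twist) auto
        then show "AE y in halfline_prod {2..m}. emeasure halfline {t \<in> {0..}. g ((y(1 := t))(Suc m := x)) \<noteq> 0} = \<infinity>"
          using x(2) by simp
      qed
    qed
  qed
qed

context poisson_halfline
begin

section \<open>First-order integrals and their atoms\<close>

lemma version_0:
  assumes "version 0 \<psi> F" shows "AE \<omega> in P. F \<omega> = \<psi> (\<lambda>_. undefined)"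
proof -
  let ?u = "\<lambda>_. undefined :: real"
  have hp0: "sqn (halfline_prod {1..0}) h = ennreal ((h ?u)\<^sup>2)" for h
    unfolding sqn_def halfline_prod_def by (simp add: halfline_prod.nn_integral_empty)
  obtain E where E: "\<And>k. disj_rects 0 (E k)"
    "(\<lambda>k. sqn (halfline_prod {1..0}) (\<lambda>z. elementary_fun 0 (E k) z - \<psi> z)) \<longlonglongrightarrow> 0"
    "(\<lambda>k. sqn P (\<lambda>\<omega>. EI 0 (E k) \<omega> - F \<omega>)) \<longlonglongrightarrow> 0"
    using assms by (auto simp: version_def)
  have eq: "EI 0 (E k) \<omega> = elementary_fun 0 (E k) ?u" for k \<omega>
    by (simp add: EI_def eint_def elementary_fun_def)
  have "sqn P (\<lambda>\<omega>. EI 0 (E k) \<omega> - \<psi> ?u) = sqn (halfline_prod {1..0}) (\<lambda>z. elementary_fun 0 (E k) z - \<psi> z)" for k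
    unfolding hp0 eq by (simp add: sqn_def P.emeasure_space_1)
  then have "(\<lambda>k. sqn P (\<lambda>\<omega>. EI 0 (E k) \<omega> - \<psi> ?u)) \<longlonglongrightarrow> 0" using E(2) by simp
  from sqn_limit_unique[OF measurable_EI[OF E(1)] versionD(1)[OF assms] _ E(3) this] show ?thesis by simp
qed

text \<open>Mecke's formula, applied to the constant 1 and to the count itself, gives the mean
  \<open>l\<close> and the second moment \<open>l * (l + 1)\<close>.\<close>

lemma N_variance:
  assumes K[measurable]: "K \<in> sets halfline" and f: "emeasure halfline K < \<infinity>"
  shows "integrable P (\<lambda>\<omega>. (measure (N \<omega>) K - measure halfline K)\<^sup>2)"
    "(\<integral>\<omega>. (measure (N \<omega>) K - measure halfline K)\<^sup>2 \<partial>P) = measure halfline K"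
proof -
  define l where "l = measure halfline K"
  define X where "X \<omega> = measure (N \<omega>) K" for \<omega>
  have i1: "integrable P (\<lambda>\<omega>. X \<omega> + 1)" using integrable_moments[OF K f, of 1] by (simp add: X_def)
  then have iX: "integrable P X" using Bochner_Integration.integrable_diff[OF i1, of "\<lambda>_. 1"] by simp
  have i2: "integrable P (\<lambda>\<omega>. (X \<omega> + 1)\<^sup>2)" using integrable_moments[OF K f, of 2] by (simp add: X_def)
  have iXX: "integrable P (\<lambda>\<omega>. X \<omega> * X \<omega>)"
    using Bochner_Integration.integrable_diff[OF i2 Bochner_Integration.integrable_add[OF iX i1]]
    by (simp add: power2_eq_square algebra_simps)
  have e1: "(\<integral>\<omega>. X \<omega> \<partial>P) = l"
    using mecke_integral(1)[of "{K}" K "\<lambda>_. 1"] integral_indicator_prod(2)[OF K f, of "\<lambda>_. 1"] K f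
    by (simp add: X_def l_def P.prob_space)
  have "(\<integral>\<omega>. X \<omega> * X \<omega> \<partial>P) = (\<integral>p. indicator K (snd p) * (X (fst p) + indicator K (snd p)) \<partial>(P \<Otimes>\<^sub>M halfline))"
    using mecke_integral(1)[of "{K}" K "\<lambda>v. v K"] K f by (simp add: X_def)
  also have "(\<lambda>p. indicator K (snd p) * (X (fst p) + indicator K (snd p))) = (\<lambda>p. indicator K (snd p) * (X (fst p) + 1))"
    by (auto simp: indicator_def fun_eq_iff)
  also have "(\<integral>p. indicator K (snd p) * (X (fst p) + 1) \<partial>(P \<Otimes>\<^sub>M halfline)) = l * (l + 1)"
    using integral_indicator_prod(2)[OF K f i1] iX by (simp add: e1 l_def[symmetric] P.prob_space)
  finally have e2: "(\<integral>\<omega>. X \<omega> * X \<omega> \<partial>P) = l * (l + 1)" .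
  have eq: "(\<lambda>\<omega>. (X \<omega> - l)\<^sup>2) = (\<lambda>\<omega>. X \<omega> * X \<omega> - 2 * l * X \<omega> + l\<^sup>2)"
    by (auto simp: power2_eq_square algebra_simps)
  have i3: "integrable P (\<lambda>\<omega>. X \<omega> * X \<omega> - 2 * l * X \<omega>)" using iXX iX by auto
  show "integrable P (\<lambda>\<omega>. (measure (N \<omega>) K - measure halfline K)\<^sup>2)"
    unfolding X_def[symmetric] l_def[symmetric] eq using i3 by auto
  have "(\<integral>\<omega>. (X \<omega> - l)\<^sup>2 \<partial>P) = (\<integral>\<omega>. X \<omega> * X \<omega> \<partial>P) - 2 * l * (\<integral>\<omega>. X \<omega> \<partial>P) + l\<^sup>2"
    unfolding eq using i3 iXX iX by (simp add: P.prob_space)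
  also have "\<dots> = l" unfolding e1 e2 by (simp add: power2_eq_square algebra_simps)
  finally show "(\<integral>\<omega>. (measure (N \<omega>) K - measure halfline K)\<^sup>2 \<partial>P) = measure halfline K"
    by (simp add: X_def l_def)
qed

text \<open>A first-order integral with infinitely many jumps has no atoms: at the heaviest atom \<open>c\<close>, Mecke's formula on a
  large set \<open>K\<close> would make \<open>c - u x\<close> an atom of almost the same weight for most \<open>x\<close> in \<open>K\<close>; there are
  finitely many such atoms, so \<open>\<bar>u\<bar>\<close> would be bounded below on a set of infinite measure.\<close>

lemma no_atoms_first_order:
  assumes F[measurable]: "F \<in> borel_measurable P" and u[measurable]: "u \<in> borel_measurable halfline"
    and mecke: "\<And>K B. K \<in> sets halfline \<Longrightarrow> emeasure halfline K < \<infinity> \<Longrightarrow> B \<in> sets borel \<Longrightarrow>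
      (\<integral>\<^sup>+\<omega>. ennreal (measure (N \<omega>) K) * indicator B (F \<omega>) \<partial>P) =
      (\<integral>\<^sup>+p. indicator K (snd p) * indicator B (F (fst p) + u (snd p)) \<partial>(P \<Otimes>\<^sub>M halfline))"
    and L2: "sqn halfline u < \<top>" and inf: "emeasure halfline {t \<in> {0..}. u t \<noteq> 0} = \<infinity>"
  shows "AE \<omega> in P. F \<omega> \<noteq> c0"
proof -
  define p where "p a = P.prob {\<omega> \<in> space P. F \<omega> = a}" for a
  have Fs[measurable]: "{\<omega> \<in> space P. F \<omega> = a} \<in> sets P" for a by measurable
  \<comment> \<open>At most \<open>1 / e\<close> values can carry probability \<open>e\<close> or
    more.\<close>
  have fin: "finite {a. p a \<ge> e}" if e: "e > 0" for e
  proof (rule ccontr)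
    assume "infinite {a. p a \<ge> e}"
    obtain n :: nat where n: "1 / e < real n" using reals_Archimedean2 by blast
    obtain T where T: "T \<subseteq> {a. p a \<ge> e}" "finite T" "card T = n"
      using infinite_arbitrarily_large[OF \<open>infinite {a. p a \<ge> e}\<close>, of n] by auto
    have "real n * e \<le> (\<Sum>a\<in>T. p a)" using T sum_mono[of T "\<lambda>_. e" p] by auto
    also have "\<dots> = P.prob (\<Union>a\<in>T. {\<omega> \<in> space P. F \<omega> = a})"
      unfolding p_def using T(2) by (intro P.finite_measure_finite_Union[symmetric]) (auto simp: disjoint_family_on_def)
    also have "\<dots> \<le> 1" by simp
    finally show False using n e by (simp add: field_simps)
  qed
  have "p c0 = 0"
  proof (rule ccontr)
    assume "p c0 \<noteq> 0"
    then have p0: "p c0 > 0" using measure_nonneg[of P] by (simp add: p_def less_le)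
    define A where "A = {a. p a \<ge> p c0}"
    have A: "finite A" "c0 \<in> A" using fin[OF p0] by (auto simp: A_def)
    \<comment> \<open>A heaviest value exists because only finitely many are at least as heavy as
      \<open>c0\<close>.\<close>
    define c where "c = arg_max_on p A"
    have cA: "c \<in> A" and cmax: "\<And>a. a \<in> A \<Longrightarrow> p a \<le> p c"
    proof -
      have "Max (p ` A) \<in> p ` A" using A by (intro Max_in) auto
      then obtain a where a: "a \<in> A" "p a = Max (p ` A)" by auto
      have "is_arg_max p (\<lambda>x. x \<in> A) a"
        using a A by (auto simp: is_arg_max_linorder)
      then have "is_arg_max p (\<lambda>x. x \<in> A) c" unfolding c_def arg_max_on_def arg_max_def by (rule someI)
      then show "c \<in> A" "\<And>a. a \<in> A \<Longrightarrow> p a \<le> p c" by (auto simp: is_arg_max_linorder)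
    qed
    define q where "q = p c"
    have q0: "q > 0" using cA p0 by (simp add: A_def q_def)
    have pq: "p a \<le> q" for a
      using cmax[of a] cA by (cases "a \<in> A") (auto simp: A_def q_def)
    \<comment> \<open>The other values with at least half of the maximal weight; \<open>e\<close>
      will bound their distance from \<open>c\<close> from below. If
      \<open>0 < \<bar>u x\<bar>\<close> and \<open>\<bar>u x\<bar> < e\<close>, then
      \<open>c - u x\<close> is neither \<open>c\<close> nor in \<open>T\<close>, so its weight is
      below \<open>q / 2\<close>.\<close>
    define T where "T = {a. p a \<ge> q / 2} - {c}"
    have T: "finite T" using fin[of "q / 2"] q0 by (simp add: T_def)
    obtain e where e: "e > 0" "\<And>a. a \<in> T \<Longrightarrow> e \<le> \<bar>c - a\<bar>"
    proof (cases "T = {}")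
      case True then show ?thesis using that[of 1] by simp
    next
      case False
      define e where "e = Min ((\<lambda>a. \<bar>c - a\<bar>) ` T)"
      have "e \<in> (\<lambda>a. \<bar>c - a\<bar>) ` T" unfolding e_def using T False by (intro Min_in) auto
      then have "e > 0" by (auto simp: T_def)
      moreover have "e \<le> \<bar>c - a\<bar>" if "a \<in> T" for a unfolding e_def using T that by (intro Min_le) auto
      ultimately show ?thesis using that by blast
    qed
    define G where "G = {t \<in> space halfline. e \<le> \<bar>u t\<bar>}"
    have G[measurable]: "G \<in> sets halfline" unfolding G_def by measurable
    \<comment> \<open>Chebyshev's inequality for the square-integrable \<open>u\<close>.\<close>
    have Gfin: "emeasure halfline G < \<top>"
    proof -
      have "ennreal (e\<^sup>2) * emeasure halfline G = (\<integral>\<^sup>+t. ennreal (e\<^sup>2) * indicator G t \<partial>halfline)"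
        by (simp add: nn_integral_cmult_indicator)
      also have "\<dots> \<le> sqn halfline u"
        unfolding sqn_def
      proof (rule nn_integral_mono)
        fix t
        have "t \<in> G \<Longrightarrow> e\<^sup>2 \<le> (u t)\<^sup>2" using e(1) abs_le_square_iff[of e "u t"] by (auto simp: G_def)
        then show "ennreal (e\<^sup>2) * indicator G t \<le> ennreal ((u t)\<^sup>2)" by (auto simp: indicator_def intro: ennreal_leI)
      qed
      finally have "ennreal (e\<^sup>2) * emeasure halfline G < \<top>" using L2 by (rule le_less_trans)
      then show ?thesis using e(1) by (auto simp: ennreal_mult_less_top)
    qed
    define b where "b = measure halfline G"
    have b: "emeasure halfline G = ennreal b" unfolding b_def using Gfin by (intro emeasure_eq_ennreal_measure) auto
    have b0: "b \<ge> 0" by (simp add: b_def)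
    define K where "K j = {t \<in> {0..real j}. u t \<noteq> 0}" for j :: nat
    have K[measurable]: "K j \<in> sets halfline" for j
    proof -
      have "K j = {t \<in> space halfline. u t \<noteq> 0} \<inter> {0..real j}" by (auto simp: K_def)
      also have "\<dots> \<in> sets halfline" using Icc_halfline(1)[of "real j"] by (intro sets.Int) measurable
      finally show ?thesis .
    qed
    have Kf: "emeasure halfline (K j) < \<infinity>" for j
    proof -
      have "emeasure halfline (K j) \<le> emeasure halfline {0..real j}"
        using Icc_halfline(1) by (intro emeasure_mono) (auto simp: K_def)
      also have "\<dots> < \<infinity>" by (simp add: Icc_halfline)
      finally show ?thesis .
    qed
    \<comment> \<open>Let \<open>X\<close> be the count of \<open>K j\<close>, with mean
      \<open>l\<close>. The expectation of \<open>X\<close> on the event \<open>F = c\<close> is at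
      least \<open>l * q - sqrt l\<close>, because the variance of \<open>X\<close> is
      \<open>l\<close>, and at most \<open>q * b + q / 2 * l\<close>, by Mecke's formula.\<close>
    have bound: "measure halfline (K j) * q \<le> sqrt (measure halfline (K j)) + (q * b + q / 2 * measure halfline (K j))" for j
    proof -
      define l where "l = measure halfline (K j)"
      have l: "emeasure halfline (K j) = ennreal l" unfolding l_def using Kf[of j] by (intro emeasure_eq_ennreal_measure) auto
      have l0: "l \<ge> 0" by (simp add: l_def)
      define X where "X \<omega> = measure (N \<omega>) (K j)" for \<omega>
      define I where "I \<omega> = (indicator {c} (F \<omega>) :: real)" for \<omega>
      have Im[measurable]: "I \<in> borel_measurable P" unfolding I_def by measurable
      have Xm[measurable]: "X \<in> borel_measurable P" unfolding X_def by measurable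
      have "integrable P (\<lambda>\<omega>. X \<omega> + 1)" using integrable_moments[OF K Kf, of j 1] by (simp add: X_def)
      from Bochner_Integration.integrable_diff[OF this, of "\<lambda>_. 1"] have iX: "integrable P X" by simp
      have iXI: "integrable P (\<lambda>\<omega>. X \<omega> * I \<omega>)"
        by (rule Bochner_Integration.integrable_bound[OF iX]) (auto simp: I_def indicator_def)
      have iI: "integrable P I"
        by (rule P.integrable_const_bound[of _ 1]) (auto simp: I_def)
      have EI': "(\<integral>\<omega>. I \<omega> \<partial>P) = q"
      proof -
        have "(\<integral>\<omega>. I \<omega> \<partial>P) = (\<integral>\<omega>. indicator {\<omega> \<in> space P. F \<omega> = c} \<omega> \<partial>P)"
          by (intro Bochner_Integration.integral_cong) (auto simp: I_def indicator_def)
        then show ?thesis by (simp add: q_def p_def)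
      qed
      have up: "(\<integral>\<omega>. X \<omega> * I \<omega> \<partial>P) \<le> q * b + q / 2 * l"
      proof -
        have "ennreal (\<integral>\<omega>. X \<omega> * I \<omega> \<partial>P) = (\<integral>\<^sup>+\<omega>. ennreal (X \<omega> * I \<omega>) \<partial>P)"
          by (rule nn_integral_eq_integral[symmetric, OF iXI]) (auto simp: X_def I_def)
        also have "\<dots> = (\<integral>\<^sup>+\<omega>. ennreal (measure (N \<omega>) (K j)) * indicator {c} (F \<omega>) \<partial>P)"
          by (intro nn_integral_cong) (auto simp: X_def I_def indicator_def)
        also have "\<dots> = (\<integral>\<^sup>+z. indicator (K j) (snd z) * indicator {c} (F (fst z) + u (snd z)) \<partial>(P \<Otimes>\<^sub>M halfline))"
          by (rule mecke[OF K Kf]) simp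
        also have "\<dots> = (\<integral>\<^sup>+x. (\<integral>\<^sup>+\<omega>. indicator (K j) x * indicator {\<omega> \<in> space P. F \<omega> = c - u x} \<omega> \<partial>P) \<partial>halfline)"
          by (subst PM.nn_integral_snd[symmetric]) (auto intro!: nn_integral_cong simp: indicator_def)
        also have "\<dots> = (\<integral>\<^sup>+x. indicator (K j) x * ennreal (p (c - u x)) \<partial>halfline)"
          by (intro nn_integral_cong) (simp add: nn_integral_cmult p_def P.emeasure_eq_measure)
        also have "\<dots> \<le> (\<integral>\<^sup>+x. ennreal q * indicator G x + ennreal (q / 2) * indicator (K j) x \<partial>halfline)"
        proof (rule nn_integral_mono)
          fix x assume x: "x \<in> space halfline"
          show "indicator (K j) x * ennreal (p (c - u x)) \<le> ennreal q * indicator G x + ennreal (q / 2) * indicator (K j) x"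
          proof (cases "x \<in> K j")
            case True
            show ?thesis
            proof (cases "x \<in> G")
              case True
              have "indicator (K j) x * ennreal (p (c - u x)) \<le> ennreal q"
                using pq[of "c - u x"] by (auto simp: indicator_def intro: ennreal_leI)
              then show ?thesis using True by (auto intro: order_trans)
            next
              case False
              have "c - u x \<notin> T"
              proof
                assume "c - u x \<in> T"
                then have "e \<le> \<bar>u x\<bar>" using e(2)[of "c - u x"] by simp
                then show False using False x by (simp add: G_def)
              qed
              then have "p (c - u x) \<le> q / 2" using True by (auto simp: T_def K_def)
              then have "ennreal (p (c - u x)) \<le> ennreal (q / 2)" by (rule ennreal_leI)
              then show ?thesis using True False by simp
            qed
          qed simp
        qed
        also have "\<dots> = ennreal q * emeasure halfline G + ennreal (q / 2) * emeasure halfline (K j)"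
          by (subst nn_integral_add) (auto simp: nn_integral_cmult_indicator)
        also have "\<dots> = ennreal (q * b + q / 2 * l)"
        proof -
          have "ennreal q * ennreal b = ennreal (q * b)" using q0 b0 by (intro ennreal_mult[symmetric]) auto
          moreover have "ennreal (q / 2) * ennreal l = ennreal (q / 2 * l)" using q0 l0 by (intro ennreal_mult[symmetric]) auto
          moreover have "ennreal (q * b + q / 2 * l) = ennreal (q * b) + ennreal (q / 2 * l)" using q0 b0 l0 by (intro ennreal_plus) auto
          ultimately show ?thesis unfolding b l by (simp only:)
        qed
        finally show ?thesis using q0 b0 l0 by (subst (asm) ennreal_le_iff) auto
      qed
      have low: "l * q - (\<integral>\<omega>. X \<omega> * I \<omega> \<partial>P) \<le> sqrt l"
      proof (cases "l = 0")
        case True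
        have "0 \<le> (\<integral>\<omega>. X \<omega> * I \<omega> \<partial>P)" by (intro integral_nonneg_AE AE_I2) (auto simp: X_def I_def)
        then show ?thesis using True by simp
      next
        case False
        then have lp: "l > 0" using l0 by simp
        \<comment> \<open>The parameter that balances the two terms of
          \<open>\<bar>d\<bar> \<le> s / 2 + d\<^sup>2 / (2 * s)\<close> when the mean of
          \<open>d\<^sup>2\<close> is \<open>l\<close>.\<close>
        define s where "s = sqrt l"
        have s: "s > 0" "s * s = l" using lp by (auto simp: s_def)
        have v: "integrable P (\<lambda>\<omega>. (X \<omega> - l)\<^sup>2)" "(\<integral>\<omega>. (X \<omega> - l)\<^sup>2 \<partial>P) = l"
          using N_variance[OF K Kf, of j] by (auto simp: X_def l_def)
        have "l * q - (\<integral>\<omega>. X \<omega> * I \<omega> \<partial>P) = (\<integral>\<omega>. l * I \<omega> - X \<omega> * I \<omega> \<partial>P)"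
          using iXI iI by (simp add: EI')
        also have "\<dots> \<le> (\<integral>\<omega>. s / 2 + (X \<omega> - l)\<^sup>2 / (2 * s) \<partial>P)"
        proof (rule integral_mono)
          fix \<omega>
          have "l * I \<omega> - X \<omega> * I \<omega> \<le> \<bar>X \<omega> - l\<bar>" by (auto simp: I_def indicator_def)
          also have "\<bar>X \<omega> - l\<bar> \<le> s / 2 + (X \<omega> - l)\<^sup>2 / (2 * s)"
          proof -
            define d where "d = \<bar>X \<omega> - l\<bar>"
            have "0 \<le> (d - s)\<^sup>2" by simp
            then have "d * (2 * s) \<le> s * s + d\<^sup>2" by (simp add: power2_eq_square algebra_simps)
            then have "d \<le> (s * s + d\<^sup>2) / (2 * s)" using s by (simp add: pos_le_divide_eq)
            also have "\<dots> = s / 2 + d\<^sup>2 / (2 * s)" using s(1) by (simp add: add_divide_distrib)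
            finally show ?thesis by (simp add: d_def)
          qed
          finally show "l * I \<omega> - X \<omega> * I \<omega> \<le> s / 2 + (X \<omega> - l)\<^sup>2 / (2 * s)" .
        qed (use iXI iI v in auto)
        also have "\<dots> = s / 2 + l / (2 * s)" using v by (simp add: P.prob_space)
        also have "\<dots> = s"
        proof -
          have "l / (2 * s) = s / 2" unfolding s(2)[symmetric] using s(1) by simp
          then show ?thesis by simp
        qed
        finally show ?thesis by (simp add: s_def)
      qed
      show ?thesis using up low by (simp add: l_def)
    qed
    have "(\<lambda>j. emeasure halfline (K j)) \<longlonglongrightarrow> emeasure halfline (\<Union>j. K j)"
      proof (rule Lim_emeasure_incseq)
      show "range K \<subseteq> sets halfline" using K by auto
      show "incseq K" by (auto simp: incseq_def K_def)
    qed
    moreover have "(\<Union>j. K j) = {t \<in> {0..}. u t \<noteq> 0}"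
      using real_arch_simple by (auto simp: K_def)
    ultimately have "(\<lambda>j. emeasure halfline (K j)) \<longlonglongrightarrow> \<infinity>" using inf by simp
    \<comment> \<open>The thresholds make \<open>sqrt l\<close> at most \<open>q * l / 4\<close> and
      \<open>q * b\<close> strictly smaller than \<open>q * l / 4\<close>, which contradicts the
      inequality \<open>q * l / 2 \<le> sqrt l + q * b\<close> obtained from
      \<open>bound\<close>.\<close>
    from order_tendstoD(1)[OF this, of "ennreal (max ((4 / q)\<^sup>2) (4 * b))"]
    have "\<forall>\<^sub>F j in sequentially. ennreal (max ((4 / q)\<^sup>2) (4 * b)) < emeasure halfline (K j)" by simp
    then obtain j where j: "ennreal (max ((4 / q)\<^sup>2) (4 * b)) < emeasure halfline (K j)" by (auto dest: eventually_happens)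
    define l where "l = measure halfline (K j)"
    have "emeasure halfline (K j) = ennreal l" unfolding l_def using Kf[of j] by (intro emeasure_eq_ennreal_measure) auto
    then have l: "(4 / q)\<^sup>2 < l" "4 * b < l" using j by (auto simp: ennreal_less_iff le_max_iff_disj)
    have "sqrt ((4 / q)\<^sup>2) \<le> sqrt l" using l by (intro real_sqrt_le_mono) auto
    then have sl: "4 / q \<le> sqrt l" using q0 by simp
    have "l = sqrt l * sqrt l" using l b0 by simp
    moreover have "4 / q * sqrt l \<le> sqrt l * sqrt l" using sl l b0 by (intro mult_right_mono) auto
    ultimately have "4 / q * sqrt l \<le> l" by simp
    then have "4 * sqrt l \<le> q * l" using q0 by (simp add: field_simps)
    moreover have "l * q \<le> sqrt l + (q * b + q / 2 * l)" using bound[of j] by (simp add: l_def)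
    moreover have "q * (4 * b) < q * l" using l q0 by simp
    ultimately show False by (simp add: algebra_simps)
  qed
  then have "emeasure P {\<omega> \<in> space P. F \<omega> = c0} = 0" by (simp add: p_def P.emeasure_eq_measure)
  then show ?thesis by (intro AE_I[of _ _ "{\<omega> \<in> space P. F \<omega> = c0}"]) auto
qed

text \<open>The exceptional outcomes must not depend on \<open>d\<close>, which ranges over an
  uncountable set and will itself be random. Comparing \<open>x\<close> with a second parameter
  \<open>x'\<close> avoids naming the level before the outcome is fixed.\<close>

lemma AE_levels_null:
  assumes V[measurable]: "V \<in> borel_measurable (P \<Otimes>\<^sub>M halfline)"
    and neq: "AE x in halfline. AE x' in halfline. AE \<omega> in P. V (\<omega>, x) \<noteq> (V (\<omega>, x') :: real)"
  shows "AE \<omega> in P. \<forall>d. AE x in halfline. V (\<omega>, x) \<noteq> d"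
proof -
  have "AE x in halfline. AE \<omega> in P. AE x' in halfline. V (\<omega>, x) \<noteq> V (\<omega>, x')"
    using neq AE_space
  proof eventually_elim
    case (elim x)
    note [measurable] = elim(2)
    have "{p \<in> space (P \<Otimes>\<^sub>M halfline). V (fst p, x) \<noteq> V (fst p, snd p)} \<in> sets (P \<Otimes>\<^sub>M halfline)" by measurable
    from PM.AE_commute[where P = "\<lambda>\<omega> x'. V (\<omega>, x) \<noteq> V (\<omega>, x')", OF this] elim(1) show ?case by (rule iffD2)
  qed
  moreover have "{p \<in> space (P \<Otimes>\<^sub>M halfline). AE x' in halfline. V (fst p, snd p) \<noteq> V (fst p, x')} \<in> sets (P \<Otimes>\<^sub>M halfline)"
  proof -
    define W where "W = {q \<in> space ((P \<Otimes>\<^sub>M halfline) \<Otimes>\<^sub>M halfline). V (fst q) \<noteq> V (fst (fst q), snd q)}"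
    have W: "W \<in> sets ((P \<Otimes>\<^sub>M halfline) \<Otimes>\<^sub>M halfline)" unfolding W_def by measurable
    have eq: "(AE x' in halfline. V (fst p, snd p) \<noteq> V (fst p, x')) \<longleftrightarrow> (AE x' in halfline. (p, x') \<in> W)" if "p \<in> space (P \<Otimes>\<^sub>M halfline)" for p
      by (rule AE_cong) (use that in \<open>auto simp: W_def space_pair_measure\<close>)
    have "{p \<in> space (P \<Otimes>\<^sub>M halfline). AE x' in halfline. V (fst p, snd p) \<noteq> V (fst p, x')} = {p \<in> space (P \<Otimes>\<^sub>M halfline). AE x' in halfline. (p, x') \<in> W}"
      by (intro Collect_cong conj_cong refl, rule eq)
    then show ?thesis using sets_AE_section[OF sigma_finite_halfline W] by simp
  qed
  ultimately have "AE \<omega> in P. AE x in halfline. AE x' in halfline. V (\<omega>, x) \<noteq> V (\<omega>, x')"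
    using PM.AE_commute[where P = "\<lambda>\<omega> x. AE x' in halfline. V (\<omega>, x) \<noteq> V (\<omega>, x')"] by blast
  then show ?thesis
  proof eventually_elim
    case (elim \<omega>)
    show ?case
    proof
      fix d
      show "AE x in halfline. V (\<omega>, x) \<noteq> d"
      \<comment> \<open>Either some good \<open>x\<close> has the value \<open>d\<close>, and then
        almost no \<open>x'\<close> shares it, or the whole level set lies in the null set of bad
        \<open>x\<close>.\<close>
      proof (cases "\<exists>x. (AE x' in halfline. V (\<omega>, x) \<noteq> V (\<omega>, x')) \<and> V (\<omega>, x) = d")
        case True
        then obtain x where "AE x' in halfline. V (\<omega>, x) \<noteq> V (\<omega>, x')" "V (\<omega>, x) = d" by blast
        then show ?thesis by (auto elim!: eventually_mono)
      next
        case False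
        then show ?thesis using elim by (auto elim!: eventually_mono)
      qed
    qed
  qed
qed

section \<open>The induction on the order\<close>

lemma AE_empty_prod: "(AE y in halfline_prod {}. Q y) \<longleftrightarrow> Q (\<lambda>_. undefined)"
  unfolding halfline_prod_def PiM_empty by (simp add: AE_count_space)

lemma not_AE_False: "\<not> (AE z in halfline_prod {1..m}. False)"
proof
  assume "AE z in halfline_prod {1..m}. False"
  then have "AE z in halfline_prod {1..m}. z \<notin> hbox m 1" by (rule eventually_mono) simp
  then have "emeasure (halfline_prod {1..m}) (hbox m 1) = 0"
    using AE_iff_null_sets[OF hbox_sets, of m 1] by auto
  moreover have "emeasure (halfline_prod {1..m}) (hbox m 1) = (\<Prod>i\<in>{1..m}. emeasure halfline {0..1})"
    unfolding hbox_def halfline_prod_def using Icc_halfline by (intro halfline_prod.emeasure_PiM) auto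
  ultimately show False by (simp add: Icc_halfline)
qed

lemma fun_upd_comp_permutes:
  assumes "p permutes {1..m}" shows "(y \<circ> p)(Suc m := x) = (y(Suc m := x)) \<circ> p"
proof
  fix i
  have "p (Suc m) = Suc m" using assms by (simp add: permutes_not_in)
  moreover have "p i \<noteq> Suc m" if "i \<noteq> Suc m"
    using permutes_inj[OF assms] that calculation by (metis injD)
  ultimately show "((y \<circ> p)(Suc m := x)) i = ((y(Suc m := x)) \<circ> p) i" by simp
qed

text \<open>The level that \<open>V\<close> has to avoid is \<open>c - F\<close>, which is random;
  hence all levels are excluded simultaneously. The induction hypothesis is called only at the value
  0, for the difference of two sections, whose kernel inherits symmetry and, for almost all frozen
  points, square integrability.\<close>

lemma no_atoms:
  assumes "1 \<le> m" "version m \<phi> F" "sqn (halfline_prod {1..m}) \<phi> < \<top>" "nondegenerate m \<phi> g"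
    and "\<And>z p. z \<in> space (halfline_prod {1..m}) \<Longrightarrow> p permutes {1..m} \<Longrightarrow> \<phi> (z \<circ> p) = \<phi> z"
  shows "AE \<omega> in P. F \<omega> \<noteq> c"
  using assms
proof (induction m arbitrary: \<phi> F g c)
  case 0 then show ?case by simp
next
  case (Suc m)
  note v = Suc.prems(2) and L2 = Suc.prems(3) and nd = Suc.prems(4) and sym = Suc.prems(5)
  note F[measurable] = versionD(1)[OF v] and \<phi>[measurable] = versionD(2)[OF v]
  have g[measurable]: "g \<in> borel_measurable (halfline_prod {1..Suc m})" using nd by (simp add: nondegenerate_def)
  obtain V where V[measurable]: "V \<in> borel_measurable (P \<Otimes>\<^sub>M halfline)"
    and Vv: "AE x in halfline. version m (\<lambda>y. \<Sum>i=1..Suc m. \<phi> (y(Suc m := x) \<circ> Transposition.transpose i (Suc m))) (\<lambda>\<omega>. V (\<omega>, x))"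
    and mecke: "\<And>K B. K \<in> sets halfline \<Longrightarrow> emeasure halfline K < \<infinity> \<Longrightarrow> B \<in> sets borel \<Longrightarrow>
      (\<integral>\<^sup>+\<omega>. ennreal (measure (N \<omega>) K) * indicator B (F \<omega>) \<partial>P) =
      (\<integral>\<^sup>+p. indicator K (snd p) * indicator B (F (fst p) + V p) \<partial>(P \<Otimes>\<^sub>M halfline))"
    using mecke_version[OF v] by blast
  have sp: "y(Suc m := x) \<in> space (halfline_prod {1..Suc m})" if "y \<in> space (halfline_prod {1..m})" "0 \<le> x" for x y
    using that unfolding Suc_insert by (auto simp: space_halfline_prod PiE_iff extensional_def)
  have sum: "(\<Sum>i=1..Suc m. \<phi> (y(Suc m := x) \<circ> Transposition.transpose i (Suc m))) = real (Suc m) * \<phi> (y(Suc m := x))"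
    if "y \<in> space (halfline_prod {1..m})" "0 \<le> x" for x y
  proof -
    have "(\<Sum>i=1..Suc m. \<phi> (y(Suc m := x) \<circ> Transposition.transpose i (Suc m))) = (\<Sum>i=1..Suc m. \<phi> (y(Suc m := x)))"
      by (intro sum.cong refl sym sp that transpose_permutes)
    then show ?thesis by simp
  qed
  show ?case
  proof (cases "m = 0")
    case True
    \<comment> \<open>At order one the sections have order 0, so \<open>V\<close> is, up to null
      sets, a deterministic function \<open>u\<close> of the added point.\<close>
    define u where "u x = \<phi> ((\<lambda>_. undefined)(1 := x))" for x
    have um[measurable]: "u \<in> borel_measurable halfline"
    proof -
      have "(\<lambda>x. (\<lambda>_. undefined)(1 := x)) \<in> halfline \<rightarrow>\<^sub>M halfline_prod {1..Suc m}"
        using measurable_halfline_upd1[of "\<lambda>_. undefined" "{}" 1] True by (simp add: space_halfline_prod One_nat_def)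
      from measurable_compose[OF this \<phi>] show ?thesis unfolding u_def .
    qed
    have hp0: "sqn (halfline_prod {1..0}) h = ennreal ((h (\<lambda>_. undefined))\<^sup>2)" for h
      unfolding sqn_def halfline_prod_def by (simp add: halfline_prod.nn_integral_empty)
    have us: "{p \<in> space (P \<Otimes>\<^sub>M halfline). V (fst p, snd p) = u (snd p)} \<in> sets (P \<Otimes>\<^sub>M halfline)" by measurable
    have "AE x in halfline. AE \<omega> in P. V (\<omega>, x) = u x"
      using Vv AE_space
    proof eventually_elim
      case (elim x)
      have "version 0 (\<lambda>y. \<Sum>i=1..Suc m. \<phi> (y(Suc m := x) \<circ> Transposition.transpose i (Suc m))) (\<lambda>\<omega>. V (\<omega>, x))"
        using elim(1) True by simp
      from version_0[OF this] show ?case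
        using sum[of "\<lambda>_. undefined" x] elim(2) True by (simp add: u_def space_halfline_prod One_nat_def)
    qed
    then have "AE \<omega> in P. AE x in halfline. V (\<omega>, x) = u x"
      by (rule PM.AE_commute[where P = "\<lambda>\<omega> x. V (\<omega>, x) = u x", OF us, THEN iffD2])
    then have Vu: "AE p in P \<Otimes>\<^sub>M halfline. V p = u (snd p)"
      using us by (intro PM.AE_pair_measure) auto
    show ?thesis
    proof (rule no_atoms_first_order[OF F um])
      fix K B assume K: "K \<in> sets halfline" "emeasure halfline K < \<infinity>" and B: "B \<in> sets (borel :: real measure)"
      show "(\<integral>\<^sup>+\<omega>. ennreal (measure (N \<omega>) K) * indicator B (F \<omega>) \<partial>P) =
        (\<integral>\<^sup>+p. indicator K (snd p) * indicator B (F (fst p) + u (snd p)) \<partial>(P \<Otimes>\<^sub>M halfline))"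
        unfolding mecke[OF K B] by (rule nn_integral_cong_AE, use Vu in eventually_elim) simp
    next
      have "sqn halfline u = (\<integral>\<^sup>+x. sqn (halfline_prod {1..0}) (\<lambda>y. \<phi> (y(Suc 0 := x))) \<partial>halfline)"
        unfolding hp0 by (simp add: sqn_def u_def One_nat_def)
      also have "\<dots> = sqn (halfline_prod {1..Suc m}) \<phi>"
        using sqn_halfline_prod_Suc(2)[OF \<phi>] unfolding True .
      finally show "sqn halfline u < \<top>" using L2 by simp
    next
      have I1: "{1..Suc m} = insert 1 {}" and I2: "{2..Suc m} = {}" using True by (auto simp: One_nat_def)
      interpret H: pair_sigma_finite "halfline_prod {1..Suc m}" "halfline_prod {1..Suc m}"
        by (intro pair_sigma_finite.intro sigma_finite_halfline_prod) auto
      have "AE p in halfline_prod {1..Suc m} \<Otimes>\<^sub>M halfline_prod {1..Suc m}. g (fst p) \<noteq> 0 \<longrightarrow> diffs (Suc m) \<phi> (fst p) (snd p) \<noteq> 0"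
        using nd unfolding nondegenerate_def by blast
      from H.AE_pair[OF this] have "AE z in halfline_prod {1..Suc m}. g z \<noteq> 0 \<longrightarrow> \<phi> z \<noteq> 0"
      proof eventually_elim
        case (elim z)
        then show ?case using not_AE_False[of "Suc m"] True diffs_1[of \<phi> z] by (auto simp: One_nat_def)
      qed
      then have "AE x in halfline. AE y in halfline_prod {}. g (y(1 := x)) \<noteq> 0 \<longrightarrow> \<phi> (y(1 := x)) \<noteq> 0"
        unfolding I1 by (rule AE_halfline_prod_insert[rotated 2]) auto
      then have 1: "AE x in halfline. g ((\<lambda>_. undefined)(1 := x)) \<noteq> 0 \<longrightarrow> u x \<noteq> 0"
        unfolding AE_empty_prod u_def .
      have "AE y in halfline_prod {2..Suc m}. emeasure halfline {t \<in> {0..}. g (y(1 := t)) \<noteq> 0} = \<infinity>"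
        using nd unfolding nondegenerate_def by blast
      then have 2: "emeasure halfline {t \<in> {0..}. g ((\<lambda>_. undefined)(1 := t)) \<noteq> 0} = \<infinity>"
        unfolding I2 AE_empty_prod .
      have us: "{t \<in> {0..}. u t \<noteq> 0} \<in> sets halfline"
      proof -
        have "{t \<in> space halfline. u t \<noteq> 0} \<in> sets halfline" by measurable
        then show ?thesis by simp
      qed
      have "emeasure halfline {t \<in> {0..}. g ((\<lambda>_. undefined)(1 := t)) \<noteq> 0} \<le> emeasure halfline {t \<in> {0..}. u t \<noteq> 0}"
        using 1 us by (intro emeasure_mono_AE) (auto elim!: eventually_mono)
      then show "emeasure halfline {t \<in> {0..}. u t \<noteq> 0} = \<infinity>" using 2 by (simp add: top_unique)
    qed
  next
    case False
    then have m: "1 \<le> m" by simp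
    define c' where "c' = real (Suc m)"
    have c': "c' \<noteq> 0" by (simp add: c'_def)
    have Vv': "AE x in halfline. version m (\<lambda>y. c' * \<phi> (y(Suc m := x))) (\<lambda>\<omega>. V (\<omega>, x))"
      using Vv AE_space
    proof eventually_elim
      case (elim x)
      show ?case by (rule version_cong[OF elim(1)]) (use elim(2) sum c'_def in simp)
    qed
    have fin: "AE x in halfline. sqn (halfline_prod {1..m}) (\<lambda>y. \<phi> (y(Suc m := x))) < \<top>"
    proof -
      have "(\<integral>\<^sup>+x. sqn (halfline_prod {1..m}) (\<lambda>y. \<phi> (y(Suc m := x))) \<partial>halfline) \<noteq> \<infinity>"
        unfolding sqn_halfline_prod_Suc(2)[OF \<phi>] using L2 by simp
      from nn_integral_noteq_infinite[OF sqn_halfline_prod_Suc(1)[OF \<phi>] this] show ?thesis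
        by eventually_elim (simp add: less_top)
    qed
    have neq: "AE x in halfline. AE x' in halfline. AE \<omega> in P. V (\<omega>, x) \<noteq> V (\<omega>, x')"
      using nondegenerate_Suc[OF nd \<phi> m c'] Vv' fin AE_space
    proof eventually_elim
      case (elim x)
      note x = elim
      show ?case using x(1) Vv' fin AE_space
      proof eventually_elim
        case (elim x')
        have x0: "0 \<le> x" "0 \<le> x'" using x(4) elim(4) by auto
        define \<phi>' where "\<phi>' y = c' * (\<phi> (y(Suc m := x)) - \<phi> (y(Suc m := x')))" for y
        have vd: "version m \<phi>' (\<lambda>\<omega>. V (\<omega>, x) - V (\<omega>, x'))"
          by (rule version_cong[OF version_diff[OF x(2) elim(2)]]) (simp add: \<phi>'_def right_diff_distrib)
        have ms: "(\<lambda>y. \<phi> (y(Suc m := x))) \<in> borel_measurable (halfline_prod {1..m})"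
          "(\<lambda>y. \<phi> (y(Suc m := x'))) \<in> borel_measurable (halfline_prod {1..m})"
          using x0 by (auto intro: measurable_section \<phi>)
        have "sqn (halfline_prod {1..m}) \<phi>' = ennreal (c'\<^sup>2) * sqn (halfline_prod {1..m}) (\<lambda>y. \<phi> (y(Suc m := x)) - \<phi> (y(Suc m := x')))"
          unfolding \<phi>'_def using ms by (intro sqn_cmult) auto
        also have "\<dots> \<le> ennreal (c'\<^sup>2) * (2 * sqn (halfline_prod {1..m}) (\<lambda>y. \<phi> (y(Suc m := x))) + 2 * sqn (halfline_prod {1..m}) (\<lambda>y. \<phi> (y(Suc m := x'))))"
          using ms by (intro mult_left_mono sqn_diff_le) auto
        also have "\<dots> < \<top>" using x(3) elim(3) by (simp add: ennreal_mult_less_top)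
        finally have sf: "sqn (halfline_prod {1..m}) \<phi>' < \<top>" .
        have "AE \<omega> in P. V (\<omega>, x) - V (\<omega>, x') \<noteq> 0"
        proof (rule Suc.IH[OF m vd sf elim(1)[folded \<phi>'_def]])
          fix z p assume z: "z \<in> space (halfline_prod {1..m})" and p: "p permutes {1..m}"
          have p': "p permutes {1..Suc m}" by (rule permutes_subset[OF p]) auto
          show "\<phi>' (z \<circ> p) = \<phi>' z"
            unfolding \<phi>'_def fun_upd_comp_permutes[OF p] sym[OF sp[OF z x0(1)] p'] sym[OF sp[OF z x0(2)] p'] ..
        qed
        then show ?case by simp
      qed
    qed
    have "AE \<omega> in P. AE x in halfline. F \<omega> + V (\<omega>, x) \<noteq> c"
      using AE_levels_null[OF V neq]
    proof eventually_elim
      case (elim \<omega>)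
      from elim[rule_format, of "c - F \<omega>"] show ?case by eventually_elim auto
    qed
    then have "AE p in P \<Otimes>\<^sub>M halfline. F (fst p) + V p \<noteq> c"
      by (intro PM.AE_pair_measure) auto
    then have ae: "AE p in P \<Otimes>\<^sub>M halfline. F (fst p) + V p \<notin> {c}" by simp
    have "AE \<omega> in P. F \<omega> \<notin> {c}"
    proof (rule mecke_null[OF F V _ _ ae])
      fix K B assume "K \<in> sets halfline" "emeasure halfline K < \<infinity>" "B \<in> sets (borel :: real measure)"
      then show "(\<integral>\<^sup>+\<omega>. ennreal (measure (N \<omega>) K) * indicator B (F \<omega>) \<partial>P) =
        (\<integral>\<^sup>+p. indicator K (snd p) * indicator B (F (fst p) + V p) \<partial>(P \<Otimes>\<^sub>M halfline))" by (rule mecke)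
    qed simp
    then show ?thesis by simp
  qed
qed

end

section \<open>The gradient of the symmetrization\<close>

lemma AE_halfline_const:
  assumes "AE x in halfline. R" shows R
proof (rule ccontr)
  assume "\<not> R"
  then have "AE x in halfline. x \<notin> {0..1}" using assms by (auto elim!: eventually_mono)
  then have "emeasure halfline {0..1} = 0"
    using AE_iff_null_sets[OF Icc_halfline(1)[of 1]] by auto
  then show False by (simp add: Icc_halfline)
qed

section \<open>Symmetrization as a contraction\<close>

lemma square_integrable_sqn:
  "square_integrable M u \<longleftrightarrow> u \<in> borel_measurable M \<and> sqn M u < \<top>"
proof (cases "u \<in> borel_measurable M")
  case True
  then have "(\<lambda>x. (u x)\<^sup>2) \<in> borel_measurable M" by simp
  then show ?thesis using True by (simp add: square_integrable_def integrable_iff_bounded sqn_def)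
qed (simp add: square_integrable_def)

lemma measurable_symmetrization:
  assumes "f \<in> borel_measurable (halfline_prod {1..n})"
  shows "symmetrization n f \<in> borel_measurable (halfline_prod {1..n})"
proof -
  have "(\<lambda>x. f (x \<circ> p)) \<in> borel_measurable (halfline_prod {1..n})" if "p permutes {1..n}" for p
    by (rule measurable_compose[OF measurable_permute[OF that] assms]) simp
  then show ?thesis unfolding symmetrization_def[abs_def]
    by (intro borel_measurable_divide borel_measurable_sum) auto
qed

lemma symmetrization_permute:
  assumes "p permutes {1..n}"
  shows "symmetrization n f (z \<circ> p) = symmetrization n f z"
proof -
  have "(\<Sum>\<sigma> | \<sigma> permutes {1..n}. f (z \<circ> \<sigma>)) = (\<Sum>\<sigma> | \<sigma> permutes {1..n}. f (z \<circ> (p \<circ> \<sigma>)))"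
    by (rule setum_permutations_compose_left[OF assms])
  then show ?thesis by (simp add: symmetrization_def comp_assoc)
qed

text \<open>Cauchy-Schwarz over the \<open>fact n\<close> permutations, whose terms all have the
  norm of \<open>f\<close>; the constants cancel exactly.\<close>

lemma sqn_symmetrization_le:
  assumes f[measurable]: "f \<in> borel_measurable (halfline_prod {1..n})"
  shows "sqn (halfline_prod {1..n}) (symmetrization n f) \<le> sqn (halfline_prod {1..n}) f"
proof -
  let ?M = "halfline_prod {1..n}" and ?S = "{\<sigma>. \<sigma> permutes {1..n}}"
  have fin: "finite ?S" by (rule finite_permutations) simp
  have card: "card ?S = fact n" by (rule card_permutations) simp_all
  have m: "(\<lambda>x. f (x \<circ> p)) \<in> borel_measurable ?M" if "p permutes {1..n}" for p
    by (rule measurable_compose[OF measurable_permute[OF that] f]) simp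
  have "sqn ?M (symmetrization n f) = sqn ?M (\<lambda>x. (1 / fact n) * (\<Sum>\<sigma>\<in>?S. f (x \<circ> \<sigma>)))"
    by (intro sqn_cong) (simp add: symmetrization_def)
  also have "\<dots> = ennreal ((1 / fact n)\<^sup>2) * sqn ?M (\<lambda>x. \<Sum>\<sigma>\<in>?S. f (x \<circ> \<sigma>))"
    using m by (intro sqn_cmult borel_measurable_sum) auto
  also have "\<dots> \<le> ennreal ((1 / fact n)\<^sup>2) * (of_nat (card ?S) * (\<Sum>\<sigma>\<in>?S. sqn ?M (\<lambda>x. f (x \<circ> \<sigma>))))"
    using m fin by (intro mult_left_mono sqn_sum_le) auto
  also have "(\<Sum>\<sigma>\<in>?S. sqn ?M (\<lambda>x. f (x \<circ> \<sigma>))) = (\<Sum>\<sigma>\<in>?S. sqn ?M f)"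
    by (intro sum.cong refl sqn_permute f) auto
  also have "\<dots> = of_nat (fact n) * sqn ?M f" by (simp add: card)
  also have "ennreal ((1 / fact n)\<^sup>2) * (of_nat (card ?S) * (of_nat (fact n) * sqn ?M f)) =
      (ennreal ((1 / fact n)\<^sup>2) * ennreal (real (fact n)) * ennreal (real (fact n))) * sqn ?M f"
    by (simp only: card ennreal_of_nat_eq_real_of_nat mult.assoc)
  also have "ennreal ((1 / fact n)\<^sup>2) * ennreal (real (fact n)) * ennreal (real (fact n)) = ennreal ((1 / fact n)\<^sup>2 * real (fact n) * real (fact n))"
    by (simp only: ennreal_mult[symmetric] zero_le_power2 of_nat_0_le_iff mult_nonneg_nonneg)
  also have "(1 / fact n)\<^sup>2 * real (fact n) * real (fact n) = (1::real)"
    by (simp add: power2_eq_square)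
  finally show ?thesis by simp
qed

text \<open>Once the coordinate \<open>i\<close> is redrawn, its former value no longer enters, so
  the hypothesis concerns the remaining coordinates and Fubini applies. This is how facts along
  almost every line become facts at almost every point.\<close>

lemma AE_halfline_prod_insertI:
  assumes I: "finite I" "i \<in> I" and Q[measurable]: "{z \<in> space (halfline_prod I). Q z} \<in> sets (halfline_prod I)"
    and ae: "AE z in halfline_prod I. AE s in halfline. Q (z(i := s))"
  shows "AE z in halfline_prod I. Q z"
proof -
  define J where "J = I - {i}"
  have J: "finite J" "i \<notin> J" "I = insert i J" using I by (auto simp: J_def)
  have "AE x in halfline. AE y in halfline_prod J. AE s in halfline. Q ((y(i := x))(i := s))"
    using ae unfolding J(3) by (rule AE_halfline_prod_insert[rotated 2]) (use J in auto)
  then have aeJ: "AE y in halfline_prod J. AE s in halfline. Q (y(i := s))"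
    using AE_halfline_const by simp
  define S where "S = {z \<in> space (halfline_prod I). \<not> Q z}"
  have S[measurable]: "S \<in> sets (halfline_prod I)" unfolding S_def by measurable
  have "emeasure (halfline_prod I) S = (\<integral>\<^sup>+z. indicator S z \<partial>halfline_prod I)" by simp
  also have "\<dots> = (\<integral>\<^sup>+y. \<integral>\<^sup>+s. indicator S (y(i := s)) \<partial>halfline \<partial>halfline_prod J)"
    using halfline_prod.product_nn_integral_insert[OF J(1,2), of "indicator S"] S
    unfolding J(3) halfline_prod_def by simp
  also have "\<dots> = (\<integral>\<^sup>+y. 0 \<partial>halfline_prod J)"
  proof (rule nn_integral_cong_AE, use aeJ in eventually_elim)
    case (elim y)
    have "(\<integral>\<^sup>+s. indicator S (y(i := s)) \<partial>halfline) = (\<integral>\<^sup>+s. 0 \<partial>halfline)"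
      by (rule nn_integral_cong_AE, use elim in eventually_elim) (simp add: S_def)
    then show ?case by simp
  qed
  finally have "emeasure (halfline_prod I) S = 0" by simp
  then show ?thesis by (intro AE_I[of _ _ S]) (auto simp: S_def)
qed

text \<open>The two points are swapped, so that the first becomes the inner variable of Fubini,
  where the one-point statement applies.\<close>

lemma AE_pair_upd_fstI:
  assumes I: "finite I" "i \<in> I"
    and Q: "{p \<in> space (halfline_prod I \<Otimes>\<^sub>M halfline_prod I). Q (fst p) (snd p)} \<in> sets (halfline_prod I \<Otimes>\<^sub>M halfline_prod I)"
    and ae: "AE p in halfline_prod I \<Otimes>\<^sub>M halfline_prod I. AE s in halfline. Q ((fst p)(i := s)) (snd p)"
  shows "AE p in halfline_prod I \<Otimes>\<^sub>M halfline_prod I. Q (fst p) (snd p)"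
proof -
  let ?M = "halfline_prod I"
  interpret MM: pair_sigma_finite ?M ?M
    by (intro pair_sigma_finite.intro sigma_finite_halfline_prod I(1))
  define sw :: "(nat \<Rightarrow> real) \<times> (nat \<Rightarrow> real) \<Rightarrow> _" where "sw = (\<lambda>(x, y). (y, x))"
  have swm: "sw \<in> ?M \<Otimes>\<^sub>M ?M \<rightarrow>\<^sub>M ?M \<Otimes>\<^sub>M ?M" unfolding sw_def by measurable
  have sw: "AE q in ?M \<Otimes>\<^sub>M ?M. R (sw q)" if "AE p in ?M \<Otimes>\<^sub>M ?M. R p" for R
  proof (rule AE_distrD[OF swm])
    show "AE p in distr (?M \<Otimes>\<^sub>M ?M) (?M \<Otimes>\<^sub>M ?M) sw. R p"
      using that unfolding sw_def MM.distr_pair_swap[symmetric] .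
  qed
  have "AE q in ?M \<Otimes>\<^sub>M ?M. AE s in halfline. Q ((snd q)(i := s)) (fst q)"
    using sw[OF ae] by (simp add: sw_def split_beta)
  from MM.AE_pair[OF this]
  have "AE z' in ?M. AE z in ?M. Q z z'" using AE_space
  proof eventually_elim
    case (elim z')
    have "{z \<in> space ?M. Q z z'} = (\<lambda>z. (z, z')) -` {p \<in> space (?M \<Otimes>\<^sub>M ?M). Q (fst p) (snd p)} \<inter> space ?M"
      using elim(2) by (auto simp: space_pair_measure)
    also have "\<dots> \<in> sets ?M" using elim(2) by (intro measurable_sets[OF _ Q]) measurable
    finally have S: "{z \<in> space ?M. Q z z'} \<in> sets ?M" .
    show ?case using elim(1) by (intro AE_halfline_prod_insertI[where Q = "\<lambda>z. Q z z'", OF I S]) simp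
  qed
  moreover have "{q \<in> space (?M \<Otimes>\<^sub>M ?M). Q (snd q) (fst q)} \<in> sets (?M \<Otimes>\<^sub>M ?M)"
  proof -
    have "{q \<in> space (?M \<Otimes>\<^sub>M ?M). Q (snd q) (fst q)} = sw -` {p \<in> space (?M \<Otimes>\<^sub>M ?M). Q (fst p) (snd p)} \<inter> space (?M \<Otimes>\<^sub>M ?M)"
      by (auto simp: space_pair_measure sw_def)
    also have "\<dots> \<in> sets (?M \<Otimes>\<^sub>M ?M)" by (rule measurable_sets[OF swm Q])
    finally show ?thesis .
  qed
  ultimately have "AE q in ?M \<Otimes>\<^sub>M ?M. Q (snd q) (fst q)"
    by (intro MM.AE_pair_measure[where P = "\<lambda>q. Q (snd q) (fst q)"]) simp_all
  from sw[OF this] show ?thesis by (simp add: sw_def split_beta)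
qed

text \<open>Adding the idle coordinate \<open>i\<close> lets statements about different variables
  live on one product space.\<close>

lemma has_partial_gradient_AE:
  assumes "has_partial_gradient n i f g" and i: "i \<in> {1..n}"
  shows "AE z in halfline_prod {1..n}. has_gradient (\<lambda>t. f (z(i := t))) (\<lambda>t. g (z(i := t)))"
proof -
  have "AE y in halfline_prod ({1..n} - {i}). has_gradient (\<lambda>t. f (y(i := t))) (\<lambda>t. g (y(i := t)))"
    using assms by (simp add: has_partial_gradient_def)
  then have "AE z in halfline_prod {1..n}. has_gradient (\<lambda>t. f ((restrict z ({1..n} - {i}))(i := t))) (\<lambda>t. g ((restrict z ({1..n} - {i}))(i := t)))"
    by (rule AE_halfline_prod_restrict[rotated 2]) auto
  then show ?thesis using AE_space
  proof eventually_elim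
    case (elim z)
    have "(restrict z ({1..n} - {i}))(i := t) = z(i := t)" for t
      using elim(2) by (auto simp: space_halfline_prod PiE_iff extensional_def fun_eq_iff)
    then show ?case using elim(1) by simp
  qed
qed

text \<open>In \<open>f (z \<circ> \<sigma>)\<close> the variable \<open>z n\<close> occupies the
  place \<open>inv \<sigma> n\<close>, so differentiating in it selects
  \<open>D (inv \<sigma> n)\<close>. Composing with a permutation that fixes \<open>n\<close>
  reindexes the sum over \<open>\<sigma>\<close> without changing \<open>inv \<sigma> n\<close>;
  hence \<open>H\<close> is symmetric in the first \<open>n - 1\<close> variables.\<close>

lemma symmetrization_gradient:
  assumes n: "1 \<le> n" and D: "\<And>i. i \<in> {1..n} \<Longrightarrow> has_partial_gradient n i f (D i)"
    and L2: "\<And>i. i \<in> {1..n} \<Longrightarrow> sqn (halfline_prod {1..n}) (D i) < \<top>"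
  obtains H where "H \<in> borel_measurable (halfline_prod {1..n})" "sqn (halfline_prod {1..n}) H < \<top>"
    "\<And>z p. p permutes {1..n - 1} \<Longrightarrow> H (z \<circ> p) = H z"
    "AE z in halfline_prod {1..n}. has_gradient (\<lambda>t. symmetrization n f (z(n := t))) (\<lambda>t. H (z(n := t)))"
proof -
  let ?M = "halfline_prod {1..n}" and ?S = "{\<sigma>. \<sigma> permutes {1..n}}"
  define H where "H z = (\<Sum>\<sigma>\<in>?S. (1 / fact n) * D (inv \<sigma> n) (z \<circ> \<sigma>))" for z
  have fin: "finite ?S" by (rule finite_permutations) simp
  have Dm: "D i \<in> borel_measurable ?M" if "i \<in> {1..n}" for i
    using D[OF that] by (simp add: has_partial_gradient_def)
  have i: "inv \<sigma> n \<in> {1..n}" if "\<sigma> permutes {1..n}" for \<sigma>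
    using permutes_in_image[OF permutes_inv[OF that], of n] n by auto
  have tm: "(\<lambda>x. D (inv \<sigma> n) (x \<circ> \<sigma>)) \<in> borel_measurable ?M" if "\<sigma> permutes {1..n}" for \<sigma>
    by (rule measurable_compose[OF measurable_permute[OF that] Dm[OF i[OF that]]]) simp
  then have tm': "(\<lambda>x. (1 / fact n) * D (inv \<sigma> n) (x \<circ> \<sigma>)) \<in> borel_measurable ?M" if "\<sigma> permutes {1..n}" for \<sigma>
    using that by (intro borel_measurable_times) auto
  show ?thesis
  proof (rule that)
    show "H \<in> borel_measurable ?M" unfolding H_def[abs_def] using tm' by (intro borel_measurable_sum) auto
    have "sqn ?M H \<le> of_nat (card ?S) * (\<Sum>\<sigma>\<in>?S. sqn ?M (\<lambda>z. (1 / fact n) * D (inv \<sigma> n) (z \<circ> \<sigma>)))"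
      unfolding H_def[abs_def] using tm' fin by (intro sqn_sum_le) auto
    also have "\<dots> = of_nat (card ?S) * (\<Sum>\<sigma>\<in>?S. ennreal ((1 / fact n)\<^sup>2) * sqn ?M (D (inv \<sigma> n)))"
    proof (intro arg_cong2[where f = "(*)"] refl sum.cong)
      fix \<sigma> assume "\<sigma> \<in> ?S"
      then have s: "\<sigma> permutes {1..n}" by simp
      show "sqn ?M (\<lambda>z. (1 / fact n) * D (inv \<sigma> n) (z \<circ> \<sigma>)) = ennreal ((1 / fact n)\<^sup>2) * sqn ?M (D (inv \<sigma> n))"
        unfolding sqn_cmult[OF tm[OF s]] sqn_permute[OF s finite_atLeastAtMost Dm[OF i[OF s]]] ..
    qed
    also have "\<dots> < \<top>"
      using L2 i fin by (auto simp: ennreal_mult_less_top ennreal_sum_less_top of_nat_less_top)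
    finally show "sqn ?M H < \<top>" .
  next
    fix z p assume p: "p permutes {1..n - 1}"
    have p': "p permutes {1..n}" by (rule permutes_subset[OF p]) auto
    have pn: "p n = n" by (rule permutes_not_in[OF p]) (use n in auto)
    have "H z = (\<Sum>\<sigma>\<in>?S. (1 / fact n) * D (inv (p \<circ> \<sigma>) n) (z \<circ> (p \<circ> \<sigma>)))"
      unfolding H_def by (rule setum_permutations_compose_left[OF p'])
    also have "\<dots> = H (z \<circ> p)"
      unfolding H_def
    proof (intro sum.cong refl)
      fix \<sigma> assume "\<sigma> \<in> ?S"
      then have "inv (p \<circ> \<sigma>) n = inv \<sigma> (inv p n)"
        using permutes_bij[OF p'] permutes_bij[of \<sigma> "{1..n}"] by (simp add: o_inv_distrib)
      also have "inv p n = n" using pn permutes_inv_eq[OF p', of n n] by simp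
      finally have e: "inv (p \<circ> \<sigma>) n = inv \<sigma> n" .
      show "(1 / fact n) * D (inv (p \<circ> \<sigma>) n) (z \<circ> (p \<circ> \<sigma>)) = (1 / fact n) * D (inv \<sigma> n) ((z \<circ> p) \<circ> \<sigma>)"
        unfolding e by (simp only: comp_assoc)
    qed
    finally show "H (z \<circ> p) = H z" ..
  next
    have "AE z in ?M. \<forall>\<sigma>\<in>?S. has_gradient (\<lambda>t. f ((z(n := t)) \<circ> \<sigma>)) (\<lambda>t. D (inv \<sigma> n) ((z(n := t)) \<circ> \<sigma>))"
    proof (rule AE_finite_allI[OF fin])
      fix \<sigma> assume "\<sigma> \<in> ?S"
      then have s: "\<sigma> permutes {1..n}" by simp
      have e: "(z(n := t)) \<circ> \<sigma> = (z \<circ> \<sigma>)(inv \<sigma> n := t)" for z :: "nat \<Rightarrow> real" and t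
      proof
        fix j
        have "\<sigma> j = n \<longleftrightarrow> j = inv \<sigma> n" using permutes_inv_eq[OF s, of n j] by auto
        then show "((z(n := t)) \<circ> \<sigma>) j = ((z \<circ> \<sigma>)(inv \<sigma> n := t)) j" by simp
      qed
      have "AE z in distr ?M ?M (\<lambda>z. z \<circ> \<sigma>). has_gradient (\<lambda>t. f (z(inv \<sigma> n := t))) (\<lambda>t. D (inv \<sigma> n) (z(inv \<sigma> n := t)))"
        using has_partial_gradient_AE[OF D[OF i[OF s]] i[OF s]] unfolding distr_halfline_prod_permute[OF s finite_atLeastAtMost] .
      from AE_distrD[OF measurable_permute[OF s finite_atLeastAtMost] this]
      show "AE z in ?M. has_gradient (\<lambda>t. f ((z(n := t)) \<circ> \<sigma>)) (\<lambda>t. D (inv \<sigma> n) ((z(n := t)) \<circ> \<sigma>))"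
        unfolding e .
    qed
    then show "AE z in ?M. has_gradient (\<lambda>t. symmetrization n f (z(n := t))) (\<lambda>t. H (z(n := t)))"
    proof eventually_elim
      case (elim z)
      have "symmetrization n f x = (\<Sum>\<sigma>\<in>?S. (1 / fact n) * f (x \<circ> \<sigma>))" for x
        by (simp add: symmetrization_def sum_divide_distrib)
      then show ?case unfolding H_def
        using has_gradient_lincomb[OF fin, of "\<lambda>\<sigma> t. f ((z(n := t)) \<circ> \<sigma>)" "\<lambda>\<sigma> t. D (inv \<sigma> n) ((z(n := t)) \<circ> \<sigma>)" "\<lambda>_. 1 / fact n"] elim
        by simp
    qed
  qed
qed

lemma diffs_cong:
  "(\<And>S. S \<subseteq> {2..m} \<Longrightarrow> \<phi> (mix S z z') = \<psi> (mix S z z')) \<Longrightarrow> diffs m \<phi> z z' = diffs m \<psi> z z'"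
  unfolding diffs_def by (intro sum.cong refl) auto

text \<open>Along coordinate \<open>Suc k\<close> of the first point, the difference of
  \<open>h (Suc k)\<close> is a function \<open>u\<close> minus its value at the corresponding
  coordinate of the second point, and the weak gradient of \<open>u\<close> is the difference of
  \<open>h k\<close>. A weakly differentiable function takes a given value almost only where its
  gradient vanishes, so nonvanishing propagates upwards from \<open>h 1\<close>. Each stage uses
  integrability along single lines only.\<close>

lemma mixed_gradient_diffs:
  assumes h: "\<And>k. k \<in> {2..n} \<Longrightarrow> has_partial_gradient n k (h k) (h (k - 1))"
    and k: "1 \<le> k" "k < n"
  shows "AE p in halfline_prod {1..n} \<Otimes>\<^sub>M halfline_prod {1..n}.
    h 1 (fst p) \<noteq> 0 \<longrightarrow> diffs k (h k) (fst p) (snd p) \<noteq> 0"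
  using k
proof (induction k rule: nat_induct_at_least)
  case base
  show ?case by (simp add: diffs_1)
next
  case (Suc k)
  let ?M = "halfline_prod {1..n}"
  have hm: "h j \<in> borel_measurable ?M" if "1 \<le> j" "j < n" for j
    using h[of "Suc j"] that by (simp add: has_partial_gradient_def)
  have hk: "AE z in ?M. has_gradient (\<lambda>t. h (Suc k) (z(Suc k := t))) (\<lambda>t. h k (z(Suc k := t)))"
    using has_partial_gradient_AE[OF h[of "Suc k"]] Suc by auto
  have "AE p in ?M \<Otimes>\<^sub>M ?M. \<forall>S\<in>Pow {2..k}. has_gradient (\<lambda>t. h (Suc k) ((mix S (fst p) (snd p))(Suc k := t))) (\<lambda>t. h k ((mix S (fst p) (snd p))(Suc k := t)))"
  proof (rule AE_finite_allI)
    fix S assume "S \<in> Pow {2..k}"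
    then have "S \<subseteq> {1..n}" using Suc by auto
    from AE_mix[OF this _ hk]
    show "AE p in ?M \<Otimes>\<^sub>M ?M. has_gradient (\<lambda>t. h (Suc k) ((mix S (fst p) (snd p))(Suc k := t))) (\<lambda>t. h k ((mix S (fst p) (snd p))(Suc k := t)))"
      by simp
  qed simp
  then have "AE p in ?M \<Otimes>\<^sub>M ?M. AE s in halfline.
    diffs (Suc k) (h (Suc k)) ((fst p)(Suc k := s)) (snd p) = 0 \<longrightarrow> diffs k (h k) ((fst p)(Suc k := s)) (snd p) = 0"
  proof eventually_elim
    case (elim p)
    have mx: "mix S ((fst p)(Suc k := t)) (snd p) = (mix S (fst p) (snd p))(Suc k := t)" if "S \<in> Pow {2..k}" for S t
      using that by (auto simp: mix_def fun_eq_iff)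
    define u where "u \<phi> t = diffs k \<phi> ((fst p)(Suc k := t)) (snd p)" for \<phi> t
    have u: "u \<phi> t = (\<Sum>S\<in>Pow {2..k}. (-1) ^ card S * \<phi> ((mix S (fst p) (snd p))(Suc k := t)))" for \<phi> t
      unfolding u_def diffs_def by (intro sum.cong refl) (simp add: mx)
    have "has_gradient (u (h (Suc k))) (u (h k))"
      unfolding u[abs_def]
      by (rule has_gradient_lincomb) (use elim in auto)
    \<comment> \<open>The null set is a single value, that of \<open>u\<close> at the coordinate of
      the second point; it stays fixed while \<open>s\<close> varies.\<close>
    from has_gradient_null_preimage[OF this, of "{u (h (Suc k)) (snd p (Suc k))}"]
    have "AE s in halfline. u (h (Suc k)) s = u (h (Suc k)) (snd p (Suc k)) \<longrightarrow> u (h k) s = 0"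
      by (simp add: null_sets_def)
    moreover have "diffs (Suc k) (h (Suc k)) ((fst p)(Suc k := s)) (snd p) = u (h (Suc k)) s - u (h (Suc k)) (snd p (Suc k))" for s
      unfolding diffs_split[OF \<open>1 \<le> k\<close>] u sum_subtractf[symmetric] right_diff_distrib[symmetric]
      by (intro sum.cong refl) (simp add: mx)
    ultimately show ?case unfolding u_def[symmetric] by simp
  qed
  note upd = this
  have "AE p in ?M \<Otimes>\<^sub>M ?M. diffs (Suc k) (h (Suc k)) (fst p) (snd p) = 0 \<longrightarrow> diffs k (h k) (fst p) (snd p) = 0"
  proof (rule AE_pair_upd_fstI[where i = "Suc k" and Q = "\<lambda>z z'. diffs (Suc k) (h (Suc k)) z z' = 0 \<longrightarrow> diffs k (h k) z z' = 0", OF finite_atLeastAtMost _ _ upd])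
    have [measurable]: "(\<lambda>p. diffs (Suc k) (h (Suc k)) (fst p) (snd p)) \<in> borel_measurable (?M \<Otimes>\<^sub>M ?M)"
      "(\<lambda>p. diffs k (h k) (fst p) (snd p)) \<in> borel_measurable (?M \<Otimes>\<^sub>M ?M)"
      using Suc.hyps Suc.prems by (auto intro!: measurable_diffs hm)
    show "{p \<in> space (?M \<Otimes>\<^sub>M ?M). diffs (Suc k) (h (Suc k)) (fst p) (snd p) = 0 \<longrightarrow> diffs k (h k) (fst p) (snd p) = 0} \<in> sets (?M \<Otimes>\<^sub>M ?M)"
      by measurable
    show "Suc k \<in> {1..n}" using Suc.prems by simp
  qed
  moreover have "AE p in ?M \<Otimes>\<^sub>M ?M. h 1 (fst p) \<noteq> 0 \<longrightarrow> diffs k (h k) (fst p) (snd p) \<noteq> 0"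
    by (rule Suc.IH) (use Suc.prems in simp)
  ultimately show ?case by eventually_elim auto
qed

text \<open>\<open>H\<close> and \<open>h m\<close> are both weak gradients of
  \<open>h (Suc m)\<close> in the last variable and so agree almost everywhere. This links the
  square-integrable kernel \<open>H\<close> to the chain of derivatives that ends in
  \<open>h 1\<close>.\<close>

lemma nondegenerate_sections:
  assumes m: "1 \<le> m" and h: "\<And>k. k \<in> {2..Suc m} \<Longrightarrow> has_partial_gradient (Suc m) k (h k) (h (k - 1))"
    and H[measurable]: "H \<in> borel_measurable (halfline_prod {1..Suc m})"
    and grad: "AE z in halfline_prod {1..Suc m}. has_gradient (\<lambda>t. h (Suc m) (z(Suc m := t))) (\<lambda>t. H (z(Suc m := t)))"
    and inf: "AE y in halfline_prod {2..Suc m}. emeasure halfline {t \<in> {0..}. h 1 (y(1 := t)) \<noteq> 0} = \<infinity>"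
    and c: "c \<noteq> 0"
  shows "AE x in halfline. nondegenerate m (\<lambda>y. c * H (y(Suc m := x))) (\<lambda>y. h 1 (y(Suc m := x)))"
proof -
  let ?M = "halfline_prod {1..m}" and ?M' = "halfline_prod {1..Suc m}"
  have hm: "h j \<in> borel_measurable ?M'" if "1 \<le> j" "j \<le> m" for j
    using h[of "Suc j"] that by (simp add: has_partial_gradient_def)
  have h1[measurable]: "h 1 \<in> borel_measurable ?M'" and hmm[measurable]: "h m \<in> borel_measurable ?M'"
    by (rule hm, use m in simp, use m in simp)+
  have "AE z in ?M'. has_gradient (\<lambda>t. h (Suc m) (z(Suc m := t))) (\<lambda>t. h m (z(Suc m := t)))"
    using has_partial_gradient_AE[OF h[of "Suc m"]] m by auto
  then have "AE z in ?M'. AE s in halfline. h m (z(Suc m := s)) = H (z(Suc m := s))"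
    using grad by eventually_elim (rule has_gradient_unique)
  then have hH: "AE z in ?M'. h m z = H z"
    by (rule AE_halfline_prod_insertI[where i = "Suc m" and Q = "\<lambda>z. h m z = H z", rotated 3]) (simp_all, measurable)
  have "AE p in ?M' \<Otimes>\<^sub>M ?M'. \<forall>S\<in>Pow {2..m}. h m (mix S (fst p) (snd p)) = H (mix S (fst p) (snd p))"
  proof (rule AE_finite_allI)
    fix S assume "S \<in> Pow {2..m}"
    then show "AE p in ?M' \<Otimes>\<^sub>M ?M'. h m (mix S (fst p) (snd p)) = H (mix S (fst p) (snd p))"
      by (intro AE_mix[OF _ _ hH]) auto
  qed simp
  moreover have "AE p in ?M' \<Otimes>\<^sub>M ?M'. h 1 (fst p) \<noteq> 0 \<longrightarrow> diffs m (h m) (fst p) (snd p) \<noteq> 0"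
    by (rule mixed_gradient_diffs[OF h]) (use m in auto)
  ultimately have ae: "AE p in ?M' \<Otimes>\<^sub>M ?M'. h 1 (fst p) \<noteq> 0 \<longrightarrow> diffs m H (fst p) (snd p) \<noteq> 0"
  proof eventually_elim
    case (elim p)
    have "diffs m (h m) (fst p) (snd p) = diffs m H (fst p) (snd p)"
      by (rule diffs_cong) (use elim(1) in auto)
    then show ?case using elim(2) by simp
  qed
  note [measurable] = measurable_diffs[OF H]
  define W where "W = {p \<in> space (?M' \<Otimes>\<^sub>M ?M'). h 1 (fst p) \<noteq> 0 \<longrightarrow> diffs m H (fst p) (snd p) \<noteq> 0}"
  have W: "W \<in> sets (?M' \<Otimes>\<^sub>M ?M')" unfolding W_def by measurable
  have "AE p in ?M' \<Otimes>\<^sub>M ?M'. p \<in> W" using ae AE_space unfolding W_def by auto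
  from AE_sections_pair[OF W this]
  have 1: "AE x in halfline. AE x' in halfline. AE p in ?M \<Otimes>\<^sub>M ?M. ((fst p)(Suc m := x), (snd p)(Suc m := x')) \<in> W" .
  have I: "{2..Suc m} = insert (Suc m) {2..m}" using m by auto
  have 2: "AE x in halfline. AE y in halfline_prod {2..m}. emeasure halfline {t \<in> {0..}. h 1 ((y(Suc m := x))(1 := t)) \<noteq> 0} = \<infinity>"
    using inf unfolding I by (rule AE_halfline_prod_insert[rotated 2]) auto
  show ?thesis using 1 2 AE_space
  proof eventually_elim
    case (elim x)
    note x = elim
    have "AE x' in halfline. nondegenerate m (\<lambda>y. c * H (y(Suc m := x))) (\<lambda>y. h 1 (y(Suc m := x)))"
      using x(1)
    proof eventually_elim
      case (elim x')
      show ?case unfolding nondegenerate_def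
      proof (intro conjI)
        show "(\<lambda>y. h 1 (y(Suc m := x))) \<in> borel_measurable ?M" using x(3) by (intro measurable_section h1) simp
        have d: "diffs m H (z(Suc m := x)) (z'(Suc m := x')) = diffs m (\<lambda>y. H (y(Suc m := x))) z z'" for z z'
        proof -
          have "mix S (z(Suc m := x)) (z'(Suc m := x')) = (mix S z z')(Suc m := x)" if "S \<in> Pow {2..m}" for S
            using that by (auto simp: mix_def fun_eq_iff)
          then show ?thesis by (simp add: diffs_def)
        qed
        show "AE p in ?M \<Otimes>\<^sub>M ?M. h 1 ((fst p)(Suc m := x)) \<noteq> 0 \<longrightarrow> diffs m (\<lambda>y. c * H (y(Suc m := x))) (fst p) (snd p) \<noteq> 0"
          using elim(1) by eventually_elim (simp add: W_def d diffs_cmult c)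
        have "(y(Suc m := x))(1 := t) = (y(1 := t))(Suc m := x)" for y :: "nat \<Rightarrow> real" and t
          using m by (intro fun_upd_twist) auto
        then show "AE y in halfline_prod {2..m}. emeasure halfline {t \<in> {0..}. h 1 ((y(1 := t))(Suc m := x)) \<noteq> 0} = \<infinity>"
          using x(2) by simp
      qed
    qed
    then show ?case by (rule AE_halfline_const)
  qed
qed

section \<open>Absolute continuity\<close>

text \<open>The primitive on the half-line, in a form that applies to sections of jointly measurable
  functions. Where the integrand is not integrable, the value is 0 by the convention for
  \<open>LINT\<close>.\<close>

definition iint :: "real \<Rightarrow> (real \<Rightarrow> real) \<Rightarrow> real" where
  "iint x w = (LINT s|halfline. indicator {0..x} s * w s)"

lemma iint_prim: "iint x w = prim (\<lambda>t. indicator {0..} t * w t) x"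
  unfolding iint_def integral_halfline prim_def by (simp add: mult.left_commute)

lemma measurable_indicator_Icc:
  fixes f g :: "'b \<Rightarrow> real"
  assumes [measurable]: "f \<in> borel_measurable M" "g \<in> borel_measurable M"
  shows "(\<lambda>p. indicator {0..f p} (g p) :: real) \<in> borel_measurable M"
proof -
  have "(\<lambda>p. indicator {0..f p} (g p) :: real) = (\<lambda>p. if 0 \<le> g p \<and> g p \<le> f p then 1 else 0)"
    by (auto simp: fun_eq_iff)
  also have "\<dots> \<in> borel_measurable M"
    using borel_measurable_le[OF borel_measurable_const[of 0] assms(2)] borel_measurable_le[OF assms(2,1)]
    by (intro measurable_If sets.sets_Collect_conj) simp_all
  finally show ?thesis .
qed

text \<open>The endpoint of the interval is itself the added point, so measurability is required
  jointly in endpoint and parameter.\<close>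

lemma measurable_iint_pair:
  assumes w: "w \<in> borel_measurable (M \<Otimes>\<^sub>M halfline)"
  shows "(\<lambda>p. iint (snd p) (\<lambda>s. w (fst p, s))) \<in> borel_measurable (M \<Otimes>\<^sub>M halfline)"
proof -
  have 1: "(\<lambda>q. indicator {0..snd (fst q)} (snd q) :: real) \<in> borel_measurable ((M \<Otimes>\<^sub>M halfline) \<Otimes>\<^sub>M halfline)"
    by (rule measurable_indicator_Icc) measurable
  have 2: "(\<lambda>q. w (fst (fst q), snd q)) \<in> borel_measurable ((M \<Otimes>\<^sub>M halfline) \<Otimes>\<^sub>M halfline)"
    by (rule measurable_compose[OF _ w]) measurable
  have "(\<lambda>q. indicator {0..snd (fst q)} (snd q) * w (fst (fst q), snd q)) \<in> borel_measurable ((M \<Otimes>\<^sub>M halfline) \<Otimes>\<^sub>M halfline)"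
    using 1 2 by (rule borel_measurable_times)
  then show ?thesis unfolding iint_def
    by (intro halfline.borel_measurable_lebesgue_integral) (simp add: split_beta')
qed

lemma measurable_iint:
  assumes w: "w \<in> borel_measurable (M \<Otimes>\<^sub>M halfline)" and x: "0 \<le> x"
  shows "(\<lambda>y. iint x (\<lambda>s. w (y, s))) \<in> borel_measurable M"
proof -
  have "(\<lambda>y. (y, x)) \<in> M \<rightarrow>\<^sub>M M \<Otimes>\<^sub>M halfline" using x by (intro measurable_Pair) auto
  from measurable_compose[OF this measurable_iint_pair[OF w]] show ?thesis by simp
qed

lemma iint_square_le:
  assumes w[measurable]: "w \<in> borel_measurable halfline"
  shows "ennreal ((iint x w)\<^sup>2) \<le> ennreal x * sqn halfline w"
proof (cases "integrable halfline (\<lambda>s. indicator {0..x} s * w s)")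
  case False
  then have "iint x w = 0" by (simp add: iint_def not_integrable_integral_eq)
  then show ?thesis by simp
next
  case True
  note [measurable] = Icc_halfline(1)[of x]
  have "ennreal \<bar>iint x w\<bar> \<le> (\<integral>\<^sup>+s. indicator {0..x} s * ennreal \<bar>w s\<bar> \<partial>halfline)"
    using integral_norm_bound_ennreal[OF True] by (simp add: iint_def abs_mult ennreal_mult' ennreal_indicator)
  then have "(ennreal \<bar>iint x w\<bar>)\<^sup>2 \<le> (\<integral>\<^sup>+s. indicator {0..x} s * ennreal \<bar>w s\<bar> \<partial>halfline)\<^sup>2"
    by (intro power_mono) auto
  also have "\<dots> \<le> (\<integral>\<^sup>+s. (indicator {0..x} s)\<^sup>2 \<partial>halfline) * (\<integral>\<^sup>+s. (ennreal \<bar>w s\<bar>)\<^sup>2 \<partial>halfline)"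
    by (rule Cauchy_Schwarz_nn_integral) measurable
  also have "(\<integral>\<^sup>+s. (indicator {0..x} s)\<^sup>2 \<partial>halfline) = (\<integral>\<^sup>+s. indicator {0..x} s \<partial>halfline)"
    by (intro nn_integral_cong) (simp add: indicator_def)
  also have "\<dots> = ennreal x" by (simp add: Icc_halfline)
  also have "(\<integral>\<^sup>+s. (ennreal \<bar>w s\<bar>)\<^sup>2 \<partial>halfline) = sqn halfline w"
    unfolding sqn_def by (intro nn_integral_cong) (simp add: ennreal_power)
  finally show ?thesis by (simp add: ennreal_power)
qed

text \<open>Taking a primitive at a fixed endpoint is bounded on L2, by Cauchy-Schwarz. This is what
  allows exchanging it with the limits that define stochastic integrals.\<close>

lemma sqn_iint_le:
  assumes w[measurable]: "w \<in> borel_measurable (M \<Otimes>\<^sub>M halfline)"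
  shows "sqn M (\<lambda>y. iint x (\<lambda>s. w (y, s))) \<le> ennreal x * sqn (M \<Otimes>\<^sub>M halfline) w"
proof -
  have "sqn M (\<lambda>y. iint x (\<lambda>s. w (y, s))) \<le> (\<integral>\<^sup>+y. ennreal x * sqn halfline (\<lambda>s. w (y, s)) \<partial>M)"
    unfolding sqn_def[of M]
  proof (rule nn_integral_mono)
    fix y assume "y \<in> space M"
    then have "(\<lambda>s. w (y, s)) \<in> borel_measurable halfline" by measurable
    then show "ennreal ((iint x (\<lambda>s. w (y, s)))\<^sup>2) \<le> ennreal x * sqn halfline (\<lambda>s. w (y, s))" by (rule iint_square_le)
  qed
  also have "\<dots> = ennreal x * (\<integral>\<^sup>+y. sqn halfline (\<lambda>s. w (y, s)) \<partial>M)"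
    unfolding sqn_def by (rule nn_integral_cmult) measurable
  also have "(\<integral>\<^sup>+y. sqn halfline (\<lambda>s. w (y, s)) \<partial>M) = sqn (M \<Otimes>\<^sub>M halfline) w"
    unfolding sqn_def by (rule halfline.nn_integral_fst) measurable
  finally show ?thesis .
qed

lemma AE_sections_square_integrable:
  assumes w[measurable]: "w \<in> borel_measurable (M \<Otimes>\<^sub>M halfline)" and "sqn (M \<Otimes>\<^sub>M halfline) w < \<top>"
  shows "AE y in M. square_integrable halfline (\<lambda>s. w (y, s))"
proof -
  have m: "(\<lambda>y. sqn halfline (\<lambda>s. w (y, s))) \<in> borel_measurable M"
    unfolding sqn_def by measurable
  have "(\<integral>\<^sup>+y. sqn halfline (\<lambda>s. w (y, s)) \<partial>M) = sqn (M \<Otimes>\<^sub>M halfline) w"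
    unfolding sqn_def by (rule halfline.nn_integral_fst) measurable
  then have "(\<integral>\<^sup>+y. sqn halfline (\<lambda>s. w (y, s)) \<partial>M) \<noteq> \<infinity>" using assms(2) by simp
  from nn_integral_noteq_infinite[OF m this] AE_space show ?thesis
    by eventually_elim (auto simp: square_integrable_sqn less_top)
qed

lemma integrable_iint:
  assumes "square_integrable halfline w"
  shows "integrable halfline (\<lambda>s. indicator {0..x} s * w s)"
  using locintD(2)[OF locint_square_integrable[OF assms], of x]
  unfolding integrable_halfline by (simp add: mult.left_commute)

lemma sqn_iint_diff_le:
  assumes a[measurable]: "a \<in> borel_measurable (M \<Otimes>\<^sub>M halfline)" and v[measurable]: "v \<in> borel_measurable (M \<Otimes>\<^sub>M halfline)"
    and fin: "sqn (M \<Otimes>\<^sub>M halfline) v < \<top>"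
    and i: "\<And>y. y \<in> space M \<Longrightarrow> integrable halfline (\<lambda>s. indicator {0..x} s * a (y, s))"
  shows "sqn M (\<lambda>y. iint x (\<lambda>s. a (y, s)) - iint x (\<lambda>s. v (y, s))) \<le> ennreal x * sqn (M \<Otimes>\<^sub>M halfline) (\<lambda>p. a p - v p)"
proof -
  have "AE y in M. iint x (\<lambda>s. a (y, s)) - iint x (\<lambda>s. v (y, s)) = iint x (\<lambda>s. a (y, s) - v (y, s))"
    using AE_sections_square_integrable[OF v fin] AE_space
  proof eventually_elim
    case (elim y)
    show ?case unfolding iint_def right_diff_distrib
      by (rule Bochner_Integration.integral_diff[symmetric, OF i[OF elim(2)] integrable_iint[OF elim(1)]])
  qed
  then have "sqn M (\<lambda>y. iint x (\<lambda>s. a (y, s)) - iint x (\<lambda>s. v (y, s))) = sqn M (\<lambda>y. iint x (\<lambda>s. a (y, s) - v (y, s)))"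
    by (rule sqn_cong_AE)
  also have "\<dots> \<le> ennreal x * sqn (M \<Otimes>\<^sub>M halfline) (\<lambda>p. a p - v p)"
    by (rule sqn_iint_le) measurable
  finally show ?thesis .
qed

text \<open>The constant is recovered, measurably in \<open>y\<close>, as the integral over the unit
  interval.\<close>

lemma AE_sections_constant:
  fixes \<Delta> :: "'b \<times> real \<Rightarrow> real"
  assumes M: "sigma_finite_measure M" and D[measurable]: "\<Delta> \<in> borel_measurable (M \<Otimes>\<^sub>M halfline)"
    and ae: "AE y in M. \<exists>c. AE t in halfline. \<Delta> (y, t) = c"
  obtains c where "c \<in> borel_measurable M" "AE t in halfline. AE y in M. \<Delta> (y, t) = c y"
proof -
  interpret M: sigma_finite_measure M by fact
  interpret Mh: pair_sigma_finite M halfline ..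
  define c where "c y = iint 1 (\<lambda>t. \<Delta> (y, t))" for y
  have c[measurable]: "c \<in> borel_measurable M" unfolding c_def[abs_def] by (rule measurable_iint) simp_all
  have "AE y in M. AE t in halfline. \<Delta> (y, t) = c y"
    using ae AE_space
  proof eventually_elim
    case (elim y)
    note [measurable] = elim(2) Icc_halfline(1)[of 1]
    obtain d where d: "AE t in halfline. \<Delta> (y, t) = d" using elim(1) by blast
    have "c y = (LINT t|halfline. indicator {0..1} t * d)"
      unfolding c_def iint_def by (rule integral_cong_AE) (measurable, use d in \<open>auto elim!: eventually_mono\<close>)
    also have "\<dots> = d" using Icc_halfline[of 1] by (simp add: measure_def)
    finally show ?case using d by simp
  qed
  moreover have "{p \<in> space (M \<Otimes>\<^sub>M halfline). \<Delta> (fst p, snd p) = c (fst p)} \<in> sets (M \<Otimes>\<^sub>M halfline)" by measurable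
  ultimately have "AE t in halfline. AE y in M. \<Delta> (y, t) = c y"
    using Mh.AE_commute[where P = "\<lambda>y t. \<Delta> (y, t) = c y"] by blast
  with c show ?thesis by (rule that)
qed

text \<open>The integral of \<open>sec k s\<close> over \<open>s\<close> in \<open>{0..x}\<close>,
  again with the side \<open>A k\<close> left in the list.\<close>

definition sweep :: "nat \<Rightarrow> real \<Rightarrow> rects \<Rightarrow> rects" where
  "sweep k x = map (\<lambda>(c, A). (c * measure halfline (A k \<inter> {0..x}), A))"

lemma disj_rects_sweep: "disj_rects (Suc m) E \<Longrightarrow> disj_rects m (sweep k x E)"
proof (rule disj_rectsI)
  fix c A assume E: "disj_rects (Suc m) E" and "(c, A) \<in> set (sweep k x E)"
  then obtain c' where A: "(c', A) \<in> set E" by (auto simp: sweep_def)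
  show "disjoint_family_on A {1..m}"
    by (rule disjoint_family_on_mono[OF _ disj_rectsD(1)[OF E A]]) auto
  show "A i \<in> sets halfline \<and> emeasure halfline (A i) < \<infinity>" if "i \<in> {1..m}" for i
    using disj_rectsD(2,3)[OF E A, of i] that by auto
qed

text \<open>\<open>X\<close> stands for the remaining product: indicators at a point in one use,
  compensated counts in the other. Kernel and integral are thus swept by one computation.\<close>

lemma iint_sec:
  assumes "\<And>c A. (c, A) \<in> set E \<Longrightarrow> A k \<in> sets halfline"
  shows "integrable halfline (\<lambda>s. indicator {0..x} s * (\<Sum>(c, A)\<leftarrow>sec k s E. c * X A))" (is ?i)
    and "iint x (\<lambda>s. \<Sum>(c, A)\<leftarrow>sec k s E. c * X A) = (\<Sum>(c, A)\<leftarrow>sweep k x E. c * X A)" (is ?e)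
proof -
  have "?i \<and> ?e" using assms
  proof (induction E)
    case Nil
    then show ?case by (simp add: sec_def sweep_def iint_def)
  next
    case (Cons z E)
    obtain c A where z: "z = (c, A)" by (cases z)
    have A: "A k \<inter> {0..x} \<in> sets halfline" using Cons.prems z Icc_halfline(1) by auto
    have "emeasure halfline (A k \<inter> {0..x}) \<le> emeasure halfline {0..x}"
      using Icc_halfline(1) by (intro emeasure_mono) auto
    also have "\<dots> < \<infinity>" by (simp add: Icc_halfline)
    finally have Af: "emeasure halfline (A k \<inter> {0..x}) < \<infinity>" .
    have sub: "A k \<inter> {0..x} \<inter> {0..} = A k \<inter> {0..x}" by auto
    have e: "(indicator {0..x} s * (\<Sum>(c, A)\<leftarrow>sec k s (z # E). c * X A) :: real) =
      (c * X A) * indicator (A k \<inter> {0..x}) s + indicator {0..x} s * (\<Sum>(c, A)\<leftarrow>sec k s E. c * X A)" for s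
      by (simp add: z sec_def indicator_inter_arith algebra_simps)
    have i1: "integrable halfline (\<lambda>s. (c * X A) * indicator (A k \<inter> {0..x}) s)"
      by (intro Bochner_Integration.integrable_mult_right integrable_real_indicator A Af)
    have IH: "integrable halfline (\<lambda>s. indicator {0..x} s * (\<Sum>(c, A)\<leftarrow>sec k s E. c * X A))"
      "iint x (\<lambda>s. \<Sum>(c, A)\<leftarrow>sec k s E. c * X A) = (\<Sum>(c, A)\<leftarrow>sweep k x E. c * X A)"
      using Cons by (auto simp: z)
    have "iint x (\<lambda>s. \<Sum>(c, A)\<leftarrow>sec k s (z # E). c * X A) = (\<Sum>(c, A)\<leftarrow>sweep k x (z # E). c * X A)"
      unfolding iint_def e Bochner_Integration.integral_add[OF i1 IH(1)]
      using IH(2) by (simp add: iint_def sweep_def z sub mult_ac)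
    then show ?case unfolding e using Bochner_Integration.integrable_add[OF i1 IH(1)] by blast
  qed
  then show ?i ?e by auto
qed

section \<open>Exchange of primitives with stochastic integrals\<close>

lemma sqn_halfline_prod_pair:
  assumes f: "f \<in> borel_measurable (halfline_prod {1..Suc m})"
  shows "(\<lambda>q. f ((fst q)(Suc m := snd q))) \<in> borel_measurable (halfline_prod {1..m} \<Otimes>\<^sub>M halfline)"
    and "sqn (halfline_prod {1..m} \<Otimes>\<^sub>M halfline) (\<lambda>q. f ((fst q)(Suc m := snd q))) = sqn (halfline_prod {1..Suc m}) f"
proof -
  show m[measurable]: "(\<lambda>q. f ((fst q)(Suc m := snd q))) \<in> borel_measurable (halfline_prod {1..m} \<Otimes>\<^sub>M halfline)"
    using measurable_compose[OF measurable_halfline_upd[of "Suc m" "{1..m}"], of f] f unfolding Suc_insert by simp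
  have m2: "(\<lambda>q. ennreal ((f ((fst q)(Suc m := snd q)))\<^sup>2)) \<in> borel_measurable (halfline_prod {1..m} \<Otimes>\<^sub>M halfline)"
    by measurable
  have "sqn (halfline_prod {1..m} \<Otimes>\<^sub>M halfline) (\<lambda>q. f ((fst q)(Suc m := snd q))) = (\<integral>\<^sup>+y. \<integral>\<^sup>+x. ennreal ((f (y(Suc m := x)))\<^sup>2) \<partial>halfline \<partial>halfline_prod {1..m})"
    unfolding sqn_def using halfline.nn_integral_fst[OF m2] by simp
  also have "\<dots> = sqn (halfline_prod {1..Suc m}) f"
    using halfline_prod.product_nn_integral_insert[of "{1..m}" "Suc m" "\<lambda>z. ennreal ((f z)\<^sup>2)"] f
    unfolding sqn_def Suc_insert halfline_prod_def by simp
  finally show "sqn (halfline_prod {1..m} \<Otimes>\<^sub>M halfline) (\<lambda>q. f ((fst q)(Suc m := snd q))) = sqn (halfline_prod {1..Suc m}) f" .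
qed

lemma quarter_tendsto: "(\<lambda>k. ennreal x * ennreal (D * (1/4) ^ k)) \<longlonglongrightarrow> 0"
proof -
  have "(\<lambda>k. ennreal (D * (1/4) ^ k)) \<longlonglongrightarrow> ennreal (D * 0)"
    by (intro tendsto_ennrealI tendsto_mult tendsto_const LIMSEQ_power_zero) simp
  from ennreal_tendsto_cmult[OF _ this, of "ennreal x"] show ?thesis by simp
qed

text \<open>\<open>poisson_integral_version\<close> asks for symmetric approximants; permuting the
  sides and averaging provides them and keeps the sides disjoint.\<close>

lemma symmetric_rects:
  obtains S where "\<And>E. disj_rects n E \<Longrightarrow> disj_rects n (S E)"
    "\<And>E z. elementary_fun n (S E) z = symmetrization n (elementary_fun n E) z"
proof -
  let ?S = "{\<sigma>. \<sigma> permutes {1..n}}"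
  have "finite ?S" by (rule finite_permutations) simp
  then obtain ps where ps: "set ps = ?S" "distinct ps" using finite_distinct_list by blast
  define sc :: "rects \<Rightarrow> rects" where "sc = map (\<lambda>(c, A). (c / fact n, A))"
  have sc: "elementary_fun n (sc E) z = elementary_fun n E z / fact n" for E z
    by (induction E) (auto simp: sc_def add_divide_distrib)
  have dsc: "disj_rects n (sc E)" if "disj_rects n E" for E
    by (rule disj_rectsI) (use that in \<open>auto simp: sc_def disj_rects_def split: prod.splits\<close>)
  show ?thesis
  proof (rule that[of "\<lambda>E. concat (map (\<lambda>p. permute_rects (inv p) (sc E)) ps)"])
    fix E assume "disj_rects n E"
    then show "disj_rects n (concat (map (\<lambda>p. permute_rects (inv p) (sc E)) ps))"
      using ps(1) by (intro disj_rects_concat) (auto intro!: disj_rects_permute dsc permutes_inv)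
  next
    fix E z
    have "elementary_fun n (permute_rects (inv p) (sc E)) z = elementary_fun n (sc E) (z \<circ> p)" if "p \<in> ?S" for p
    proof -
      have "(z \<circ> p) \<circ> inv p = z" using that by (simp add: comp_assoc permutes_inv_o)
      then show ?thesis using efun_permute[OF permutes_inv, of p n "sc E" "z \<circ> p"] that by simp
    qed
    then have "elementary_fun n (concat (map (\<lambda>p. permute_rects (inv p) (sc E)) ps)) z = (\<Sum>p\<in>?S. elementary_fun n (sc E) (z \<circ> p))"
      unfolding efun_concat map_map comp_def using ps
      by (subst sum.distinct_set_conv_list[symmetric]) (auto intro!: sum.cong simp: comp_def)
    then show "elementary_fun n (concat (map (\<lambda>p. permute_rects (inv p) (sc E)) ps)) z = symmetrization n (elementary_fun n E) z"
      by (simp add: sc symmetrization_def sum_divide_distrib)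
  qed
qed

context poisson_halfline
begin

text \<open>\<open>poisson_integral\<close> is a choice, meaningful only once some version exists.
  Symmetrization is a contraction, so symmetrized rectangles approach the symmetrized kernel at the
  original rate.\<close>

lemma poisson_integral_version_exists:
  assumes f: "f \<in> borel_measurable (halfline_prod {1..n})" "sqn (halfline_prod {1..n}) f < \<top>"
  shows "\<exists>F. poisson_integral_version P N n f F"
proof -
  let ?M = "halfline_prod {1..n}"
  obtain E where E: "\<And>k. disj_rects n (E k)" "\<And>k. sqn ?M (\<lambda>z. elementary_fun n (E k) z - f z) \<le> ennreal (1 * (1/4) ^ k)"
    by (rule L2_fast_rects[OF f]) blast
  obtain S where S: "\<And>E. disj_rects n E \<Longrightarrow> disj_rects n (S E)"
    "\<And>E z. elementary_fun n (S E) z = symmetrization n (elementary_fun n E) z"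
    by (rule symmetric_rects) blast
  have b: "sqn ?M (\<lambda>z. elementary_fun n (S (E k)) z - symmetrization n f z) \<le> ennreal (1 * (1/4) ^ k)" for k
  proof -
    have "sqn ?M (\<lambda>z. elementary_fun n (S (E k)) z - symmetrization n f z) = sqn ?M (symmetrization n (\<lambda>z. elementary_fun n (E k) z - f z))"
      by (intro sqn_cong) (simp add: S(2) symmetrization_def sum_subtractf diff_divide_distrib)
    also have "\<dots> \<le> sqn ?M (\<lambda>z. elementary_fun n (E k) z - f z)"
      by (intro sqn_symmetrization_le borel_measurable_diff measurable_efun E(1) f(1))
    finally show ?thesis using E(2) by (rule order_trans)
  qed
  obtain F where F: "F \<in> borel_measurable P" "(\<lambda>k. sqn P (\<lambda>\<omega>. EI n (S (E k)) \<omega> - F \<omega>)) \<longlonglongrightarrow> 0"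
    using EI_fast_limit[OF S(1)[OF E(1)] measurable_symmetrization[OF f(1)] _ b] by auto
  have l: "(\<lambda>k. sqn ?M (\<lambda>z. elementary_fun n (S (E k)) z - symmetrization n f z)) \<longlonglongrightarrow> 0"
    by (rule tendsto_0_ennreal_le[OF quarter_tendsto[of 1 1]]) (use b in simp)
  have "elementary n (S (E k))" for k
    using S(1)[OF E(1)[of k]] unfolding elementary_def disj_rects_def by (auto simp: S(2) symmetrization_permute)
  then have "poisson_integral_version P N n f F"
    unfolding poisson_integral_version_def using F l
    by (intro conjI exI[of _ "\<lambda>k. S (E k)"]) (auto simp: sqn_def EI_eq)
  then show ?thesis by blast
qed

lemma version_poisson_integral:
  assumes f: "f \<in> borel_measurable (halfline_prod {1..n})" "sqn (halfline_prod {1..n}) f < \<top>"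
  shows "version n (symmetrization n f) (poisson_integral P N n f)"
proof -
  have "poisson_integral_version P N n f (poisson_integral P N n f)"
    unfolding poisson_integral_def by (rule someI_ex[OF poisson_integral_version_exists[OF f]])
  then obtain E where E: "\<And>k. elementary n (E k)"
    "(\<lambda>k. sqn (halfline_prod {1..n}) (\<lambda>x. elementary_fun n (E k) x - symmetrization n f x)) \<longlonglongrightarrow> 0"
    "(\<lambda>k. sqn P (\<lambda>\<omega>. EI n (E k) \<omega> - poisson_integral P N n f \<omega>)) \<longlonglongrightarrow> 0"
    and m: "poisson_integral P N n f \<in> borel_measurable P"
    unfolding poisson_integral_version_def sqn_def[symmetric] EI_eq by blast
  have "disj_rects n (E k)" for k using E(1)[of k] unfolding elementary_def disj_rects_def by blast
  then show ?thesis unfolding version_def using m E(2,3) measurable_symmetrization[OF f(1)] by blast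
qed

lemma section_process_iint:
  assumes \<psi>[measurable]: "\<psi> \<in> borel_measurable (halfline_prod {1..Suc m})" and fin: "sqn (halfline_prod {1..Suc m}) \<psi> < \<top>"
  obtains V where "V \<in> borel_measurable (P \<Otimes>\<^sub>M halfline)" "sqn (P \<Otimes>\<^sub>M halfline) V < \<top>"
    "AE x in halfline. version m (\<lambda>y. \<psi> (y(Suc m := x))) (\<lambda>\<omega>. V (\<omega>, x))"
    "\<And>x. 0 \<le> x \<Longrightarrow> version m (\<lambda>y. iint x (\<lambda>s. \<psi> (y(Suc m := s)))) (\<lambda>\<omega>. iint x (\<lambda>s. V (\<omega>, s)))"
proof -
  let ?M = "halfline_prod {1..m}" and ?M' = "halfline_prod {1..Suc m}"
  obtain G where G: "\<And>k. disj_rects (Suc m) (G k)"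
    and b: "\<And>k. sqn ?M' (\<lambda>z. elementary_fun (Suc m) (G k) z - \<psi> z) \<le> ennreal (1 * (1/4) ^ k)"
    by (rule L2_fast_rects[OF \<psi> fin]) blast
  obtain V D where V[measurable]: "V \<in> borel_measurable (P \<Otimes>\<^sub>M halfline)"
    and Vv: "AE x in halfline. version m (\<lambda>y. \<psi> (y(Suc m := x))) (\<lambda>\<omega>. V (\<omega>, x))"
    and D: "0 \<le> D" "\<And>k. sqn (P \<Otimes>\<^sub>M halfline) (\<lambda>p. EI m (sec (Suc m) (snd p) (G k)) (fst p) - V p) \<le> ennreal (D * (1/4) ^ k)"
    by (rule section_process[OF G \<psi> zero_le_one b]) blast
  note Gm[measurable] = measurable_efun[OF G] and am[measurable] = measurable_EI_sec[OF G]
  obtain C where C: "0 \<le> C" "\<And>E. disj_rects m E \<Longrightarrow> sqn P (EI m E) \<le> ennreal C * sqn ?M (elementary_fun m E)"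
    using sqn_EI_le by blast
  have "sqn ?M' (elementary_fun (Suc m) (G 0)) = sqn ?M' (\<lambda>z. (elementary_fun (Suc m) (G 0) z - \<psi> z) + \<psi> z)" by simp
  also have "\<dots> \<le> 2 * sqn ?M' (\<lambda>z. elementary_fun (Suc m) (G 0) z - \<psi> z) + 2 * sqn ?M' \<psi>"
    by (rule sqn_add_le) measurable
  also have "\<dots> < \<top>" using fin le_less_trans[OF b[of 0]] by (simp add: ennreal_mult_less_top)
  finally have fG: "sqn ?M' (elementary_fun (Suc m) (G 0)) < \<top>" .
  have "sqn (P \<Otimes>\<^sub>M halfline) (\<lambda>p. EI m (sec (Suc m) (snd p) (G 0)) (fst p)) \<le> ennreal C * sqn ?M' (elementary_fun (Suc m) (G 0))"
    by (rule sqn_EI_sec_le[OF G C])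
  also have "\<dots> < \<top>" using fG by (simp add: ennreal_mult_less_top)
  finally have fa: "sqn (P \<Otimes>\<^sub>M halfline) (\<lambda>p. EI m (sec (Suc m) (snd p) (G 0)) (fst p)) < \<top>" .
  have "sqn (P \<Otimes>\<^sub>M halfline) V = sqn (P \<Otimes>\<^sub>M halfline) (\<lambda>p. EI m (sec (Suc m) (snd p) (G 0)) (fst p) - (EI m (sec (Suc m) (snd p) (G 0)) (fst p) - V p))" by simp
  also have "\<dots> \<le> 2 * sqn (P \<Otimes>\<^sub>M halfline) (\<lambda>p. EI m (sec (Suc m) (snd p) (G 0)) (fst p)) + 2 * sqn (P \<Otimes>\<^sub>M halfline) (\<lambda>p. EI m (sec (Suc m) (snd p) (G 0)) (fst p) - V p)"
    by (rule sqn_diff_le) measurable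
  also have "\<dots> < \<top>" using fa le_less_trans[OF D(2)[of 0]] by (simp add: ennreal_mult_less_top)
  finally have fV: "sqn (P \<Otimes>\<^sub>M halfline) V < \<top>" .
  note up = sqn_halfline_prod_pair[OF \<psi>]
  have "version m (\<lambda>y. iint x (\<lambda>s. \<psi> (y(Suc m := s)))) (\<lambda>\<omega>. iint x (\<lambda>s. V (\<omega>, s)))" if x: "0 \<le> x" for x
    unfolding version_def
  proof (intro conjI exI[of _ "\<lambda>k. sweep (Suc m) x (G k)"] allI)
    show "(\<lambda>\<omega>. iint x (\<lambda>s. V (\<omega>, s))) \<in> borel_measurable P" by (rule measurable_iint[OF V x])
    show "(\<lambda>y. iint x (\<lambda>s. \<psi> (y(Suc m := s)))) \<in> borel_measurable ?M"
      using measurable_iint[OF up(1) x] by simp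
    show "disj_rects m (sweep (Suc m) x (G k))" for k by (rule disj_rects_sweep[OF G])
    have Gs: "A (Suc m) \<in> sets halfline" if "(c, A) \<in> set (G k)" for c A k
      using disj_rectsD(2)[OF G that] by auto
    have efun: "elementary_fun m (sweep (Suc m) x (G k)) y = iint x (\<lambda>s. elementary_fun (Suc m) (G k) (y(Suc m := s)))"
      and efun_i: "integrable halfline (\<lambda>s. indicator {0..x} s * elementary_fun (Suc m) (G k) (y(Suc m := s)))" for k y
      unfolding efun_sec[symmetric] unfolding elementary_fun_def by ((rule iint_sec(2)[symmetric], erule Gs), (rule iint_sec(1), erule Gs))
    have EIx: "EI m (sweep (Suc m) x (G k)) \<omega> = iint x (\<lambda>s. EI m (sec (Suc m) s (G k)) \<omega>)"
      and EI_i: "integrable halfline (\<lambda>s. indicator {0..x} s * EI m (sec (Suc m) s (G k)) \<omega>)" for k \<omega>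
      unfolding EI_def eint_def by ((rule iint_sec(2)[symmetric], erule Gs), (rule iint_sec(1), erule Gs))
    show "(\<lambda>k. sqn ?M (\<lambda>y. elementary_fun m (sweep (Suc m) x (G k)) y - iint x (\<lambda>s. \<psi> (y(Suc m := s))))) \<longlonglongrightarrow> 0"
    proof (rule tendsto_0_ennreal_le[OF quarter_tendsto[of x 1]])
      fix k
      have "sqn ?M (\<lambda>y. elementary_fun m (sweep (Suc m) x (G k)) y - iint x (\<lambda>s. \<psi> (y(Suc m := s)))) \<le>
        ennreal x * sqn (?M \<Otimes>\<^sub>M halfline) (\<lambda>q. elementary_fun (Suc m) (G k) ((fst q)(Suc m := snd q)) - \<psi> ((fst q)(Suc m := snd q)))"
        unfolding efun using sqn_iint_diff_le[OF sqn_halfline_prod_pair(1)[OF Gm] up(1), of x k] up(2) fin efun_i by simp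
      also have "sqn (?M \<Otimes>\<^sub>M halfline) (\<lambda>q. elementary_fun (Suc m) (G k) ((fst q)(Suc m := snd q)) - \<psi> ((fst q)(Suc m := snd q))) =
          sqn ?M' (\<lambda>z. elementary_fun (Suc m) (G k) z - \<psi> z)"
        by (rule sqn_halfline_prod_pair(2)[of "\<lambda>z. elementary_fun (Suc m) (G k) z - \<psi> z"]) measurable
      also have "ennreal x * \<dots> \<le> ennreal x * ennreal (1 * (1/4) ^ k)" by (intro mult_left_mono b) simp
      finally show "sqn ?M (\<lambda>y. elementary_fun m (sweep (Suc m) x (G k)) y - iint x (\<lambda>s. \<psi> (y(Suc m := s)))) \<le> ennreal x * ennreal (1 * (1/4) ^ k)" .
    qed
    show "(\<lambda>k. sqn P (\<lambda>\<omega>. EI m (sweep (Suc m) x (G k)) \<omega> - iint x (\<lambda>s. V (\<omega>, s)))) \<longlonglongrightarrow> 0"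
    proof (rule tendsto_0_ennreal_le[OF quarter_tendsto[of x D]])
      fix k
      have "sqn P (\<lambda>\<omega>. EI m (sweep (Suc m) x (G k)) \<omega> - iint x (\<lambda>s. V (\<omega>, s))) \<le>
        ennreal x * sqn (P \<Otimes>\<^sub>M halfline) (\<lambda>p. EI m (sec (Suc m) (snd p) (G k)) (fst p) - V p)"
        unfolding EIx using sqn_iint_diff_le[OF am V fV, of x k] EI_i by simp
      also have "\<dots> \<le> ennreal x * ennreal (D * (1/4) ^ k)" by (intro mult_left_mono D) simp
      finally show "sqn P (\<lambda>\<omega>. EI m (sweep (Suc m) x (G k)) \<omega> - iint x (\<lambda>s. V (\<omega>, s))) \<le> ennreal x * ennreal (D * (1/4) ^ k)" .
    qed
  qed
  with V fV Vv show ?thesis by (rule that)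
qed

text \<open>In the added point \<open>x\<close> the increment \<open>V\<close> of \<open>F\<close> is weakly differentiable, and its derivative is
  a process of integrals of order \<open>m\<close> without atoms. So \<open>x \<mapsto> F + V\<close> hits a null set only where its
  derivative vanishes, that is almost nowhere.\<close>

lemma null_set_avoided:
  assumes m: "1 \<le> m" and v: "version (Suc m) \<phi> F"
    and sym: "\<And>z p. p permutes {1..Suc m} \<Longrightarrow> \<phi> (z \<circ> p) = \<phi> z"
    and H: "H \<in> borel_measurable (halfline_prod {1..Suc m})" "sqn (halfline_prod {1..Suc m}) H < \<top>"
    and Hsym: "\<And>z p. p permutes {1..m} \<Longrightarrow> H (z \<circ> p) = H z"
    and grad: "AE z in halfline_prod {1..Suc m}. has_gradient (\<lambda>t. \<phi> (z(Suc m := t))) (\<lambda>t. H (z(Suc m := t)))"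
    and nd: "AE x in halfline. nondegenerate m (\<lambda>y. real (Suc m) * H (y(Suc m := x))) (\<lambda>y. g (y(Suc m := x)))"
    and B: "B \<in> null_sets lborel"
  shows "AE \<omega> in P. F \<omega> \<notin> B"
proof -
  let ?M = "halfline_prod {1..m}" and ?M' = "halfline_prod {1..Suc m}"
  define c where "c = real (Suc m)"
  note F[measurable] = versionD(1)[OF v] and \<phi>[measurable] = versionD(2)[OF v] and H(1)[measurable]
  define \<Phi> where "\<Phi> z = c * \<phi> z" for z
  define \<Psi> where "\<Psi> z = c * H z" for z
  have \<Phi>[measurable]: "\<Phi> \<in> borel_measurable ?M'" unfolding \<Phi>_def[abs_def] by measurable
  have \<Psi>[measurable]: "\<Psi> \<in> borel_measurable ?M'" unfolding \<Psi>_def[abs_def] by measurable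
  have \<Psi>fin: "sqn ?M' \<Psi> < \<top>"
    unfolding \<Psi>_def[abs_def] sqn_cmult[OF H(1)] using H(2) by (simp add: ennreal_mult_less_top)
  obtain V where V[measurable]: "V \<in> borel_measurable (P \<Otimes>\<^sub>M halfline)"
    and Vv: "AE x in halfline. version m (\<lambda>y. \<Sum>i=1..Suc m. \<phi> (y(Suc m := x) \<circ> Transposition.transpose i (Suc m))) (\<lambda>\<omega>. V (\<omega>, x))"
    and mecke: "\<And>K B. K \<in> sets halfline \<Longrightarrow> emeasure halfline K < \<infinity> \<Longrightarrow> B \<in> sets borel \<Longrightarrow>
      (\<integral>\<^sup>+\<omega>. ennreal (measure (N \<omega>) K) * indicator B (F \<omega>) \<partial>P) =
      (\<integral>\<^sup>+p. indicator K (snd p) * indicator B (F (fst p) + V p) \<partial>(P \<Otimes>\<^sub>M halfline))"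
    using mecke_version[OF v] by blast
  have "(\<Sum>i=1..Suc m. \<phi> (y(Suc m := x) \<circ> Transposition.transpose i (Suc m))) = \<Phi> (y(Suc m := x))" for x y
  proof -
    have "(\<Sum>i=1..Suc m. \<phi> (y(Suc m := x) \<circ> Transposition.transpose i (Suc m))) = (\<Sum>i=1..Suc m. \<phi> (y(Suc m := x)))"
      by (intro sum.cong refl sym transpose_permutes)
    then show ?thesis by (simp add: \<Phi>_def c_def)
  qed
  with Vv have Vv: "AE x in halfline. version m (\<lambda>y. \<Phi> (y(Suc m := x))) (\<lambda>\<omega>. V (\<omega>, x))" by simp
  obtain V' where V'[measurable]: "V' \<in> borel_measurable (P \<Otimes>\<^sub>M halfline)" and V'fin: "sqn (P \<Otimes>\<^sub>M halfline) V' < \<top>"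
    and V'v: "AE x in halfline. version m (\<lambda>y. \<Psi> (y(Suc m := x))) (\<lambda>\<omega>. V' (\<omega>, x))"
    and W: "\<And>x. 0 \<le> x \<Longrightarrow> version m (\<lambda>y. iint x (\<lambda>s. \<Psi> (y(Suc m := s)))) (\<lambda>\<omega>. iint x (\<lambda>s. V' (\<omega>, s)))"
    by (rule section_process_iint[OF \<Psi> \<Psi>fin]) blast
  have V'fin': "AE \<omega> in P. square_integrable halfline (\<lambda>s. V' (\<omega>, s))"
    by (rule AE_sections_square_integrable[OF V' V'fin])
  have V'0: "AE \<omega> in P. AE x in halfline. V' (\<omega>, x) \<noteq> 0"
  proof -
    have "(\<integral>\<^sup>+x. sqn ?M (\<lambda>y. \<Psi> (y(Suc m := x))) \<partial>halfline) \<noteq> \<infinity>"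
      unfolding sqn_halfline_prod_Suc(2)[OF \<Psi>] using \<Psi>fin by simp
    from nn_integral_noteq_infinite[OF sqn_halfline_prod_Suc(1)[OF \<Psi>] this] V'v nd
    have "AE x in halfline. AE \<omega> in P. V' (\<omega>, x) \<noteq> 0"
    proof eventually_elim
      case (elim x)
      show ?case
      proof (rule no_atoms[OF m elim(2)])
        show "sqn ?M (\<lambda>y. \<Psi> (y(Suc m := x))) < \<top>" using elim(1) by (simp add: less_top)
        show "nondegenerate m (\<lambda>y. \<Psi> (y(Suc m := x))) (\<lambda>y. g (y(Suc m := x)))"
          using elim(3) by (simp add: \<Psi>_def c_def)
        show "\<Psi> ((z \<circ> p)(Suc m := x)) = \<Psi> (z(Suc m := x))" if "p permutes {1..m}" for z p
          unfolding fun_upd_comp_permutes[OF that] \<Psi>_def Hsym[OF that] ..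
      qed
    qed
    moreover have "{p \<in> space (P \<Otimes>\<^sub>M halfline). V' (fst p, snd p) \<noteq> 0} \<in> sets (P \<Otimes>\<^sub>M halfline)" by measurable
    ultimately show ?thesis using PM.AE_commute[where P = "\<lambda>\<omega> x. V' (\<omega>, x) \<noteq> 0"] by blast
  qed
  \<comment> \<open>\<open>\<Phi>\<close> minus the primitive of its gradient: for almost every
    \<open>y\<close> it is constant in the last variable, up to null sets. \<open>U\<close> below is
    the corresponding combination of integrals.\<close>
  define \<Delta> where "\<Delta> q = \<Phi> ((fst q)(Suc m := snd q)) - iint (snd q) (\<lambda>s. \<Psi> ((fst q)(Suc m := s)))" for q
  have \<Delta>[measurable]: "\<Delta> \<in> borel_measurable (?M \<Otimes>\<^sub>M halfline)"
    unfolding \<Delta>_def[abs_def]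
    using sqn_halfline_prod_pair(1)[OF \<Phi>] measurable_iint_pair[OF sqn_halfline_prod_pair(1)[OF \<Psi>]]
    by (intro borel_measurable_diff) simp_all
  have "AE x in halfline. AE y in ?M. has_gradient (\<lambda>t. \<phi> ((y(Suc m := x))(Suc m := t))) (\<lambda>t. H ((y(Suc m := x))(Suc m := t)))"
    using grad unfolding Suc_insert by (rule AE_halfline_prod_insert[rotated 2]) auto
  then have "AE y in ?M. has_gradient (\<lambda>t. \<phi> (y(Suc m := t))) (\<lambda>t. H (y(Suc m := t)))"
    using AE_halfline_const by simp
  then have "AE y in ?M. \<exists>d. AE t in halfline. \<Delta> (y, t) = d"
  proof eventually_elim
    case (elim y)
    have "has_gradient (\<lambda>t. \<Sum>i\<in>{0::nat}. c * \<phi> (y(Suc m := t))) (\<lambda>t. \<Sum>i\<in>{0::nat}. c * H (y(Suc m := t)))"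
      by (rule has_gradient_lincomb[where I = "{0::nat}" and c = "\<lambda>_. c"]) (use elim in auto)
    then have "has_gradient (\<lambda>t. \<Phi> (y(Suc m := t))) (\<lambda>t. \<Psi> (y(Suc m := t)))" by (simp add: \<Phi>_def \<Psi>_def)
    from has_gradient_prim[OF this] obtain d where
      "AE t in halfline. \<Phi> (y(Suc m := t)) = d + iint t (\<lambda>s. \<Psi> (y(Suc m := s)))"
      unfolding iint_prim by blast
    then have "AE t in halfline. \<Delta> (y, t) = d" by eventually_elim (simp add: \<Delta>_def)
    then show ?case by blast
  qed
  then obtain d where d: "AE t in halfline. AE y in ?M. \<Delta> (y, t) = d y"
    by (rule AE_sections_constant[OF sigma_finite_halfline_prod[OF finite_atLeastAtMost] \<Delta>]) blast
  define U where "U q = V q - iint (snd q) (\<lambda>s. V' (fst q, s))" for q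
  have U[measurable]: "U \<in> borel_measurable (P \<Otimes>\<^sub>M halfline)"
    unfolding U_def[abs_def] using measurable_iint_pair[OF V'] by measurable
  have good: "AE x in halfline. version m (\<lambda>y. \<Delta> (y, x)) (\<lambda>\<omega>. U (\<omega>, x)) \<and> (AE y in ?M. \<Delta> (y, x) = d y)"
    using Vv d AE_space
  proof eventually_elim
    case (elim x)
    then show ?case using version_diff[OF elim(1) W[of x]] by (simp add: \<Delta>_def U_def)
  qed
  \<comment> \<open>A good reference point. For almost every \<open>x\<close>, \<open>U\<close> at
    \<open>x\<close> and at \<open>x0\<close> are versions of integrals whose kernels agree almost
    everywhere, hence equal almost surely.\<close>
  have "\<exists>x0\<in>{0..}. version m (\<lambda>y. \<Delta> (y, x0)) (\<lambda>\<omega>. U (\<omega>, x0)) \<and> (AE y in ?M. \<Delta> (y, x0) = d y)"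
  proof (rule ccontr)
    assume no: "\<not> ?thesis"
    have "AE x in halfline. False" using good AE_space by eventually_elim (use no in auto)
    then show False by (rule AE_halfline_const)
  qed
  then obtain x0 where x0: "0 \<le> x0" "version m (\<lambda>y. \<Delta> (y, x0)) (\<lambda>\<omega>. U (\<omega>, x0))" "AE y in ?M. \<Delta> (y, x0) = d y"
    by auto
  have [measurable]: "x0 \<in> space halfline" using x0(1) by simp
  have "AE x in halfline. AE \<omega> in P. U (\<omega>, x) = U (\<omega>, x0)"
    using good
  proof eventually_elim
    case (elim x)
    have "AE y in ?M. \<Delta> (y, x) = \<Delta> (y, x0)"
      using conjunct2[OF elim] x0(3) by eventually_elim simp
    then show ?case by (rule version_unique[OF conjunct1[OF elim] x0(2)])
  qed
  moreover have "{p \<in> space (P \<Otimes>\<^sub>M halfline). U (fst p, snd p) = U (fst p, x0)} \<in> sets (P \<Otimes>\<^sub>M halfline)" by measurable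
  ultimately have Uc: "AE \<omega> in P. AE x in halfline. U (\<omega>, x) = U (\<omega>, x0)"
    using PM.AE_commute[where P = "\<lambda>\<omega> x. U (\<omega>, x) = U (\<omega>, x0)"] by blast
  have Bb: "B \<in> sets borel" using B by auto
  have "AE \<omega> in P. AE x in halfline. F \<omega> + V (\<omega>, x) \<notin> B"
    using Uc V'0 V'fin'
  proof eventually_elim
    case (elim \<omega>)
    \<comment> \<open>For a fixed good outcome and almost every \<open>x\<close>,
      \<open>F + V\<close> is the primitive of \<open>V'\<close> at \<open>x\<close> plus a
      constant, and the one-variable fact applies to it.\<close>
    from prim_null_preimage[OF locint_square_integrable[OF elim(3)] B, of "F \<omega> + U (\<omega>, x0)"]
    have "AE x in halfline. iint x (\<lambda>s. V' (\<omega>, s)) + (F \<omega> + U (\<omega>, x0)) \<in> B \<longrightarrow> indicator {0..} x * V' (\<omega>, x) = 0"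
      unfolding AE_halfline iint_prim .
    then show ?case using elim(1,2) AE_space
    proof eventually_elim
      case (elim x)
      have "F \<omega> + V (\<omega>, x) = iint x (\<lambda>s. V' (\<omega>, s)) + (F \<omega> + U (\<omega>, x0))"
        using elim(2) by (simp add: U_def)
      then show ?case using elim(1,3,4) by (metis (no_types) atLeast_iff indicator_simps(1) mult_1 space_halfline)
    qed
  qed
  then have "AE p in P \<Otimes>\<^sub>M halfline. F (fst p) + V p \<notin> B"
  proof (intro PM.AE_pair_measure[where P = "\<lambda>p. F (fst p) + V p \<notin> B"])
    show "{p \<in> space (P \<Otimes>\<^sub>M halfline). F (fst p) + V p \<notin> B} \<in> sets (P \<Otimes>\<^sub>M halfline)"
      using Bb by measurable
  qed simp
  then show ?thesis
  proof (rule mecke_null[OF F V Bb, rotated])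
    fix K B assume "K \<in> sets halfline" "emeasure halfline K < \<infinity>" "B \<in> sets (borel :: real measure)"
    then show "(\<integral>\<^sup>+\<omega>. ennreal (measure (N \<omega>) K) * indicator B (F \<omega>) \<partial>P) =
      (\<integral>\<^sup>+p. indicator K (snd p) * indicator B (F (fst p) + V p) \<partial>(P \<Otimes>\<^sub>M halfline))" by (rule mecke)
  qed
qed

end

text \<open>Avoiding null sets is absolute continuity of the law, and the Radon-Nikodym theorem
  provides the density.\<close>

lemma distributed_if_null_sets_avoided:
  fixes F :: "'b \<Rightarrow> real"
  assumes F: "F \<in> borel_measurable P" and P: "prob_space P"
    and null: "\<And>B :: real set. B \<in> null_sets lborel \<Longrightarrow> AE \<omega> in P. F \<omega> \<notin> B"
  shows "\<exists>\<rho>. distributed P lborel F \<rho>"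
proof -
  interpret P: prob_space P by fact
  have F'[measurable]: "F \<in> P \<rightarrow>\<^sub>M lborel" using F by simp
  have "absolutely_continuous lborel (distr P lborel F)"
    unfolding absolutely_continuous_def
  proof
    fix B :: "real set" assume B: "B \<in> null_sets lborel"
    then have Bs: "B \<in> sets lborel" by auto
    have "AE x in distr P lborel F. x \<notin> B"
      using null[OF B] Bs by (subst AE_distr_iff[OF F']) auto
    then show "B \<in> null_sets (distr P lborel F)"
      using Bs AE_iff_null_sets[of B "distr P lborel F"] by simp
  qed
  then obtain \<rho> where "\<rho> \<in> borel_measurable lborel" "density lborel \<rho> = distr P lborel F"
    using sigma_finite_measure.Radon_Nikodym[OF sigma_finite_lborel, of "distr P lborel F"] by auto
  then have "distributed P lborel F \<rho>" unfolding distributed_def using F' by simp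
  then show ?thesis by blast
qed

theorem proposition24:
  fixes P :: "'a measure" and N :: "'a \<Rightarrow> real measure" and n :: nat
    and f g :: "(nat \<Rightarrow> real) \<Rightarrow> real"
  assumes "poisson_random_measure P halfline N"
    and "n \<ge> 2"
    and "f \<in> H1_prod n"
    and "has_mixed_gradient n (symmetrization n f) g"
    and "AE y in halfline_prod {2..n}. emeasure halfline {t \<in> {0..}. g (y(1 := t)) \<noteq> 0} = \<infinity>"
  shows "\<exists>\<rho>. distributed P lborel (poisson_integral P N n f) \<rho>"
proof -
  interpret poisson_halfline P N by (rule poisson_halfline.intro) (rule assms(1))
  obtain m where n: "n = Suc m" and m: "1 \<le> m" using assms(2) by (cases n) auto
  let ?M = "halfline_prod {1..Suc m}"
  have f: "f \<in> borel_measurable ?M" "sqn ?M f < \<top>"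
    using assms(3) by (auto simp: H1_prod_def square_integrable_sqn n)
  obtain D where D: "\<And>i. i \<in> {1..Suc m} \<Longrightarrow> has_partial_gradient (Suc m) i f (D i)"
    and Di: "integrable ?M (\<lambda>x. \<Sum>i=1..Suc m. (D i x)\<^sup>2)"
    using assms(3) unfolding H1_prod_def n by blast
  have Dfin: "sqn ?M (D i) < \<top>" if i: "i \<in> {1..Suc m}" for i
  proof -
    have [measurable]: "D i \<in> borel_measurable ?M" using D[OF i] by (simp add: has_partial_gradient_def)
    have "(D i x)\<^sup>2 \<le> (\<Sum>i=1..Suc m. (D i x)\<^sup>2)" for x
      using i by (intro member_le_sum) auto
    then have "integrable ?M (\<lambda>x. (D i x)\<^sup>2)"
      by (intro Bochner_Integration.integrable_bound[OF Di]) (auto simp: sum_nonneg)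
    then have "square_integrable ?M (D i)" by (simp add: square_integrable_def)
    then show ?thesis by (simp add: square_integrable_sqn)
  qed
  \<comment> \<open>\<open>H\<close> is built from the square-integrable partial derivatives of
    \<open>f\<close>, whereas \<open>h\<close> below comes from the mixed gradient;
    \<open>nondegenerate_sections\<close> ties the two together.\<close>
  obtain H where H: "H \<in> borel_measurable ?M" "sqn ?M H < \<top>" "\<And>z p. p permutes {1..Suc m - 1} \<Longrightarrow> H (z \<circ> p) = H z"
    "AE z in ?M. has_gradient (\<lambda>t. symmetrization (Suc m) f (z(Suc m := t))) (\<lambda>t. H (z(Suc m := t)))"
    by (rule symmetrization_gradient[of "Suc m" f D]) (use D Dfin in auto)
  have Hsym: "H (z \<circ> p) = H z" if "p permutes {1..m}" for z p
    by (rule H(3)) (use that in simp)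
  obtain h where h: "h (Suc m) = symmetrization (Suc m) f" "h 1 = g"
    "\<And>k. k \<in> {2..Suc m} \<Longrightarrow> has_partial_gradient (Suc m) k (h k) (h (k - 1))"
    using assms(4) unfolding has_mixed_gradient_def n by blast
  have nd: "AE x in halfline. nondegenerate m (\<lambda>y. real (Suc m) * H (y(Suc m := x))) (\<lambda>y. g (y(Suc m := x)))"
    unfolding h(2)[symmetric]
    by (rule nondegenerate_sections[OF m h(3) H(1)]) (use H(4) assms(5)[unfolded n] in \<open>simp_all add: h\<close>)
  have v: "version (Suc m) (symmetrization (Suc m) f) (poisson_integral P N (Suc m) f)"
    by (rule version_poisson_integral[OF f])
  show ?thesis unfolding n
  proof (rule distributed_if_null_sets_avoided[OF versionD(1)[OF v] P.prob_space_axioms])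
    fix B :: "real set" assume B: "B \<in> null_sets lborel"
    show "AE \<omega> in P. poisson_integral P N (Suc m) f \<omega> \<notin> B"
      by (rule null_set_avoided[OF m v symmetrization_permute H(1,2) Hsym H(4) nd B])
  qed
qed

end
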